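(* Let $\mathcal G=(V,E)$ be an infinite, connected, locally finite, non-directed graph endowed with conductances $W$, let $i_0\in V$ be fixed, and let $\mathcal R(dr)$ be the distribution of a random environment representing $P^{VRJP(i_0)}$. Write $\mathcal R(dr,d\gamma)=\mathcal R(dr)\otimes\frac{\mathbf 1_{\{\gamma>0\}}}{\sqrt{\pi\gamma}}e^{-\gamma}d\gamma$. For $r\in\mathcal J_V^E$ and $\gamma>0$, define $\beta\in(\mathbb R_+)^V$ by $\beta_i=r_i+\mathbf 1_{\{i=i_0\}}\gamma$ for $i\in V$, where $r_i=\sum_{j\sim i}r_{i,j}$. Then under $\mathcal R(dr,d\gamma)$, $\beta$ has distribution $\nu_V^W$, and there exists a random $H_\beta$-harmonic function $h:V\to\mathbb R_+$ such that, almost surely, for all $i\sim j$, $$r_{i,j}=\frac{W_{i,j}}{2}\,\frac{G(i_0,j)}{G(i_0,i)},\qquad\text{where } G(i_0,i)=\hat G(i_0,i)+h(i)\ \text{ for } i\in V,$$ and $\hat G$ is the function of $\beta$ defined (almost surely) in the context.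
   Context: Graph and conductances: $i\sim j$ means $\{i,j\}\in E$; $(W_e)_{e\in E}$ are positive, and $W_{i,j}=W_{\{i,j\}}$ if $\{i,j\}\in E$, $W_{i,j}=0$ otherwise. For $A,B\subset V$, $W_{A,B}=(W_{i,j})_{i\in A,j\in B}$; $\mathbf 1_A$ is the all-ones vector on $A$. VRJP: the Vertex Reinforced Jump Process $(Y_s)_{s\ge0}$ starts at $i_0$ and, conditionally on the past at time $s$, jumps from $i=Y_s$ to a neighbour $j$ at rate $W_{i,j}L_j(s)$, $L_j(s)=1+\int_0^s\mathbf 1_{\{Y_u=j\}}du$. Let $D(s)=\sum_{i\in V}(L_i(s)^2-1)$ and $Z_t=Y_{D^{-1}(t)}$. $P^{VRJP(i_0)}$ is the law of the time-changed VRJP $(Z_t)_{t\ge0}$, on the space $D([0,\infty),V)$ of càdlàg functions. Representations: $\mathcal J_V^E$ is the set of families $r=(r_{i,j})_{i\sim j}$ of nonnegative jump rates (one for each ordered pair of neighbours); for $r\in\mathcal J_V^E$, $P^r_{i_0}$ is the law of the Markov jump process started at $i_0$ with jump rate $r_{i,j}$ from $i$ to $j$. A probability distribution $\mathcal R(dr)$ on $\mathcal J_V^E$ is the distribution of a random environment representing $P^{VRJP(i_0)}$ if $P^{VRJP(i_0)}[\cdot]=\int P^r_{i_0}[\cdot]\,\mathcal R(dr)$. Operator and potential: for $\beta\in\mathbb R^V$, $H_\beta=2\beta-W$, i.e. $(H_\beta f)(i)=2\beta_if(i)-\sum_{j\sim i}W_{i,j}f(j)$; $f$ is $H_\beta$-harmonic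 if $H_\beta f=0$ on $V$. For finite $U$, a symmetric nonnegative matrix $W$ on $U$ with zero diagonal and $\eta\in\mathbb R_+^U$, $\nu_U^{W,\eta}$ is the probability measure on $\mathcal D_U^W=\{\beta\in\mathbb R^U: H_\beta\text{ positive definite}\}$ given by $$\nu_U^{W,\eta}(d\beta)=\Big(\tfrac2\pi\Big)^{|U|/2}e^{-\frac12(\langle\mathbf 1,H_\beta\mathbf 1\rangle+\langle\eta,H_\beta^{-1}\eta\rangle)}e^{\langle\eta,\mathbf 1\rangle}\frac{\prod_{i\in U}d\beta_i}{\sqrt{\det H_\beta}}.$$ For infinite $V$, $\mathcal D_V^W=\{\beta\in\mathbb R^V:(H_\beta)_{U,U}\text{ positive definite for all finite }U\subset V\}$ and $\nu_V^W$ is the unique probability distribution on $\mathcal D_V^W$ under which, for every finite $U\subset V$, $\beta_U\sim\nu_U^{W_{U,U},\eta}$ with $\eta=W_{U,U^c}\mathbf 1_{U^c}$. Green function: let $(V_n)$ be an increasing sequence of finite connected subsets with $\bigcup_nV_n=V$. $\hat G^{(n)}$ equals $((H_\beta)_{V_n,V_n})^{-1}$ on $V_n\times V_n$ and $0$ elsewhere. Under $\nu_V^W$, the increasing sequence $\hat G^{(n)}(i,j)$ converges a.s. to a finite limit $\hat G(i,j)$ for all $i,j\in V$. *)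

theory Defs
  imports "HOL-Probability.Probability"
begin

section \<open>Graphs and conductances\<close>

definition simple_graph :: "'v set \<Rightarrow> 'v set set \<Rightarrow> bool" where
  "simple_graph V E \<longleftrightarrow> (\<forall>e\<in>E. \<exists>u\<in>V. \<exists>v\<in>V. u \<noteq> v \<and> e = {u, v})"

definition nbrs :: "'v set set \<Rightarrow> 'v \<Rightarrow> 'v set" where
  "nbrs E i = {j. {i, j} \<in> E}"

definition locally_finite :: "'v set \<Rightarrow> 'v set set \<Rightarrow> bool" where
  "locally_finite V E \<longleftrightarrow> (\<forall>i\<in>V. finite (nbrs E i))"

definition connected_on :: "'v set set \<Rightarrow> 'v set \<Rightarrow> bool" where
  "connected_on E U \<longleftrightarrow>
     (\<forall>u\<in>U. \<forall>v\<in>U. (u, v) \<in> {(a, b). a \<in> U \<and> b \<in> U \<and> {a, b} \<in> E}\<^sup>*)"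

definition weight :: "'v set set \<Rightarrow> ('v set \<Rightarrow> real) \<Rightarrow> 'v \<Rightarrow> 'v \<Rightarrow> real" where
  "weight E W i j = (if {i, j} \<in> E then W {i, j} else 0)"

definition exhaustion :: "'v set \<Rightarrow> 'v set set \<Rightarrow> (nat \<Rightarrow> 'v set) \<Rightarrow> bool" where
  "exhaustion V E Vs \<longleftrightarrow>
     incseq Vs \<and> (\<forall>n. finite (Vs n) \<and> connected_on E (Vs n)) \<and> (\<Union>n. Vs n) = V"

section \<open>Path space and jump processes\<close>

text \<open>
  The space of cadlag functions from the half-line \<open>{0..}\<close> to the discrete set \<open>V\<close>,
  with the sigma-algebra generated by the coordinate maps. Paths are extensional:
  their values at negative times are \<open>undefined\<close>. Having left limits in a discrete set
  forces finitely many jumps in bounded time, so explosion is excluded.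
\<close>

definition cadlag_space :: "'v set \<Rightarrow> (real \<Rightarrow> 'v) measure" where
  "cadlag_space V = restrict_space (PiM {0..} (\<lambda>_. count_space V))
     {y. (\<forall>t\<ge>0. \<forall>\<^sub>F u in at_right t. y u = y t) \<and>
         (\<forall>t>0. \<exists>x\<in>V. \<forall>\<^sub>F u in at_left t. y u = x)}"

definition past :: "'v set \<Rightarrow> real \<Rightarrow> (real \<Rightarrow> 'v) measure" where
  "past V s = vimage_algebra (space (cadlag_space V))
     (\<lambda>y. restrict y {0..s}) (PiM {0..s} (\<lambda>_. count_space V))"

definition next_jump :: "(real \<Rightarrow> 'v) \<Rightarrow> real \<Rightarrow> real \<Rightarrow> 'v \<Rightarrow> bool" where
  "next_jump y s t j \<longleftrightarrow> j \<noteq> y s \<and>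
     (\<exists>u\<in>{s<..s + t}. y u = j \<and> (\<forall>v\<in>{s..<u}. y v = y s))"

text \<open>
  \<open>Q\<close> is the law of a process started at \<open>i0\<close> which, conditionally on the past at time \<open>s\<close>,
  jumps from its current position to a neighbour \<open>j\<close> at rate \<open>q y s j\<close>. For rates that
  do not change between successive jumps of the path, this means that, given the past at
  time \<open>s\<close>, the waiting time \<open>u\<close> until the next jump and its target \<open>j\<close> have joint density
  \<open>q y s j * exp (- u * (\<Sum>k\<in>nbrs E (y s). q y s k))\<close>. If all rates vanish, there is no
  further jump. Both rate functions used below are constant between jumps; for the VRJP this
  is because the local times of the neighbours of the current position do not grow.
\<close>

definition jump_process_law ::
    "'v set \<Rightarrow> 'v set set \<Rightarrow> ((real \<Rightarrow> 'v) \<Rightarrow> real \<Rightarrow> 'v \<Rightarrow> real) \<Rightarrow> 'v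
      \<Rightarrow> (real \<Rightarrow> 'v) measure \<Rightarrow> bool" where
  "jump_process_law V E q i0 Q \<longleftrightarrow>
     prob_space Q \<and> sets Q = sets (cadlag_space V) \<and> (AE y in Q. y 0 = i0) \<and>
     (\<forall>s\<ge>0. \<forall>t\<ge>0. \<forall>j\<in>V. \<forall>A\<in>sets (past V s).
        measure Q {y\<in>A. next_jump y s t j} =
        (LINT y:A|Q. (LINT u:{0..t}|lborel.
           (if j \<in> nbrs E (y s)
            then q y s j * exp (- u * (\<Sum>k\<in>nbrs E (y s). q y s k)) else 0))))"

subsection \<open>The vertex reinforced jump process\<close>

definition local_time :: "(real \<Rightarrow> 'v) \<Rightarrow> 'v \<Rightarrow> real \<Rightarrow> real" where
  "local_time y j s = 1 + (LINT u:{0..s}|lborel. of_bool (y u = j))"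

definition vrjp_law ::
    "'v set \<Rightarrow> 'v set set \<Rightarrow> ('v set \<Rightarrow> real) \<Rightarrow> 'v \<Rightarrow> (real \<Rightarrow> 'v) measure \<Rightarrow> bool" where
  "vrjp_law V E W i0 =
     jump_process_law V E (\<lambda>y s j. weight E W (y s) j * local_time y j s) i0"

definition clock :: "'v set \<Rightarrow> (real \<Rightarrow> 'v) \<Rightarrow> real \<Rightarrow> real" where
  "clock V y s = (\<Sum>\<^sub>\<infinity>i\<in>V. (local_time y i s)\<^sup>2 - 1)"

definition time_changed :: "'v set \<Rightarrow> (real \<Rightarrow> 'v) \<Rightarrow> real \<Rightarrow> 'v" where
  "time_changed V y = (\<lambda>t\<in>{0..}. y (the_inv_into {0..} (clock V y) t))"

subsection \<open>Random environments\<close>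

definition rate_space :: "'v set set \<Rightarrow> ('v \<times> 'v \<Rightarrow> real) measure" where
  "rate_space E = PiM {(i, j). {i, j} \<in> E} (\<lambda>_. restrict_space borel {0..})"

definition markov_law ::
    "'v set \<Rightarrow> 'v set set \<Rightarrow> ('v \<times> 'v \<Rightarrow> real) \<Rightarrow> 'v \<Rightarrow> (real \<Rightarrow> 'v) measure \<Rightarrow> bool" where
  "markov_law V E r i0 = jump_process_law V E (\<lambda>y s j. r (y s, j)) i0"

text \<open>
  \<open>Q\<close> is the law of the VRJP before the time change. The law \<open>P r\<close> on cadlag paths exists only
  for non-explosive rates \<open>r\<close>, hence it is prescribed for almost every \<open>r\<close>.
\<close>

definition represents_vrjp ::
    "'v set \<Rightarrow> 'v set set \<Rightarrow> ('v set \<Rightarrow> real) \<Rightarrow> 'v \<Rightarrow> ('v \<times> 'v \<Rightarrow> real) measure \<Rightarrow> bool" where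
  "represents_vrjp V E W i0 R \<longleftrightarrow>
     prob_space R \<and> sets R = sets (rate_space E) \<and>
     (\<exists>Q P. vrjp_law V E W i0 Q \<and>
        P \<in> R \<rightarrow>\<^sub>M prob_algebra (cadlag_space V) \<and> (AE r in R. markov_law V E r i0 (P r)) \<and>
        (\<forall>A\<in>sets (cadlag_space V).
           emeasure (distr Q (cadlag_space V) (time_changed V)) A =
           (\<integral>\<^sup>+ r. emeasure (P r) A \<partial>R)))"

section \<open>The operator and the random potential\<close>

text \<open>
  Matrices indexed by a finite set \<open>U\<close> are functions of two arguments; only their values
  on \<open>U \<times> U\<close> matter. The inverse is extended by zero outside \<open>U \<times> U\<close>.
\<close>

definition pos_def_on :: "'v set \<Rightarrow> ('v \<Rightarrow> 'v \<Rightarrow> real) \<Rightarrow> bool" where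
  "pos_def_on U A \<longleftrightarrow>
     (\<forall>f. (\<exists>i\<in>U. f i \<noteq> 0) \<longrightarrow> (\<Sum>i\<in>U. \<Sum>j\<in>U. f i * A i j * f j) > 0)"

definition det_on :: "'v set \<Rightarrow> ('v \<Rightarrow> 'v \<Rightarrow> real) \<Rightarrow> real" where
  "det_on U A = (\<Sum>p | p permutes U. of_int (sign p) * (\<Prod>i\<in>U. A i (p i)))"

definition inverse_on :: "'v set \<Rightarrow> ('v \<Rightarrow> 'v \<Rightarrow> real) \<Rightarrow> 'v \<Rightarrow> 'v \<Rightarrow> real" where
  "inverse_on U A = (THE B.
     (\<forall>i\<in>U. \<forall>j\<in>U. (\<Sum>k\<in>U. A i k * B k j) = of_bool (i = j) \<and>
                   (\<Sum>k\<in>U. B i k * A k j) = of_bool (i = j)) \<and>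
     (\<forall>i j. i \<notin> U \<or> j \<notin> U \<longrightarrow> B i j = 0))"

definition H_mat ::
    "('v \<Rightarrow> 'v \<Rightarrow> real) \<Rightarrow> ('v \<Rightarrow> real) \<Rightarrow> 'v \<Rightarrow> 'v \<Rightarrow> real" where
  "H_mat w \<beta> i j = (if i = j then 2 * \<beta> i else 0) - w i j"

definition H_op ::
    "'v set set \<Rightarrow> ('v set \<Rightarrow> real) \<Rightarrow> ('v \<Rightarrow> real) \<Rightarrow> ('v \<Rightarrow> real) \<Rightarrow> 'v \<Rightarrow> real" where
  "H_op E W \<beta> f i = 2 * \<beta> i * f i - (\<Sum>j\<in>nbrs E i. weight E W i j * f j)"

definition harmonic ::
    "'v set \<Rightarrow> 'v set set \<Rightarrow> ('v set \<Rightarrow> real) \<Rightarrow> ('v \<Rightarrow> real) \<Rightarrow> ('v \<Rightarrow> real) \<Rightarrow> bool" where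
  "harmonic V E W \<beta> f \<longleftrightarrow> (\<forall>i\<in>V. H_op E W \<beta> f i = 0)"

definition nu_fin ::
    "'v set \<Rightarrow> ('v \<Rightarrow> 'v \<Rightarrow> real) \<Rightarrow> ('v \<Rightarrow> real) \<Rightarrow> ('v \<Rightarrow> real) measure" where
  "nu_fin U w \<eta> = density (PiM U (\<lambda>_. lborel)) (\<lambda>\<beta>. ennreal
     (if pos_def_on U (H_mat w \<beta>)
      then (2 / pi) powr (real (card U) / 2) *
           exp (- ((\<Sum>i\<in>U. \<Sum>j\<in>U. H_mat w \<beta> i j) +
                   (\<Sum>i\<in>U. \<Sum>j\<in>U. \<eta> i * inverse_on U (H_mat w \<beta>) i j * \<eta> j)) / 2) *
           exp (\<Sum>i\<in>U. \<eta> i) / sqrt (det_on U (H_mat w \<beta>))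
      else 0))"

definition boundary_weight :: "'v set set \<Rightarrow> ('v set \<Rightarrow> real) \<Rightarrow> 'v set \<Rightarrow> 'v \<Rightarrow> real" where
  "boundary_weight E W U i = (\<Sum>j\<in>nbrs E i - U. weight E W i j)"

definition nu_inf :: "'v set \<Rightarrow> 'v set set \<Rightarrow> ('v set \<Rightarrow> real) \<Rightarrow> ('v \<Rightarrow> real) measure" where
  "nu_inf V E W = (THE N. prob_space N \<and> sets N = sets (PiM V (\<lambda>_. borel)) \<and>
     (AE \<beta> in N. \<forall>U. finite U \<and> U \<subseteq> V \<longrightarrow> pos_def_on U (H_mat (weight E W) \<beta>)) \<and>
     (\<forall>U. finite U \<and> U \<subseteq> V \<longrightarrow>
        distr N (PiM U (\<lambda>_. borel)) (\<lambda>\<beta>. restrict \<beta> U) =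
        nu_fin U (weight E W) (boundary_weight E W U)))"

section \<open>Green function\<close>

text \<open>
  The limit exists almost surely under \<open>nu_inf V E W\<close>; where it does not, \<open>lim\<close> returns an
  unspecified value.
\<close>

definition G_hat ::
    "'v set set \<Rightarrow> ('v set \<Rightarrow> real) \<Rightarrow> (nat \<Rightarrow> 'v set) \<Rightarrow> ('v \<Rightarrow> real) \<Rightarrow> 'v \<Rightarrow> 'v \<Rightarrow> real" where
  "G_hat E W Vs \<beta> i j = lim (\<lambda>n. inverse_on (Vs n) (H_mat (weight E W) \<beta>) i j)"

section \<open>The potential associated with an environment\<close>

definition gamma_half :: "real measure" where
  "gamma_half = density lborel (\<lambda>\<gamma>. ennreal (indicator {0<..} \<gamma> / sqrt (pi * \<gamma>) * exp (- \<gamma>)))"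

definition env_potential ::
    "'v set \<Rightarrow> 'v set set \<Rightarrow> 'v \<Rightarrow> ('v \<times> 'v \<Rightarrow> real) \<times> real \<Rightarrow> 'v \<Rightarrow> real" where
  "env_potential V E i0 = (\<lambda>(r, \<gamma>). \<lambda>i\<in>V.
     (\<Sum>j\<in>nbrs E i. r (i, j)) + (if i = i0 then \<gamma> else 0))"

end

theory Submission imports Defs begin

text \<open>
  Write \<open>r i\<close> for the total rate at \<open>i\<close>. Both laws in the representation are compared through the
  density of a finite trajectory of \<open>Z\<close>, that is, of a walk \<open>\<sigma> 0, ..., \<sigma> n\<close> with holding times
  \<open>x 0, ..., x (n - 1)\<close>. Let \<open>l j\<close> be the total holding time at \<open>j\<close> and \<open>m j = sqrt (1 + l j)\<close>. For
  a Markov jump process with random rates the density is the expectation of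
  \<open>(\<Prod>k<n. r (\<sigma> k, \<sigma> (k + 1))) * exp (- (\<Sum>j. r j * l j))\<close>. For the VRJP, the clock is chosen such that
  the local time at \<open>j\<close> is exactly \<open>m j\<close>, and multiplying the densities of the single steps gives
  the telescoping product (\<open>prod_step_density\<close>)
  \<open>(\<Prod>k<n. W (\<sigma> k) (\<sigma> (k + 1)) / 2) * (\<Prod>j. 1 / m j) * m (\<sigma> n) * exp (- (\<Sum>i j. W i j * (m i * m j - 1)) / 2)\<close>.
  Equality of the two (\<open>trajectory_identity\<close>) is all that is used about the processes; it has two
  consequences.

  Cycles. With zero holding times, the product \<open>X\<close> of the ratios \<open>2 * r (i, j) / W i j\<close> along a
  closed walk from \<open>i0\<close> has expectation 1. The walk traversed twice is again closed, so \<open>X\<^sup>2\<close> has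
  expectation 1 as well, hence \<open>X = 1\<close> almost surely (\<open>closed_walk_AE\<close>). Therefore these ratios
  are quotients \<open>u j / u i\<close> for a positive random function \<open>u\<close>, the product along any path from
  \<open>i0\<close>. By the definition of the potential \<open>\<beta>\<close>, the multiple \<open>G = u / (2 * \<gamma> * u i0)\<close> then satisfies
  \<open>H G = \<delta>\<close> with \<open>\<delta>\<close> the unit mass at \<open>i0\<close>, and the rates are \<open>W i j / 2 * (G j / G i)\<close>.
  The Green function of a finite subset is the smallest nonnegative solution of this equation on
  that subset, so its limit along the exhaustion is at most \<open>G\<close>, and it solves the same equation.
  The difference is the nonnegative harmonic function \<open>h\<close> (\<open>green_decomposition\<close>).

  Laplace transform. Along a closed walk that covers a finite set \<open>U\<close> the product of the ratios
  is 1 almost surely, so the identity gives the joint Laplace transform of the total rates on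
  \<open>U\<close> (\<open>total_rate_laplace\<close>). It carries an extra factor \<open>m i0\<close>, which the independent variable
  \<open>\<gamma>\<close> removes, since its Laplace transform at \<open>l\<close> is \<open>1 / sqrt (1 + l)\<close>. The result is the Laplace
  transform of the finite-volume law (\<open>nu_fin_laplace\<close>). The latter is computed by
  integrating out one vertex at a time: in terms of the Schur complement of the remaining matrix,
  the integral over one coordinate is the inverse Gaussian integral, and the remaining integrand
  is again of the same form with a different source \<open>\<eta>\<close>. Since Laplace transforms determine finite
  measures on the nonnegative orthant, all finite marginals of \<open>\<beta>\<close> are as required, which
  characterizes its law.
\<close>

section \<open>Cadlag paths\<close>

lemma space_cadlag_space:
  "y \<in> space (cadlag_space V) \<longleftrightarrow> y \<in> (\<Pi>\<^sub>E t\<in>{0..}. V) \<and>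
     (\<forall>t\<ge>0. \<forall>\<^sub>F u in at_right t. y u = y t) \<and> (\<forall>t>0. \<exists>x\<in>V. \<forall>\<^sub>F u in at_left t. y u = x)"
  by (auto simp: cadlag_space_def space_restrict_space space_PiM)

lemma cadlag_in_V: "y \<in> space (cadlag_space V) \<Longrightarrow> 0 \<le> t \<Longrightarrow> y t \<in> V"
  by (auto simp: space_cadlag_space PiE_iff)

lemma cadlag_right_interval:
  assumes "y \<in> space (cadlag_space V)" "0 \<le> t"
  obtains d where "d > 0" "\<And>u. t \<le> u \<Longrightarrow> u < t + d \<Longrightarrow> y u = y t"
proof -
  have "\<forall>\<^sub>F u in at_right t. y u = y t" using assms by (auto simp: space_cadlag_space)
  then obtain b where b: "b > t" "\<And>u. u > t \<Longrightarrow> u < b \<Longrightarrow> y u = y t"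
    unfolding eventually_at_right_field by auto
  show ?thesis
  proof (rule that[of "b - t"])
    fix u assume "t \<le> u" "u < t + (b - t)"
    then show "y u = y t" using b(2)[of u] by (cases "u = t") auto
  qed (use b in auto)
qed

lemma cadlag_left_interval:
  assumes "y \<in> space (cadlag_space V)" "0 < t"
  obtains x d where "x \<in> V" "0 < d" "\<And>u. t - d < u \<Longrightarrow> u < t \<Longrightarrow> y u = x"
proof -
  obtain x where x: "x \<in> V" "\<forall>\<^sub>F u in at_left t. y u = x"
    using assms unfolding space_cadlag_space by blast
  then obtain b where b: "b < t" "\<And>u. u > b \<Longrightarrow> u < t \<Longrightarrow> y u = x"
    unfolding eventually_at_left_field by auto
  show ?thesis by (rule that[of x "t - b"]) (use b x in auto)
qed

lemma cadlag_spaceI: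
  assumes "y \<in> (\<Pi>\<^sub>E t\<in>{0..}. V)"
    and "\<And>t. 0 \<le> t \<Longrightarrow> \<exists>d>0. \<forall>u. t < u \<and> u < t + d \<longrightarrow> y u = y t"
    and "\<And>t. 0 < t \<Longrightarrow> \<exists>x\<in>V. \<exists>d>0. \<forall>u. t - d < u \<and> u < t \<longrightarrow> y u = x"
  shows "y \<in> space (cadlag_space V)"
  unfolding space_cadlag_space
proof (intro conjI allI impI)
  fix t :: real assume "0 \<le> t"
  then obtain d where "d > 0" "\<forall>u. t < u \<and> u < t + d \<longrightarrow> y u = y t" using assms(2) by blast
  then show "\<forall>\<^sub>F u in at_right t. y u = y t"
    unfolding eventually_at_right_field by (intro exI[of _ "t + d"]) auto
next
  fix t :: real assume "0 < t"
  then obtain x d where "x \<in> V" "d > 0" "\<forall>u. t - d < u \<and> u < t \<longrightarrow> y u = x" using assms(3) by blast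
  then show "\<exists>x\<in>V. \<forall>\<^sub>F u in at_left t. y u = x"
    unfolding eventually_at_left_field by (intro bexI[of _ x] exI[of _ "t - d"]) auto
qed (use assms in auto)

lemma measurable_coord: "0 \<le> u \<Longrightarrow> (\<lambda>y. y u) \<in> cadlag_space V \<rightarrow>\<^sub>M count_space V"
  unfolding cadlag_space_def
  by (intro measurable_restrict_space1 measurable_component_singleton) auto

lemma pred_coord[measurable]:
  "Measurable.pred (cadlag_space V) (\<lambda>y. y (max 0 q) = i)"
proof -
  have "(\<lambda>y. y (max 0 q)) \<in> cadlag_space V \<rightarrow>\<^sub>M count_space V" by (rule measurable_coord) simp
  moreover have "Measurable.pred (count_space V) (\<lambda>x. x = i)" by simp
  ultimately show ?thesis by (rule measurable_compose)
qed

lemma rat_between_right: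
  fixes a b :: real assumes "a < b" obtains p :: rat where "a < of_rat p" "of_rat p < b"
  using of_rat_dense[OF assms] by blast

text \<open>
  By right continuity, the value at a random time is the common value at all rational times in a
  short interval after it, so countably many coordinates decide the event.
\<close>

lemma pred_eval_random_time:
  assumes [measurable]: "\<tau> \<in> borel_measurable (cadlag_space V)" 
    and pos: "\<And>y. y \<in> space (cadlag_space V) \<Longrightarrow> 0 \<le> \<tau> y"
  shows "Measurable.pred (cadlag_space V) (\<lambda>y. y (\<tau> y) = i)"
proof -
  have "y (\<tau> y) = i \<longleftrightarrow> (\<exists>m::nat. \<forall>p::rat. \<tau> y < of_rat p \<and> of_rat p < \<tau> y + 1 / Suc m
            \<longrightarrow> y (max 0 (of_rat p)) = i)" (is "_ = ?R")
    if y: "y \<in> space (cadlag_space V)" for y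
  proof -
    obtain d where d: "d > 0" "\<And>u. \<tau> y \<le> u \<Longrightarrow> u < \<tau> y + d \<Longrightarrow> y u = y (\<tau> y)"
      using cadlag_right_interval[OF y pos[OF y]] by blast
    show ?thesis
    proof
      assume a: "y (\<tau> y) = i"
      obtain m :: nat where m: "1 / Suc m < d" using d(1) nat_approx_posE by blast
      show ?R
      proof (intro exI[of _ m] allI impI)
        fix p :: rat assume p: "\<tau> y < of_rat p \<and> of_rat p < \<tau> y + 1 / Suc m"
        then have "max 0 (of_rat p) = (of_rat p :: real)" using pos[OF y] by (intro max_absorb2) linarith
        then show "y (max 0 (of_rat p)) = i"
          using p d(2)[of "of_rat p"] m a by simp
      qed
    next
      assume ?R
      then obtain m :: nat where m: "\<And>p::rat. \<tau> y < of_rat p \<Longrightarrow> of_rat p < \<tau> y + 1 / Suc m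
            \<Longrightarrow> y (max 0 (of_rat p)) = i" by blast
      obtain p :: rat where p: "\<tau> y < of_rat p" "of_rat p < \<tau> y + min d (1 / Suc m)"
        using rat_between_right[of "\<tau> y" "\<tau> y + min d (1 / Suc m)"] d(1) by auto
      then have "max 0 (of_rat p) = (of_rat p :: real)" using pos[OF y] by (intro max_absorb2) linarith
      then show "y (\<tau> y) = i" using p m[of p] d(2)[of "of_rat p"] by simp
    qed
  qed
  then have "Measurable.pred (cadlag_space V) (\<lambda>y. y (\<tau> y) = i) \<longleftrightarrow>
    Measurable.pred (cadlag_space V) (\<lambda>y. (\<exists>m::nat. \<forall>p::rat. \<tau> y < of_rat p \<and> of_rat p < \<tau> y + 1 / Suc m
            \<longrightarrow> y (max 0 (of_rat p)) = i))" by (intro measurable_cong)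
  also have "\<dots>" by measurable
  finally show ?thesis .
qed

section \<open>Exit times\<close>

definition leaves :: "'v \<Rightarrow> real \<Rightarrow> (real \<Rightarrow> 'v) \<Rightarrow> bool" where
  "leaves i s y \<longleftrightarrow> (\<exists>u>s. y u \<noteq> i)"

text \<open>
  For a path that never leaves \<open>i\<close> after time \<open>s\<close>, the value 0 is a mere default; \<open>leaves\<close>
  tells the two cases apart.
\<close>

definition exit_time :: "'v \<Rightarrow> real \<Rightarrow> (real \<Rightarrow> 'v) \<Rightarrow> real" where
  "exit_time i s y = (if leaves i s y then Inf {u. s < u \<and> y u \<noteq> i} else 0)"

lemma exit_time_nonneg: "0 \<le> s \<Longrightarrow> 0 \<le> exit_time i s y"
proof (cases "leaves i s y")
  case True
  assume s: "0 \<le> s"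
  have "0 \<le> Inf {u. s < u \<and> y u \<noteq> i}"
  proof (rule cInf_greatest)
    show "{u. s < u \<and> y u \<noteq> i} \<noteq> {}" using True unfolding leaves_def by blast
    show "0 \<le> u" if "u \<in> {u. s < u \<and> y u \<noteq> i}" for u using that s by simp
  qed
  then show ?thesis using True by (simp add: exit_time_def)
qed (simp add: exit_time_def)

lemma exit_time_props:
  assumes y: "y \<in> space (cadlag_space V)" and s: "0 \<le> s" and i: "y s = i" and l: "leaves i s y"
  shows "s < exit_time i s y" and "\<And>u. s \<le> u \<Longrightarrow> u < exit_time i s y \<Longrightarrow> y u = i"
    and "y (exit_time i s y) \<noteq> i"
proof -
  define S where "S = {u. s < u \<and> y u \<noteq> i}"
  have S: "S \<noteq> {}" "bdd_below S" using l unfolding leaves_def S_def by (auto intro!: bdd_belowI[of _ s])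
  have e: "exit_time i s y = Inf S" using l by (simp add: exit_time_def S_def)
  obtain d where d: "d > 0" "\<And>u. s \<le> u \<Longrightarrow> u < s + d \<Longrightarrow> y u = y s"
    using cadlag_right_interval[OF y s] by blast
  have "s + d \<le> Inf S"
  proof (rule cInf_greatest[OF S(1)])
    show "s + d \<le> u" if "u \<in> S" for u
      using d(2)[of u] i that by (cases "u < s + d") (simp_all add: S_def)
  qed
  then show 1: "s < exit_time i s y" using d e by simp
  show "y u = i" if "s \<le> u" "u < exit_time i s y" for u
  proof (rule ccontr)
    assume "y u \<noteq> i"
    then have "u \<in> S" using that i by (cases "u = s") (auto simp: S_def)
    then have "Inf S \<le> u" using S by (intro cInf_lower)
    then show False using that e by simp
  qed
  show "y (exit_time i s y) \<noteq> i"
  proof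
    assume a: "y (exit_time i s y) = i"
    have "0 \<le> Inf S" using 1 s e by simp
    then obtain d where d: "d > 0" "\<And>u. Inf S \<le> u \<Longrightarrow> u < Inf S + d \<Longrightarrow> y u = y (Inf S)"
      using cadlag_right_interval[OF y] by blast
    have "Inf S + d \<le> u" if "u \<in> S" for u
      using d(2)[of u] that a e cInf_lower[OF that S(2)] by (cases "u < Inf S + d") (simp_all add: S_def)
    then have "Inf S + d \<le> Inf S" by (intro cInf_greatest S)
    then show False using d by simp
  qed
qed

lemma exit_time_eqI:
  assumes "s < t" "\<And>u. s < u \<Longrightarrow> u < t \<Longrightarrow> y u = i" "y t \<noteq> i"
  shows "leaves i s y" "exit_time i s y = t"
proof -
  show l: "leaves i s y" using assms unfolding leaves_def by blast
  have "Inf {u. s < u \<and> y u \<noteq> i} = t"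
  proof (rule cInf_eq_minimum)
    show "t \<in> {u. s < u \<and> y u \<noteq> i}" using assms by simp
    show "t \<le> u" if "u \<in> {u. s < u \<and> y u \<noteq> i}" for u
      using assms(2)[of u] that by (cases "u < t") simp_all
  qed
  then show "exit_time i s y = t" using l by (simp add: exit_time_def)
qed

lemma exit_time_shift:
  assumes "s \<le> s'" "\<And>u. s \<le> u \<Longrightarrow> u \<le> s' \<Longrightarrow> y u = i"
  shows "leaves i s' y = leaves i s y" "exit_time i s' y = exit_time i s y"
proof -
  have "s' < u \<and> y u \<noteq> i \<longleftrightarrow> s < u \<and> y u \<noteq> i" for u
    using assms(1) assms(2)[of u] by (cases "u \<le> s'") auto
  then have "{u. s' < u \<and> y u \<noteq> i} = {u. s < u \<and> y u \<noteq> i}" by blast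
  moreover from this have "leaves i s' y = leaves i s y" unfolding leaves_def by blast
  ultimately show "leaves i s' y = leaves i s y" "exit_time i s' y = exit_time i s y"
    by (simp_all add: exit_time_def)
qed

text \<open>
  Expresses the jump event in the definition of a jump process through exit times, whose
  measurability is clear.
\<close>

lemma next_jump_iff_exit:
  assumes y: "y \<in> space (cadlag_space V)" and s: "0 \<le> s" and i: "y s = i"
  shows "next_jump y s t j \<longleftrightarrow> j \<noteq> i \<and> leaves i s y \<and> exit_time i s y \<le> s + t \<and> y (exit_time i s y) = j"
proof
  assume "next_jump y s t j"
  then obtain u where u: "j \<noteq> i" "u \<in> {s<..s + t}" "y u = j" "\<forall>v\<in>{s..<u}. y v = i"
    unfolding next_jump_def i by blast
  have "leaves i s y" "exit_time i s y = u"
    by (rule exit_time_eqI[of s u y i]; use u in simp)+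
  then show "j \<noteq> i \<and> leaves i s y \<and> exit_time i s y \<le> s + t \<and> y (exit_time i s y) = j"
    using u by simp
next
  assume a: "j \<noteq> i \<and> leaves i s y \<and> exit_time i s y \<le> s + t \<and> y (exit_time i s y) = j"
  note e = exit_time_props[OF y s i]
  have "\<exists>u\<in>{s<..s + t}. y u = j \<and> (\<forall>v\<in>{s..<u}. y v = y s)"
  proof (intro bexI conjI ballI)
    show "exit_time i s y \<in> {s<..s + t}" using a e(1) by simp
    show "y (exit_time i s y) = j" using a by simp
    show "y v = y s" if "v \<in> {s..<exit_time i s y}" for v
      using e(2)[of v] a that unfolding i by simp
  qed
  then show "next_jump y s t j" using a unfolding next_jump_def i by blast
qed

text \<open>
  By right continuity, a path that leaves \<open>i\<close> is away from \<open>i\<close> at some rational time.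
\<close>

lemma pred_leaves:
  assumes [measurable]: "\<tau> \<in> borel_measurable (cadlag_space V)" 
    and pos: "\<And>y. y \<in> space (cadlag_space V) \<Longrightarrow> 0 \<le> \<tau> y"
  shows "Measurable.pred (cadlag_space V) (\<lambda>y. leaves i (\<tau> y) y)"
    and "Measurable.pred (cadlag_space V) (\<lambda>y. \<exists>u>\<tau> y. u < c \<and> y u \<noteq> i)"
proof -
  have rat: "(\<exists>u>\<tau> y. u < c \<and> y u \<noteq> i) \<longleftrightarrow>
      (\<exists>p::rat. \<tau> y < of_rat p \<and> of_rat p < c \<and> y (max 0 (of_rat p)) \<noteq> i)"
    if y: "y \<in> space (cadlag_space V)" for y c
  proof
    assume "\<exists>u>\<tau> y. u < c \<and> y u \<noteq> i"
    then obtain u where u: "\<tau> y < u" "u < c" "y u \<noteq> i" by auto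
    have "0 \<le> u" using u(1) pos[OF y] by simp
    then obtain d where d: "d > 0" "\<And>v. u \<le> v \<Longrightarrow> v < u + d \<Longrightarrow> y v = y u"
      using cadlag_right_interval[OF y] by blast
    obtain p :: rat where p: "u < of_rat p" "of_rat p < min c (u + d)"
      using rat_between_right[of u "min c (u + d)"] u d(1) by auto
    have "max 0 (of_rat p) = (of_rat p :: real)" using pos[OF y] u p by (intro max_absorb2) linarith
    then show "\<exists>p::rat. \<tau> y < of_rat p \<and> of_rat p < c \<and> y (max 0 (of_rat p)) \<noteq> i"
      using p u d(2)[of "of_rat p"] by (intro exI[of _ p]) simp
  next
    assume "\<exists>p::rat. \<tau> y < of_rat p \<and> of_rat p < c \<and> y (max 0 (of_rat p)) \<noteq> i"
    then obtain p :: rat where p: "\<tau> y < of_rat p" "of_rat p < c" "y (max 0 (of_rat p)) \<noteq> i" by blast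
    moreover have "max 0 (of_rat p) = (of_rat p :: real)" using pos[OF y] p by (intro max_absorb2) linarith
    ultimately show "\<exists>u>\<tau> y. u < c \<and> y u \<noteq> i" by metis
  qed
  show *: "Measurable.pred (cadlag_space V) (\<lambda>y. \<exists>u>\<tau> y. u < c \<and> y u \<noteq> i)" for c
  proof -
    have "Measurable.pred (cadlag_space V) (\<lambda>y. \<exists>u>\<tau> y. u < c \<and> y u \<noteq> i) \<longleftrightarrow>
      Measurable.pred (cadlag_space V) (\<lambda>y. \<exists>p::rat. \<tau> y < of_rat p \<and> of_rat p < c \<and> y (max 0 (of_rat p)) \<noteq> i)"
      by (intro measurable_cong rat)
    also have "\<dots>" by measurable
    finally show ?thesis .
  qed
  have "leaves i (\<tau> y) y \<longleftrightarrow> (\<exists>m::nat. \<exists>u>\<tau> y. u < real m \<and> y u \<noteq> i)" for y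
  proof
    assume "leaves i (\<tau> y) y"
    then obtain u where "\<tau> y < u" "y u \<noteq> i" unfolding leaves_def by blast
    moreover obtain m :: nat where "u < real m" using reals_Archimedean2 by blast
    ultimately show "\<exists>m::nat. \<exists>u>\<tau> y. u < real m \<and> y u \<noteq> i" by blast
  next
    assume "\<exists>m::nat. \<exists>u>\<tau> y. u < real m \<and> y u \<noteq> i"
    then show "leaves i (\<tau> y) y" unfolding leaves_def by blast
  qed
  then have "(\<lambda>y. leaves i (\<tau> y) y) = (\<lambda>y. \<exists>m::nat. \<exists>u>\<tau> y. u < real m \<and> y u \<noteq> i)" by (rule ext)
  moreover have "Measurable.pred (cadlag_space V) (\<lambda>y. \<exists>m::nat. \<exists>u>\<tau> y. u < real m \<and> y u \<noteq> i)"
    by (rule pred_intros_countable(2)) (rule *)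
  ultimately show "Measurable.pred (cadlag_space V) (\<lambda>y. leaves i (\<tau> y) y)" by (simp only:)
qed

lemma measurable_exit_time:
  assumes [measurable]: "\<tau> \<in> borel_measurable (cadlag_space V)" 
    and pos: "\<And>y. y \<in> space (cadlag_space V) \<Longrightarrow> 0 \<le> \<tau> y"
  shows "(\<lambda>y. exit_time i (\<tau> y) y) \<in> borel_measurable (cadlag_space V)"
  unfolding borel_measurable_iff_less
proof
  fix c
  have "{y \<in> space (cadlag_space V). exit_time i (\<tau> y) y < c} =
    {y \<in> space (cadlag_space V). (leaves i (\<tau> y) y \<longrightarrow> (\<exists>u>\<tau> y. u < c \<and> y u \<noteq> i)) \<and>
        (\<not> leaves i (\<tau> y) y \<longrightarrow> 0 < c)}"
  proof (intro Collect_cong conj_cong refl)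
    fix y
    have "Inf {u. \<tau> y < u \<and> y u \<noteq> i} < c \<longleftrightarrow> (\<exists>u>\<tau> y. u < c \<and> y u \<noteq> i)" if "leaves i (\<tau> y) y"
    proof -
      have "{u. \<tau> y < u \<and> y u \<noteq> i} \<noteq> {}" using that by (auto simp: leaves_def)
      moreover have "bdd_below {u. \<tau> y < u \<and> y u \<noteq> i}" by (auto intro!: bdd_belowI[of _ "\<tau> y"])
      ultimately show ?thesis by (subst cInf_less_iff) blast+
    qed
    then show "(exit_time i (\<tau> y) y < c) = ((leaves i (\<tau> y) y \<longrightarrow> (\<exists>u>\<tau> y. u < c \<and> y u \<noteq> i)) \<and>
        (\<not> leaves i (\<tau> y) y \<longrightarrow> 0 < c))" unfolding exit_time_def by auto
  qed
  also have "\<dots> \<in> sets (cadlag_space V)"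
    by (intro predE pred_intros_logic pred_leaves[OF assms]) auto
  finally show "{y \<in> space (cadlag_space V). exit_time i (\<tau> y) y < c} \<in> sets (cadlag_space V)" .
qed

section \<open>The past\<close>

definition stopped :: "real \<Rightarrow> (real \<Rightarrow> 'v) \<Rightarrow> real \<Rightarrow> 'v" where
  "stopped s y = (\<lambda>u\<in>{0..}. y (min u s))"

lemma stopped_in_space:
  assumes y: "y \<in> space (cadlag_space V)" and s: "0 \<le> s"
  shows "stopped s y \<in> space (cadlag_space V)"
proof (rule cadlag_spaceI)
  show "stopped s y \<in> (\<Pi>\<^sub>E t\<in>{0..}. V)" using y s by (auto simp: stopped_def cadlag_in_V)
next
  fix t :: real assume t: "0 \<le> t"
  show "\<exists>d>0. \<forall>u. t < u \<and> u < t + d \<longrightarrow> stopped s y u = stopped s y t"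
  proof (cases "t < s")
    case True
    obtain d where d: "d > 0" "\<And>u. t \<le> u \<Longrightarrow> u < t + d \<Longrightarrow> y u = y t"
      using cadlag_right_interval[OF y t] by blast
    show ?thesis
    proof (intro exI[of _ "min d (s - t)"] conjI allI impI)
      show "0 < min d (s - t)" using d(1) True by simp
      fix u assume u: "t < u \<and> u < t + min d (s - t)"
      then have "y u = y t" by (intro d(2); linarith)
      moreover have "min u s = u" using u by linarith
      ultimately show "stopped s y u = stopped s y t"
        using u t True by (simp add: stopped_def)
    qed
  next
    case False
    then show ?thesis using t by (intro exI[of _ 1]) (auto simp: stopped_def min_def)
  qed
next
  fix t :: real assume t: "0 < t"
  show "\<exists>x\<in>V. \<exists>d>0. \<forall>u. t - d < u \<and> u < t \<longrightarrow> stopped s y u = x"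
  proof (cases "t \<le> s")
    case True
    obtain x d where d: "x \<in> V" "0 < d" "\<And>u. t - d < u \<Longrightarrow> u < t \<Longrightarrow> y u = x"
      using cadlag_left_interval[OF y t] by blast
    show ?thesis
    proof (intro bexI[of _ x] exI[of _ "min d t"] conjI allI impI)
      show "0 < min d t" using d(2) t by simp
      fix u assume u: "t - min d t < u \<and> u < t"
      have "y u = x" using u by (intro d(3); linarith)
      moreover have "0 \<le> u" "u \<le> s" using u True by linarith+
      ultimately show "stopped s y u = x" by (simp add: stopped_def)
    qed (rule d(1))
  next
    case False
    then show ?thesis using t s y
      by (intro bexI[of _ "y s"] exI[of _ "t - s"]) (auto simp: stopped_def min_def cadlag_in_V)
  qed
qed

lemma stopped_eq: "0 \<le> u \<Longrightarrow> u \<le> s \<Longrightarrow> stopped s y u = y u"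
  by (simp add: stopped_def)

text \<open>
  Galmarino's test. Stopping a path at time \<open>s\<close> is a measurable map from the past at time
  \<open>s\<close> to the path space, and an event that does not distinguish a path from the stopped path
  is its own preimage under this map.
\<close>

lemma in_past_if_determined:
  assumes s: "0 \<le> s" and A: "A \<in> sets (cadlag_space V)"
    and inv: "\<And>y. y \<in> space (cadlag_space V) \<Longrightarrow> stopped s y \<in> A \<longleftrightarrow> y \<in> A"
  shows "A \<in> sets (past V s)"
proof -
  let ?P = "PiM {0..s} (\<lambda>_. count_space V)"
  have sp: "space (past V s) = space (cadlag_space V)" by (simp add: past_def)
  have r: "(\<lambda>y. restrict y {0..s}) \<in> past V s \<rightarrow>\<^sub>M ?P"
    unfolding past_def by (rule measurable_vimage_algebra1) (auto simp: space_PiM space_cadlag_space PiE_iff)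
  have c: "(\<lambda>y. y u) \<in> past V s \<rightarrow>\<^sub>M count_space V" if "u \<in> {0..s}" for u
    using measurable_compose[OF r measurable_component_singleton[OF that]] that by simp
  have "stopped s \<in> past V s \<rightarrow>\<^sub>M cadlag_space V"
    unfolding cadlag_space_def
  proof (rule measurable_restrict_space2)
    show "stopped s \<in> space (past V s) \<rightarrow>
      {y. (\<forall>t\<ge>0. \<forall>\<^sub>F u in at_right t. y u = y t) \<and> (\<forall>t>0. \<exists>x\<in>V. \<forall>\<^sub>F u in at_left t. y u = x)}"
    proof
      fix y assume "y \<in> space (past V s)"
      then have "stopped s y \<in> space (cadlag_space V)" using stopped_in_space[OF _ s] unfolding sp by blast
      then show "stopped s y \<in> {y. (\<forall>t\<ge>0. \<forall>\<^sub>F u in at_right t. y u = y t) \<and> (\<forall>t>0. \<exists>x\<in>V. \<forall>\<^sub>F u in at_left t. y u = x)}"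
        unfolding space_cadlag_space by blast
    qed
    show "stopped s \<in> past V s \<rightarrow>\<^sub>M PiM {0..} (\<lambda>_. count_space V)"
      unfolding stopped_def
      by (rule measurable_restrict) (use c s in auto)
  qed
  from measurable_sets[OF this A] have "stopped s -` A \<inter> space (cadlag_space V) \<in> sets (past V s)"
    by (simp add: sp)
  also have "stopped s -` A \<inter> space (cadlag_space V) = A"
    using inv sets.sets_into_space[OF A] by auto
  finally show ?thesis .
qed

section \<open>The strong Markov property at adapted times\<close>

text \<open>
  The integral of \<open>a * exp (- k * u)\<close> over \<open>{0..t}\<close>, with its value for \<open>k = 0\<close>:
  the probability that a jump happens before time \<open>t\<close> and goes to a target with rate \<open>a\<close>, if
  the total rate is \<open>k\<close>.
\<close>

definition jump_prob :: "real \<Rightarrow> real \<Rightarrow> real \<Rightarrow> real" where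
  "jump_prob a k t = a * (if k = 0 then t else (1 - exp (- (k * t))) / k)"

lemma jump_prob_integral:
  assumes t: "0 \<le> t"
  shows "(LINT u:{0..t}|lborel. a * exp (- u * k)) = jump_prob a k t"
proof (cases "k = 0")
  case True
  then show ?thesis using t by (simp add: jump_prob_def set_lebesgue_integral_def)
next
  case False
  have d: "((\<lambda>u. - a / k * exp (- u * k)) has_real_derivative a * exp (- x * k)) (at x)" for x
    using False by (auto intro!: derivative_eq_intros)
  have "(LINT u|lborel. (a * exp (- u * k)) * indicator {0..t} u) =
      (- a / k * exp (- t * k)) - (- a / k * exp (- 0 * k))"
    by (rule integral_FTC_Icc_real[OF t d]) (auto intro!: continuous_intros)
  then show ?thesis using False by (simp add: jump_prob_def set_lebesgue_integral_def field_simps)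
qed

text \<open>
  The density \<open>a * exp (- k * u)\<close> is decreasing in \<open>u\<close>, so on \<open>{l..h}\<close> it lies
  between its values at the end points.
\<close>

lemma jump_prob_bounds:
  assumes "0 \<le> a" "0 \<le> k" "0 \<le> l" "l \<le> h"
  shows "a * (h - l) * exp (- (k * h)) \<le> jump_prob a k h - jump_prob a k l"
    and "jump_prob a k h - jump_prob a k l \<le> a * (h - l) * exp (- (k * l))"
proof -
  have "k * (h - l) * exp (- (k * h)) \<le> exp (- (k * l)) - exp (- (k * h))"
  proof -
    have "exp (- (k * l)) = exp (- (k * h)) * exp (k * (h - l))"
      by (simp add: exp_add[symmetric] algebra_simps)
    moreover have "exp (- (k * h)) * (1 + k * (h - l)) \<le> exp (- (k * h)) * exp (k * (h - l))"
      by (intro mult_left_mono exp_ge_add_one_self) auto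
    ultimately show ?thesis by (simp add: algebra_simps)
  qed
  moreover have "exp (- (k * l)) - exp (- (k * h)) \<le> k * (h - l) * exp (- (k * l))"
  proof -
    have "exp (- (k * h)) = exp (- (k * l)) * exp (- (k * (h - l)))"
      by (simp add: exp_add[symmetric] algebra_simps)
    moreover have "exp (- (k * l)) * (1 + - (k * (h - l))) \<le> exp (- (k * l)) * exp (- (k * (h - l)))"
      by (intro mult_left_mono exp_ge_add_one_self) auto
    ultimately show ?thesis by (simp add: algebra_simps)
  qed
  moreover have "jump_prob a k h - jump_prob a k l = a * ((exp (- (k * l)) - exp (- (k * h))) / k)" if "k \<noteq> 0"
    using that by (simp add: jump_prob_def field_simps)
  ultimately have "k > 0 \<Longrightarrow> (h - l) * exp (- (k * h)) \<le> (exp (- (k * l)) - exp (- (k * h))) / k"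
    "k > 0 \<Longrightarrow> (exp (- (k * l)) - exp (- (k * h))) / k \<le> (h - l) * exp (- (k * l))"
    and *: "k \<noteq> 0 \<Longrightarrow> jump_prob a k h - jump_prob a k l = a * ((exp (- (k * l)) - exp (- (k * h))) / k)"
    by (simp_all add: field_simps)
  from mult_left_mono[OF this(1) \<open>0 \<le> a\<close>] mult_left_mono[OF this(2) \<open>0 \<le> a\<close>] *
  show "a * (h - l) * exp (- (k * h)) \<le> jump_prob a k h - jump_prob a k l"
    and "jump_prob a k h - jump_prob a k l \<le> a * (h - l) * exp (- (k * l))"
    using assms(2) by (cases "k = 0"; simp add: jump_prob_def algebra_simps)+
qed

lemma jump_prob_range:
  assumes "0 \<le> a" "a \<le> k" "0 \<le> t"
  shows "0 \<le> jump_prob a k t" "jump_prob a k t \<le> 1"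
proof -
  show "0 \<le> jump_prob a k t" using assms by (auto simp: jump_prob_def)
  show "jump_prob a k t \<le> 1"
  proof (cases "k = 0")
    case False
    then have "a * (1 - exp (- (k * t))) \<le> k * 1" using assms by (intro mult_mono) auto
    then show ?thesis using False assms by (simp add: jump_prob_def field_simps)
  qed (use assms in \<open>simp add: jump_prob_def\<close>)
qed

lemma tendsto_jump_prob: "(f \<longlongrightarrow> t) F \<Longrightarrow> ((\<lambda>m. jump_prob a k (f m)) \<longlongrightarrow> jump_prob a k t) F"
  unfolding jump_prob_def by (cases "k = 0") (auto intro!: tendsto_intros)

lemma measurable_jump_prob:
  assumes [measurable]: "f \<in> borel_measurable M" "g \<in> borel_measurable M" "h \<in> borel_measurable M"
  shows "(\<lambda>x. jump_prob (f x) (g x) (h x)) \<in> borel_measurable M"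
  unfolding jump_prob_def by measurable

text \<open>
  For nonnegative \<open>x\<close>, the first multiple of \<open>1 / 2 ^ m\<close> strictly after \<open>x\<close>. Because
  the inequality is strict, a path that sits at a site at time \<open>x\<close> still sits there at
  \<open>grid_up m x\<close> for all large \<open>m\<close>.
\<close>

definition grid_up :: "nat \<Rightarrow> real \<Rightarrow> real" where
  "grid_up m x = (real (nat \<lfloor>2 ^ m * x\<rfloor>) + 1) / 2 ^ m"

lemma grid_up_bounds:
  assumes "0 \<le> x" shows "x < grid_up m x" "grid_up m x \<le> x + (1/2) ^ m"
proof -
  have "real (nat \<lfloor>2 ^ m * x\<rfloor>) = of_int \<lfloor>2 ^ m * x\<rfloor>" using assms by simp
  then have g: "grid_up m x = (of_int \<lfloor>2 ^ m * x\<rfloor> + 1) / 2 ^ m" by (simp add: grid_up_def)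
  have "2 ^ m * x < of_int \<lfloor>2 ^ m * x\<rfloor> + 1" "of_int \<lfloor>2 ^ m * x\<rfloor> \<le> 2 ^ m * x" by linarith+
  then show "x < grid_up m x" "grid_up m x \<le> x + (1/2) ^ m"
    unfolding g by (simp_all add: field_simps)
qed

lemma grid_up_mono: "x \<le> x' \<Longrightarrow> grid_up m x \<le> grid_up m x'"
  unfolding grid_up_def
  by (intro divide_right_mono add_right_mono of_nat_mono nat_mono floor_mono mult_left_mono) auto

lemma grid_up_tendsto:
  assumes "0 \<le> x" shows "(\<lambda>m. grid_up m x) \<longlonglongrightarrow> x"
proof (rule tendsto_sandwich[of "\<lambda>_. x" _ _ "\<lambda>m. x + (1/2) ^ m"])
  show "(\<lambda>m. x + (1/2) ^ m) \<longlonglongrightarrow> x"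
    using tendsto_add[OF tendsto_const[of x] LIMSEQ_realpow_zero[of "1/2"]] by simp
qed (auto intro!: always_eventually less_imp_le grid_up_bounds assms)

lemma measurable_grid_up[measurable]: "grid_up m \<in> borel_measurable borel"
  unfolding grid_up_def[abs_def] by measurable

lemma borel_measurable_pred_le[measurable (raw)]:
  fixes f :: "'a \<Rightarrow> real"
  shows "f \<in> borel_measurable M \<Longrightarrow> g \<in> borel_measurable M \<Longrightarrow> Measurable.pred M (\<lambda>w. f w \<le> g w)"
  unfolding Measurable.pred_def by (rule borel_measurable_le)

text \<open>
  The law of a jump process prescribes jump probabilities at deterministic times only. The
  random times \<open>\<tau>\<close> and \<open>\<tau> + g\<close> are therefore rounded up to a dyadic grid. There
  are countably many cells on which both rounded times are constants; there, the event that the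
  path has not yet jumped at the rounded time belongs to the past of that time, and the
  prescribed probability applies. Summation over the cells and refinement of the grid, with
  dominated convergence, give the claim. The hypothesis \<open>adapted\<close> says that \<open>B\<close>, \<open>\<tau>\<close>
  and \<open>g\<close> are determined by the path up to time \<open>\<tau>\<close>, as for a stopping time, and
  \<open>const\<close> says that the rates are frozen until the next jump.
\<close>

lemma strong_markov:
  assumes law: "jump_process_law V E q i0 Q"
    and B: "B \<in> sets (cadlag_space V)"
    and \<tau>[measurable]: "\<tau> \<in> borel_measurable (cadlag_space V)"
    and \<tau>0: "\<And>y. y \<in> space (cadlag_space V) \<Longrightarrow> 0 \<le> \<tau> y"
    and g[measurable]: "g \<in> borel_measurable (cadlag_space V)"
    and g0: "\<And>y. y \<in> B \<Longrightarrow> 0 \<le> g y"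
    and \<kappa>[measurable]: "\<And>k. k \<in> nbrs E i \<Longrightarrow> (\<lambda>y. \<kappa> y k) \<in> borel_measurable (cadlag_space V)"
    and \<kappa>0: "\<And>y k. y \<in> B \<Longrightarrow> k \<in> nbrs E i \<Longrightarrow> 0 \<le> \<kappa> y k"
    and at: "\<And>y. y \<in> B \<Longrightarrow> y (\<tau> y) = i"
    and adapted: "\<And>y y'. y \<in> B \<Longrightarrow> y' \<in> space (cadlag_space V) \<Longrightarrow> (\<And>u. 0 \<le> u \<Longrightarrow> u \<le> \<tau> y \<Longrightarrow> y' u = y u)
        \<Longrightarrow> y' \<in> B \<and> \<tau> y' = \<tau> y \<and> g y' = g y"
    and const: "\<And>y s k. y \<in> B \<Longrightarrow> \<tau> y \<le> s \<Longrightarrow> (\<And>u. \<tau> y \<le> u \<Longrightarrow> u \<le> s \<Longrightarrow> y u = i)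
        \<Longrightarrow> k \<in> nbrs E i \<Longrightarrow> q y s k = \<kappa> y k"
    and fin: "finite (nbrs E i)" and j: "j \<in> V"
  shows "measure Q {y \<in> B. next_jump y (\<tau> y) (g y) j} =
     (LINT y:B|Q. (if j \<in> nbrs E i then jump_prob (\<kappa> y j) (\<Sum>k\<in>nbrs E i. \<kappa> y k) (g y) else 0))"
proof -
  let ?C = "cadlag_space V"
  interpret Q: prob_space Q using law by (simp add: jump_process_law_def)
  have sQ[measurable_cong]: "sets Q = sets ?C" using law by (simp add: jump_process_law_def)
  have spQ: "space Q = space ?C" using sQ by (rule sets_eq_imp_space_eq)
  have formula: "measure Q {y\<in>A. next_jump y s t j} =
        (LINT y:A|Q. (LINT u:{0..t}|lborel.
           (if j \<in> nbrs E (y s)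
            then q y s j * exp (- u * (\<Sum>k\<in>nbrs E (y s). q y s k)) else 0)))"
    if "0 \<le> s" "0 \<le> t" "A \<in> sets (past V s)" for s t A
    using law that j unfolding jump_process_law_def by blast
  have BC: "y \<in> space ?C" if "y \<in> B" for y using sets.sets_into_space[OF B] that by blast
  define e where "e y = exit_time i (\<tau> y) y" for y
  define lv where "lv y = leaves i (\<tau> y) y" for y
  have e[measurable]: "e \<in> borel_measurable ?C"
    unfolding e_def by (rule measurable_exit_time[OF \<tau> \<tau>0])
  have lv[measurable]: "Measurable.pred ?C lv"
    unfolding lv_def by (rule pred_leaves(1)[OF \<tau> \<tau>0])
  have e0: "0 \<le> e y" if "y \<in> space ?C" for y unfolding e_def by (rule exit_time_nonneg[OF \<tau>0[OF that]])
  have ej[measurable]: "Measurable.pred ?C (\<lambda>y. y (e y) = j)"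
    by (rule pred_eval_random_time[OF e e0])
  note BB[measurable] = B
  have ex: "\<tau> y < e y" "\<And>u. \<tau> y \<le> u \<Longrightarrow> u < e y \<Longrightarrow> y u = i" "y (e y) \<noteq> i" if "y \<in> B" "lv y" for y
    using exit_time_props[OF BC[OF that(1)] \<tau>0[OF BC[OF that(1)]] at[OF that(1)]] that(2)
    unfolding e_def lv_def by blast+
  define con where "con y s \<longleftrightarrow> (\<forall>u. \<tau> y \<le> u \<longrightarrow> u \<le> s \<longrightarrow> y u = i)" for y s
  have con: "con y s \<longleftrightarrow> \<not> (lv y \<and> e y \<le> s)" if y: "y \<in> B" and "\<tau> y \<le> s" for y s
  proof
    assume c: "con y s"
    show "\<not> (lv y \<and> e y \<le> s)"
    proof
      assume l: "lv y \<and> e y \<le> s"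
      then have "y (e y) = i" using c ex(1)[OF y] unfolding con_def by (meson less_imp_le)
      then show False using ex(3)[OF y] l by blast
    qed
  next
    assume n: "\<not> (lv y \<and> e y \<le> s)"
    show "con y s" unfolding con_def
    proof (intro allI impI)
      fix u assume u: "\<tau> y \<le> u" "u \<le> s"
      show "y u = i"
      proof (cases "lv y")
        case True
        then show ?thesis using ex(2)[OF y True u(1)] n u by linarith
      next
        case False
        then show ?thesis using at[OF y] u unfolding lv_def leaves_def by (cases "u = \<tau> y") auto
      qed
    qed
  qed
  \<comment> \<open>The paths that have not jumped between \<open>\<tau>\<close> and its rounded value.\<close>
  define K where "K m = {y \<in> B. con y (grid_up m (\<tau> y))}" for m
  have K_eq: "K m = {y \<in> B. \<not> (lv y \<and> e y \<le> grid_up m (\<tau> y))}" for m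
    unfolding K_def using con[OF _ less_imp_le[OF grid_up_bounds(1)[OF \<tau>0[OF BC]]]] by blast
  have K[measurable]: "K m \<in> sets ?C" for m
  proof -
    have "K m = B \<inter> {y \<in> space ?C. \<not> (lv y \<and> e y \<le> grid_up m (\<tau> y))}" using BC K_eq by blast
    also have "\<dots> \<in> sets ?C" by (intro sets.Int B predE) measurable
    finally show ?thesis .
  qed
  define J where "J y b \<longleftrightarrow> j \<noteq> i \<and> lv y \<and> e y \<le> b \<and> y (e y) = j" for y b
  have nj: "next_jump y s t j \<longleftrightarrow> J y (s + t)" if y: "y \<in> B" "\<tau> y \<le> s" "con y s" for y s t
  proof -
    have s0: "0 \<le> s" using \<tau>0[OF BC[OF y(1)]] y(2) by linarith
    have "leaves i s y = lv y" "exit_time i s y = e y"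
      using exit_time_shift[of "\<tau> y" s y i] y(2,3) unfolding lv_def e_def con_def by blast+
    moreover have "y s = i" using y unfolding con_def by blast
    ultimately show ?thesis unfolding J_def next_jump_iff_exit[OF BC[OF y(1)] s0 \<open>y s = i\<close>] by simp
  qed
  define b where "b m y = grid_up m (\<tau> y + g y)" for m y
  define a where "a m y = grid_up m (\<tau> y)" for m y
  have [measurable]: "a m \<in> borel_measurable ?C" "b m \<in> borel_measurable ?C" for m
    unfolding a_def[abs_def] b_def[abs_def] by measurable
  have ab: "\<tau> y < a m y" "a m y \<le> b m y" "\<tau> y + g y < b m y" if "y \<in> B" for y m
    unfolding a_def b_def using \<tau>0[OF BC[OF that]] g0[OF that]
    by (auto intro!: grid_up_bounds grid_up_mono)
  define X where "X m = {y \<in> K m. J y (b m y)}" for m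
  have X[measurable]: "X m \<in> sets ?C" for m
  proof -
    have "X m = K m \<inter> {y \<in> space ?C. j \<noteq> i \<and> lv y \<and> e y \<le> b m y \<and> y (e y) = j}"
      using BC unfolding X_def J_def K_def by blast
    also have "\<dots> \<in> sets ?C" by (intro sets.Int B K predE) measurable
    finally show ?thesis .
  qed
  define G where "G y t = (if j \<in> nbrs E i then jump_prob (\<kappa> y j) (\<Sum>k\<in>nbrs E i. \<kappa> y k) t else 0)" for y t
  have Gm: "(\<lambda>y. G y (h y)) \<in> borel_measurable ?C" if [measurable]: "h \<in> borel_measurable ?C" for h
    unfolding G_def using measurable_jump_prob[of "\<lambda>y. \<kappa> y j" ?C "\<lambda>y. \<Sum>k\<in>nbrs E i. \<kappa> y k" h] by (cases "j \<in> nbrs E i") auto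
  have Gab[measurable]: "(\<lambda>y. G y (b m y - a m y)) \<in> borel_measurable ?C" for m
    by (rule Gm) measurable
  have Gg[measurable]: "(\<lambda>y. G y (g y)) \<in> borel_measurable ?C"
    by (rule Gm) measurable
  have Gr: "0 \<le> G y t \<and> G y t \<le> 1" if "y \<in> B" "0 \<le> t" for y t
    using jump_prob_range[of "\<kappa> y j" "\<Sum>k\<in>nbrs E i. \<kappa> y k" t] \<kappa>0[OF that(1)] that(2) fin member_le_sum[of j "nbrs E i" "\<kappa> y"]
    unfolding G_def by auto
  have step: "measure Q (X m) = (LINT y|Q. indicator (K m) y * G y (b m y - a m y))" for m
  proof -
    \<comment> \<open>The cells on which both rounded times are constant, enumerated through pairs of naturals.\<close>
    define cell where "cell c = {y \<in> B. nat \<lfloor>2 ^ m * \<tau> y\<rfloor> = fst (prod_decode c) \<and>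
        nat \<lfloor>2 ^ m * (\<tau> y + g y)\<rfloor> = snd (prod_decode c)}" for c
    have cell_m[measurable]: "cell c \<in> sets ?C" for c
    proof -
      have "cell c = B \<inter> {y \<in> space ?C. nat \<lfloor>2 ^ m * \<tau> y\<rfloor> = fst (prod_decode c) \<and>
        nat \<lfloor>2 ^ m * (\<tau> y + g y)\<rfloor> = snd (prod_decode c)}" using BC unfolding cell_def by blast
      also have "\<dots> \<in> sets ?C" by (intro sets.Int B K predE) measurable
      finally show ?thesis .
    qed
    have disj: "disjoint_family cell"
      unfolding disjoint_family_on_def cell_def
      by (auto simp: prod_eq_iff[symmetric]) (metis prod.collapse prod_decode_inverse)
    have cover: "(\<Union>c. cell c) = B"
    proof -
      have "y \<in> cell (prod_encode (nat \<lfloor>2 ^ m * \<tau> y\<rfloor>, nat \<lfloor>2 ^ m * (\<tau> y + g y)\<rfloor>))" if "y \<in> B" for y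
        using that by (simp add: cell_def)
      moreover have "cell c \<subseteq> B" for c unfolding cell_def by blast
      ultimately show ?thesis by blast
    qed
    have one: "emeasure Q (X m \<inter> cell c) = (\<integral>\<^sup>+y\<in>cell c. ennreal (indicator (K m) y * G y (b m y - a m y)) \<partial>Q)" for c
    proof -
      define s where "s = (real (fst (prod_decode c)) + 1) / 2 ^ m"
      define t where "t = (real (snd (prod_decode c)) + 1) / 2 ^ m"
      have as: "a m y = s" "b m y = t" if "y \<in> cell c" for y
        using that unfolding cell_def a_def b_def grid_up_def s_def t_def by auto
      define A where "A = K m \<inter> cell c"
      have AB: "y \<in> B" if "y \<in> A" for y using that unfolding A_def cell_def by blast
      have A[measurable]: "A \<in> sets ?C" unfolding A_def by measurable
      show ?thesis
      proof (cases "s \<le> t \<and> 0 \<le> s")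
        case False
        then have "cell c = {}" using ab(2)[of _ m] as unfolding cell_def s_def by fastforce
        then show ?thesis by simp
      next
        case True
        have Aiff: "y \<in> A \<longleftrightarrow> y \<in> B \<and> con y s \<and> y \<in> cell c" for y
          unfolding A_def K_def using as[of y] unfolding a_def by auto
        have trans: "y' \<in> A" if y: "y \<in> A" and y': "y' \<in> space ?C" and eq: "\<And>u. 0 \<le> u \<Longrightarrow> u \<le> s \<Longrightarrow> y' u = y u" for y y'
        proof -
          have yB: "y \<in> B" and cy: "con y s" and ce: "y \<in> cell c" using y Aiff by blast+
          have ts: "\<tau> y < s" using ab(1)[OF yB, of m] as(1)[OF ce] by simp
          have h: "y' \<in> B \<and> \<tau> y' = \<tau> y \<and> g y' = g y"
            using adapted[OF yB y'] eq ts by (meson less_imp_le order_trans)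
          moreover have "con y' s" unfolding con_def
          proof (intro allI impI)
            fix u assume u: "\<tau> y' \<le> u" "u \<le> s"
            then show "y' u = i" using h cy eq[of u] \<tau>0[OF y'] unfolding con_def by simp
          qed
          moreover have "y' \<in> cell c" using ce h unfolding cell_def by simp
          ultimately show ?thesis using Aiff by blast
        qed
        have past: "A \<in> sets (past V s)"
        proof (rule in_past_if_determined[OF _ A])
          show "0 \<le> s" using True by simp
          fix y assume y: "y \<in> space ?C"
          note st = stopped_in_space[OF y conjunct2[OF True]]
          show "stopped s y \<in> A \<longleftrightarrow> y \<in> A"
            using trans[OF _ y, of "stopped s y"] trans[OF _ st, of y] stopped_eq[of _ s y] by metis
        qed
        have "X m \<inter> cell c = {y \<in> A. next_jump y s (t - s) j}"
        proof -
          have "y \<in> A \<Longrightarrow> next_jump y s (t - s) j \<longleftrightarrow> J y (b m y)" for y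
            using nj[of y s "t - s"] Aiff[of y] ab(1)[of y m] as[of y] by simp
          then show ?thesis unfolding X_def A_def by blast
        qed
        then have "measure Q (X m \<inter> cell c) = (LINT y:A|Q. (LINT u:{0..t - s}|lborel.
           (if j \<in> nbrs E (y s)
            then q y s j * exp (- u * (\<Sum>k\<in>nbrs E (y s). q y s k)) else 0)))"
          using formula[OF _ _ past, of "t - s"] True by simp
        also have "\<dots> = (LINT y:A|Q. G y (b m y - a m y))"
        proof (intro set_lebesgue_integral_cong allI impI)
          show "A \<in> sets Q" by measurable
          fix y assume y: "y \<in> A"
          then have yB: "y \<in> B" and cy: "con y s" and ce: "y \<in> cell c" using Aiff by blast+
          have ts: "\<tau> y \<le> s" using ab(1)[OF yB, of m] as(1)[OF ce] by simp
          have ysi: "y s = i" using cy ts unfolding con_def by blast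
          have qk: "q y s k = \<kappa> y k" if "k \<in> nbrs E i" for k
            using const[OF yB ts _ that] cy unfolding con_def by blast
          have sk: "(\<Sum>k\<in>nbrs E i. q y s k) = (\<Sum>k\<in>nbrs E i. \<kappa> y k)"
            by (intro sum.cong refl qk)
          show "(LINT u:{0..t - s}|lborel.
           (if j \<in> nbrs E (y s)
            then q y s j * exp (- u * (\<Sum>k\<in>nbrs E (y s). q y s k)) else 0)) = G y (b m y - a m y)"
          proof (cases "j \<in> nbrs E i")
            case jn: True
            show ?thesis unfolding ysi sk G_def as[OF ce] using jn True
              by (simp only: qk if_True jump_prob_integral diff_ge_0_iff_ge simp_thms)
          next
            case False
            then show ?thesis unfolding ysi G_def by (simp add: set_lebesgue_integral_def)
          qed
        qed
        also have "\<dots> = (LINT y|Q. indicator A y * G y (b m y - a m y))"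
          by (simp add: set_lebesgue_integral_def)
        finally have 1: "measure Q (X m \<inter> cell c) = (LINT y|Q. indicator A y * G y (b m y - a m y))" .
        have nonneg: "0 \<le> indicator A y * G y (b m y - a m y)" for y
          using Gr[of y "b m y - a m y"] ab(2)[of y m] AB[of y] by (auto simp: indicator_def)
        have "integrable Q (\<lambda>y. indicator A y * G y (b m y - a m y))"
        proof (rule Q.integrable_const_bound[where B=1])
          show "AE y in Q. norm (indicator A y * G y (b m y - a m y)) \<le> 1"
            using Gr[of _ "b m _ - a m _"] ab(2)[of _ m] AB by (intro AE_I2) (auto simp: indicator_def)
          show "(\<lambda>y. indicator A y * G y (b m y - a m y)) \<in> borel_measurable Q"
            by measurable
        qed
        then have "ennreal (measure Q (X m \<inter> cell c)) = (\<integral>\<^sup>+y. ennreal (indicator A y * G y (b m y - a m y)) \<partial>Q)"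
          unfolding 1 by (subst nn_integral_eq_integral) (use nonneg in auto)
        also have "\<dots> = (\<integral>\<^sup>+y\<in>cell c. ennreal (indicator (K m) y * G y (b m y - a m y)) \<partial>Q)"
          by (intro nn_integral_cong) (auto simp: A_def indicator_def)
        finally show ?thesis by (simp add: Q.emeasure_eq_measure)
      qed
    qed
    have "emeasure Q (X m) = emeasure Q (\<Union>c. X m \<inter> cell c)"
      using cover unfolding X_def K_def by (intro arg_cong[where f="emeasure Q"]) blast
    also have "\<dots> = (\<Sum>c. emeasure Q (X m \<inter> cell c))"
      using disj by (intro suminf_emeasure[symmetric]) (auto simp: disjoint_family_on_def)
    also have "\<dots> = (\<integral>\<^sup>+y\<in>(\<Union>c. cell c). ennreal (indicator (K m) y * G y (b m y - a m y)) \<partial>Q)"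
      unfolding one by (intro nn_integral_disjoint_family[symmetric] disj) measurable
    also have "\<dots> = (\<integral>\<^sup>+y. ennreal (indicator (K m) y * G y (b m y - a m y)) \<partial>Q)"
      unfolding cover by (intro nn_integral_cong) (auto simp: K_def indicator_def)
    also have "\<dots> = ennreal (LINT y|Q. indicator (K m) y * G y (b m y - a m y))"
    proof (rule nn_integral_eq_integral)
      have r: "0 \<le> indicator (K m) y * G y (b m y - a m y) \<and> indicator (K m) y * G y (b m y - a m y) \<le> 1" for y
        using Gr[of y "b m y - a m y"] ab(2)[of y m] by (auto simp: indicator_def K_def)
      then show "AE y in Q. 0 \<le> indicator (K m) y * G y (b m y - a m y)" by simp
      show "integrable Q (\<lambda>y. indicator (K m) y * G y (b m y - a m y))"
      proof (rule Q.integrable_const_bound[where B=1])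
        show "AE y in Q. norm (indicator (K m) y * G y (b m y - a m y)) \<le> 1"
          using r by (intro AE_I2) (simp add: abs_le_iff order_trans[of _ 0])
        show "(\<lambda>y. indicator (K m) y * G y (b m y - a m y)) \<in> borel_measurable Q"
          by measurable
      qed
    qed
    finally show ?thesis
      using Gr ab(2)
      by (subst (asm) Q.emeasure_eq_measure, subst (asm) ennreal_inj)
        (auto intro!: Bochner_Integration.integral_nonneg simp: indicator_def K_def)
  qed
  define X' where "X' = {y \<in> B. J y (\<tau> y + g y)}"
  have X'[measurable]: "X' \<in> sets ?C"
  proof -
    have "X' = B \<inter> {y \<in> space ?C. j \<noteq> i \<and> lv y \<and> e y \<le> \<tau> y + g y \<and> y (e y) = j}"
      using BC unfolding X'_def J_def by blast
    also have "\<dots> \<in> sets ?C" by (intro sets.Int B K predE) measurable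
    finally show ?thesis .
  qed
  have evK: "\<forall>\<^sub>F m in sequentially. y \<in> K m" if y: "y \<in> B" for y
  proof (cases "lv y")
    case True
    have "\<forall>\<^sub>F m in sequentially. grid_up m (\<tau> y) < e y"
      using order_tendstoD(2)[OF grid_up_tendsto[OF \<tau>0[OF BC[OF y]]]] ex(1)[OF y True] by blast
    then show ?thesis by eventually_elim (use y in \<open>auto simp: K_eq\<close>)
  qed (use y in \<open>auto simp: K_eq\<close>)
  have evX: "\<forall>\<^sub>F m in sequentially. (y \<in> X m) = (y \<in> X')" if y: "y \<in> B" for y
  proof (cases "e y \<le> \<tau> y + g y")
    case True
    show ?thesis using evK[OF y]
    proof eventually_elim
      case (elim m)
      then show ?case using True ab(3)[OF y, of m] y unfolding X_def X'_def J_def by auto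
    qed
  next
    case False
    have "0 \<le> \<tau> y + g y" using \<tau>0[OF BC[OF y]] g0[OF y] by simp
    from order_tendstoD(2)[OF grid_up_tendsto[OF this]] False
    have "\<forall>\<^sub>F m in sequentially. b m y < e y" unfolding b_def by simp
    then show ?thesis by eventually_elim (use False in \<open>auto simp: X_def X'_def J_def\<close>)
  qed
  have sub: "X m \<subseteq> B" "K m \<subseteq> B" "X' \<subseteq> B" for m unfolding X_def K_def X'_def by auto
  have "(\<lambda>m. LINT y|Q. indicator (X m) y :: real) \<longlonglongrightarrow> (LINT y|Q. indicator X' y)"
  proof (rule integral_dominated_convergence[where w="\<lambda>_. 1"])
    show "AE y in Q. (\<lambda>m. indicator (X m) y :: real) \<longlonglongrightarrow> indicator X' y"
    proof (rule AE_I2)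
      fix y
      show "(\<lambda>m. indicator (X m) y :: real) \<longlonglongrightarrow> indicator X' y"
      proof (cases "y \<in> B")
        case True
        show ?thesis by (rule tendsto_eventually) (use evX[OF True] in \<open>auto elim!: eventually_mono simp: indicator_def\<close>)
      next
        case False
        then have "y \<notin> X'" "\<And>m. y \<notin> X m" using sub by blast+
        then show ?thesis by simp
      qed
    qed
  qed (auto simp: indicator_def)
  then have 1: "(\<lambda>m. measure Q (X m)) \<longlonglongrightarrow> measure Q X'" by simp
  have "(\<lambda>m. LINT y|Q. indicator (K m) y * G y (b m y - a m y)) \<longlonglongrightarrow> (LINT y|Q. indicator B y * G y (g y))"
  proof (rule integral_dominated_convergence[where w="\<lambda>_. 1"])
    show "AE y in Q. (\<lambda>m. indicator (K m) y * G y (b m y - a m y)) \<longlonglongrightarrow> indicator B y * G y (g y)"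
    proof (rule AE_I2)
      fix y
      show "(\<lambda>m. indicator (K m) y * G y (b m y - a m y)) \<longlonglongrightarrow> indicator B y * G y (g y)"
      proof (cases "y \<in> B")
        case True
        have "(\<lambda>m. indicator (K m) y :: real) \<longlonglongrightarrow> indicator B y"
          by (rule tendsto_eventually) (use evK[OF True] True in \<open>auto elim!: eventually_mono simp: indicator_def\<close>)
        moreover have "(\<lambda>m. G y (b m y - a m y)) \<longlonglongrightarrow> G y (g y)"
        proof -
          have "(\<lambda>m. b m y - a m y) \<longlonglongrightarrow> (\<tau> y + g y) - \<tau> y"
            unfolding a_def b_def using \<tau>0[OF BC[OF True]] g0[OF True]
            by (intro tendsto_diff grid_up_tendsto) auto
          then show ?thesis unfolding G_def by (auto intro!: tendsto_jump_prob)
        qed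
        ultimately show ?thesis by (intro tendsto_mult)
      next
        case False
        then have "\<And>m. y \<notin> K m" using sub by blast
        then show ?thesis using False by simp
      qed
    qed
    show "AE y in Q. norm (indicator (K m) y * G y (b m y - a m y)) \<le> 1" for m
      using Gr[of _ "b m _ - a m _"] ab(2)[of _ m] sub(2)[of m]
      by (intro AE_I2) (auto simp: indicator_def)
    show "(\<lambda>y. indicator (K m) y * G y (b m y - a m y)) \<in> borel_measurable Q" for m
      by measurable
    show "(\<lambda>y. indicator B y * G y (g y)) \<in> borel_measurable Q"
      by measurable
  qed auto
  then have "(\<lambda>m. measure Q (X m)) \<longlonglongrightarrow> (LINT y|Q. indicator B y * G y (g y))" by (simp add: step)
  from LIMSEQ_unique[OF 1 this] have "measure Q X' = (LINT y|Q. indicator B y * G y (g y))" .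
  moreover have "X' = {y \<in> B. next_jump y (\<tau> y) (g y) j}"
    unfolding X'_def using nj[of _ "\<tau> _"] at unfolding con_def by (auto; metis order_antisym order_refl)
  ultimately show ?thesis by (simp add: G_def set_lebesgue_integral_def)
qed

section \<open>Probabilities of finite trajectories\<close>

text \<open>
  Successive exit times along a prescribed itinerary. They are jump times of the path only if
  the path follows the itinerary.
\<close>

primrec jump_times :: "(nat \<Rightarrow> 'v) \<Rightarrow> (real \<Rightarrow> 'v) \<Rightarrow> nat \<Rightarrow> real" where
  "jump_times \<sigma> y 0 = 0"
| "jump_times \<sigma> y (Suc n) = exit_time (\<sigma> n) (jump_times \<sigma> y n) y"

declare jump_times.simps(2)[simp del]

definition follows :: "(real \<Rightarrow> 'v) \<Rightarrow> (nat \<Rightarrow> 'v) \<Rightarrow> nat \<Rightarrow> (nat \<Rightarrow> real) \<Rightarrow> bool" where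
  "follows y \<sigma> n t \<longleftrightarrow> t 0 = 0 \<and>
     (\<forall>k<n. t k < t (Suc k) \<and> (\<forall>u. t k \<le> u \<longrightarrow> u < t (Suc k) \<longrightarrow> y u = \<sigma> k)) \<and> y (t n) = \<sigma> n"

lemma follows_0: "follows y \<sigma> 0 t \<longleftrightarrow> t 0 = 0 \<and> y 0 = \<sigma> 0"
  by (auto simp: follows_def)

lemma follows_at: "follows y \<sigma> n t \<Longrightarrow> k \<le> n \<Longrightarrow> y (t k) = \<sigma> k"
  unfolding follows_def by (cases "k = n") auto

lemma follows_prefix: "follows y \<sigma> n t \<Longrightarrow> k \<le> n \<Longrightarrow> follows y \<sigma> k t"
  using follows_at[of y \<sigma> n t k] unfolding follows_def by auto

lemma follows_mono: "follows y \<sigma> n t \<Longrightarrow> k \<le> m \<Longrightarrow> m \<le> n \<Longrightarrow> t k \<le> t m"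
proof (induction m)
  case (Suc m)
  show ?case
  proof (cases "k = Suc m")
    case False
    then have "t k \<le> t m" using Suc by simp
    also have "t m < t (Suc m)" using Suc.prems unfolding follows_def by simp
    finally show ?thesis by simp
  qed simp
qed simp

lemma follows_nonneg: "follows y \<sigma> n t \<Longrightarrow> k \<le> n \<Longrightarrow> 0 \<le> t k"
  using follows_mono[of y \<sigma> n t 0 k] by (simp add: follows_def)

lemma follows_cong:
  assumes "follows y \<sigma> n t" "\<And>u. 0 \<le> u \<Longrightarrow> u \<le> t n \<Longrightarrow> y' u = y u"
  shows "follows y' \<sigma> n t"
proof -
  have "y' u = \<sigma> k" if "k < n" "t k \<le> u" "u < t (Suc k)" for k u
  proof -
    have "0 \<le> t k" using follows_nonneg[OF assms(1)] that by simp
    moreover have "t (Suc k) \<le> t n" using follows_mono[OF assms(1)] that by simp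
    ultimately have "y' u = y u" using that by (intro assms(2)) auto
    then show ?thesis using assms(1) that unfolding follows_def by simp
  qed
  moreover have "y' (t n) = \<sigma> n" using assms follows_nonneg[OF assms(1), of n] follows_at[OF assms(1), of n] by simp
  ultimately show ?thesis using assms(1) unfolding follows_def by simp
qed

lemma follows_Suc_iff:
  "follows y \<sigma> (Suc n) t \<longleftrightarrow> follows y \<sigma> n t \<and> t n < t (Suc n) \<and>
     (\<forall>u. t n \<le> u \<longrightarrow> u < t (Suc n) \<longrightarrow> y u = \<sigma> n) \<and> y (t (Suc n)) = \<sigma> (Suc n)" (is "?L = ?R")
proof
  assume L: ?L
  from follows_prefix[OF L, of n] L show ?R unfolding follows_def by simp
next
  assume ?R then show ?L unfolding follows_def by (auto simp: less_Suc_eq)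
qed

text \<open>
  Consecutive sites differ, so the times at which a path moves along the itinerary are
  determined by the path.
\<close>

lemma follows_jump_times:
  assumes f: "follows y \<sigma> n t" and p: "\<And>k. k < n \<Longrightarrow> \<sigma> k \<noteq> \<sigma> (Suc k)"
  shows "k \<le> n \<Longrightarrow> t k = jump_times \<sigma> y k"
proof (induction k)
  case 0
  then show ?case using f by (simp add: follows_def)
next
  case (Suc k)
  then have k: "k < n" "t k = jump_times \<sigma> y k" by simp_all
  have "exit_time (\<sigma> k) (t k) y = t (Suc k)"
  proof (rule exit_time_eqI(2))
    show "t k < t (Suc k)" using f k(1) by (simp add: follows_def)
    show "y u = \<sigma> k" if "t k < u" "u < t (Suc k)" for u using f k(1) that by (simp add: follows_def)
    show "y (t (Suc k)) \<noteq> \<sigma> k" using follows_at[OF f Suc.prems] p[OF k(1)] by simp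
  qed
  then show ?case using k by (simp add: jump_times.simps)
qed

lemma jump_times_nonneg: "0 \<le> jump_times \<sigma> y n"
  by (induction n) (auto intro: exit_time_nonneg simp: jump_times.simps)

lemma measurable_jump_times[measurable]: "(\<lambda>y. jump_times \<sigma> y n) \<in> borel_measurable (cadlag_space V)"
proof (induction n)
  case (Suc n)
  then show ?case unfolding jump_times.simps by (intro measurable_exit_time jump_times_nonneg)
qed simp

lemma follows_jump_times_Suc:
  assumes y: "y \<in> space (cadlag_space V)" and p: "\<sigma> n \<noteq> \<sigma> (Suc n)"
  shows "follows y \<sigma> (Suc n) (jump_times \<sigma> y) \<longleftrightarrow> follows y \<sigma> n (jump_times \<sigma> y) \<and>
     leaves (\<sigma> n) (jump_times \<sigma> y n) y \<and> y (jump_times \<sigma> y (Suc n)) = \<sigma> (Suc n)" (is "?L \<longleftrightarrow> ?R")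
proof
  assume ?L
  then show ?R unfolding follows_Suc_iff leaves_def using p by metis
next
  assume R: ?R
  then have at: "y (jump_times \<sigma> y n) = \<sigma> n" by (simp add: follows_def)
  note e = exit_time_props[OF y jump_times_nonneg[of \<sigma> y n] at]
  show ?L unfolding follows_Suc_iff using R e by (simp add: jump_times.simps)
qed

lemma pred_follows:
  assumes "\<And>k. k < n \<Longrightarrow> \<sigma> k \<noteq> \<sigma> (Suc k)"
  shows "Measurable.pred (cadlag_space V) (\<lambda>y. follows y \<sigma> n (jump_times \<sigma> y))"
  using assms
proof (induction n)
  case 0
  then show ?case unfolding follows_0 using pred_coord[where q=0 and V=V and i="\<sigma> 0"] by simp
next
  case (Suc n)
  have [measurable]: "Measurable.pred (cadlag_space V) (\<lambda>y. follows y \<sigma> n (jump_times \<sigma> y))"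
    using Suc by simp
  have [measurable]: "Measurable.pred (cadlag_space V) (\<lambda>y. leaves (\<sigma> n) (jump_times \<sigma> y n) y)"
    by (rule pred_leaves) (auto intro: jump_times_nonneg)
  have [measurable]: "Measurable.pred (cadlag_space V) (\<lambda>y. y (jump_times \<sigma> y (Suc n)) = \<sigma> (Suc n))"
    by (rule pred_eval_random_time) (auto intro: jump_times_nonneg simp del: jump_times.simps)
  have "Measurable.pred (cadlag_space V) (\<lambda>y. follows y \<sigma> (Suc n) (jump_times \<sigma> y)) \<longleftrightarrow>
    Measurable.pred (cadlag_space V) (\<lambda>y. follows y \<sigma> n (jump_times \<sigma> y) \<and>
     leaves (\<sigma> n) (jump_times \<sigma> y n) y \<and> y (jump_times \<sigma> y (Suc n)) = \<sigma> (Suc n))"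
    using Suc.prems by (intro measurable_cong follows_jump_times_Suc) auto
  also have "\<dots>" by measurable
  finally show ?case .
qed

text \<open>
  Bounds for the \<open>k\<close>-th holding time, which may depend on the jump times up to the \<open>k\<close>-th
  one. The dependence is needed because a constant window on the scale of the clock is not
  constant on the original time scale.
\<close>

type_synonym window = "nat \<Rightarrow> (nat \<Rightarrow> real) \<Rightarrow> real"

definition within_windows :: "window \<Rightarrow> window \<Rightarrow> nat \<Rightarrow> (nat \<Rightarrow> real) \<Rightarrow> bool" where
  "within_windows lo hi n t \<longleftrightarrow> (\<forall>k<n. lo k t < t (Suc k) - t k \<and> t (Suc k) - t k \<le> hi k t)"

definition path_event :: "'v set \<Rightarrow> (nat \<Rightarrow> 'v) \<Rightarrow> window \<Rightarrow> window \<Rightarrow> nat \<Rightarrow> (real \<Rightarrow> 'v) set" where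
  "path_event V \<sigma> lo hi n = {y \<in> space (cadlag_space V).
     follows y \<sigma> n (jump_times \<sigma> y) \<and> within_windows lo hi n (jump_times \<sigma> y)}"

definition history_window :: "'v set \<Rightarrow> (nat \<Rightarrow> 'v) \<Rightarrow> window \<Rightarrow> bool" where
  "history_window V \<sigma> f \<longleftrightarrow> (\<forall>k. (\<lambda>y. f k (jump_times \<sigma> y)) \<in> borel_measurable (cadlag_space V)) \<and>
     (\<forall>k t t'. (\<forall>m\<le>k. t m = t' m) \<longrightarrow> f k t = f k t')"

lemma sets_path_event:
  assumes "\<And>k. k < n \<Longrightarrow> \<sigma> k \<noteq> \<sigma> (Suc k)" "history_window V \<sigma> lo" "history_window V \<sigma> hi"
  shows "path_event V \<sigma> lo hi n \<in> sets (cadlag_space V)"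
proof -
  have [measurable]: "Measurable.pred (cadlag_space V) (\<lambda>y. follows y \<sigma> n (jump_times \<sigma> y))"
    by (rule pred_follows) (use assms(1) in auto)
  have [measurable]: "(\<lambda>y. lo k (jump_times \<sigma> y)) \<in> borel_measurable (cadlag_space V)"
    "(\<lambda>y. hi k (jump_times \<sigma> y)) \<in> borel_measurable (cadlag_space V)" for k
    using assms by (auto simp: history_window_def)
  show ?thesis unfolding path_event_def within_windows_def by measurable
qed

text \<open>
  A condition \<open>lo < d \<and> d \<le> hi\<close> on the next holding time is the difference of
  two events of the form treated by the strong Markov property.
\<close>

lemma path_event_Suc_eq:
  assumes p: "\<sigma> n \<noteq> \<sigma> (Suc n)"
  shows "path_event V \<sigma> lo hi (Suc n) =
     {y \<in> path_event V \<sigma> lo hi n. next_jump y (jump_times \<sigma> y n) (hi n (jump_times \<sigma> y)) (\<sigma> (Suc n))} -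
     {y \<in> path_event V \<sigma> lo hi n. next_jump y (jump_times \<sigma> y n) (lo n (jump_times \<sigma> y)) (\<sigma> (Suc n))}"
proof -
  have nj: "next_jump y (jump_times \<sigma> y n) g (\<sigma> (Suc n)) \<longleftrightarrow>
      leaves (\<sigma> n) (jump_times \<sigma> y n) y \<and> jump_times \<sigma> y (Suc n) \<le> jump_times \<sigma> y n + g \<and>
      y (jump_times \<sigma> y (Suc n)) = \<sigma> (Suc n)"
    if y: "y \<in> space (cadlag_space V)" "follows y \<sigma> n (jump_times \<sigma> y)" for y g
    using next_jump_iff_exit[OF y(1) jump_times_nonneg follows_at[OF y(2) order_refl], of g "\<sigma> (Suc n)"] p
    by (auto simp: jump_times.simps)
  have ww: "within_windows lo hi (Suc n) t \<longleftrightarrow> within_windows lo hi n t \<and>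
      \<not> t (Suc n) \<le> t n + lo n t \<and> t (Suc n) \<le> t n + hi n t" for t
    unfolding within_windows_def by (auto simp: less_Suc_eq)
  show ?thesis
  proof (rule set_eqI)
    fix y
    show "y \<in> path_event V \<sigma> lo hi (Suc n) \<longleftrightarrow> y \<in> {y \<in> path_event V \<sigma> lo hi n. next_jump y (jump_times \<sigma> y n) (hi n (jump_times \<sigma> y)) (\<sigma> (Suc n))} -
     {y \<in> path_event V \<sigma> lo hi n. next_jump y (jump_times \<sigma> y n) (lo n (jump_times \<sigma> y)) (\<sigma> (Suc n))}"
    proof (cases "y \<in> space (cadlag_space V) \<and> follows y \<sigma> n (jump_times \<sigma> y)")
      case True
      then show ?thesis
        unfolding path_event_def ww mem_Collect_eq Diff_iff
          follows_jump_times_Suc[OF conjunct1[OF True] p] nj[OF conjunct1[OF True] conjunct2[OF True]]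
        by argo
    next
      case False
      then show ?thesis
        using follows_jump_times_Suc[OF _ p] unfolding path_event_def by blast
    qed
  qed
qed

text \<open>
  A path event is decided by the path up to its last jump time; this is the adaptedness that the
  strong Markov property requires.
\<close>

lemma path_event_adapted:
  assumes p: "\<And>k. k < n \<Longrightarrow> \<sigma> k \<noteq> \<sigma> (Suc k)" "history_window V \<sigma> lo" "history_window V \<sigma> hi"
    and y: "y \<in> path_event V \<sigma> lo hi n" and y': "y' \<in> space (cadlag_space V)"
    and eq: "\<And>u. 0 \<le> u \<Longrightarrow> u \<le> jump_times \<sigma> y n \<Longrightarrow> y' u = y u"
  shows "y' \<in> path_event V \<sigma> lo hi n" "\<And>k. k \<le> n \<Longrightarrow> jump_times \<sigma> y' k = jump_times \<sigma> y k"
    "lo n (jump_times \<sigma> y') = lo n (jump_times \<sigma> y)" "hi n (jump_times \<sigma> y') = hi n (jump_times \<sigma> y)"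
proof -
  have f: "follows y' \<sigma> n (jump_times \<sigma> y)"
    using y by (intro follows_cong[OF _ eq]) (auto simp: path_event_def)
  show jt: "jump_times \<sigma> y' k = jump_times \<sigma> y k" if "k \<le> n" for k
    using follows_jump_times[OF f p(1) that] by simp
  have w: "lo k (jump_times \<sigma> y') = lo k (jump_times \<sigma> y)" "hi k (jump_times \<sigma> y') = hi k (jump_times \<sigma> y)"
    if "k \<le> n" for k
    using p(2,3) jt that unfolding history_window_def by (meson order_trans)+
  show "lo n (jump_times \<sigma> y') = lo n (jump_times \<sigma> y)" "hi n (jump_times \<sigma> y') = hi n (jump_times \<sigma> y)"
    by (simp_all add: w)
  have "follows y' \<sigma> n (jump_times \<sigma> y') \<longleftrightarrow> follows y' \<sigma> n (jump_times \<sigma> y)"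
    unfolding follows_def by (simp add: jt Suc_le_eq cong: conj_cong)
  moreover have "within_windows lo hi n (jump_times \<sigma> y')"
    using y jt w unfolding path_event_def within_windows_def by simp
  ultimately show "y' \<in> path_event V \<sigma> lo hi n" using f y' by (simp add: path_event_def)
qed

lemma next_jump_mono:
  assumes "t \<le> t'" "next_jump y s t j" shows "next_jump y s t' j"
proof -
  obtain u where u: "j \<noteq> y s" "u \<in> {s<..s + t}" "y u = j" "\<forall>v\<in>{s..<u}. y v = y s"
    using assms(2) unfolding next_jump_def by blast
  have "u \<in> {s<..s + t'}" using assms(1) u(2) by simp
  then show ?thesis using u unfolding next_jump_def by blast
qed

text \<open>
  Given the event up to the \<open>n\<close>-th jump, the conditional probability of the next step is a
  difference of two values of \<open>jump_prob\<close>. If it is bounded below by \<open>cl\<close> and above by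
  \<open>cu\<close> uniformly over the event, the bounds carry over to the probability of the extended
  event.
\<close>

lemma path_event_step_bounds:
  fixes \<kappa> :: "(real \<Rightarrow> 'v) \<Rightarrow> 'v \<Rightarrow> real"
  assumes law: "jump_process_law V E q i0 Q"
    and p: "\<And>k. k < Suc n \<Longrightarrow> \<sigma> k \<noteq> \<sigma> (Suc k)" "history_window V \<sigma> lo" "history_window V \<sigma> hi"
    and lohi: "\<And>y. y \<in> path_event V \<sigma> lo hi n \<Longrightarrow>
      0 \<le> lo n (jump_times \<sigma> y) \<and> lo n (jump_times \<sigma> y) \<le> hi n (jump_times \<sigma> y)"
    and \<kappa>[measurable]: "\<And>k. k \<in> nbrs E (\<sigma> n) \<Longrightarrow> (\<lambda>y. \<kappa> y k) \<in> borel_measurable (cadlag_space V)"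
    and \<kappa>0: "\<And>y k. y \<in> path_event V \<sigma> lo hi n \<Longrightarrow> k \<in> nbrs E (\<sigma> n) \<Longrightarrow> 0 \<le> \<kappa> y k"
    and const: "\<And>y s k. y \<in> path_event V \<sigma> lo hi n \<Longrightarrow> jump_times \<sigma> y n \<le> s \<Longrightarrow>
        (\<And>u. jump_times \<sigma> y n \<le> u \<Longrightarrow> u \<le> s \<Longrightarrow> y u = \<sigma> n) \<Longrightarrow> k \<in> nbrs E (\<sigma> n) \<Longrightarrow> q y s k = \<kappa> y k"
    and fin: "finite (nbrs E (\<sigma> n))" and j: "\<sigma> (Suc n) \<in> V" "\<sigma> (Suc n) \<in> nbrs E (\<sigma> n)"
    and lb: "\<And>y. y \<in> path_event V \<sigma> lo hi n \<Longrightarrow> cl \<le> \<kappa> y (\<sigma> (Suc n)) * 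
        (hi n (jump_times \<sigma> y) - lo n (jump_times \<sigma> y)) * exp (- ((\<Sum>k\<in>nbrs E (\<sigma> n). \<kappa> y k) * hi n (jump_times \<sigma> y)))"
    and ub: "\<And>y. y \<in> path_event V \<sigma> lo hi n \<Longrightarrow> \<kappa> y (\<sigma> (Suc n)) * 
        (hi n (jump_times \<sigma> y) - lo n (jump_times \<sigma> y)) * exp (- ((\<Sum>k\<in>nbrs E (\<sigma> n). \<kappa> y k) * lo n (jump_times \<sigma> y))) \<le> cu"
  shows "cl * measure Q (path_event V \<sigma> lo hi n) \<le> measure Q (path_event V \<sigma> lo hi (Suc n))"
    and "measure Q (path_event V \<sigma> lo hi (Suc n)) \<le> cu * measure Q (path_event V \<sigma> lo hi n)"
proof -
  let ?C = "cadlag_space V" and ?B = "path_event V \<sigma> lo hi n" and ?j = "\<sigma> (Suc n)"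
  interpret Q: prob_space Q using law by (simp add: jump_process_law_def)
  have sQ[measurable_cong]: "sets Q = sets ?C" using law by (simp add: jump_process_law_def)
  have p': "\<And>k. k < n \<Longrightarrow> \<sigma> k \<noteq> \<sigma> (Suc k)" using p(1) by simp
  have B[measurable]: "?B \<in> sets ?C" by (rule sets_path_event[OF p' p(2,3)])
  define K where "K y = (\<Sum>k\<in>nbrs E (\<sigma> n). \<kappa> y k)" for y
  have Km[measurable]: "K \<in> borel_measurable ?C" unfolding K_def by measurable
  have \<kappa>K: "0 \<le> \<kappa> y ?j" "\<kappa> y ?j \<le> K y" if "y \<in> ?B" for y
    using \<kappa>0[OF that] j(2) member_le_sum[of ?j "nbrs E (\<sigma> n)" "\<kappa> y"] fin unfolding K_def by auto
  have [measurable]: "(\<lambda>y. lo k (jump_times \<sigma> y)) \<in> borel_measurable ?C"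
    "(\<lambda>y. hi k (jump_times \<sigma> y)) \<in> borel_measurable ?C" for k
    using p by (auto simp: history_window_def)
  have [measurable]: "(\<lambda>y. \<kappa> y ?j) \<in> borel_measurable ?C" by (rule \<kappa>[OF j(2)])
  define N where "N f = {y \<in> ?B. next_jump y (jump_times \<sigma> y n) (f n (jump_times \<sigma> y)) ?j}" for f :: window
  have Nm: "measure Q (N f) = (LINT y|Q. indicator ?B y * jump_prob (\<kappa> y ?j) (K y) (f n (jump_times \<sigma> y)))"
    if f: "f = lo \<or> f = hi" for f
  proof -
    have "measure Q (N f) = (LINT y:?B|Q. (if ?j \<in> nbrs E (\<sigma> n) then
        jump_prob (\<kappa> y ?j) (\<Sum>k\<in>nbrs E (\<sigma> n). \<kappa> y k) (f n (jump_times \<sigma> y)) else 0))"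
      unfolding N_def
    proof (rule strong_markov[OF law B])
      show "y (jump_times \<sigma> y n) = \<sigma> n" if "y \<in> ?B" for y
        using that by (auto simp: path_event_def follows_def)
      show "y' \<in> ?B \<and> jump_times \<sigma> y' n = jump_times \<sigma> y n \<and> f n (jump_times \<sigma> y') = f n (jump_times \<sigma> y)"
        if "y \<in> ?B" "y' \<in> space ?C" "\<And>u. 0 \<le> u \<Longrightarrow> u \<le> jump_times \<sigma> y n \<Longrightarrow> y' u = y u" for y y'
      proof -
        have 1: "y' \<in> ?B" by (rule path_event_adapted(1); (fact p' p(2) p(3) that)?)
        have 2: "jump_times \<sigma> y' n = jump_times \<sigma> y n"
          by (rule path_event_adapted(2)[where y=y and lo=lo and hi=hi]; (fact p' p(2) p(3) that order_refl)?)
        have 3: "lo n (jump_times \<sigma> y') = lo n (jump_times \<sigma> y)"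
          by (rule path_event_adapted(3)[where hi=hi]; (fact p' p(2) p(3) that)?)
        have 4: "hi n (jump_times \<sigma> y') = hi n (jump_times \<sigma> y)"
          by (rule path_event_adapted(4)[where lo=lo]; (fact p' p(2) p(3) that)?)
        show ?thesis using f 1 2 3 4 by blast
      qed
      show "0 \<le> f n (jump_times \<sigma> y)" if "y \<in> ?B" for y using lohi[OF that] f by auto
      show "(\<lambda>y. f n (jump_times \<sigma> y)) \<in> borel_measurable ?C" using f by auto
      show "q y s k = \<kappa> y k" if "y \<in> ?B" "jump_times \<sigma> y n \<le> s"
        "\<And>u. jump_times \<sigma> y n \<le> u \<Longrightarrow> u \<le> s \<Longrightarrow> y u = \<sigma> n" "k \<in> nbrs E (\<sigma> n)" for y s k
        by (rule const[OF that])
    qed (simp_all add: fin j(1) \<kappa> \<kappa>0 jump_times_nonneg)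
    then show ?thesis using j by (simp add: set_lebesgue_integral_def K_def)
  qed
  have jpr: "0 \<le> jump_prob (\<kappa> y ?j) (K y) (f n (jump_times \<sigma> y))" "jump_prob (\<kappa> y ?j) (K y) (f n (jump_times \<sigma> y)) \<le> 1"
    if "f = lo \<or> f = hi" "y \<in> ?B" for f y
    using jump_prob_range[OF \<kappa>K[OF that(2)], of "f n (jump_times \<sigma> y)"] lohi[OF that(2)] that(1) by auto
  have int: "integrable Q (\<lambda>y. indicator ?B y * jump_prob (\<kappa> y ?j) (K y) (f n (jump_times \<sigma> y)))"
    if f: "f = lo \<or> f = hi" for f
  proof (rule Q.integrable_const_bound[where B=1])
    show "AE y in Q. norm (indicator ?B y * jump_prob (\<kappa> y ?j) (K y) (f n (jump_times \<sigma> y))) \<le> 1"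
      using jpr[OF f] by (intro AE_I2) (auto simp: indicator_def)
    have "(\<lambda>y. f n (jump_times \<sigma> y)) \<in> borel_measurable ?C" using f by auto
    then have [measurable]: "(\<lambda>y. jump_prob (\<kappa> y ?j) (K y) (f n (jump_times \<sigma> y))) \<in> borel_measurable ?C"
      by (intro measurable_jump_prob) measurable
    show "(\<lambda>y. indicator ?B y * jump_prob (\<kappa> y ?j) (K y) (f n (jump_times \<sigma> y))) \<in> borel_measurable Q"
      by measurable
  qed
  have Nsets: "N f \<in> sets Q" if f: "f = lo \<or> f = hi" for f
  proof -
    have "Measurable.pred ?C (\<lambda>y. leaves (\<sigma> n) (jump_times \<sigma> y n) y)"
      by (rule pred_leaves) (auto intro: jump_times_nonneg)
    note [measurable] = this
    have [measurable]: "Measurable.pred ?C (\<lambda>y. y (exit_time (\<sigma> n) (jump_times \<sigma> y n) y) = ?j)"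
      using measurable_jump_times[of \<sigma> "Suc n" V] jump_times_nonneg[of \<sigma> _ "Suc n"]
      unfolding jump_times.simps by (intro pred_eval_random_time) auto
    have [measurable]: "(\<lambda>y. exit_time (\<sigma> n) (jump_times \<sigma> y n) y) \<in> borel_measurable ?C"
      using measurable_jump_times[of \<sigma> "Suc n" V] by (simp add: jump_times.simps)
    have [measurable]: "(\<lambda>y. f n (jump_times \<sigma> y)) \<in> borel_measurable ?C" using f by auto
    have "N f = ?B \<inter> {y \<in> space ?C. ?j \<noteq> \<sigma> n \<and> leaves (\<sigma> n) (jump_times \<sigma> y n) y \<and>
        exit_time (\<sigma> n) (jump_times \<sigma> y n) y \<le> jump_times \<sigma> y n + f n (jump_times \<sigma> y) \<and>
        y (exit_time (\<sigma> n) (jump_times \<sigma> y n) y) = ?j}"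
    proof (rule set_eqI)
      fix y
      show "y \<in> N f \<longleftrightarrow> y \<in> ?B \<inter> {y \<in> space ?C. ?j \<noteq> \<sigma> n \<and> leaves (\<sigma> n) (jump_times \<sigma> y n) y \<and>
        exit_time (\<sigma> n) (jump_times \<sigma> y n) y \<le> jump_times \<sigma> y n + f n (jump_times \<sigma> y) \<and>
        y (exit_time (\<sigma> n) (jump_times \<sigma> y n) y) = ?j}"
      proof (cases "y \<in> ?B")
        case True
        then have y: "y \<in> space ?C" "y (jump_times \<sigma> y n) = \<sigma> n" by (simp_all add: path_event_def follows_def)
        show ?thesis unfolding N_def Int_iff mem_Collect_eq
          next_jump_iff_exit[OF y(1) jump_times_nonneg y(2)] using True y(1) by argo
      next
        case False
        then show ?thesis unfolding N_def by blast
      qed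
    qed
    also have "\<dots> \<in> sets Q" unfolding sQ by (intro sets.Int B predE) measurable
    finally show ?thesis .
  qed
  have "N lo \<subseteq> N hi" 
    unfolding N_def by (auto intro: next_jump_mono[OF conjunct2[OF lohi]])
  have eq: "path_event V \<sigma> lo hi (Suc n) = N hi - N lo"
    unfolding N_def using p(1) by (intro path_event_Suc_eq) simp
  have "measure Q (path_event V \<sigma> lo hi (Suc n)) = measure Q (N hi) - measure Q (N lo)"
    unfolding eq using Nsets \<open>N lo \<subseteq> N hi\<close> by (intro Q.finite_measure_Diff) auto
  also have "\<dots> = (LINT y|Q. indicator ?B y * (jump_prob (\<kappa> y ?j) (K y) (hi n (jump_times \<sigma> y)) -
       jump_prob (\<kappa> y ?j) (K y) (lo n (jump_times \<sigma> y))))"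
    using int by (simp add: Nm right_diff_distrib)
  finally have P: "measure Q (path_event V \<sigma> lo hi (Suc n)) = \<dots>" .
  have I: "integrable Q (\<lambda>y. indicator ?B y * (jump_prob (\<kappa> y ?j) (K y) (hi n (jump_times \<sigma> y)) -
       jump_prob (\<kappa> y ?j) (K y) (lo n (jump_times \<sigma> y))))"
    using int by (simp add: right_diff_distrib)
  have c: "integrable Q (\<lambda>y. indicator ?B y * c)" "(LINT y|Q. indicator ?B y * c) = c * measure Q ?B" for c :: real
    by (auto simp: Q.emeasure_finite less_top[symmetric])
  have jb: "cl \<le> jump_prob (\<kappa> y ?j) (K y) (hi n (jump_times \<sigma> y)) - jump_prob (\<kappa> y ?j) (K y) (lo n (jump_times \<sigma> y))"
    "jump_prob (\<kappa> y ?j) (K y) (hi n (jump_times \<sigma> y)) - jump_prob (\<kappa> y ?j) (K y) (lo n (jump_times \<sigma> y)) \<le> cu"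
    if y: "y \<in> ?B" for y
    using jump_prob_bounds[OF \<kappa>K(1)[OF y] order_trans[OF \<kappa>K[OF y]] conjunct1[OF lohi[OF y]] conjunct2[OF lohi[OF y]]]
      lb[OF y] ub[OF y] unfolding K_def by (auto intro: order_trans)
  show "cl * measure Q ?B \<le> measure Q (path_event V \<sigma> lo hi (Suc n))"
    unfolding P c(2)[symmetric] using jb by (intro integral_mono c I) (auto simp: indicator_def)
  show "measure Q (path_event V \<sigma> lo hi (Suc n)) \<le> cu * measure Q ?B"
    unfolding P c(2)[symmetric] using jb by (intro integral_mono c I) (auto simp: indicator_def)
qed

lemma path_event_0:
  assumes law: "jump_process_law V E q (\<sigma> 0) Q"
  shows "measure Q (path_event V \<sigma> lo hi 0) = 1"
proof -
  interpret Q: prob_space Q using law by (simp add: jump_process_law_def)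
  have sQ: "sets Q = sets (cadlag_space V)" using law by (simp add: jump_process_law_def)
  have "path_event V \<sigma> lo hi 0 = {y \<in> space (cadlag_space V). y (max 0 0) = \<sigma> 0}"
    by (auto simp: path_event_def follows_0 within_windows_def)
  moreover from this have "path_event V \<sigma> lo hi 0 \<in> sets Q" unfolding sQ
    using predE[OF pred_coord[where q=0 and V=V and i="\<sigma> 0"]] by simp
  moreover have "AE y in Q. y \<in> path_event V \<sigma> lo hi 0"
  proof -
    have "AE y in Q. y 0 = \<sigma> 0" using law by (simp add: jump_process_law_def)
    then show ?thesis using AE_space
      by eventually_elim (simp add: path_event_def follows_0 within_windows_def sets_eq_imp_space_eq[OF sQ])
  qed
  ultimately show ?thesis using Q.prob_eq_1 by blast
qed

lemma history_window_const: "history_window V \<sigma> (\<lambda>k t. x k)"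
  by (simp add: history_window_def)

text \<open>
  Multiplying the bounds for the single steps. Both bounds, divided by \<open>\<epsilon> ^ n\<close>,
  tend to the trajectory density of the Markov jump process as \<open>\<epsilon>\<close> tends to 0.
\<close>

lemma markov_path_prob:
  assumes law: "markov_law V E r (\<sigma> 0) Q"
    and p: "\<And>k. k < n \<Longrightarrow> \<sigma> k \<noteq> \<sigma> (Suc k) \<and> \<sigma> (Suc k) \<in> V \<and> \<sigma> (Suc k) \<in> nbrs E (\<sigma> k) \<and> finite (nbrs E (\<sigma> k))"
    and r: "\<And>i k. k \<in> nbrs E i \<Longrightarrow> 0 \<le> r (i, k)" and x: "\<And>k. 0 \<le> x k" and \<epsilon>: "0 \<le> \<epsilon>"
  shows "\<epsilon> ^ n * (\<Prod>k<n. r (\<sigma> k, \<sigma> (Suc k)) * exp (- ((\<Sum>j\<in>nbrs E (\<sigma> k). r (\<sigma> k, j)) * (x k + \<epsilon>))))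
           \<le> measure Q (path_event V \<sigma> (\<lambda>k t. x k) (\<lambda>k t. x k + \<epsilon>) n) \<and>
         measure Q (path_event V \<sigma> (\<lambda>k t. x k) (\<lambda>k t. x k + \<epsilon>) n) \<le>
           \<epsilon> ^ n * (\<Prod>k<n. r (\<sigma> k, \<sigma> (Suc k)) * exp (- ((\<Sum>j\<in>nbrs E (\<sigma> k). r (\<sigma> k, j)) * x k)))"
  using p
proof (induction n)
  case 0
  show ?case using path_event_0[where \<sigma>=\<sigma>, OF law[unfolded markov_law_def]] by simp
next
  case (Suc n)
  let ?P = "\<lambda>n. path_event V \<sigma> (\<lambda>k t. x k) (\<lambda>k t. x k + \<epsilon>) n"
  have Sucp: "\<sigma> k \<noteq> \<sigma> (Suc k) \<and> \<sigma> (Suc k) \<in> V \<and> \<sigma> (Suc k) \<in> nbrs E (\<sigma> k) \<and> finite (nbrs E (\<sigma> k))"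
    if "k < Suc n" for k using Suc.prems that by blast
  let ?cl = "r (\<sigma> n, \<sigma> (Suc n)) * \<epsilon> * exp (- ((\<Sum>j\<in>nbrs E (\<sigma> n). r (\<sigma> n, j)) * (x n + \<epsilon>)))"
  let ?cu = "r (\<sigma> n, \<sigma> (Suc n)) * \<epsilon> * exp (- ((\<Sum>j\<in>nbrs E (\<sigma> n). r (\<sigma> n, j)) * x n))"
  let ?L = "\<epsilon> ^ n * (\<Prod>k<n. r (\<sigma> k, \<sigma> (Suc k)) * exp (- ((\<Sum>j\<in>nbrs E (\<sigma> k). r (\<sigma> k, j)) * (x k + \<epsilon>))))"
  let ?U = "\<epsilon> ^ n * (\<Prod>k<n. r (\<sigma> k, \<sigma> (Suc k)) * exp (- ((\<Sum>j\<in>nbrs E (\<sigma> k). r (\<sigma> k, j)) * x k)))"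
  have step: "?cl * measure Q (?P n) \<le> measure Q (?P (Suc n))" "measure Q (?P (Suc n)) \<le> ?cu * measure Q (?P n)"
    by (rule path_event_step_bounds[OF law[unfolded markov_law_def], where \<kappa>="\<lambda>y k. r (\<sigma> n, k)" and cl="?cl" and cu="?cu"];
        use Sucp r x \<epsilon> in \<open>simp add: history_window_const\<close>)+
  have r0: "0 \<le> r (\<sigma> n, \<sigma> (Suc n))" using Sucp[of n] r by simp
  have IH: "?L \<le> measure Q (?P n)" "measure Q (?P n) \<le> ?U" using Suc.IH Sucp by auto
  have "?cl * ?L \<le> ?cl * measure Q (?P n)" using IH(1) r0 \<epsilon> by (intro mult_left_mono) auto
  moreover have "?cu * measure Q (?P n) \<le> ?cu * ?U" using IH(2) r0 \<epsilon> by (intro mult_left_mono) auto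
  ultimately show ?case using step by (simp add: mult_ac)
qed

section \<open>Local times and the clock along a trajectory\<close>

definition path_local_time :: "(nat \<Rightarrow> 'v) \<Rightarrow> (nat \<Rightarrow> real) \<Rightarrow> nat \<Rightarrow> 'v \<Rightarrow> real" where
  "path_local_time \<sigma> t n j = 1 + (\<Sum>k<n. if \<sigma> k = j then t (Suc k) - t k else 0)"

lemma path_local_time_0 [simp]: "path_local_time \<sigma> t 0 j = 1"
  by (simp add: path_local_time_def)

lemma path_local_time_Suc:
  "path_local_time \<sigma> t (Suc n) j = path_local_time \<sigma> t n j + (if \<sigma> n = j then t (Suc n) - t n else 0)"
  by (simp add: path_local_time_def)

lemma occupation_before:
  assumes "follows y \<sigma> n t"
  shows "has_bochner_integral lborel (\<lambda>u. indicator {0..<t n} u * of_bool (y u = j)) (path_local_time \<sigma> t n j - 1)"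
  using assms
proof (induction n)
  case 0
  then have "t 0 = 0" by (simp add: follows_def)
  then show ?case by (simp add: has_bochner_integral_zero)
next
  case (Suc n)
  have f: "follows y \<sigma> n t" "t n < t (Suc n)" "\<And>u. t n \<le> u \<Longrightarrow> u < t (Suc n) \<Longrightarrow> y u = \<sigma> n"
    using Suc.prems unfolding follows_Suc_iff by blast+
  have t0: "0 \<le> t n" using follows_nonneg[OF f(1)] by simp
  have eq: "indicator {0..<t (Suc n)} u * of_bool (y u = j) =
      indicator {0..<t n} u * of_bool (y u = j) + indicator {t n..<t (Suc n)} u * (of_bool (\<sigma> n = j) :: real)" for u
    using f(2) f(3)[of u] t0 by (auto simp: indicator_def)
  have "has_bochner_integral lborel (\<lambda>u. indicator {t n..<t (Suc n)} u * (of_bool (\<sigma> n = j) :: real))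
      (measure lborel {t n..<t (Suc n)} * of_bool (\<sigma> n = j))"
    using f(2) by (intro has_bochner_integral_mult_left has_bochner_integral_real_indicator) auto
  from has_bochner_integral_add[OF Suc.IH[OF f(1)] this]
  show ?case unfolding eq path_local_time_Suc using f(2) by (cases "\<sigma> n = j") (simp_all add: algebra_simps)
qed

lemma occupation_integral:
  assumes f: "follows y \<sigma> n t" and s: "t n \<le> s" "\<And>u. t n \<le> u \<Longrightarrow> u \<le> s \<Longrightarrow> y u = \<sigma> n"
  shows "has_bochner_integral lborel (\<lambda>u. indicator {0..s} u * of_bool (y u = j))
    (path_local_time \<sigma> t n j - 1 + (if \<sigma> n = j then s - t n else 0))"
proof -
  have t0: "0 \<le> t n" using follows_nonneg[OF f(1)] by simp
  have eq: "indicator {0..s} u * of_bool (y u = j) =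
      indicator {0..<t n} u * of_bool (y u = j) + indicator {t n..s} u * (of_bool (\<sigma> n = j) :: real)" for u
    using s(1) s(2)[of u] t0 by (auto simp: indicator_def)
  have "has_bochner_integral lborel (\<lambda>u. indicator {t n..s} u * (of_bool (\<sigma> n = j) :: real))
      (measure lborel {t n..s} * of_bool (\<sigma> n = j))"
    using s(1) by (intro has_bochner_integral_mult_left has_bochner_integral_real_indicator) auto
  from has_bochner_integral_add[OF occupation_before[OF f, of j] this]
  show ?thesis unfolding eq using s(1) by (cases "\<sigma> n = j") (simp_all add: algebra_simps)
qed

lemma local_time_follows:
  assumes "follows y \<sigma> n t" "t n \<le> s" "\<And>u. t n \<le> u \<Longrightarrow> u \<le> s \<Longrightarrow> y u = \<sigma> n"
  shows "local_time y j s = path_local_time \<sigma> t n j + (if \<sigma> n = j then s - t n else 0)"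
  using has_bochner_integral_integral_eq[OF occupation_integral[OF assms], of j]
  by (simp add: local_time_def set_lebesgue_integral_def)

lemma local_time_at_jump:
  assumes "follows y \<sigma> n t"
  shows "local_time y j (t n) = path_local_time \<sigma> t n j"
proof -
  have "local_time y j (t n) = path_local_time \<sigma> t n j + (if \<sigma> n = j then t n - t n else 0)"
    by (rule local_time_follows[OF assms order_refl]) (use follows_at[OF assms order_refl] in force)
  then show ?thesis by simp
qed

lemma follows_cong_seq:
  assumes "\<And>k. k \<le> n \<Longrightarrow> \<sigma> k = \<sigma>' k \<and> t k = t' k"
  shows "follows y \<sigma> n t \<longleftrightarrow> follows y \<sigma>' n t'"
  using assms unfolding follows_def by (simp add: Suc_le_eq cong: conj_cong)

definition skeleton_upto :: "(real \<Rightarrow> 'v) \<Rightarrow> real \<Rightarrow> bool" where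
  "skeleton_upto y s \<longleftrightarrow> (\<exists>n \<sigma> t. follows y \<sigma> n t \<and> t n \<le> s \<and> (\<forall>u. t n \<le> u \<longrightarrow> u \<le> s \<longrightarrow> y u = \<sigma> n))"

lemma skeleton_upto_extend:
  assumes "skeleton_upto y s" "s \<le> s'" "\<And>u. s \<le> u \<Longrightarrow> u < s' \<Longrightarrow> y u = y s"
  shows "skeleton_upto y s'"
proof -
  obtain n \<sigma> t where f: "follows y \<sigma> n t" "t n \<le> s" "\<And>u. t n \<le> u \<Longrightarrow> u \<le> s \<Longrightarrow> y u = \<sigma> n"
    using assms(1) unfolding skeleton_upto_def by blast
  have ys: "y s = \<sigma> n" using f(2,3) by blast
  have c: "y u = \<sigma> n" if "t n \<le> u" "u < s'" for u
    using f(3)[of u] assms(3)[of u] that ys by (cases "u \<le> s") simp_all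
  show ?thesis
  proof (cases "y s' = \<sigma> n")
    case True
    have "y u = \<sigma> n" if "t n \<le> u" "u \<le> s'" for u
      using c[of u] that True by (cases "u = s'") simp_all
    then show ?thesis unfolding skeleton_upto_def using f(1,2) assms(2) by (meson order_trans)
  next
    case False
    then have "s \<noteq> s'" using ys by blast
    then have lt: "t n < s'" using f(2) assms(2) by simp
    define \<sigma>' where "\<sigma>' = \<sigma>(Suc n := y s')"
    define t' where "t' = t(Suc n := s')"
    have "follows y \<sigma>' n t'" using f(1) follows_cong_seq[of n \<sigma> \<sigma>' t t' y] by (simp add: \<sigma>'_def t'_def)
    then have "follows y \<sigma>' (Suc n) t'"
      unfolding follows_Suc_iff using lt c by (simp add: \<sigma>'_def t'_def)
    moreover have "t' (Suc n) = s'" "\<sigma>' (Suc n) = y s'" by (simp_all add: \<sigma>'_def t'_def)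
    ultimately show ?thesis unfolding skeleton_upto_def by (metis order_antisym order_refl)
  qed
qed

text \<open>
  Let \<open>m\<close> be the infimum of the times that finitely many jumps do not reach. By the existence
  of a left limit at \<open>m\<close>, the time \<open>m\<close> is reached with at most one further jump, and by
  right continuity so are all times shortly after \<open>m\<close>, a contradiction.
\<close>

lemma cadlag_skeleton:
  assumes y: "y \<in> space (cadlag_space V)" and s: "0 \<le> s"
  shows "skeleton_upto y s"
proof (rule ccontr)
  assume neg: "\<not> skeleton_upto y s"
  define B where "B = {s. 0 \<le> s \<and> \<not> skeleton_upto y s}"
  define m where "m = Inf B"
  have B: "B \<noteq> {}" "bdd_below B" using neg s unfolding B_def by (auto intro!: bdd_belowI[of _ 0])
  have m0: "0 \<le> m" unfolding m_def by (rule cInf_greatest[OF B(1)]) (simp add: B_def)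
  have before: "skeleton_upto y u" if "0 \<le> u" "u < m" for u
  proof (rule ccontr)
    assume "\<not> skeleton_upto y u"
    then have "u \<in> B" using that by (simp add: B_def)
    from cInf_lower[OF this B(2)] show False using that by (simp add: m_def)
  qed
  have sm: "skeleton_upto y m"
  proof (cases "m = 0")
    case True
    have "follows y (\<lambda>_. y 0) 0 (\<lambda>_. 0)" by (simp add: follows_0)
    then show ?thesis unfolding skeleton_upto_def True by (metis order_antisym order_refl)
  next
    case False
    obtain x d where d: "0 < d" "\<And>u. m - d < u \<Longrightarrow> u < m \<Longrightarrow> y u = x"
      using cadlag_left_interval[OF y, of m] m0 False by (metis less_eq_real_def)
    define u where "u = max 0 (m - d / 2)"
    have u: "0 \<le> u" "u < m" "m - d < u" using m0 False d(1) by (auto simp: u_def)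
    show ?thesis
    proof (rule skeleton_upto_extend[OF before[OF u(1,2)] less_imp_le[OF u(2)]])
      fix v assume v: "u \<le> v" "v < m"
      have "y v = x" by (rule d(2)) (use u v in linarith)+
      moreover have "y u = x" by (rule d(2)) (use u in linarith)+
      ultimately show "y v = y u" by simp
    qed
  qed
  obtain d where d: "d > 0" "\<And>u. m \<le> u \<Longrightarrow> u < m + d \<Longrightarrow> y u = y m"
    using cadlag_right_interval[OF y m0] by blast
  have "m + d \<le> u" if "u \<in> B" for u
  proof (rule ccontr)
    assume "\<not> m + d \<le> u"
    moreover have mu: "m \<le> u" unfolding m_def by (rule cInf_lower[OF that B(2)])
    ultimately have "skeleton_upto y u" by (intro skeleton_upto_extend[OF sm mu] d(2)) linarith+
    then show False using that by (simp add: B_def)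
  qed
  then have "m + d \<le> m" unfolding m_def by (intro cInf_greatest B)
  then show False using d by simp
qed

lemma follows_locate:
  assumes "follows y \<sigma> n t" "0 \<le> u" "u < t n"
  shows "\<exists>k<n. y u = \<sigma> k"
  using assms
proof (induction n)
  case 0 then show ?case by (simp add: follows_def)
next
  case (Suc n)
  have f: "follows y \<sigma> n t" "\<And>u. t n \<le> u \<Longrightarrow> u < t (Suc n) \<Longrightarrow> y u = \<sigma> n"
    using Suc.prems unfolding follows_Suc_iff by blast+
  show ?case
  proof (cases "u < t n")
    case True then show ?thesis using Suc.IH[OF f(1) Suc.prems(2)] less_SucI by blast
  next
    case False then show ?thesis using f(2)[of u] Suc.prems by (intro exI[of _ n]) simp
  qed
qed

lemma finite_visited:
  assumes y: "y \<in> space (cadlag_space V)"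
  shows "finite (y ` {0..b})"
proof (cases "0 \<le> b")
  case True
  obtain n \<sigma> t where f: "follows y \<sigma> n t" "t n \<le> b" "\<And>u. t n \<le> u \<Longrightarrow> u \<le> b \<Longrightarrow> y u = \<sigma> n"
    using cadlag_skeleton[OF y True] unfolding skeleton_upto_def by blast
  have "y u \<in> \<sigma> ` {..n}" if u: "u \<in> {0..b}" for u
  proof (cases "u < t n")
    case lt: True
    then show ?thesis using follows_locate[OF f(1) _ lt] u by auto
  next
    case False
    then show ?thesis using f(3)[of u] u by auto
  qed
  then have "y ` {0..b} \<subseteq> \<sigma> ` {..n}" by blast
  then show ?thesis by (rule finite_subset) simp
qed simp

lemma integrable_occupation:
  assumes y: "y \<in> space (cadlag_space V)"
  shows "integrable lborel (\<lambda>u. indicator {0..b} u * (of_bool (y u = j) :: real))"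
proof (cases "0 \<le> b")
  case True
  obtain n \<sigma> t where f: "follows y \<sigma> n t" "t n \<le> b" "\<And>u. t n \<le> u \<Longrightarrow> u \<le> b \<Longrightarrow> y u = \<sigma> n"
    using cadlag_skeleton[OF y True] unfolding skeleton_upto_def by blast
  from occupation_integral[OF f, of j] show ?thesis by (auto simp: has_bochner_integral_iff)
qed simp

context
  fixes V :: "'v set" and y :: "real \<Rightarrow> 'v"
  assumes y: "y \<in> space (cadlag_space V)"
begin

lemma local_time_increment:
  assumes "0 \<le> a" "a \<le> b"
  shows "local_time y j b - local_time y j a = (LINT u|lborel. indicator {a<..b} u * of_bool (y u = j))"
proof -
  have "local_time y j b - local_time y j a =
    (LINT u|lborel. indicator {0..b} u * of_bool (y u = j) - indicator {0..a} u * of_bool (y u = j))"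
    unfolding local_time_def set_lebesgue_integral_def using integrable_occupation[OF y] by simp
  also have "\<dots> = (LINT u|lborel. indicator {a<..b} u * of_bool (y u = j))"
    using assms by (intro Bochner_Integration.integral_cong) (auto simp: indicator_def)
  finally show ?thesis .
qed

lemma local_time_mono: 
  assumes "0 \<le> a" "a \<le> b" shows "local_time y j a \<le> local_time y j b"
proof -
  have "0 \<le> (LINT u|lborel. indicator {a<..b} u * (of_bool (y u = j) :: real))"
    by (intro Bochner_Integration.integral_nonneg) simp
  then show ?thesis using local_time_increment[OF assms, of j] by linarith
qed

lemma local_time_0: "local_time y j 0 = 1"
proof -
  have "(LINT u|lborel. indicator {0..0} u * (of_bool (y u = j) :: real)) = 0"
    by (rule integral_eq_zero_AE) (use AE_lborel_singleton[of 0] in \<open>eventually_elim, auto simp: indicator_def\<close>)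
  then show ?thesis by (simp add: local_time_def set_lebesgue_integral_def)
qed

lemma local_time_ge_1: "0 \<le> a \<Longrightarrow> 1 \<le> local_time y j a"
  using local_time_mono[of 0 a j] by (simp add: local_time_0)

lemma local_time_unvisited:
  assumes "0 \<le> a" "a \<le> b" "j \<notin> y ` {0..b}" shows "local_time y j a = 1"
proof -
  have "(\<lambda>u. indicator {0..a} u * (of_bool (y u = j) :: real)) = (\<lambda>u. 0)"
    using assms by (auto simp: indicator_def fun_eq_iff)
  then show ?thesis by (simp add: local_time_def set_lebesgue_integral_def)
qed

text \<open>
  At every time exactly one site is occupied.
\<close>

lemma sum_local_time_increments:
  assumes "0 \<le> a" "a \<le> b"
  shows "(\<Sum>j\<in>y ` {0..b}. local_time y j b - local_time y j a) = b - a"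
proof -
  have i: "integrable lborel (\<lambda>u. indicator {a<..b} u * (of_bool (y u = j) :: real))" for j
  proof -
    have "integrable lborel (\<lambda>u. indicator {0..b} u * of_bool (y u = j) - indicator {0..a} u * (of_bool (y u = j) :: real))"
      by (intro Bochner_Integration.integrable_diff integrable_occupation[OF y])
    moreover have "(\<lambda>u. indicator {0..b} u * of_bool (y u = j) - indicator {0..a} u * (of_bool (y u = j) :: real))
       = (\<lambda>u. indicator {a<..b} u * (of_bool (y u = j) :: real))"
      using assms by (auto simp: indicator_def fun_eq_iff)
    ultimately show ?thesis by simp
  qed
  have "(\<Sum>j\<in>y ` {0..b}. local_time y j b - local_time y j a) =
     (LINT u|lborel. (\<Sum>j\<in>y ` {0..b}. indicator {a<..b} u * of_bool (y u = j)))"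
    using i by (simp add: local_time_increment[OF assms] Bochner_Integration.integral_sum)
  also have "\<dots> = (LINT u|lborel. indicator {a<..b} u)"
  proof (intro Bochner_Integration.integral_cong refl)
    fix u
    show "(\<Sum>j\<in>y ` {0..b}. indicator {a<..b} u * of_bool (y u = j)) = (indicator {a<..b} u :: real)"
    proof (cases "u \<in> {a<..b}")
      case True
      then have "y u \<in> y ` {0..b}" using assms by auto
      then have "(\<Sum>j\<in>y ` {0..b}. (of_bool (y u = j) :: real)) = 1"
        using finite_visited[OF y, of b] by (simp add: of_bool_def)
      then show ?thesis using True by simp
    qed simp
  qed
  also have "\<dots> = b - a" using assms by simp
  finally show ?thesis .
qed

lemma clock_eq_sum:
  assumes "0 \<le> a" "a \<le> b"
  shows "clock V y a = (\<Sum>j\<in>y ` {0..b}. (local_time y j a)\<^sup>2 - 1)"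
proof -
  have "clock V y a = (\<Sum>\<^sub>\<infinity>j\<in>y ` {0..b}. (local_time y j a)\<^sup>2 - 1)"
    unfolding clock_def
    by (intro infsum_cong_neutral) (use local_time_unvisited[OF assms] cadlag_in_V[OF y] in auto)
  then show ?thesis by (simp add: finite_visited[OF y])
qed

text \<open>
  The increment of the clock is the sum of \<open>(L b + L a) * (L b - L a)\<close> over the
  visited sites. The local times \<open>L\<close> lie between 1 and \<open>1 + b\<close>, and their increments add
  up to \<open>b - a\<close>. Hence the clock is strictly increasing, locally Lipschitz and unbounded.
\<close>

lemma clock_increment_bounds:
  assumes ab: "0 \<le> a" "a \<le> b"
  shows "2 * (b - a) \<le> clock V y b - clock V y a" "clock V y b - clock V y a \<le> 2 * (1 + b) * (b - a)"
proof -
  let ?F = "y ` {0..b}"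
  have b0: "0 \<le> b" using ab by simp
  have eq: "clock V y b - clock V y a =
      (\<Sum>j\<in>?F. (local_time y j b + local_time y j a) * (local_time y j b - local_time y j a))"
    unfolding clock_eq_sum[OF ab] clock_eq_sum[OF b0 order_refl] sum_subtractf[symmetric]
    by (intro sum.cong refl) (simp add: power2_eq_square algebra_simps)
  have m: "0 \<le> local_time y j b - local_time y j a" for j using local_time_mono[OF ab] by simp
  have up: "local_time y j b \<le> 1 + b" if "j \<in> ?F" for j
  proof -
    have "local_time y j b - local_time y j 0 \<le> (\<Sum>j\<in>?F. local_time y j b - local_time y j 0)"
      using that finite_visited[OF y] local_time_mono[OF order_refl b0] by (intro member_le_sum) auto
    then show ?thesis using sum_local_time_increments[OF order_refl b0] by (simp add: local_time_0)
  qed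
  have "2 * (b - a) = (\<Sum>j\<in>?F. 2 * (local_time y j b - local_time y j a))"
    unfolding sum_distrib_left[symmetric] sum_local_time_increments[OF ab] ..
  also have "\<dots> \<le> clock V y b - clock V y a"
    unfolding eq using local_time_ge_1[OF ab(1)] local_time_ge_1[OF b0]
    by (intro sum_mono mult_right_mono m) (smt (verit))
  finally show "2 * (b - a) \<le> clock V y b - clock V y a" .
  have "clock V y b - clock V y a \<le> (\<Sum>j\<in>?F. (2 * (1 + b)) * (local_time y j b - local_time y j a))"
    unfolding eq using up local_time_mono[OF ab] by (intro sum_mono mult_right_mono m) (smt (verit))
  also have "\<dots> = 2 * (1 + b) * (b - a)"
    unfolding sum_distrib_left[symmetric] sum_local_time_increments[OF ab] ..
  finally show "clock V y b - clock V y a \<le> 2 * (1 + b) * (b - a)" .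
qed

lemma clock_0: "clock V y 0 = 0"
  unfolding clock_eq_sum[OF order_refl order_refl] by (simp add: local_time_0)

lemma clock_less_iff: "0 \<le> a \<Longrightarrow> 0 \<le> b \<Longrightarrow> clock V y a < clock V y b \<longleftrightarrow> a < b"
  using clock_increment_bounds(1)[of a b] clock_increment_bounds(1)[of b a] by (cases a b rule: linorder_cases) auto

lemma clock_nonneg: "0 \<le> a \<Longrightarrow> 0 \<le> clock V y a"
  using clock_increment_bounds(1)[of 0 a] by (simp add: clock_0)

lemma clock_surj:
  assumes v: "0 \<le> v" shows "\<exists>s\<ge>0. clock V y s = v"
proof -
  have "continuous_on {0..v} (clock V y)"
  proof (rule lipschitz_on_continuous_on)
    show "(2 * (1 + v))-lipschitz_on {0..v} (clock V y)"
    proof (rule lipschitz_onI)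
      have *: "\<bar>clock V y b - clock V y a\<bar> \<le> 2 * (1 + v) * (b - a)" if "0 \<le> a" "a \<le> b" "b \<le> v" for a b
      proof -
        have "2 * (1 + b) * (b - a) \<le> 2 * (1 + v) * (b - a)" using that by (intro mult_right_mono) auto
        then show ?thesis using clock_increment_bounds[OF that(1,2)] that by (auto simp: abs_le_iff)
      qed
      show "dist (clock V y a) (clock V y b) \<le> 2 * (1 + v) * dist a b" if "a \<in> {0..v}" "b \<in> {0..v}" for a b
        using *[of a b] *[of b a] that unfolding dist_real_def by (cases "a \<le> b") (auto simp: abs_minus_commute)
    qed (use v in simp)
  qed
  moreover have "clock V y 0 \<le> v" using v by (simp add: clock_0)
  moreover have "v \<le> clock V y v" using clock_increment_bounds(1)[of 0 v] v by (simp add: clock_0)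
  ultimately show ?thesis using IVT'[of "clock V y" 0 v v] v by auto
qed

abbreviation "inv_clock \<equiv> the_inv_into {0..} (clock V y)"

lemma inj_clock: "inj_on (clock V y) {0..}"
proof (rule inj_onI)
  fix a b assume ab: "a \<in> {0..}" "b \<in> {0..}" "clock V y a = clock V y b"
  then have "\<not> a < b" "\<not> b < a" using clock_less_iff[of a b] clock_less_iff[of b a] by auto
  then show "a = b" by simp
qed

lemma inv_clock_clock: "0 \<le> s \<Longrightarrow> inv_clock (clock V y s) = s"
  by (intro the_inv_into_f_f inj_clock) simp

lemma inv_clock: assumes "0 \<le> v" shows "0 \<le> inv_clock v" "clock V y (inv_clock v) = v"
proof -
  obtain s where s: "s \<ge> 0" "clock V y s = v" using clock_surj[OF assms] by blast
  have "inv_clock v = s" using inv_clock_clock[OF s(1)] s(2) by simp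
  then show "0 \<le> inv_clock v" "clock V y (inv_clock v) = v" using s by simp_all
qed

lemma inv_clock_less_iff: "0 \<le> u \<Longrightarrow> 0 \<le> v \<Longrightarrow> inv_clock u < inv_clock v \<longleftrightarrow> u < v"
  using clock_less_iff[of "inv_clock u" "inv_clock v"] inv_clock by simp

lemma time_changed_eq: "0 \<le> v \<Longrightarrow> time_changed V y v = y (inv_clock v)"
  by (simp add: time_changed_def)

lemma time_changed_clock: "0 \<le> s \<Longrightarrow> time_changed V y (clock V y s) = y s"
  by (simp add: time_changed_eq clock_nonneg inv_clock_clock)

lemma time_changed_in_space: "time_changed V y \<in> space (cadlag_space V)"
proof (rule cadlag_spaceI)
  show "time_changed V y \<in> (\<Pi>\<^sub>E t\<in>{0..}. V)"
    using cadlag_in_V[OF y] inv_clock(1) by (auto simp: time_changed_def)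
next
  fix t :: real assume t: "0 \<le> t"
  define s where "s = inv_clock t"
  have s: "0 \<le> s" "clock V y s = t" using inv_clock[OF t] by (simp_all add: s_def)
  obtain d where d: "d > 0" "\<And>u. s \<le> u \<Longrightarrow> u < s + d \<Longrightarrow> y u = y s"
    using cadlag_right_interval[OF y s(1)] by blast
  show "\<exists>d>0. \<forall>u. t < u \<and> u < t + d \<longrightarrow> time_changed V y u = time_changed V y t"
  proof (intro exI[of _ "clock V y (s + d) - t"] conjI allI impI)
    have "clock V y s < clock V y (s + d)" using clock_less_iff[of s "s + d"] s(1) d(1) by simp
    then show "0 < clock V y (s + d) - t" using s(2) by simp
    fix u assume u: "t < u \<and> u < t + (clock V y (s + d) - t)"
    then have u0: "0 \<le> u" using t by simp
    have "inv_clock t < inv_clock u" using inv_clock_less_iff[OF t u0] u by simp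
    moreover have "inv_clock u < s + d"
      using clock_less_iff[of "inv_clock u" "s + d"] inv_clock[OF u0] s(1) d(1) u by simp
    ultimately have "y (inv_clock u) = y s" by (intro d(2)) (simp_all add: s_def)
    then show "time_changed V y u = time_changed V y t" by (simp add: time_changed_eq t u0 s_def)
  qed
next
  fix t :: real assume t: "0 < t"
  define s where "s = inv_clock t"
  have s: "0 \<le> s" "clock V y s = t" using inv_clock[of t] t by (simp_all add: s_def)
  have "0 < s" using s t clock_0 by (cases "s = 0") auto
  obtain x d where d: "x \<in> V" "0 < d" "\<And>u. s - d < u \<Longrightarrow> u < s \<Longrightarrow> y u = x"
    using cadlag_left_interval[OF y \<open>0 < s\<close>] by blast
  define l where "l = max 0 (s - d)"
  have l: "0 \<le> l" "l < s" "s - d \<le> l" using \<open>0 < s\<close> d(2) by (auto simp: l_def)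
  show "\<exists>x\<in>V. \<exists>d>0. \<forall>u. t - d < u \<and> u < t \<longrightarrow> time_changed V y u = x"
  proof (intro bexI[OF _ d(1)] exI[of _ "t - clock V y l"] conjI allI impI)
    show "0 < t - clock V y l" using clock_less_iff[OF l(1) s(1)] l(2) s(2) by simp
    fix u assume u: "t - (t - clock V y l) < u \<and> u < t"
    have u0: "0 \<le> u" using u clock_nonneg[OF l(1)] by simp
    have "l < inv_clock u" using clock_less_iff[OF l(1) inv_clock(1)[OF u0]] inv_clock(2)[OF u0] u by simp
    moreover have "inv_clock u < s" using inv_clock_less_iff[OF u0, of t] t u by (simp add: s_def)
    ultimately have "y (inv_clock u) = x" using l(3) by (intro d(3)) simp_all
    then show "time_changed V y u = x" by (simp add: time_changed_eq u0)
  qed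
qed

lemma follows_time_changed:
  assumes f: "follows y \<sigma> n t"
  shows "follows (time_changed V y) \<sigma> n (\<lambda>k. clock V y (t k))"
  unfolding follows_def
proof (intro conjI allI impI)
  show "clock V y (t 0) = 0" using f by (simp add: follows_def clock_0)
  show "time_changed V y (clock V y (t n)) = \<sigma> n"
    using time_changed_clock[OF follows_nonneg[OF f order_refl]] follows_at[OF f order_refl] by simp
  fix k assume k: "k < n"
  have tk: "0 \<le> t k" "0 \<le> t (Suc k)" "t k < t (Suc k)"
    using follows_nonneg[OF f, of k] follows_nonneg[OF f, of "Suc k"] k f by (auto simp: follows_def)
  show "clock V y (t k) < clock V y (t (Suc k))" using clock_less_iff[OF tk(1,2)] tk(3) by simp
  fix u assume u: "clock V y (t k) \<le> u" "u < clock V y (t (Suc k))"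
  have u0: "0 \<le> u" using u(1) clock_nonneg[OF tk(1)] by simp
  have "\<not> inv_clock u < t k" "inv_clock u < t (Suc k)"
    using clock_less_iff[OF inv_clock(1)[OF u0] tk(1)] clock_less_iff[OF inv_clock(1)[OF u0] tk(2)] inv_clock(2)[OF u0] u
    by auto
  then have "y (inv_clock u) = \<sigma> k" using f k unfolding follows_def by (simp add: not_less)
  then show "time_changed V y u = \<sigma> k" by (simp add: time_changed_eq u0)
qed

lemma follows_of_time_changed:
  assumes f: "follows (time_changed V y) \<sigma> n t"
  shows "follows y \<sigma> n (\<lambda>k. inv_clock (t k))"
  unfolding follows_def
proof (intro conjI allI impI)
  show "inv_clock (t 0) = 0" using f inv_clock_clock[of 0] by (simp add: follows_def clock_0)
  show "y (inv_clock (t n)) = \<sigma> n"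
    using time_changed_eq[OF follows_nonneg[OF f order_refl]] follows_at[OF f order_refl] by simp
  fix k assume k: "k < n"
  have tk: "0 \<le> t k" "0 \<le> t (Suc k)" "t k < t (Suc k)"
    using follows_nonneg[OF f, of k] follows_nonneg[OF f, of "Suc k"] k f by (auto simp: follows_def)
  show "inv_clock (t k) < inv_clock (t (Suc k))" using inv_clock_less_iff[OF tk(1,2)] tk(3) by simp
  fix u assume u: "inv_clock (t k) \<le> u" "u < inv_clock (t (Suc k))"
  have u0: "0 \<le> u" using u(1) inv_clock(1)[OF tk(1)] by simp
  have "\<not> clock V y u < t k" "clock V y u < t (Suc k)"
    using clock_less_iff[OF u0 inv_clock(1)[OF tk(1)]] clock_less_iff[OF u0 inv_clock(1)[OF tk(2)]]
      inv_clock(2)[OF tk(1)] inv_clock(2)[OF tk(2)] u by auto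
  then have "time_changed V y (clock V y u) = \<sigma> k" using f k unfolding follows_def by (simp add: not_less)
  then show "y u = \<sigma> k" by (simp add: time_changed_clock u0)
qed

text \<open>
  While the path stays at a site, only the local time of this site grows.
\<close>

lemma clock_jump_increment:
  assumes f: "follows y \<sigma> n t" and k: "k < n"
  shows "clock V y (t (Suc k)) - clock V y (t k) =
    (path_local_time \<sigma> t k (\<sigma> k) + (t (Suc k) - t k))\<^sup>2 - (path_local_time \<sigma> t k (\<sigma> k))\<^sup>2"
proof -
  have tk: "0 \<le> t k" "t k \<le> t (Suc k)" "0 \<le> t (Suc k)"
    using follows_nonneg[OF f, of k] follows_mono[OF f, of k "Suc k"] k by auto
  let ?F = "y ` {0..t (Suc k)}"
  have "y (t k) = \<sigma> k" using follows_at[OF f] k by simp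
  then have inF: "\<sigma> k \<in> ?F" using tk by force
  have L: "local_time y j (t k) = path_local_time \<sigma> t k j" "local_time y j (t (Suc k)) = path_local_time \<sigma> t (Suc k) j" for j
    using follows_prefix[OF f] k by (auto intro!: local_time_at_jump)
  have "clock V y (t (Suc k)) - clock V y (t k) =
     (\<Sum>j\<in>?F. (path_local_time \<sigma> t (Suc k) j)\<^sup>2 - (path_local_time \<sigma> t k j)\<^sup>2)"
    unfolding clock_eq_sum[OF tk(1,2)] clock_eq_sum[OF tk(3) order_refl] L sum_subtractf[symmetric] by simp
  also have "\<dots> = (\<Sum>j\<in>?F. if j = \<sigma> k then (path_local_time \<sigma> t (Suc k) j)\<^sup>2 - (path_local_time \<sigma> t k j)\<^sup>2 else 0)"
    by (intro sum.cong refl) (auto simp: path_local_time_Suc)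
  also have "\<dots> = (path_local_time \<sigma> t (Suc k) (\<sigma> k))\<^sup>2 - (path_local_time \<sigma> t k (\<sigma> k))\<^sup>2"
    using inF finite_visited[OF y] by (simp add: sum.delta')
  finally show ?thesis by (simp add: path_local_time_Suc)
qed

end

section \<open>The VRJP on the scale of its clock\<close>

text \<open>
  A site with local time \<open>L\<close> has to be occupied for a time \<open>u\<close> with
  \<open>(L + u)\<^sup>2 - L\<^sup>2 = x k\<close> until the clock has advanced by \<open>x k\<close>.
\<close>

definition clock_window :: "(nat \<Rightarrow> 'v) \<Rightarrow> (nat \<Rightarrow> real) \<Rightarrow> window" where
  "clock_window \<sigma> x k t = sqrt ((path_local_time \<sigma> t k (\<sigma> k))\<^sup>2 + x k) - path_local_time \<sigma> t k (\<sigma> k)"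

lemma measurable_path_local_time[measurable]:
  "(\<lambda>y. path_local_time \<sigma> (jump_times \<sigma> y) k j) \<in> borel_measurable (cadlag_space V)"
  unfolding path_local_time_def by measurable

lemma history_window_clock: "history_window V \<sigma> (clock_window \<sigma> x)"
  unfolding history_window_def
proof (intro conjI allI impI)
  show "(\<lambda>y. clock_window \<sigma> x k (jump_times \<sigma> y)) \<in> borel_measurable (cadlag_space V)" for k
    unfolding clock_window_def by measurable
  fix k and t t' :: "nat \<Rightarrow> real" assume eq: "\<forall>m\<le>k. t m = t' m"
  have "path_local_time \<sigma> t k j = path_local_time \<sigma> t' k j" for j
    unfolding path_local_time_def using eq by (intro arg_cong2[where f="(+)"] sum.cong refl) auto
  then show "clock_window \<sigma> x k t = clock_window \<sigma> x k t'" by (simp add: clock_window_def)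
qed

lemma path_local_time_ge_1:
  assumes "follows y \<sigma> n t" "k \<le> n" shows "1 \<le> path_local_time \<sigma> t k j"
proof -
  have "0 \<le> t (Suc m) - t m" if "m < k" for m
    using follows_mono[OF assms(1), of m "Suc m"] that assms(2) by simp
  then show ?thesis unfolding path_local_time_def by (auto intro!: sum_nonneg)
qed

lemma clock_window_less_iff:
  fixes L :: real
  assumes "1 \<le> L" "0 \<le> u" "0 \<le> x"
  shows "sqrt (L\<^sup>2 + x) - L < u \<longleftrightarrow> x < (L + u)\<^sup>2 - L\<^sup>2"
proof -
  have "sqrt (L\<^sup>2 + x) - L < u \<longleftrightarrow> sqrt (L\<^sup>2 + x) < sqrt ((L + u)\<^sup>2)" using assms by auto
  also have "\<dots> \<longleftrightarrow> L\<^sup>2 + x < (L + u)\<^sup>2" by (rule real_sqrt_less_iff)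
  finally show ?thesis by linarith
qed

lemma within_clock_windows_iff:
  assumes y: "y \<in> space (cadlag_space V)" and f: "follows y \<sigma> n t"
    and x: "\<And>k. 0 \<le> x k" "\<And>k. 0 \<le> x' k"
  shows "within_windows (\<lambda>k t. x k) (\<lambda>k t. x' k) n (\<lambda>k. clock V y (t k)) \<longleftrightarrow>
    within_windows (clock_window \<sigma> x) (clock_window \<sigma> x') n t"
  unfolding within_windows_def
proof (intro all_cong1 imp_cong refl)
  fix k assume k: "k < n"
  let ?L = "path_local_time \<sigma> t k (\<sigma> k)" and ?u = "t (Suc k) - t k"
  have L: "1 \<le> ?L" using path_local_time_ge_1[OF f] k by simp
  have u: "0 \<le> ?u" using f k unfolding follows_def by (simp add: less_imp_le)
  show "(x k < clock V y (t (Suc k)) - clock V y (t k) \<and> clock V y (t (Suc k)) - clock V y (t k) \<le> x' k) =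
      (clock_window \<sigma> x k t < ?u \<and> ?u \<le> clock_window \<sigma> x' k t)"
    unfolding clock_jump_increment[OF y f k] clock_window_def
    using clock_window_less_iff[OF L u x(1)] clock_window_less_iff[OF L u x(2)] by (metis not_less)
qed

lemma within_windows_const_cong:
  "(\<And>k. k \<le> n \<Longrightarrow> t k = t' k) \<Longrightarrow>
    within_windows (\<lambda>k t. x k) (\<lambda>k t. x' k) n t \<longleftrightarrow> within_windows (\<lambda>k t. x k) (\<lambda>k t. x' k) n t'"
  unfolding within_windows_def by (simp add: Suc_le_eq cong: conj_cong)

text \<open>
  The time change turns constant windows for the holding times of \<open>Z\<close> into windows for the
  holding times of the VRJP that depend on its history.
\<close>

lemma time_changed_path_event_iff:
  assumes y: "y \<in> space (cadlag_space V)" and p: "\<And>k. k < n \<Longrightarrow> \<sigma> k \<noteq> \<sigma> (Suc k)"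
    and x: "\<And>k. 0 \<le> x k" "\<And>k. 0 \<le> x' k"
  shows "time_changed V y \<in> path_event V \<sigma> (\<lambda>k t. x k) (\<lambda>k t. x' k) n \<longleftrightarrow>
    y \<in> path_event V \<sigma> (clock_window \<sigma> x) (clock_window \<sigma> x') n"
proof -
  let ?z = "time_changed V y"
  have key: "follows ?z \<sigma> n (jump_times \<sigma> ?z) \<and>
      (within_windows (\<lambda>k t. x k) (\<lambda>k t. x' k) n (jump_times \<sigma> ?z) \<longleftrightarrow>
       within_windows (clock_window \<sigma> x) (clock_window \<sigma> x') n (jump_times \<sigma> y))"
    if f: "follows y \<sigma> n (jump_times \<sigma> y)"
  proof -
    note fz = follows_time_changed[OF y f]
    have jt: "jump_times \<sigma> ?z k = clock V y (jump_times \<sigma> y k)" if "k \<le> n" for k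
      using follows_jump_times[OF fz p that] by simp
    have "follows ?z \<sigma> n (jump_times \<sigma> ?z)"
      using fz follows_cong_seq[of n \<sigma> \<sigma> "jump_times \<sigma> ?z" "\<lambda>k. clock V y (jump_times \<sigma> y k)" ?z] jt by simp
    moreover have "within_windows (\<lambda>k t. x k) (\<lambda>k t. x' k) n (jump_times \<sigma> ?z) \<longleftrightarrow>
        within_windows (\<lambda>k t. x k) (\<lambda>k t. x' k) n (\<lambda>k. clock V y (jump_times \<sigma> y k))"
      by (rule within_windows_const_cong) (rule jt)
    ultimately show ?thesis using within_clock_windows_iff[OF y f x] by simp
  qed
  have conv: "follows y \<sigma> n (jump_times \<sigma> y)" if f: "follows ?z \<sigma> n (jump_times \<sigma> ?z)"
  proof -
    note fy = follows_of_time_changed[OF y f]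
    show ?thesis
      using fy follows_cong_seq[of n \<sigma> \<sigma> "jump_times \<sigma> y" "\<lambda>k. the_inv_into {0..} (clock V y) (jump_times \<sigma> ?z k)" y]
        follows_jump_times[OF fy p] by simp
  qed
  show ?thesis
    unfolding path_event_def mem_Collect_eq using key conv time_changed_in_space[OF y] y by blast
qed

definition site_time :: "(nat \<Rightarrow> 'v) \<Rightarrow> (nat \<Rightarrow> real) \<Rightarrow> nat \<Rightarrow> 'v \<Rightarrow> real" where
  "site_time \<sigma> x n j = (\<Sum>k<n. if \<sigma> k = j then x k else 0)"

lemma site_time_nonneg: "(\<And>k. 0 \<le> x k) \<Longrightarrow> 0 \<le> site_time \<sigma> x n j"
  unfolding site_time_def by (intro sum_nonneg) auto

lemma site_time_Suc: "site_time \<sigma> x (Suc n) j = site_time \<sigma> x n j + (if \<sigma> n = j then x n else 0)"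
  by (simp add: site_time_def)

text \<open>
  The square of a local time is 1 plus the sum of the clock increments during the visits, each
  of which is known up to \<open>\<epsilon>\<close>. On the scale of the clock, the local times and with
  them the jump rates of the VRJP are thus functions of the holding times.
\<close>

lemma path_local_time_sq_bounds:
  assumes f: "follows y \<sigma> n t" and x: "\<And>k. 0 \<le> x k" and \<epsilon>: "0 \<le> \<epsilon>"
    and w: "within_windows (clock_window \<sigma> x) (clock_window \<sigma> (\<lambda>k. x k + \<epsilon>)) n t"
  shows "m \<le> n \<Longrightarrow> 1 + site_time \<sigma> x m j \<le> (path_local_time \<sigma> t m j)\<^sup>2 \<and>
     (path_local_time \<sigma> t m j)\<^sup>2 \<le> 1 + site_time \<sigma> x m j + real m * \<epsilon>"
proof (induction m)
  case 0 then show ?case by (simp add: site_time_def)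
next
  case (Suc m)
  then have IH: "1 + site_time \<sigma> x m j \<le> (path_local_time \<sigma> t m j)\<^sup>2"
     "(path_local_time \<sigma> t m j)\<^sup>2 \<le> 1 + site_time \<sigma> x m j + real m * \<epsilon>" and m: "m < n" by auto
  show ?case
  proof (cases "\<sigma> m = j")
    case False
    then show ?thesis using IH \<epsilon> by (simp add: path_local_time_Suc site_time_Suc algebra_simps)
  next
    case True
    let ?L = "path_local_time \<sigma> t m j" and ?u = "t (Suc m) - t m"
    have L: "1 \<le> ?L" using path_local_time_ge_1[OF f] m by simp
    have u: "0 \<le> ?u" using f m unfolding follows_def by (simp add: less_imp_le)
    have "sqrt (?L\<^sup>2 + x m) - ?L < ?u" "\<not> sqrt (?L\<^sup>2 + (x m + \<epsilon>)) - ?L < ?u"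
      using w m True unfolding within_windows_def clock_window_def by auto
    then have "x m < (?L + ?u)\<^sup>2 - ?L\<^sup>2" "\<not> x m + \<epsilon> < (?L + ?u)\<^sup>2 - ?L\<^sup>2"
      using clock_window_less_iff[OF L u, of "x m"] clock_window_less_iff[OF L u, of "x m + \<epsilon>"] x[of m] \<epsilon> by auto
    moreover have e: "path_local_time \<sigma> t (Suc m) j = ?L + ?u" "site_time \<sigma> x (Suc m) j = site_time \<sigma> x m j + x m"
      "real (Suc m) * \<epsilon> = real m * \<epsilon> + \<epsilon>"
      using True by (simp_all add: path_local_time_Suc site_time_Suc algebra_simps)
    ultimately show ?thesis unfolding e using IH by linarith
  qed
qed

lemma sqrt_diff_eq:
  assumes "0 < p" "0 \<le> c" shows "sqrt (p + c) - sqrt p = c / (sqrt (p + c) + sqrt p)"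
proof -
  have "(sqrt (p + c) - sqrt p) * (sqrt (p + c) + sqrt p) = c"
    using assms by (simp add: algebra_simps)
  moreover have "sqrt (p + c) + sqrt p > 0" using assms by (simp add: add_nonneg_pos)
  ultimately show ?thesis by (simp add: field_simps)
qed

lemma sqrt_diff_antimono:
  assumes "0 < p" "p \<le> q" "0 \<le> c" shows "sqrt (q + c) - sqrt q \<le> sqrt (p + c) - sqrt p"
proof -
  have "sqrt (p + c) + sqrt p > 0" using assms by (simp add: add_nonneg_pos)
  then have "c / (sqrt (q + c) + sqrt q) \<le> c / (sqrt (p + c) + sqrt p)"
    using assms by (intro divide_left_mono add_mono mult_pos_pos) (auto intro!: add_nonneg_pos)
  then show ?thesis using assms by (simp add: sqrt_diff_eq)
qed

text \<open>
  The rate of the jump, times the derivative of the inverse clock, times the probability that no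
  jump happens before. The denominator is left as a sum of two equal roots because it is the
  limit of the denominator in \<open>sqrt (p + \<epsilon>) - sqrt p = \<epsilon> / (sqrt (p +
  \<epsilon>) + sqrt p)\<close>.
\<close>

definition step_density :: "'v set set \<Rightarrow> ('v set \<Rightarrow> real) \<Rightarrow> (nat \<Rightarrow> 'v) \<Rightarrow> (nat \<Rightarrow> real) \<Rightarrow> nat \<Rightarrow> real" where
  "step_density E W \<sigma> x n =
     weight E W (\<sigma> n) (\<sigma> (Suc n)) * sqrt (1 + site_time \<sigma> x n (\<sigma> (Suc n))) *
     (1 / (sqrt (1 + site_time \<sigma> x n (\<sigma> n) + x n) + sqrt (1 + site_time \<sigma> x n (\<sigma> n) + x n))) *
     exp (- ((\<Sum>k\<in>nbrs E (\<sigma> n). weight E W (\<sigma> n) k * sqrt (1 + site_time \<sigma> x n k)) *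
        (sqrt (1 + site_time \<sigma> x n (\<sigma> n) + x n) - sqrt (1 + site_time \<sigma> x n (\<sigma> n)))))"

text \<open>
  On the path event the squares of the local times at the \<open>n\<close>-th jump are known up to
  \<open>n * \<epsilon>\<close>, so the jump rates and the window can be replaced by their extreme values
  in the bounds for the next step.
\<close>

lemma vrjp_path_prob_step:
  assumes law: "vrjp_law V E W i0 Q"
    and p: "\<And>k. k < Suc n \<Longrightarrow> \<sigma> k \<noteq> \<sigma> (Suc k)" 
    and j: "\<sigma> (Suc n) \<in> V" "\<sigma> (Suc n) \<in> nbrs E (\<sigma> n)" and fin: "finite (nbrs E (\<sigma> n))"
    and noloop: "\<sigma> n \<notin> nbrs E (\<sigma> n)"
    and w: "\<And>i j. 0 \<le> weight E W i j" and x: "\<And>k. 0 \<le> x k" and \<epsilon>: "0 < \<epsilon>"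
    and P_def: "\<And>n. P n = measure Q (path_event V \<sigma> (clock_window \<sigma> x) (clock_window \<sigma> (\<lambda>k. x k + \<epsilon>)) n)"
    and A_def: "\<And>k. A k = 1 + site_time \<sigma> x n k"
  shows "\<epsilon> * (weight E W (\<sigma> n) (\<sigma> (Suc n)) * sqrt (A (\<sigma> (Suc n))) *
     (1 / (sqrt (A (\<sigma> n) + n * \<epsilon> + x n + \<epsilon>) + sqrt (A (\<sigma> n) + n * \<epsilon> + x n))) *
     exp (- ((\<Sum>k\<in>nbrs E (\<sigma> n). weight E W (\<sigma> n) k * sqrt (A k + n * \<epsilon>)) *
        (sqrt (A (\<sigma> n) + x n + \<epsilon>) - sqrt (A (\<sigma> n)))))) * P n \<le> P (Suc n)"
    and "P (Suc n) \<le> \<epsilon> * (weight E W (\<sigma> n) (\<sigma> (Suc n)) * sqrt (A (\<sigma> (Suc n)) + n * \<epsilon>) *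
     (1 / (sqrt (A (\<sigma> n) + x n + \<epsilon>) + sqrt (A (\<sigma> n) + x n))) *
     exp (- ((\<Sum>k\<in>nbrs E (\<sigma> n). weight E W (\<sigma> n) k * sqrt (A k)) *
        (sqrt (A (\<sigma> n) + n * \<epsilon> + x n) - sqrt (A (\<sigma> n) + n * \<epsilon>))))) * P n"
proof -
  define lo where "lo = clock_window \<sigma> x"
  define hi where "hi = clock_window \<sigma> (\<lambda>k. x k + \<epsilon>)"
  define \<kappa> where "\<kappa> y k = weight E W (\<sigma> n) k * path_local_time \<sigma> (jump_times \<sigma> y) n k" for y k
  define a where "a = A (\<sigma> n)"
  define cl where "cl = weight E W (\<sigma> n) (\<sigma> (Suc n)) * sqrt (A (\<sigma> (Suc n))) *
     (\<epsilon> / (sqrt (a + n * \<epsilon> + x n + \<epsilon>) + sqrt (a + n * \<epsilon> + x n))) *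
     exp (- ((\<Sum>k\<in>nbrs E (\<sigma> n). weight E W (\<sigma> n) k * sqrt (A k + n * \<epsilon>)) *
        (sqrt (a + x n + \<epsilon>) - sqrt a)))"
  define cu where "cu = weight E W (\<sigma> n) (\<sigma> (Suc n)) * sqrt (A (\<sigma> (Suc n)) + n * \<epsilon>) *
     (\<epsilon> / (sqrt (a + x n + \<epsilon>) + sqrt (a + x n))) *
     exp (- ((\<Sum>k\<in>nbrs E (\<sigma> n). weight E W (\<sigma> n) k * sqrt (A k)) *
        (sqrt (a + n * \<epsilon> + x n) - sqrt (a + n * \<epsilon>))))"
  have law': "jump_process_law V E (\<lambda>y s j. weight E W (y s) j * local_time y j s) i0 Q"
    using law by (simp add: vrjp_law_def)
  have A1: "1 \<le> A k" for k using site_time_nonneg[of x \<sigma> n k, OF x] by (simp add: A_def)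
  then have A0: "0 \<le> A k" for k using order_trans[OF zero_le_one] by blast
  have a1: "1 \<le> a" using A1 by (simp add: a_def)
  have n\<epsilon>: "0 \<le> n * \<epsilon>" using \<epsilon> by simp
  have xn: "0 \<le> x n" by (rule x)
  have facts: "1 \<le> l \<and> sqrt (A k) \<le> l \<and> l \<le> sqrt (A k + n * \<epsilon>) \<and> A k \<le> l\<^sup>2 \<and> l\<^sup>2 \<le> A k + n * \<epsilon>"
    if y: "y \<in> path_event V \<sigma> lo hi n" and l: "l = path_local_time \<sigma> (jump_times \<sigma> y) n k" for y k l
  proof -
    have f: "follows y \<sigma> n (jump_times \<sigma> y)" and ww: "within_windows lo hi n (jump_times \<sigma> y)"
      using y by (auto simp: path_event_def)
    have l1: "1 \<le> l" unfolding l by (rule path_local_time_ge_1[OF f order_refl])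
    have b: "A k \<le> l\<^sup>2" "l\<^sup>2 \<le> A k + n * \<epsilon>"
      using path_local_time_sq_bounds[OF f x less_imp_le[OF \<epsilon>] ww[unfolded lo_def hi_def] order_refl, of k]
      unfolding A_def l by auto
    have "sqrt (A k) \<le> l" using real_sqrt_le_mono[OF b(1)] l1 by simp
    moreover have "l \<le> sqrt (A k + n * \<epsilon>)" using real_sqrt_le_mono[OF b(2)] l1 by simp
    ultimately show ?thesis using l1 b by simp
  qed
  have win: "lo n t = sqrt (L\<^sup>2 + x n) - L" "hi n t = sqrt (L\<^sup>2 + x n + \<epsilon>) - L" if "L = path_local_time \<sigma> t n (\<sigma> n)" for t L
    using that by (simp_all add: lo_def hi_def clock_window_def add.assoc)
  have main: "cl * measure Q (path_event V \<sigma> lo hi n) \<le> measure Q (path_event V \<sigma> lo hi (Suc n))"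
    "measure Q (path_event V \<sigma> lo hi (Suc n)) \<le> cu * measure Q (path_event V \<sigma> lo hi n)"
  proof -
    have lohi: "0 \<le> lo n (jump_times \<sigma> y) \<and> lo n (jump_times \<sigma> y) \<le> hi n (jump_times \<sigma> y)"
      if y: "y \<in> path_event V \<sigma> lo hi n" for y
    proof -
      let ?L = "path_local_time \<sigma> (jump_times \<sigma> y) n (\<sigma> n)"
      have "sqrt (?L\<^sup>2) \<le> sqrt (?L\<^sup>2 + x n)" using xn by (intro real_sqrt_le_mono) simp
      then have "?L \<le> sqrt (?L\<^sup>2 + x n)" using facts[OF y refl, of "\<sigma> n"] by simp
      then show ?thesis using \<epsilon> by (simp add: win[OF refl])
    qed
    have const: "weight E W (y s) k * local_time y k s = \<kappa> y k"
      if y: "y \<in> path_event V \<sigma> lo hi n" and s: "jump_times \<sigma> y n \<le> s"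
        "\<And>u. jump_times \<sigma> y n \<le> u \<Longrightarrow> u \<le> s \<Longrightarrow> y u = \<sigma> n" and k: "k \<in> nbrs E (\<sigma> n)" for y s k
    proof -
      have f: "follows y \<sigma> n (jump_times \<sigma> y)" using y by (simp add: path_event_def)
      have "\<sigma> n \<noteq> k" using k noloop by blast
      then have "local_time y k s = path_local_time \<sigma> (jump_times \<sigma> y) n k"
        using local_time_follows[OF f s, of k] by simp
      moreover have "y s = \<sigma> n" using s by blast
      ultimately show ?thesis by (simp add: \<kappa>_def)
    qed
    have \<kappa>0: "0 \<le> \<kappa> y k" if "y \<in> path_event V \<sigma> lo hi n" for y k
      using facts[OF that refl, of k] w unfolding \<kappa>_def by simp
    have hist: "history_window V \<sigma> lo" "history_window V \<sigma> hi"
      by (simp_all add: lo_def hi_def history_window_clock)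
    have \<kappa>m: "(\<lambda>y. \<kappa> y k) \<in> borel_measurable (cadlag_space V)" for k
      unfolding \<kappa>_def by measurable
    have lb: "cl \<le> \<kappa> y (\<sigma> (Suc n)) * (hi n (jump_times \<sigma> y) - lo n (jump_times \<sigma> y)) *
        exp (- ((\<Sum>k\<in>nbrs E (\<sigma> n). \<kappa> y k) * hi n (jump_times \<sigma> y)))"
      and ub: "\<kappa> y (\<sigma> (Suc n)) * (hi n (jump_times \<sigma> y) - lo n (jump_times \<sigma> y)) *
        exp (- ((\<Sum>k\<in>nbrs E (\<sigma> n). \<kappa> y k) * lo n (jump_times \<sigma> y))) \<le> cu"
      if y: "y \<in> path_event V \<sigma> lo hi n" for y
    proof -
      define L where "L = path_local_time \<sigma> (jump_times \<sigma> y) n (\<sigma> n)"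
      define lt where "lt k = path_local_time \<sigma> (jump_times \<sigma> y) n k" for k
      note win' = win[OF L_def]
      have L: "1 \<le> L" "a \<le> L\<^sup>2" "L\<^sup>2 \<le> a + n * \<epsilon>" using facts[OF y L_def] by (auto simp: a_def)
      have sL: "sqrt (L\<^sup>2) = L" using L by simp
      have lt: "sqrt (A k) \<le> lt k" "lt k \<le> sqrt (A k + n * \<epsilon>)" "1 \<le> lt k" for k
        using facts[OF y lt_def[of k]] by blast+
      have d: "hi n (jump_times \<sigma> y) - lo n (jump_times \<sigma> y) = \<epsilon> / (sqrt (L\<^sup>2 + x n + \<epsilon>) + sqrt (L\<^sup>2 + x n))"
        unfolding win' using sqrt_diff_eq[of "L\<^sup>2 + x n" \<epsilon>] L a1 xn \<epsilon> by simp
      have pos: "0 < sqrt p + sqrt q" if "1 \<le> p" "1 \<le> q" for p q :: real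
        using that by (intro add_pos_pos) auto
      have d1: "\<epsilon> / (sqrt (a + n * \<epsilon> + x n + \<epsilon>) + sqrt (a + n * \<epsilon> + x n)) \<le> \<epsilon> / (sqrt (L\<^sup>2 + x n + \<epsilon>) + sqrt (L\<^sup>2 + x n))"
        using L a1 xn \<epsilon> n\<epsilon> by (intro divide_left_mono add_mono real_sqrt_le_mono mult_pos_pos pos) auto
      have d2: "\<epsilon> / (sqrt (L\<^sup>2 + x n + \<epsilon>) + sqrt (L\<^sup>2 + x n)) \<le> \<epsilon> / (sqrt (a + x n + \<epsilon>) + sqrt (a + x n))"
        using L a1 xn \<epsilon> n\<epsilon> by (intro divide_left_mono add_mono real_sqrt_le_mono mult_pos_pos pos) auto
      have "sqrt (L\<^sup>2 + (x n + \<epsilon>)) - sqrt (L\<^sup>2) \<le> sqrt (a + (x n + \<epsilon>)) - sqrt a"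
        using L(2) a1 xn \<epsilon> by (intro sqrt_diff_antimono) auto
      then have h: "hi n (jump_times \<sigma> y) \<le> sqrt (a + x n + \<epsilon>) - sqrt a" "0 \<le> hi n (jump_times \<sigma> y)"
        using lohi[OF y] unfolding win'(2) sL by (simp_all add: add.assoc)
      have "sqrt (a + n * \<epsilon> + x n) - sqrt (a + n * \<epsilon>) \<le> sqrt (L\<^sup>2 + x n) - sqrt (L\<^sup>2)"
        using L xn a1 by (intro sqrt_diff_antimono) auto
      then have l: "sqrt (a + n * \<epsilon> + x n) - sqrt (a + n * \<epsilon>) \<le> lo n (jump_times \<sigma> y)"
        unfolding win'(1) sL .
      have l0: "0 \<le> sqrt (a + n * \<epsilon> + x n) - sqrt (a + n * \<epsilon>)" using xn by simp
      have s1: "(\<Sum>k\<in>nbrs E (\<sigma> n). \<kappa> y k) \<le> (\<Sum>k\<in>nbrs E (\<sigma> n). weight E W (\<sigma> n) k * sqrt (A k + n * \<epsilon>))"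
        unfolding \<kappa>_def lt_def[symmetric] using lt w by (intro sum_mono mult_left_mono) auto
      have s2: "(\<Sum>k\<in>nbrs E (\<sigma> n). weight E W (\<sigma> n) k * sqrt (A k)) \<le> (\<Sum>k\<in>nbrs E (\<sigma> n). \<kappa> y k)"
        unfolding \<kappa>_def lt_def[symmetric] using lt w by (intro sum_mono mult_left_mono) auto
      have s0: "0 \<le> (\<Sum>k\<in>nbrs E (\<sigma> n). weight E W (\<sigma> n) k * sqrt (A k))"
        using w A0 by (intro sum_nonneg mult_nonneg_nonneg) auto
      have s3: "0 \<le> (\<Sum>k\<in>nbrs E (\<sigma> n). \<kappa> y k)" using s0 s2 by linarith
      have e1: "(\<Sum>k\<in>nbrs E (\<sigma> n). \<kappa> y k) * hi n (jump_times \<sigma> y) \<le>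
          (\<Sum>k\<in>nbrs E (\<sigma> n). weight E W (\<sigma> n) k * sqrt (A k + n * \<epsilon>)) * (sqrt (a + x n + \<epsilon>) - sqrt a)"
        using s1 s3 h by (intro mult_mono) auto
      have e2: "(\<Sum>k\<in>nbrs E (\<sigma> n). weight E W (\<sigma> n) k * sqrt (A k)) * (sqrt (a + n * \<epsilon> + x n) - sqrt (a + n * \<epsilon>)) \<le>
          (\<Sum>k\<in>nbrs E (\<sigma> n). \<kappa> y k) * lo n (jump_times \<sigma> y)"
        using s2 s3 l l0 by (intro mult_mono) auto
      have w0: "0 \<le> weight E W (\<sigma> n) (\<sigma> (Suc n))" by (rule w)
      have q0: "0 \<le> sqrt (A (\<sigma> (Suc n)))" "0 \<le> lt (\<sigma> (Suc n))" using A0 lt(3)[of "\<sigma> (Suc n)"] by auto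
      have \<epsilon>q: "0 \<le> \<epsilon> / (sqrt (a + n * \<epsilon> + x n + \<epsilon>) + sqrt (a + n * \<epsilon> + x n))"
        "0 \<le> \<epsilon> / (sqrt (L\<^sup>2 + x n + \<epsilon>) + sqrt (L\<^sup>2 + x n))"
        using \<epsilon> a1 xn n\<epsilon> L by (auto intro!: divide_nonneg_nonneg add_nonneg_nonneg)
      have \<kappa>e: "\<kappa> y (\<sigma> (Suc n)) = weight E W (\<sigma> n) (\<sigma> (Suc n)) * lt (\<sigma> (Suc n))" by (simp add: \<kappa>_def lt_def)
      show "cl \<le> \<kappa> y (\<sigma> (Suc n)) * (hi n (jump_times \<sigma> y) - lo n (jump_times \<sigma> y)) *
        exp (- ((\<Sum>k\<in>nbrs E (\<sigma> n). \<kappa> y k) * hi n (jump_times \<sigma> y)))"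
        unfolding cl_def d \<kappa>e using w0 q0 \<epsilon>q d1 e1 lt(1)
        by (intro mult_mono mult_nonneg_nonneg mult_left_mono) auto
      show "\<kappa> y (\<sigma> (Suc n)) * (hi n (jump_times \<sigma> y) - lo n (jump_times \<sigma> y)) *
        exp (- ((\<Sum>k\<in>nbrs E (\<sigma> n). \<kappa> y k) * lo n (jump_times \<sigma> y))) \<le> cu"
        unfolding cu_def d \<kappa>e using w0 q0 \<epsilon>q d2 e2 lt(2) A0 n\<epsilon> \<epsilon> a1 xn
        by (intro mult_mono mult_nonneg_nonneg mult_left_mono) (auto intro!: add_nonneg_nonneg divide_nonneg_nonneg)
    qed
    show "cl * measure Q (path_event V \<sigma> lo hi n) \<le> measure Q (path_event V \<sigma> lo hi (Suc n))"
      by (rule path_event_step_bounds(1)[OF law' p hist lohi \<kappa>m \<kappa>0 const fin j lb ub])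
    show "measure Q (path_event V \<sigma> lo hi (Suc n)) \<le> cu * measure Q (path_event V \<sigma> lo hi n)"
      by (rule path_event_step_bounds(2)[OF law' p hist lohi \<kappa>m \<kappa>0 const fin j lb ub])
  qed
  show "\<epsilon> * (weight E W (\<sigma> n) (\<sigma> (Suc n)) * sqrt (A (\<sigma> (Suc n))) *
     (1 / (sqrt (A (\<sigma> n) + n * \<epsilon> + x n + \<epsilon>) + sqrt (A (\<sigma> n) + n * \<epsilon> + x n))) *
     exp (- ((\<Sum>k\<in>nbrs E (\<sigma> n). weight E W (\<sigma> n) k * sqrt (A k + n * \<epsilon>)) *
        (sqrt (A (\<sigma> n) + x n + \<epsilon>) - sqrt (A (\<sigma> n)))))) * P n \<le> P (Suc n)"
    using main(1) unfolding P_def lo_def hi_def cl_def a_def by (simp add: mult_ac)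
  show "P (Suc n) \<le> \<epsilon> * (weight E W (\<sigma> n) (\<sigma> (Suc n)) * sqrt (A (\<sigma> (Suc n)) + n * \<epsilon>) *
     (1 / (sqrt (A (\<sigma> n) + x n + \<epsilon>) + sqrt (A (\<sigma> n) + x n))) *
     exp (- ((\<Sum>k\<in>nbrs E (\<sigma> n). weight E W (\<sigma> n) k * sqrt (A k)) *
        (sqrt (A (\<sigma> n) + n * \<epsilon> + x n) - sqrt (A (\<sigma> n) + n * \<epsilon>))))) * P n"
    using main(2) unfolding P_def lo_def hi_def cu_def a_def by (simp add: mult_ac)
qed

text \<open>
  Both bounds of the preceding lemma, divided by \<open>\<epsilon>\<close>, converge to the step density.
\<close>

lemma vrjp_path_density:
  assumes law: "vrjp_law V E W (\<sigma> 0) Q"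
    and p: "\<And>k. k < n \<Longrightarrow> \<sigma> k \<noteq> \<sigma> (Suc k) \<and> \<sigma> (Suc k) \<in> V \<and> \<sigma> (Suc k) \<in> nbrs E (\<sigma> k) \<and>
      finite (nbrs E (\<sigma> k)) \<and> \<sigma> k \<notin> nbrs E (\<sigma> k)"
    and w: "\<And>i j. 0 \<le> weight E W i j" and x: "\<And>k. 0 \<le> x k"
  shows "((\<lambda>\<epsilon>. measure Q (path_event V \<sigma> (clock_window \<sigma> x) (clock_window \<sigma> (\<lambda>k. x k + \<epsilon>)) n) / \<epsilon> ^ n)
     \<longlongrightarrow> (\<Prod>k<n. step_density E W \<sigma> x k)) (at_right 0)"
  using p
proof (induction n)
  case 0
  have "measure Q (path_event V \<sigma> lo hi 0) = 1" for lo hi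
    by (rule path_event_0) (use law in \<open>simp add: vrjp_law_def\<close>)
  then show ?case by simp
next
  case (Suc n)
  define P where "P \<epsilon> m = measure Q (path_event V \<sigma> (clock_window \<sigma> x) (clock_window \<sigma> (\<lambda>k. x k + \<epsilon>)) m)" for \<epsilon> m
  define A where "A k = 1 + site_time \<sigma> x n k" for k
  have pn: "\<sigma> k \<noteq> \<sigma> (Suc k)" "\<sigma> (Suc k) \<in> V" "\<sigma> (Suc k) \<in> nbrs E (\<sigma> k)"
      "finite (nbrs E (\<sigma> k))" "\<sigma> k \<notin> nbrs E (\<sigma> k)" if "k < Suc n" for k
    using Suc.prems that by blast+
  have A1: "1 \<le> A k" for k using site_time_nonneg[of x \<sigma> n k, OF x] by (simp add: A_def)
  define cl where "cl \<epsilon> = weight E W (\<sigma> n) (\<sigma> (Suc n)) * sqrt (A (\<sigma> (Suc n))) *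
     (1 / (sqrt (A (\<sigma> n) + n * \<epsilon> + x n + \<epsilon>) + sqrt (A (\<sigma> n) + n * \<epsilon> + x n))) *
     exp (- ((\<Sum>k\<in>nbrs E (\<sigma> n). weight E W (\<sigma> n) k * sqrt (A k + n * \<epsilon>)) *
        (sqrt (A (\<sigma> n) + x n + \<epsilon>) - sqrt (A (\<sigma> n)))))" for \<epsilon> :: real
  define cu where "cu \<epsilon> = weight E W (\<sigma> n) (\<sigma> (Suc n)) * sqrt (A (\<sigma> (Suc n)) + n * \<epsilon>) *
     (1 / (sqrt (A (\<sigma> n) + x n + \<epsilon>) + sqrt (A (\<sigma> n) + x n))) *
     exp (- ((\<Sum>k\<in>nbrs E (\<sigma> n). weight E W (\<sigma> n) k * sqrt (A k)) *
        (sqrt (A (\<sigma> n) + n * \<epsilon> + x n) - sqrt (A (\<sigma> n) + n * \<epsilon>))))" for \<epsilon> :: real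
  have b: "\<epsilon> * cl \<epsilon> * P \<epsilon> n \<le> P \<epsilon> (Suc n)" "P \<epsilon> (Suc n) \<le> \<epsilon> * cu \<epsilon> * P \<epsilon> n" if "0 < \<epsilon>" for \<epsilon> :: real
    unfolding cl_def cu_def
    by (rule vrjp_path_prob_step[where P="P \<epsilon>" and A=A and x=x and \<sigma>=\<sigma>, OF law pn(1) pn(2)[OF lessI] pn(3)[OF lessI] pn(4)[OF lessI] pn(5)[OF lessI]
        w x that P_def A_def]; simp)+
  have pos: "0 < A (\<sigma> n) + x n" using A1[of "\<sigma> n"] x[of n] by linarith
  have "(cl \<longlongrightarrow> cl 0) (at_right 0)"
    unfolding cl_def by (intro tendsto_intros) (use pos in simp)
  moreover have "(cu \<longlongrightarrow> cu 0) (at_right 0)"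
    unfolding cu_def by (intro tendsto_intros) (use pos in simp)
  moreover have "cl 0 = step_density E W \<sigma> x n" "cu 0 = step_density E W \<sigma> x n"
    unfolding cl_def cu_def step_density_def A_def by simp_all
  ultimately have c: "(cl \<longlongrightarrow> step_density E W \<sigma> x n) (at_right 0)" "(cu \<longlongrightarrow> step_density E W \<sigma> x n) (at_right 0)"
    by simp_all
  have IH: "((\<lambda>\<epsilon>. P \<epsilon> n / \<epsilon> ^ n) \<longlongrightarrow> (\<Prod>k<n. step_density E W \<sigma> x k)) (at_right 0)"
    unfolding P_def by (rule Suc.IH) (use Suc.prems in simp)
  have "((\<lambda>\<epsilon>. P \<epsilon> (Suc n) / \<epsilon> ^ Suc n) \<longlongrightarrow> step_density E W \<sigma> x n * (\<Prod>k<n. step_density E W \<sigma> x k)) (at_right 0)"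
  proof (rule tendsto_sandwich[OF _ _ tendsto_mult[OF c(1) IH] tendsto_mult[OF c(2) IH]])
    show "\<forall>\<^sub>F \<epsilon> in at_right 0. cl \<epsilon> * (P \<epsilon> n / \<epsilon> ^ n) \<le> P \<epsilon> (Suc n) / \<epsilon> ^ Suc n"
      using eventually_at_right_less[of "0::real"]
    proof eventually_elim
      case (elim \<epsilon>)
      have "cl \<epsilon> * (P \<epsilon> n / \<epsilon> ^ n) = (\<epsilon> * cl \<epsilon> * P \<epsilon> n) / \<epsilon> ^ Suc n" using elim by (simp add: field_simps)
      also have "\<dots> \<le> P \<epsilon> (Suc n) / \<epsilon> ^ Suc n" using b(1)[OF elim] elim by (intro divide_right_mono) auto
      finally show ?case .
    qed
    show "\<forall>\<^sub>F \<epsilon> in at_right 0. P \<epsilon> (Suc n) / \<epsilon> ^ Suc n \<le> cu \<epsilon> * (P \<epsilon> n / \<epsilon> ^ n)"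
      using eventually_at_right_less[of "0::real"]
    proof eventually_elim
      case (elim \<epsilon>)
      have "P \<epsilon> (Suc n) / \<epsilon> ^ Suc n \<le> (\<epsilon> * cu \<epsilon> * P \<epsilon> n) / \<epsilon> ^ Suc n"
        using b(2)[OF elim] elim by (intro divide_right_mono) auto
      also have "\<dots> = cu \<epsilon> * (P \<epsilon> n / \<epsilon> ^ n)" using elim by (simp add: field_simps)
      finally show ?case .
    qed
  qed
  then show ?case by (simp add: P_def mult.commute)
qed

section \<open>Trajectory densities of the mixture and of the VRJP\<close>

lemma measurable_rate:
  assumes "sets R = sets (rate_space E)" "{i, j} \<in> E"
  shows "(\<lambda>r. r (i, j)) \<in> borel_measurable R"
proof -
  have "(\<lambda>r. r (i, j)) \<in> rate_space E \<rightarrow>\<^sub>M restrict_space borel {0..}"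
    unfolding rate_space_def by (rule measurable_component_singleton) (use assms in simp)
  from measurable_compose[OF this measurable_restrict_space1[OF measurable_ident]]
  show ?thesis using assms(1) by (simp cong: measurable_cong_sets)
qed

lemma rate_nonneg:
  assumes "r \<in> space (rate_space E)" "{i, j} \<in> E"
  shows "0 \<le> r (i, j)"
proof -
  have "r (i, j) \<in> space (restrict_space borel {0::real..})"
    using assms unfolding rate_space_def space_PiM by (auto simp: PiE_iff)
  then show ?thesis by (simp add: space_restrict_space)
qed

text \<open>
  By convention \<open>distr\<close> is the null measure unless the measures of the preimages define a
  measure. If its total mass is not zero, the usual formula therefore holds; for the time
  change, this follows from the representation, because the mixture has mass 1.
\<close>

lemma emeasure_distr_if_full_mass:
  assumes "emeasure (distr M N f) (space N) \<noteq> 0" "A \<in> sets N"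
  shows "emeasure (distr M N f) A = emeasure M (f -` A \<inter> space M)"
proof -
  let ?\<mu> = "\<lambda>A. emeasure M (f -` A \<inter> space M)"
  have "emeasure (distr M N f) B = (if B \<in> sigma_sets (space N) (sets N) \<and>
      measure_space (space N) (sigma_sets (space N) (sets N)) ?\<mu> then ?\<mu> B else 0)" for B
    unfolding distr_def by (simp add: emeasure_measure_of_conv)
  then show ?thesis using assms by (auto simp: sets.sigma_sets_eq split: if_splits)
qed

definition trajectory_weight ::
    "'v set set \<Rightarrow> (nat \<Rightarrow> 'v) \<Rightarrow> (nat \<Rightarrow> real) \<Rightarrow> nat \<Rightarrow> ('v \<times> 'v \<Rightarrow> real) \<Rightarrow> real" where
  "trajectory_weight E \<sigma> x n r =
     (\<Prod>k<n. r (\<sigma> k, \<sigma> (Suc k)) * exp (- ((\<Sum>j\<in>nbrs E (\<sigma> k). r (\<sigma> k, j)) * x k)))"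

lemma measurable_trajectory_weight:
  assumes R: "sets R = sets (rate_space E)" and p: "\<And>k. k < n \<Longrightarrow> \<sigma> (Suc k) \<in> nbrs E (\<sigma> k)"
  shows "trajectory_weight E \<sigma> x n \<in> borel_measurable R"
proof -
  have [measurable]: "(\<lambda>r. r (i, j)) \<in> borel_measurable R" if "j \<in> nbrs E i" for i j
    using measurable_rate[OF R] that by (simp add: nbrs_def)
  have "(\<lambda>r. \<Sum>j\<in>nbrs E i. r (i, j)) \<in> borel_measurable R" for i by measurable
  note [measurable] = this
  show ?thesis unfolding trajectory_weight_def[abs_def]
  proof (rule borel_measurable_prod)
    fix k assume "k \<in> {..<n}"
    then have "\<sigma> (Suc k) \<in> nbrs E (\<sigma> k)" using p by simp
    note [measurable] = \<open>\<And>i j. j \<in> nbrs E i \<Longrightarrow> (\<lambda>r. r (i, j)) \<in> borel_measurable R\<close>[OF this]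
    show "(\<lambda>r. r (\<sigma> k, \<sigma> (Suc k)) * exp (- ((\<Sum>j\<in>nbrs E (\<sigma> k). r (\<sigma> k, j)) * x k))) \<in> borel_measurable R"
      by measurable
  qed
qed

text \<open>
  The representation gives the probability of a path event with windows of width \<open>\<epsilon>\<close>
  in two ways, and both are divided by \<open>\<epsilon> ^ n\<close>. For the VRJP the limit is the
  product of the step densities. For the mixture, one inequality follows directly from the upper
  bound for fixed rates and the other one from the lower bound and Fatou's lemma, as no
  integrability of the rates is known beforehand.
\<close>

theorem trajectory_identity:
  assumes rep: "represents_vrjp V E W (\<sigma> 0) R"
    and p: "\<And>k. k < n \<Longrightarrow> \<sigma> k \<noteq> \<sigma> (Suc k) \<and> \<sigma> (Suc k) \<in> V \<and> \<sigma> (Suc k) \<in> nbrs E (\<sigma> k) \<and>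
      finite (nbrs E (\<sigma> k)) \<and> \<sigma> k \<notin> nbrs E (\<sigma> k)"
    and w: "\<And>i j. 0 \<le> weight E W i j" and x: "\<And>k. 0 \<le> x k"
  shows "(\<integral>\<^sup>+ r. ennreal (trajectory_weight E \<sigma> x n r) \<partial>R) = ennreal (\<Prod>k<n. step_density E W \<sigma> x k)"
proof -
  let ?C = "cadlag_space V"
  obtain Q P where R: "prob_space R" "sets R = sets (rate_space E)"
    and Q: "vrjp_law V E W (\<sigma> 0) Q"
    and P: "P \<in> R \<rightarrow>\<^sub>M prob_algebra ?C" "AE r in R. markov_law V E r (\<sigma> 0) (P r)"
    and eq: "\<And>A. A \<in> sets ?C \<Longrightarrow> emeasure (distr Q ?C (time_changed V)) A = (\<integral>\<^sup>+ r. emeasure (P r) A \<partial>R)"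
    using rep unfolding represents_vrjp_def by blast
  interpret R: prob_space R by (rule R)
  have p1: "\<And>k. k < n \<Longrightarrow> \<sigma> k \<noteq> \<sigma> (Suc k)" and p2: "\<And>k. k < n \<Longrightarrow> \<sigma> (Suc k) \<in> nbrs E (\<sigma> k)"
    and p3: "\<And>k. k < n \<Longrightarrow> \<sigma> k \<noteq> \<sigma> (Suc k) \<and> \<sigma> (Suc k) \<in> V \<and> \<sigma> (Suc k) \<in> nbrs E (\<sigma> k) \<and> finite (nbrs E (\<sigma> k))"
    using p by blast+
  have lQ: "prob_space Q" "sets Q = sets ?C" using Q by (auto simp: vrjp_law_def jump_process_law_def)
  interpret Q: prob_space Q by (rule lQ)
  have spQ: "space Q = space ?C" by (rule sets_eq_imp_space_eq[OF lQ(2)])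
  have spR: "space R = space (rate_space E)" by (rule sets_eq_imp_space_eq[OF R(2)])
  define X where "X \<epsilon> = trajectory_weight E \<sigma> (\<lambda>k. x k + \<epsilon>) n" for \<epsilon>
  have Xm[measurable]: "X \<epsilon> \<in> borel_measurable R" for \<epsilon>
    unfolding X_def by (rule measurable_trajectory_weight[where \<sigma>=\<sigma> and n=n, OF R(2) p2])
  define A where "A \<epsilon> = path_event V \<sigma> (\<lambda>k t. x k) (\<lambda>k t. x k + \<epsilon>) n" for \<epsilon>
  define m where "m \<epsilon> = measure Q (path_event V \<sigma> (clock_window \<sigma> x) (clock_window \<sigma> (\<lambda>k. x k + \<epsilon>)) n)" for \<epsilon>
  define F where "F = (\<Prod>k<n. step_density E W \<sigma> x k)"
  have lim: "((\<lambda>\<epsilon>. m \<epsilon> / \<epsilon> ^ n) \<longlongrightarrow> F) (at_right 0)"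
    unfolding m_def F_def by (rule vrjp_path_density[where \<sigma>=\<sigma> and n=n, OF Q p w x])
  have AP: "AE r in R. prob_space (P r) \<and> space (P r) = space ?C"
  proof (rule AE_I2)
    fix r assume "r \<in> space R"
    then have "P r \<in> space (prob_algebra ?C)" by (rule measurable_space[OF P(1)])
    then show "prob_space (P r) \<and> space (P r) = space ?C"
      by (auto simp: space_prob_algebra dest: sets_eq_imp_space_eq)
  qed
  have mass: "emeasure (distr Q ?C (time_changed V)) (space ?C) = 1"
  proof -
    have "(\<integral>\<^sup>+ r. emeasure (P r) (space ?C) \<partial>R) = (\<integral>\<^sup>+ r. 1 \<partial>R)"
      by (rule nn_integral_cong_AE) (use AP in \<open>eventually_elim, metis prob_space.emeasure_space_1\<close>)
    then show ?thesis using eq[OF sets.top] by (simp add: R.emeasure_space_1)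
  qed
  have mix: "(\<integral>\<^sup>+ r. emeasure (P r) (A \<epsilon>) \<partial>R) = ennreal (m \<epsilon>)" if \<epsilon>: "0 < \<epsilon>" for \<epsilon>
  proof -
    have As: "A \<epsilon> \<in> sets ?C" unfolding A_def
      by (rule sets_path_event[where \<sigma>=\<sigma> and n=n, OF p1 history_window_const history_window_const])
    have "emeasure (distr Q ?C (time_changed V)) (A \<epsilon>) = emeasure Q (time_changed V -` A \<epsilon> \<inter> space Q)"
      by (rule emeasure_distr_if_full_mass) (use mass As in simp_all)
    also have "time_changed V -` A \<epsilon> \<inter> space Q =
        path_event V \<sigma> (clock_window \<sigma> x) (clock_window \<sigma> (\<lambda>k. x k + \<epsilon>)) n"
    proof (rule set_eqI)
      fix y
      have "y \<in> space ?C \<Longrightarrow> time_changed V y \<in> A \<epsilon> \<longleftrightarrow> y \<in> path_event V \<sigma> (clock_window \<sigma> x) (clock_window \<sigma> (\<lambda>k. x k + \<epsilon>)) n"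
        unfolding A_def using x \<epsilon> by (intro time_changed_path_event_iff p1) (auto simp: less_imp_le add_nonneg_nonneg)
      then show "y \<in> time_changed V -` A \<epsilon> \<inter> space Q \<longleftrightarrow>
        y \<in> path_event V \<sigma> (clock_window \<sigma> x) (clock_window \<sigma> (\<lambda>k. x k + \<epsilon>)) n"
        unfolding spQ by (auto simp: path_event_def)
    qed
    also have "emeasure Q \<dots> = ennreal (m \<epsilon>)" unfolding m_def by (rule Q.emeasure_eq_measure)
    finally show ?thesis using eq[OF As] by simp
  qed
  have bnd: "AE r in R. ennreal (\<epsilon> ^ n * X \<epsilon> r) \<le> emeasure (P r) (A \<epsilon>) \<and> emeasure (P r) (A \<epsilon>) \<le> ennreal (\<epsilon> ^ n * X 0 r)"
    if \<epsilon>: "0 < \<epsilon>" for \<epsilon>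
    using P(2) AE_space AP
  proof eventually_elim
    case (elim r)
    interpret Pr: prob_space "P r" using elim by blast
    have rn: "0 \<le> r (i, k)" if "k \<in> nbrs E i" for i k
      using rate_nonneg[of r E i k] elim(2) that unfolding spR by (simp add: nbrs_def)
    from markov_path_prob[where \<sigma>=\<sigma> and n=n and x=x, OF elim(1) p3 rn x less_imp_le[OF \<epsilon>]]
    show ?case unfolding A_def X_def trajectory_weight_def Pr.emeasure_eq_measure
      by (auto intro: ennreal_leI)
  qed
  have scale: "(\<integral>\<^sup>+ r. ennreal (\<epsilon> ^ n * X \<delta> r) \<partial>R) = ennreal (\<epsilon> ^ n) * (\<integral>\<^sup>+ r. ennreal (X \<delta> r) \<partial>R)" if "0 < \<epsilon>" for \<epsilon> \<delta>
    using that by (simp add: ennreal_mult' nn_integral_cmult)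
  have low: "(\<integral>\<^sup>+ r. ennreal (X \<epsilon> r) \<partial>R) \<le> ennreal (m \<epsilon> / \<epsilon> ^ n)"
    and up: "ennreal (m \<epsilon> / \<epsilon> ^ n) \<le> (\<integral>\<^sup>+ r. ennreal (X 0 r) \<partial>R)" if \<epsilon>: "0 < \<epsilon>" for \<epsilon>
  proof -
    have en: "ennreal (\<epsilon> ^ n) \<noteq> 0" "ennreal (\<epsilon> ^ n) \<noteq> \<top>" using \<epsilon> by (auto simp: ennreal_eq_0_iff not_le)
    have d: "ennreal (m \<epsilon> / \<epsilon> ^ n) = ennreal (m \<epsilon>) / ennreal (\<epsilon> ^ n)"
      using \<epsilon> by (intro divide_ennreal[symmetric]) (auto simp: m_def)
    have 1: "ennreal (\<epsilon> ^ n) * (\<integral>\<^sup>+ r. ennreal (X \<epsilon> r) \<partial>R) \<le> ennreal (m \<epsilon>)"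
      unfolding scale[OF \<epsilon>, symmetric] mix[OF \<epsilon>, symmetric]
      by (rule nn_integral_mono_AE) (use bnd[OF \<epsilon>] in \<open>eventually_elim, blast\<close>)
    have 2: "ennreal (m \<epsilon>) \<le> ennreal (\<epsilon> ^ n) * (\<integral>\<^sup>+ r. ennreal (X 0 r) \<partial>R)"
      unfolding scale[OF \<epsilon>, symmetric] mix[OF \<epsilon>, symmetric]
      by (rule nn_integral_mono_AE) (use bnd[OF \<epsilon>] in \<open>eventually_elim, blast\<close>)
    have c: "ennreal (\<epsilon> ^ n) * I / ennreal (\<epsilon> ^ n) = I" for I
      using en by (metis ennreal_mult_divide_eq mult.commute)
    show "(\<integral>\<^sup>+ r. ennreal (X \<epsilon> r) \<partial>R) \<le> ennreal (m \<epsilon> / \<epsilon> ^ n)"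
      using divide_right_mono_ennreal[OF 1, of "ennreal (\<epsilon> ^ n)"] unfolding c d .
    show "ennreal (m \<epsilon> / \<epsilon> ^ n) \<le> (\<integral>\<^sup>+ r. ennreal (X 0 r) \<partial>R)"
      using divide_right_mono_ennreal[OF 2, of "ennreal (\<epsilon> ^ n)"] unfolding c d .
  qed
  define e where "e i = inverse (real (Suc i))" for i
  have e: "0 < e i" for i by (simp add: e_def)
  have e_lim: "filterlim e (at_right 0) sequentially"
    unfolding filterlim_at e_def using LIMSEQ_inverse_real_of_nat by simp
  have me: "(\<lambda>i. ennreal (m (e i) / e i ^ n)) \<longlonglongrightarrow> ennreal F"
    by (intro tendsto_ennrealI filterlim_compose[OF lim e_lim])
  have "ennreal F \<le> (\<integral>\<^sup>+ r. ennreal (X 0 r) \<partial>R)"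
    by (rule LIMSEQ_le_const2[OF me]) (use up[OF e] in blast)
  moreover have "(\<integral>\<^sup>+ r. ennreal (X 0 r) \<partial>R) \<le> ennreal F"
  proof -
    have pt: "(\<lambda>i. ennreal (X (e i) r)) \<longlonglongrightarrow> ennreal (X 0 r)" for r
    proof (rule tendsto_ennrealI)
      have "e \<longlonglongrightarrow> 0" unfolding e_def by (rule LIMSEQ_inverse_real_of_nat)
      then show "(\<lambda>i. X (e i) r) \<longlonglongrightarrow> X 0 r"
        unfolding X_def trajectory_weight_def by (intro tendsto_intros)
    qed
    have "(\<integral>\<^sup>+ r. ennreal (X 0 r) \<partial>R) = (\<integral>\<^sup>+ r. liminf (\<lambda>i. ennreal (X (e i) r)) \<partial>R)"
      by (intro nn_integral_cong) (simp add: lim_imp_Liminf[OF _ pt])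
    also have "\<dots> \<le> liminf (\<lambda>i. \<integral>\<^sup>+ r. ennreal (X (e i) r) \<partial>R)"
      by (rule nn_integral_liminf) measurable
    also have "\<dots> \<le> liminf (\<lambda>i. ennreal (m (e i) / e i ^ n))"
      by (intro Liminf_mono always_eventually allI low e)
    also have "\<dots> = ennreal F" by (rule lim_imp_Liminf[OF _ me]) simp
    finally show ?thesis .
  qed
  ultimately show ?thesis unfolding F_def X_def by simp
qed

section \<open>Schur complements of symmetric matrices\<close>

definition is_inverse_on :: "'v set \<Rightarrow> ('v \<Rightarrow> 'v \<Rightarrow> real) \<Rightarrow> ('v \<Rightarrow> 'v \<Rightarrow> real) \<Rightarrow> bool" where
  "is_inverse_on U A B \<longleftrightarrow>
     (\<forall>i\<in>U. \<forall>j\<in>U. (\<Sum>k\<in>U. A i k * B k j) = of_bool (i = j) \<and> (\<Sum>k\<in>U. B i k * A k j) = of_bool (i = j)) \<and>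
     (\<forall>i j. i \<notin> U \<or> j \<notin> U \<longrightarrow> B i j = 0)"

lemma is_inverse_onD:
  assumes "is_inverse_on U A B"
  shows "\<And>i j. i \<in> U \<Longrightarrow> j \<in> U \<Longrightarrow> (\<Sum>k\<in>U. A i k * B k j) = of_bool (i = j)"
    "\<And>i j. i \<in> U \<Longrightarrow> j \<in> U \<Longrightarrow> (\<Sum>k\<in>U. B i k * A k j) = of_bool (i = j)"
    "\<And>i j. i \<notin> U \<Longrightarrow> B i j = 0" "\<And>i j. j \<notin> U \<Longrightarrow> B i j = 0"
  using assms unfolding is_inverse_on_def by auto

lemma sum_of_bool_mult:
  fixes f :: "'a \<Rightarrow> real"
  assumes "finite U" "i \<in> U"
  shows "(\<Sum>k\<in>U. of_bool (i = k) * f k) = f i" "(\<Sum>k\<in>U. of_bool (k = i) * f k) = f i"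
    "(\<Sum>k\<in>U. f k * of_bool (i = k)) = f i" "(\<Sum>k\<in>U. f k * of_bool (k = i)) = f i"
proof -
  have "of_bool (i = k) * f k = (if k = i then f k else 0)" "of_bool (k = i) * f k = (if k = i then f k else 0)"
    "f k * of_bool (i = k) = (if k = i then f k else 0)" "f k * of_bool (k = i) = (if k = i then f k else 0)" for k by auto
  then show "(\<Sum>k\<in>U. of_bool (i = k) * f k) = f i" "(\<Sum>k\<in>U. of_bool (k = i) * f k) = f i"
    "(\<Sum>k\<in>U. f k * of_bool (i = k)) = f i" "(\<Sum>k\<in>U. f k * of_bool (k = i)) = f i"
    using assms by (simp_all add: sum.delta)
qed

lemma inverse_on_eqI:
  assumes U: "finite U" and B: "is_inverse_on U A B"
  shows "inverse_on U A = B"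
proof -
  have uniq: "C = B" if C: "is_inverse_on U A C" for C
  proof (intro ext)
    fix i j
    show "C i j = B i j"
    proof (cases "i \<in> U \<and> j \<in> U")
      case True
      then have ij: "i \<in> U" "j \<in> U" by auto
      have "C i j = (\<Sum>k\<in>U. C i k * of_bool (k = j))" using sum_of_bool_mult(4)[OF U ij(2)] by simp
      also have "\<dots> = (\<Sum>k\<in>U. C i k * (\<Sum>l\<in>U. A k l * B l j))"
        using is_inverse_onD(1)[OF B _ ij(2)] by (intro sum.cong refl) simp
      also have "\<dots> = (\<Sum>l\<in>U. (\<Sum>k\<in>U. C i k * A k l) * B l j)"
        by (simp add: sum_distrib_left sum_distrib_right mult.assoc) (rule sum.swap)
      also have "\<dots> = (\<Sum>l\<in>U. of_bool (i = l) * B l j)"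
        using is_inverse_onD(2)[OF C ij(1)] by (intro sum.cong refl) simp
      also have "\<dots> = B i j" using sum_of_bool_mult(1)[OF U ij(1)] by simp
      finally show ?thesis .
    next
      case False
      then show ?thesis using B C unfolding is_inverse_on_def by auto
    qed
  qed
  show ?thesis unfolding inverse_on_def is_inverse_on_def[symmetric]
    by (rule the_equality) (fact B, rule uniq)
qed

lemma pos_def_on_cong:
  "(\<And>k l. k \<in> U \<Longrightarrow> l \<in> U \<Longrightarrow> A k l = A' k l) \<Longrightarrow> pos_def_on U A \<longleftrightarrow> pos_def_on U A'"
  unfolding pos_def_on_def by simp

lemma is_inverse_on_cong:
  "(\<And>k l. k \<in> U \<Longrightarrow> l \<in> U \<Longrightarrow> A k l = A' k l) \<Longrightarrow> is_inverse_on U A B \<longleftrightarrow> is_inverse_on U A' B"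
  unfolding is_inverse_on_def by simp

text \<open>
  If \<open>B\<close> inverts \<open>A\<close> on \<open>U\<close>, then \<open>schur_vector\<close> solves \<open>A v = (column i of A)\<close>
  on \<open>U\<close>, \<open>schur_complement\<close> is the Schur complement of the block \<open>U\<close> in \<open>insert i U\<close>,
  and \<open>bordered_inverse\<close> is the block formula for the inverse on \<open>insert i U\<close>.
\<close>

definition schur_vector where
  "schur_vector U A B i k = (\<Sum>l\<in>U. B k l * A l i)"

definition schur_complement where
  "schur_complement U A B i = A i i - (\<Sum>k\<in>U. A i k * schur_vector U A B i k)"

definition bordered_inverse where
  "bordered_inverse U A B i k l =
     (let s = schur_complement U A B i; v = schur_vector U A B i in
      if k = i then if l = i then 1 / s else if l \<in> U then - v l / s else 0
      else if l = i then if k \<in> U then - v k / s else 0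
      else if k \<in> U \<and> l \<in> U then B k l + v k * v l / s else 0)"

context
  fixes U :: "'v set" and A B :: "'v \<Rightarrow> 'v \<Rightarrow> real" and i :: 'v
  assumes fin: "finite U" and iU: "i \<notin> U" and symA: "\<And>k l. A k l = A l k" and symB: "\<And>k l. B k l = B l k"
    and inv: "is_inverse_on U A B"
begin

abbreviation "border \<equiv> schur_vector U A B i"
abbreviation "pivot \<equiv> schur_complement U A B i"

lemma mult_schur_vector: "k \<in> U \<Longrightarrow> (\<Sum>l\<in>U. A k l * border l) = A k i"
proof -
  assume k: "k \<in> U"
  have "(\<Sum>l\<in>U. A k l * border l) = (\<Sum>m\<in>U. (\<Sum>l\<in>U. A k l * B l m) * A m i)"
    unfolding schur_vector_def by (simp add: sum_distrib_left sum_distrib_right mult.assoc) (rule sum.swap)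
  also have "\<dots> = (\<Sum>m\<in>U. of_bool (k = m) * A m i)"
    using is_inverse_onD(1)[OF inv k] by (intro sum.cong refl) simp
  also have "\<dots> = A k i" by (rule sum_of_bool_mult(1)[OF fin k])
  finally show ?thesis .
qed

lemma quadratic_form_insert:
  "(\<Sum>k\<in>insert i U. \<Sum>l\<in>insert i U. f k * A k l * f l) =
    (\<Sum>k\<in>U. \<Sum>l\<in>U. f k * A k l * f l) + 2 * f i * (\<Sum>k\<in>U. f k * A k i) + (f i)\<^sup>2 * A i i"
proof -
  have "(\<Sum>k\<in>insert i U. \<Sum>l\<in>insert i U. f k * A k l * f l) =
      f i * A i i * f i + (\<Sum>l\<in>U. f i * A i l * f l) + (\<Sum>k\<in>U. f k * A k i * f i + (\<Sum>l\<in>U. f k * A k l * f l))"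
    using fin iU by simp
  also have "(\<Sum>l\<in>U. f i * A i l * f l) = f i * (\<Sum>k\<in>U. f k * A k i)"
    unfolding sum_distrib_left by (intro sum.cong refl) (simp add: symA[of i] mult_ac)
  also have "(\<Sum>k\<in>U. f k * A k i * f i + (\<Sum>l\<in>U. f k * A k l * f l)) =
      f i * (\<Sum>k\<in>U. f k * A k i) + (\<Sum>k\<in>U. \<Sum>l\<in>U. f k * A k l * f l)"
    unfolding sum.distrib sum_distrib_left by (simp add: mult_ac)
  finally show ?thesis by (simp add: power2_eq_square algebra_simps)
qed

lemma quadratic_form_shift:
  "(\<Sum>k\<in>U. \<Sum>l\<in>U. (f k + c * border k) * A k l * (f l + c * border l)) =
    (\<Sum>k\<in>U. \<Sum>l\<in>U. f k * A k l * f l) + 2 * c * (\<Sum>k\<in>U. f k * A k i) + c\<^sup>2 * (\<Sum>k\<in>U. A i k * border k)"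
proof -
  have e: "(f k + c * border k) * A k l * (f l + c * border l) =
     f k * A k l * f l + c * (f k * (A k l * border l)) + c * (f l * (A l k * border k)) + c\<^sup>2 * (border k * (A k l * border l))" for k l
    by (simp add: power2_eq_square algebra_simps symA[of l k])
  have 1: "(\<Sum>k\<in>U. \<Sum>l\<in>U. c * (f k * (A k l * border l))) = c * (\<Sum>k\<in>U. f k * A k i)"
    by (simp add: sum_distrib_left[symmetric] mult_schur_vector)
  have 2: "(\<Sum>k\<in>U. \<Sum>l\<in>U. c * (f l * (A l k * border k))) = c * (\<Sum>k\<in>U. f k * A k i)"
    by (subst sum.swap) (rule 1)
  have 3: "(\<Sum>k\<in>U. \<Sum>l\<in>U. c\<^sup>2 * (border k * (A k l * border l))) = c\<^sup>2 * (\<Sum>k\<in>U. A i k * border k)"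
    by (simp add: sum_distrib_left[symmetric] mult_schur_vector symA[of _ i] mult.commute)
  show ?thesis unfolding e sum.distrib 1 2 3 by simp
qed

text \<open>
  Completing the square in the coordinates of \<open>U\<close>, with the coordinate \<open>i\<close> held fixed.
\<close>

lemma quadratic_form_complete_square:
  "(\<Sum>k\<in>insert i U. \<Sum>l\<in>insert i U. f k * A k l * f l) =
    (\<Sum>k\<in>U. \<Sum>l\<in>U. (f k + f i * border k) * A k l * (f l + f i * border l)) + (f i)\<^sup>2 * pivot"
  unfolding quadratic_form_insert quadratic_form_shift schur_complement_def by (simp add: algebra_simps)

lemma pos_def_on_insert: "pos_def_on (insert i U) A \<longleftrightarrow> pos_def_on U A \<and> 0 < pivot"
proof
  assume L: "pos_def_on (insert i U) A"
  have "pos_def_on U A" unfolding pos_def_on_def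
  proof (intro allI impI)
    fix f :: "'v \<Rightarrow> real" assume f: "\<exists>k\<in>U. f k \<noteq> 0"
    define g where "g = f(i := 0)"
    have "\<exists>k\<in>insert i U. g k \<noteq> 0" using f iU by (auto simp: g_def)
    then have "0 < (\<Sum>k\<in>insert i U. \<Sum>l\<in>insert i U. g k * A k l * g l)" using L unfolding pos_def_on_def by blast
    also have "\<dots> = (\<Sum>k\<in>U. \<Sum>l\<in>U. g k * A k l * g l)" unfolding quadratic_form_insert by (simp add: g_def)
    also have "\<dots> = (\<Sum>k\<in>U. \<Sum>l\<in>U. f k * A k l * f l)"
      using iU by (intro sum.cong refl) (auto simp: g_def)
    finally show "0 < \<dots>" .
  qed
  moreover have "0 < pivot"
  proof -
    define g where "g k = (if k = i then 1 else - border k)" for k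
    have "\<exists>k\<in>insert i U. g k \<noteq> 0" by (auto simp: g_def)
    then have "0 < (\<Sum>k\<in>insert i U. \<Sum>l\<in>insert i U. g k * A k l * g l)" using L unfolding pos_def_on_def by blast
    also have "\<dots> = (\<Sum>k\<in>U. \<Sum>l\<in>U. (g k + g i * border k) * A k l * (g l + g i * border l)) + pivot"
      unfolding quadratic_form_complete_square by (simp add: g_def)
    also have "(\<Sum>k\<in>U. \<Sum>l\<in>U. (g k + g i * border k) * A k l * (g l + g i * border l)) = 0"
      using iU by (intro sum.neutral ballI) (auto simp: g_def)
    finally show ?thesis by simp
  qed
  ultimately show "pos_def_on U A \<and> 0 < pivot" ..
next
  assume R: "pos_def_on U A \<and> 0 < pivot"
  have nonneg: "0 \<le> (\<Sum>k\<in>U. \<Sum>l\<in>U. f k * A k l * f l)" for f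
  proof (cases "\<exists>k\<in>U. f k \<noteq> 0")
    case True then show ?thesis using R unfolding pos_def_on_def by (blast intro: less_imp_le)
  next
    case False then show ?thesis by (intro sum_nonneg) auto
  qed
  show "pos_def_on (insert i U) A" unfolding pos_def_on_def
  proof (intro allI impI)
    fix f :: "'v \<Rightarrow> real" assume f: "\<exists>k\<in>insert i U. f k \<noteq> 0"
    show "0 < (\<Sum>k\<in>insert i U. \<Sum>l\<in>insert i U. f k * A k l * f l)"
    proof (cases "f i = 0")
      case True
      then have "\<exists>k\<in>U. f k \<noteq> 0" using f by auto
      then have "0 < (\<Sum>k\<in>U. \<Sum>l\<in>U. f k * A k l * f l)" using R unfolding pos_def_on_def by blast
      then show ?thesis unfolding quadratic_form_insert using True by simp
    next
      case False
      then have "0 < (f i)\<^sup>2 * pivot" using R by simp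
      then show ?thesis unfolding quadratic_form_complete_square
        using nonneg[of "\<lambda>k. f k + f i * border k"] by linarith
    qed
  qed
qed

lemma bordered_inverse_sym: "bordered_inverse U A B i k l = bordered_inverse U A B i l k"
  unfolding bordered_inverse_def by (auto simp: Let_def symB mult.commute)

lemma is_inverse_on_insert:
  assumes pivot: "pivot \<noteq> 0"
  shows "is_inverse_on (insert i U) A (bordered_inverse U A B i)"
proof -
  let ?C = "bordered_inverse U A B i"
  have C: "?C i i = 1 / pivot" "\<And>l. l \<in> U \<Longrightarrow> ?C i l = - border l / pivot" "\<And>l. l \<in> U \<Longrightarrow> ?C l i = - border l / pivot"
    "\<And>k l. k \<in> U \<Longrightarrow> l \<in> U \<Longrightarrow> ?C k l = B k l + border k * border l / pivot"
    using iU unfolding bordered_inverse_def by (auto simp: Let_def)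
  have Bv: "(\<Sum>l\<in>U. A i l * B l k) = border k" if "k \<in> U" for k
    unfolding schur_vector_def by (intro sum.cong refl) (simp add: symA[of i] symB[of _ k])
  have e: "(\<Sum>l\<in>insert i U. A k l * ?C l m) = A k i * ?C i m + (\<Sum>l\<in>U. A k l * ?C l m)" for k m
    using fin iU by simp
  have one: "(\<Sum>l\<in>insert i U. A k l * ?C l m) = of_bool (k = m)" if km: "k \<in> insert i U" "m \<in> insert i U" for k m
  proof -
    show ?thesis
    proof (cases "m = i")
      case True
      have e2: "(\<Sum>l\<in>U. A k l * ?C l i) = - (\<Sum>l\<in>U. A k l * border l) / pivot" for k
        by (simp add: C sum_negf sum_divide_distrib)
      show ?thesis
      proof (cases "k = i")
        case k: True
        have S: "(\<Sum>l\<in>U. A i l * border l) = A i i - pivot" by (simp add: schur_complement_def)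
        have "a * (1 / p) + - (a - p) / p = 1" if "p \<noteq> 0" for a p :: real using that by (simp add: field_simps)
        from this[OF pivot] show ?thesis unfolding e True k e2 C S by simp
      next
        case False
        then have "k \<in> U" using km by simp
        then show ?thesis unfolding e True e2 C mult_schur_vector[OF \<open>k \<in> U\<close>] using False by simp
      qed
    next
      case False
      then have m: "m \<in> U" using km by simp
      have e2: "(\<Sum>l\<in>U. A k l * ?C l m) = (\<Sum>l\<in>U. A k l * B l m) + (\<Sum>l\<in>U. A k l * border l) * border m / pivot" for k
      proof -
        have "(\<Sum>l\<in>U. A k l * ?C l m) = (\<Sum>l\<in>U. A k l * B l m + A k l * border l * border m / pivot)"
          using m by (intro sum.cong refl) (simp add: C algebra_simps)
        then show ?thesis by (simp add: sum.distrib sum_divide_distrib sum_distrib_right)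
      qed
      show ?thesis
      proof (cases "k = i")
        case k: True
        have S: "(\<Sum>l\<in>U. A i l * border l) = A i i - pivot" by (simp add: schur_complement_def)
        show ?thesis unfolding e k e2 C(2)[OF m] Bv[OF m] S using False pivot by (simp add: field_simps)
      next
        case k: False
        then have "k \<in> U" using km by simp
        then show ?thesis unfolding e e2 C(2)[OF m] mult_schur_vector[OF \<open>k \<in> U\<close>] is_inverse_onD(1)[OF inv \<open>k \<in> U\<close> m]
          by simp
      qed
    qed
  qed
  have two: "(\<Sum>l\<in>insert i U. ?C k l * A l m) = of_bool (k = m)" if km: "k \<in> insert i U" "m \<in> insert i U" for k m
  proof -
    have "(\<Sum>l\<in>insert i U. ?C k l * A l m) = (\<Sum>l\<in>insert i U. A m l * ?C l k)"
      by (intro sum.cong refl) (simp add: symA[of m] bordered_inverse_sym[of k] mult.commute)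
    also have "\<dots> = of_bool (m = k)" by (rule one[OF km(2,1)])
    finally show ?thesis by (simp add: eq_commute)
  qed
  show ?thesis unfolding is_inverse_on_def
    using one two by (auto simp: bordered_inverse_def Let_def)
qed

text \<open>
  This is how the quadratic form of the inverse depends on the pivot, which for the random
  potential is the only quantity that involves the last coordinate.
\<close>

lemma bordered_quadratic_form:
  "(\<Sum>k\<in>insert i U. \<Sum>l\<in>insert i U. f k * bordered_inverse U A B i k l * f l) =
    (\<Sum>k\<in>U. \<Sum>l\<in>U. f k * B k l * f l) + (f i - (\<Sum>k\<in>U. f k * border k))\<^sup>2 / pivot"
proof -
  let ?C = "bordered_inverse U A B i"
  let ?S = "\<Sum>k\<in>U. f k * border k"
  have C: "?C i i = 1 / pivot" "\<And>l. l \<in> U \<Longrightarrow> ?C i l = - border l / pivot" "\<And>l. l \<in> U \<Longrightarrow> ?C l i = - border l / pivot"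
    "\<And>k l. k \<in> U \<Longrightarrow> l \<in> U \<Longrightarrow> ?C k l = B k l + border k * border l / pivot"
    using iU unfolding bordered_inverse_def by (auto simp: Let_def)
  have "(\<Sum>k\<in>insert i U. \<Sum>l\<in>insert i U. f k * ?C k l * f l) =
      f i * ?C i i * f i + (\<Sum>l\<in>U. f i * ?C i l * f l) + (\<Sum>k\<in>U. f k * ?C k i * f i) + (\<Sum>k\<in>U. \<Sum>l\<in>U. f k * ?C k l * f l)"
    using fin iU by (simp add: sum.distrib)
  also have "(\<Sum>l\<in>U. f i * ?C i l * f l) = - f i * ?S / pivot"
    by (simp add: C sum_distrib_left sum_divide_distrib sum_negf mult_ac)
  also have "(\<Sum>k\<in>U. f k * ?C k i * f i) = - f i * ?S / pivot"
    by (simp add: C sum_distrib_left sum_divide_distrib sum_negf mult_ac)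
  also have "(\<Sum>k\<in>U. \<Sum>l\<in>U. f k * ?C k l * f l) = (\<Sum>k\<in>U. \<Sum>l\<in>U. f k * B k l * f l) + ?S * ?S / pivot"
  proof -
    have "(\<Sum>k\<in>U. \<Sum>l\<in>U. f k * ?C k l * f l) = (\<Sum>k\<in>U. \<Sum>l\<in>U. f k * B k l * f l + (f k * border k) * (f l * border l) / pivot)"
      by (intro sum.cong refl) (simp add: C algebra_simps)
    also have "\<dots> = (\<Sum>k\<in>U. \<Sum>l\<in>U. f k * B k l * f l) + (\<Sum>k\<in>U. \<Sum>l\<in>U. (f k * border k) * (f l * border l)) / pivot"
      by (simp add: sum.distrib sum_divide_distrib)
    finally show ?thesis by (simp add: sum_product)
  qed
  finally show ?thesis by (simp add: C power2_eq_square diff_divide_distrib add_divide_distrib algebra_simps)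
qed

end

section \<open>Determinants\<close>

lemma det_on_empty: "det_on {} A = 1"
  by (simp add: det_on_def)

lemma det_on_split_row:
  assumes U: "finite U" and i: "i \<in> U"
  shows "det_on U (A(i := \<lambda>l. f l + c * g l)) = det_on U (A(i := f)) + c * det_on U (A(i := g))"
proof -
  have e: "(\<Prod>k\<in>U. (A(i := h)) k (p k)) = h (p i) * (\<Prod>k\<in>U - {i}. A k (p k))" for h :: "'a \<Rightarrow> real" and p
  proof -
    have "(\<Prod>k\<in>U - {i}. (A(i := h)) k (p k)) = (\<Prod>k\<in>U - {i}. A k (p k))" by (rule prod.cong) auto
    then show ?thesis using prod.remove[OF U i, of "\<lambda>k. (A(i := h)) k (p k)"] by simp
  qed
  show ?thesis unfolding det_on_def e
    by (simp add: sum_distrib_left sum.distrib[symmetric] algebra_simps)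
qed

lemma det_on_equal_rows:
  assumes U: "finite U" and ij: "i \<in> U" "j \<in> U" "i \<noteq> j" and eq: "A i = A j"
  shows "det_on U A = 0"
proof -
  let ?t = "Transposition.transpose i j"
  let ?P = "{p. p permutes U}"
  have t: "?t permutes U" using ij by (intro permutes_swap_id)
  define F where "F p = (of_int (sign p) * (\<Prod>k\<in>U. A k (p k)) :: real)" for p
  have bij: "bij_betw (\<lambda>p. p \<circ> ?t) ?P ?P"
    by (rule bij_betw_byWitness[where f'="\<lambda>p. p \<circ> ?t"]) (auto simp: o_assoc[symmetric] permutes_compose[OF t])
  have F: "F (p \<circ> ?t) = - F p" if p: "p \<in> ?P" for p
  proof -
    have pp: "permutation p" using p U permutation_permutes by blast
    have "sign (p \<circ> ?t) = - sign p"
      using ij(3) by (simp add: sign_compose[OF pp permutation_swap_id] sign_swap_id)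
    moreover have "(\<Prod>k\<in>U. A k ((p \<circ> ?t) k)) = (\<Prod>k\<in>U. A (?t k) (p k))"
      using prod.permute[OF t, of "\<lambda>k. A k ((p \<circ> ?t) k)"] by (simp add: o_def)
    moreover have "A (?t k) = A k" for k using eq by (auto simp: Transposition.transpose_def)
    ultimately show ?thesis by (simp add: F_def)
  qed
  have "sum F ?P = (\<Sum>p\<in>?P. F (p \<circ> ?t))" by (rule sum.reindex_bij_betw[OF bij, symmetric])
  also have "\<dots> = - sum F ?P" using F by (simp add: sum_negf)
  finally show ?thesis unfolding det_on_def F_def[abs_def] by simp
qed

lemma det_on_unit_row:
  assumes U: "finite U" and i: "i \<notin> U" and row: "\<And>l. A i l = s * of_bool (l = i)"
  shows "det_on (insert i U) A = s * det_on U A"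
proof -
  let ?f = "\<lambda>p. of_int (sign p) * (\<Prod>k\<in>insert i U. A k (p k))"
  have fin: "finite {p. p permutes insert i U}" using U by (simp add: finite_permutations)
  have sub: "{p. p permutes U} \<subseteq> {p. p permutes insert i U}" by (auto intro: permutes_subset)
  have "det_on (insert i U) A = sum ?f {p. p permutes U}"
    unfolding det_on_def
  proof (rule sum.mono_neutral_right[OF fin sub], rule ballI)
    fix p assume p: "p \<in> {p. p permutes insert i U} - {p. p permutes U}"
    have "p i \<noteq> i"
    proof
      assume "p i = i"
      then have "p permutes U" using p unfolding permutes_def by auto
      then show False using p by simp
    qed
    then show "?f p = 0" using U i by (simp add: row)
  qed
  also have "\<dots> = s * det_on U A"
    unfolding det_on_def sum_distrib_left
  proof (intro sum.cong refl)
    fix p assume "p \<in> {p. p permutes U}"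
    then have "p i = i" using i by (simp add: permutes_not_in)
    then show "?f p = s * (of_int (sign p) * (\<Prod>k\<in>U. A k (p k)))" using U i by (simp add: row)
  qed
  finally show ?thesis .
qed

lemma det_on_cong:
  assumes "\<And>k l. k \<in> U \<Longrightarrow> l \<in> U \<Longrightarrow> A k l = A' k l" shows "det_on U A = det_on U A'"
  unfolding det_on_def
  by (intro sum.cong arg_cong2[where f="(*)"] prod.cong refl) (auto simp: assms permutes_in_image)

lemma det_on_subtract_rows:
  assumes U: "finite U" "S \<subseteq> U" and i: "i \<notin> U"
  shows "det_on (insert i U) (A(i := \<lambda>l. A i l - (\<Sum>k\<in>S. c k * A k l))) = det_on (insert i U) A"
proof -
  have "finite S" using U finite_subset by blast
  then show ?thesis using U(2)
  proof (induction S)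
    case (insert k S)
    have "det_on (insert i U) (A(i := \<lambda>l. A i l - (\<Sum>k\<in>insert k S. c k * A k l))) =
       det_on (insert i U) (A(i := \<lambda>l. (A i l - (\<Sum>k\<in>S. c k * A k l)) + (- c k) * A k l))"
      using insert by (simp add: algebra_simps)
    also have "\<dots> = det_on (insert i U) (A(i := \<lambda>l. A i l - (\<Sum>k\<in>S. c k * A k l))) + (- c k) * det_on (insert i U) (A(i := A k))"
      using det_on_split_row[of "insert i U" i A _ "- c k" "A k"] U by simp
    also have "det_on (insert i U) (A(i := A k)) = 0"
      using U insert.prems i by (intro det_on_equal_rows[of _ i k]) auto
    finally show ?case using insert by simp
  qed simp
qed

text \<open>
  Subtracting the combination of the other rows with coefficients \<open>schur_vector\<close> turns row
  \<open>i\<close> into a multiple of a unit row, the factor being the Schur complement.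
\<close>

lemma det_on_insert:
  assumes fin: "finite U" and iU: "i \<notin> U" and symA: "\<And>k l. A k l = A l k" and symB: "\<And>k l. B k l = B l k"
    and inv: "is_inverse_on U A B"
  shows "det_on (insert i U) A = schur_complement U A B i * det_on U A"
proof -
  let ?v = "schur_vector U A B i"
  define A' where "A' = A(i := \<lambda>l. A i l - (\<Sum>k\<in>U. ?v k * A k l))"
  define A'' where "A'' = A(i := \<lambda>l. schur_complement U A B i * of_bool (l = i))"
  have "det_on (insert i U) A = det_on (insert i U) A'"
    unfolding A'_def by (rule det_on_subtract_rows[OF fin order_refl iU, symmetric])
  also have "\<dots> = det_on (insert i U) A''"
  proof (rule det_on_cong)
    fix k l assume kl: "k \<in> insert i U" "l \<in> insert i U"
    have s: "(\<Sum>k\<in>U. ?v k * A k l) = (\<Sum>k\<in>U. A l k * ?v k)"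
      by (intro sum.cong refl) (simp add: symA[of l] mult.commute)
    show "A' k l = A'' k l"
    proof (cases "k = i")
      case True
      show ?thesis
      proof (cases "l = i")
        case l: True
        have "(\<Sum>k\<in>U. ?v k * A k i) = (\<Sum>k\<in>U. A i k * ?v k)" using s l by simp
        then show ?thesis by (simp add: A'_def A''_def True l schur_complement_def)
      next
        case False
        then have l: "l \<in> U" using kl by simp
        have "(\<Sum>k\<in>U. ?v k * A k l) = A l i"
          unfolding s by (rule mult_schur_vector[OF fin iU symA symB inv l])
        then show ?thesis using False by (simp add: A'_def A''_def True symA[of i l])
      qed
    next
      case False
      then show ?thesis by (simp add: A'_def A''_def)
    qed
  qed
  also have "\<dots> = schur_complement U A B i * det_on U A''"
    by (rule det_on_unit_row[OF fin iU]) (simp add: A''_def)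
  also have "det_on U A'' = det_on U A" using iU by (intro det_on_cong) (auto simp: A''_def)
  finally show ?thesis .
qed

section \<open>Positive definite matrices with nonpositive off-diagonal entries\<close>

lemma pos_def_on_remove:
  assumes "finite U" "i \<notin> U" "pos_def_on (insert i U) A"
  shows "pos_def_on U A"
  unfolding pos_def_on_def
proof (intro allI impI)
  fix f :: "'a \<Rightarrow> real" assume f: "\<exists>k\<in>U. f k \<noteq> 0"
  define g where "g = f(i := 0)"
  have "\<exists>k\<in>insert i U. g k \<noteq> 0" using f assms(2) by (auto simp: g_def)
  then have "0 < (\<Sum>k\<in>insert i U. \<Sum>l\<in>insert i U. g k * A k l * g l)" using assms(3) unfolding pos_def_on_def by blast
  also have "\<dots> = (\<Sum>k\<in>U. \<Sum>l\<in>U. g k * A k l * g l)" using assms(1,2) by (simp add: g_def)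
  also have "\<dots> = (\<Sum>k\<in>U. \<Sum>l\<in>U. f k * A k l * f l)" using assms(2) by (intro sum.cong refl) (auto simp: g_def)
  finally show "0 < \<dots>" .
qed

text \<open>
  Adding one vertex at a time. Nonpositive off-diagonal entries make the Schur vector
  nonpositive, the Schur complement is positive, and so all terms in the block formula for the
  inverse are nonnegative.
\<close>

lemma pos_def_inverse_exists:
  assumes "finite U" "\<And>k l. A k l = A l k" "pos_def_on U A" "\<And>k l. k \<noteq> l \<Longrightarrow> A k l \<le> 0"
  shows "\<exists>B. is_inverse_on U A B \<and> (\<forall>k l. B k l = B l k) \<and> (\<forall>k l. 0 \<le> B k l) \<and> 0 < det_on U A"
  using assms(1,3)
proof (induction U)
  case empty
  then show ?case by (intro exI[of _ "\<lambda>_ _. 0"]) (auto simp: is_inverse_on_def det_on_empty)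
next
  case (insert i U)
  note symA = assms(2)
  have pdU: "pos_def_on U A" by (rule pos_def_on_remove[OF insert(1,2) insert.prems])
  then obtain B where B: "is_inverse_on U A B" "\<And>k l. B k l = B l k" "\<And>k l. 0 \<le> B k l" "0 < det_on U A"
    using insert.IH by blast
  have s: "0 < schur_complement U A B i"
    using pos_def_on_insert[OF insert(1,2) symA B(2) B(1)] insert.prems by blast
  have v: "schur_vector U A B i k \<le> 0" for k
    unfolding schur_vector_def using insert(2) by (intro sum_nonpos mult_nonneg_nonpos B assms(4)) auto
  have "0 \<le> bordered_inverse U A B i k l" for k l
    unfolding bordered_inverse_def Let_def using s v B(3)
    by (auto intro!: add_nonneg_nonneg divide_nonneg_pos divide_nonpos_pos mult_nonpos_nonpos)
  moreover have "0 < det_on (insert i U) A"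
    unfolding det_on_insert[OF insert(1,2) symA B(2) B(1)] using s B(4) by simp
  ultimately show ?case
    using is_inverse_on_insert[OF insert(1,2) symA B(2) B(1)] s bordered_inverse_sym[OF insert(1,2) symA B(2) B(1)]
    by (intro exI[of _ "bordered_inverse U A B i"]) auto
qed

section \<open>The inverse Gaussian integral\<close>

definition gauss_primitive :: "real \<Rightarrow> real" where
  "gauss_primitive x = (LBINT t=ereal 0..ereal x. exp (- t\<^sup>2))"

lemma gauss_primitive_deriv: "(gauss_primitive has_real_derivative exp (- x\<^sup>2)) (at x)"
proof -
  let ?a = "- \<bar>x\<bar> - 1" and ?b = "\<bar>x\<bar> + 1"
  have "((\<lambda>u. LBINT t=ereal 0..ereal u. exp (- t\<^sup>2)) has_vector_derivative exp (- x\<^sup>2)) (at x within {?a..?b})"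
    by (rule interval_integral_FTC2) (auto intro!: continuous_intros)
  moreover have "at x within {?a..?b} = at x"
    by (rule at_within_interior) auto
  ultimately show ?thesis
    by (simp add: gauss_primitive_def[abs_def] has_real_derivative_iff_has_vector_derivative)
qed

lemma gauss_primitive_0: "gauss_primitive 0 = 0"
  by (simp add: gauss_primitive_def)

lemma gauss_primitive_minus: "gauss_primitive (- x) = - gauss_primitive x"
proof -
  have "((\<lambda>x. gauss_primitive x + gauss_primitive (- x)) has_real_derivative 0) (at x)" for x
  proof -
    have "((\<lambda>x. gauss_primitive (- x)) has_real_derivative exp (- (- x)\<^sup>2) * (- 1)) (at x)"
      by (rule DERIV_chain2[OF gauss_primitive_deriv]) (auto intro!: derivative_eq_intros)
    from DERIV_add[OF gauss_primitive_deriv[of x] this] show ?thesis by simp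
  qed
  then have "gauss_primitive x + gauss_primitive (- x) = gauss_primitive 0 + gauss_primitive (- 0)"
    by (intro DERIV_isconst_all) auto
  then show ?thesis by (simp add: gauss_primitive_0)
qed

lemma gauss_primitive_at_top: "(gauss_primitive \<longlongrightarrow> sqrt pi / 2) at_top"
proof -
  let ?f = "\<lambda>t::real. indicator {0..} t *\<^sub>R exp (- t\<^sup>2)"
  have "((\<lambda>y. LINT t|lborel. indicator {..y} t *\<^sub>R ?f t) \<longlongrightarrow> (LINT t|lborel. ?f t)) at_top"
    using gaussian_moment_0 by (intro tendsto_integral_at_top) (auto simp: has_bochner_integral_iff)
  also have "(LINT t|lborel. ?f t) = sqrt pi / 2"
    using gaussian_moment_0 by (rule has_bochner_integral_integral_eq)
  finally have lim: "((\<lambda>y. LINT t|lborel. indicator {..y} t *\<^sub>R ?f t) \<longlongrightarrow> sqrt pi / 2) at_top" .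
  have ev: "\<forall>\<^sub>F y in at_top. (LINT t|lborel. indicator {..y} t *\<^sub>R ?f t) = gauss_primitive y"
    using eventually_ge_at_top[of 0]
  proof eventually_elim
    case (elim y)
    have "gauss_primitive y = (LINT t:{0..y}|lborel. exp (- t\<^sup>2))"
      unfolding gauss_primitive_def using elim by (simp add: interval_integral_Icc)
    also have "\<dots> = (LINT t|lborel. indicator {..y} t *\<^sub>R ?f t)"
      unfolding set_lebesgue_integral_def by (intro Bochner_Integration.integral_cong) (auto simp: indicator_def)
    finally show ?case by simp
  qed
  show ?thesis by (rule Lim_transform_eventually[OF lim ev])
qed

lemma gauss_primitive_at_bot: "(gauss_primitive \<longlongrightarrow> - (sqrt pi / 2)) at_bot"
proof -
  have "((\<lambda>x. - gauss_primitive (- x)) \<longlongrightarrow> - (sqrt pi / 2)) at_bot"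
    by (intro tendsto_minus filterlim_compose[OF gauss_primitive_at_top] filterlim_uminus_at_top_at_bot)
  then show ?thesis by (simp add: gauss_primitive_minus)
qed

text \<open>
  Put \<open>p, q = (a * sqrt s \<mp> c / sqrt s) / sqrt 2\<close>. Both
  \<open>exp (- a * c) * exp (- p\<^sup>2)\<close> and \<open>exp (a * c) * exp (- q\<^sup>2)\<close>
  equal \<open>exp (- (a\<^sup>2 * s + c\<^sup>2 / s) / 2)\<close>, and in the sum of the
  derivatives of \<open>p\<close> and \<open>q\<close> the terms with \<open>c\<close> cancel. So an antiderivative of the
  integrand is a combination of the primitive of the Gaussian at \<open>p\<close> and at \<open>q\<close>. For \<open>s\<close>
  tending to 0, \<open>p\<close> tends to minus infinity if \<open>c\<close> is positive and to 0 if \<open>c = 0\<close>; the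
  limit of the antiderivative is given by the same formula in both cases.
\<close>

lemma inverse_gaussian_integral:
  fixes a c :: real
  assumes a: "0 < a" and c: "0 \<le> c"
  shows "(\<integral>\<^sup>+s. ennreal (indicator {0<..} s * (exp (- (a\<^sup>2 * s + c\<^sup>2 / s) / 2) / sqrt s)) \<partial>lborel) =
     ennreal (sqrt (2 * pi) / a * exp (- a * c))"
proof -
  define p where "p s = (a * sqrt s - c / sqrt s) / sqrt 2" for s
  define q where "q s = (a * sqrt s + c / sqrt s) / sqrt 2" for s
  define f where "f s = exp (- (a\<^sup>2 * s + c\<^sup>2 / s) / 2) / sqrt s" for s
  define F where "F s = sqrt 2 / a * (exp (- a * c) * gauss_primitive (p s) + exp (a * c) * gauss_primitive (q s))" for s
  have dF: "(F has_real_derivative f s) (at s)" if s: "0 < s" for s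
  proof -
    have dp: "(p has_real_derivative (a / (2 * sqrt s) + c / (2 * s * sqrt s)) / sqrt 2) (at s)"
      unfolding p_def using s by (auto intro!: derivative_eq_intros simp: field_simps)
    have dq: "(q has_real_derivative (a / (2 * sqrt s) - c / (2 * s * sqrt s)) / sqrt 2) (at s)"
      unfolding q_def using s by (auto intro!: derivative_eq_intros simp: field_simps)
    have sp: "(p s)\<^sup>2 = (a\<^sup>2 * s + c\<^sup>2 / s) / 2 - a * c" "(q s)\<^sup>2 = (a\<^sup>2 * s + c\<^sup>2 / s) / 2 + a * c"
      unfolding p_def q_def power_divide power2_diff power2_sum power_mult_distrib using s by (auto simp: field_simps)
    have ep: "exp (- a * c) * exp (- (p s)\<^sup>2) = sqrt s * f s" "exp (a * c) * exp (- (q s)\<^sup>2) = sqrt s * f s"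
      unfolding exp_add[symmetric] sp f_def using s by (simp_all add: field_simps)
    have "(F has_real_derivative sqrt 2 / a * (exp (- a * c) * (exp (- (p s)\<^sup>2) * ((a / (2 * sqrt s) + c / (2 * s * sqrt s)) / sqrt 2)) +
        exp (a * c) * (exp (- (q s)\<^sup>2) * ((a / (2 * sqrt s) - c / (2 * s * sqrt s)) / sqrt 2)))) (at s)"
      unfolding F_def by (intro DERIV_cmult DERIV_add DERIV_chain2[OF gauss_primitive_deriv] dp dq)
    also have "sqrt 2 / a * (exp (- a * c) * (exp (- (p s)\<^sup>2) * ((a / (2 * sqrt s) + c / (2 * s * sqrt s)) / sqrt 2)) +
        exp (a * c) * (exp (- (q s)\<^sup>2) * ((a / (2 * sqrt s) - c / (2 * s * sqrt s)) / sqrt 2))) =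
        sqrt 2 / a * ((sqrt s * f s) * ((a / (2 * sqrt s) + c / (2 * s * sqrt s)) / sqrt 2) +
          (sqrt s * f s) * ((a / (2 * sqrt s) - c / (2 * s * sqrt s)) / sqrt 2))"
      by (simp only: mult.assoc[symmetric] ep)
    also have "\<dots> = f s" using s a by (simp add: field_simps)
    finally show ?thesis .
  qed
  have sqrt_at_top: "filterlim sqrt at_top at_top" by (rule sqrt_at_top)
  have c_lim: "((\<lambda>s. c / sqrt s) \<longlongrightarrow> 0) at_top"
    by (rule real_tendsto_divide_at_top[OF tendsto_const sqrt_at_top])
  have as: "filterlim (\<lambda>s. a * sqrt s) at_top at_top"
    by (rule filterlim_tendsto_pos_mult_at_top[OF tendsto_const a sqrt_at_top])
  have qp_top: "filterlim p at_top at_top" "filterlim q at_top at_top"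
  proof -
    have "filterlim (\<lambda>s. 1 / sqrt 2 * (- (c / sqrt s) + a * sqrt s)) at_top at_top"
      by (intro filterlim_tendsto_pos_mult_at_top[OF tendsto_const] filterlim_tendsto_add_at_top[OF tendsto_minus[OF c_lim]] as) auto
    also have "(\<lambda>s. 1 / sqrt 2 * (- (c / sqrt s) + a * sqrt s)) = p"
      by (simp add: p_def fun_eq_iff field_simps)
    finally show "filterlim p at_top at_top" .
    have "filterlim (\<lambda>s. 1 / sqrt 2 * ((c / sqrt s) + a * sqrt s)) at_top at_top"
      by (intro filterlim_tendsto_pos_mult_at_top[OF tendsto_const] filterlim_tendsto_add_at_top[OF c_lim] as) auto
    also have "(\<lambda>s. 1 / sqrt 2 * ((c / sqrt s) + a * sqrt s)) = q"
      by (simp add: q_def fun_eq_iff field_simps)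
    finally show "filterlim q at_top at_top" .
  qed
  have F_top: "(F \<longlongrightarrow> sqrt 2 / a * (exp (- a * c) * (sqrt pi / 2) + exp (a * c) * (sqrt pi / 2))) at_top"
    unfolding F_def by (intro tendsto_intros filterlim_compose[OF gauss_primitive_at_top] qp_top)
  have F_0: "(F \<longlongrightarrow> sqrt 2 / a * (exp (a * c) * (sqrt pi / 2) - exp (- a * c) * (sqrt pi / 2))) (at_right 0)"
  proof (cases "c = 0")
    case True
    have "((\<lambda>s. a * sqrt s / sqrt 2) \<longlongrightarrow> a * sqrt 0 / sqrt 2) (at_right 0)" by (intro tendsto_intros) auto
    then have t: "((\<lambda>s. a * sqrt s / sqrt 2) \<longlongrightarrow> 0) (at_right 0)" by simp
    have "((\<lambda>s. gauss_primitive (a * sqrt s / sqrt 2)) \<longlongrightarrow> gauss_primitive 0) (at_right 0)"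
      by (rule isCont_tendsto_compose[OF DERIV_isCont[OF gauss_primitive_deriv] t])
    then have "((\<lambda>s. sqrt 2 / a * (gauss_primitive (a * sqrt s / sqrt 2) + gauss_primitive (a * sqrt s / sqrt 2)))
        \<longlongrightarrow> sqrt 2 / a * (0 + 0)) (at_right 0)"
      by (intro tendsto_mult tendsto_const tendsto_add) (simp_all add: gauss_primitive_0)
    then show ?thesis using True unfolding F_def p_def q_def by simp
  next
    case False
    then have c: "0 < c" using \<open>0 \<le> c\<close> by simp
    have s0: "((\<lambda>s. a * sqrt s) \<longlongrightarrow> a * sqrt 0) (at_right 0)" by (intro tendsto_intros)
    have "filterlim sqrt (at_right 0) (at_right 0)"
      unfolding filterlim_at using tendsto_real_sqrt[OF tendsto_ident_at, of 0 "{0<..}"]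
      by (auto simp: eventually_at_filter)
    then have "filterlim (\<lambda>s. inverse (sqrt s)) at_top (at_right 0)"
      by (rule filterlim_compose[OF filterlim_inverse_at_top_right])
    then have cs: "filterlim (\<lambda>s. c * inverse (sqrt s)) at_top (at_right 0)"
      by (rule filterlim_tendsto_pos_mult_at_top[OF tendsto_const c])
    have q0: "filterlim q at_top (at_right 0)"
    proof -
      have "filterlim (\<lambda>s. 1 / sqrt 2 * (a * sqrt s + c * inverse (sqrt s))) at_top (at_right 0)"
        by (intro filterlim_tendsto_pos_mult_at_top[OF tendsto_const] filterlim_tendsto_add_at_top[OF s0] cs) auto
      also have "(\<lambda>s. 1 / sqrt 2 * (a * sqrt s + c * inverse (sqrt s))) = q"
        by (simp add: q_def fun_eq_iff divide_inverse algebra_simps)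
      finally show ?thesis .
    qed
    have p0: "filterlim p at_bot (at_right 0)"
    proof -
      have "filterlim (\<lambda>s. 1 / sqrt 2 * (- (a * sqrt s) + c * inverse (sqrt s))) at_top (at_right 0)"
        by (intro filterlim_tendsto_pos_mult_at_top[OF tendsto_const] filterlim_tendsto_add_at_top[OF tendsto_minus[OF s0]] cs) auto
      moreover have "(\<lambda>s. 1 / sqrt 2 * (- (a * sqrt s) + c * inverse (sqrt s))) = (\<lambda>s. - p s)"
        by (simp add: p_def fun_eq_iff divide_inverse algebra_simps)
      ultimately show ?thesis by (simp add: filterlim_uminus_at_bot)
    qed
    have "(F \<longlongrightarrow> sqrt 2 / a * (exp (- a * c) * (- (sqrt pi / 2)) + exp (a * c) * (sqrt pi / 2))) (at_right 0)"
      unfolding F_def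
      by (intro tendsto_mult tendsto_const tendsto_add filterlim_compose[OF gauss_primitive_at_top q0]
        filterlim_compose[OF gauss_primitive_at_bot p0])
    then show ?thesis by (simp add: algebra_simps)
  qed
  have f0: "0 \<le> f s" if "0 < s" for s using that by (simp add: f_def)
  have FTC: "set_integrable lborel (einterval 0 \<infinity>) f"
    "(LBINT s=0..\<infinity>. f s) = sqrt 2 / a * (exp (- a * c) * (sqrt pi / 2) + exp (a * c) * (sqrt pi / 2)) -
      sqrt 2 / a * (exp (a * c) * (sqrt pi / 2) - exp (- a * c) * (sqrt pi / 2))"
  proof -
    have cont: "isCont f s" if "0 < s" for s
      unfolding f_def using that by (auto intro!: continuous_intros)
    have lA: "((F \<circ> real_of_ereal) \<longlongrightarrow> sqrt 2 / a * (exp (a * c) * (sqrt pi / 2) - exp (- a * c) * (sqrt pi / 2))) (at_right 0)"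
      using F_0 unfolding zero_ereal_def by (simp only: ereal_tendsto_simps)
    have lB: "((F \<circ> real_of_ereal) \<longlongrightarrow> sqrt 2 / a * (exp (- a * c) * (sqrt pi / 2) + exp (a * c) * (sqrt pi / 2))) (at_left \<infinity>)"
      using F_top by (simp only: ereal_tendsto_simps)
    have "AE s in lborel. 0 < ereal s \<longrightarrow> ereal s < \<infinity> \<longrightarrow> 0 \<le> f s"
      using f0 by (intro AE_I2) auto
    then show "set_integrable lborel (einterval 0 \<infinity>) f"
      "(LBINT s=0..\<infinity>. f s) = sqrt 2 / a * (exp (- a * c) * (sqrt pi / 2) + exp (a * c) * (sqrt pi / 2)) -
      sqrt 2 / a * (exp (a * c) * (sqrt pi / 2) - exp (- a * c) * (sqrt pi / 2))"
      using interval_integral_FTC_nonneg[of 0 \<infinity> F f, OF _ _ _ _ lA lB] dF cont by auto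
  qed
  have e: "einterval 0 \<infinity> = {0::real<..}" by (auto simp: einterval_def)
  have i: "integrable lborel (\<lambda>s. indicator {0<..} s * f s)"
    using FTC(1) unfolding e set_integrable_def by simp
  have "(\<integral>\<^sup>+s. ennreal (indicator {0<..} s * f s) \<partial>lborel) = ennreal (LINT s|lborel. indicator {0<..} s * f s)"
    by (rule nn_integral_eq_integral[OF i]) (auto simp: indicator_def f0)
  also have "(LINT s|lborel. indicator {0<..} s * f s) = sqrt 2 / a * (exp (- a * c) * (sqrt pi / 2) + exp (a * c) * (sqrt pi / 2)) -
      sqrt 2 / a * (exp (a * c) * (sqrt pi / 2) - exp (- a * c) * (sqrt pi / 2))"
    using FTC(2) unfolding interval_lebesgue_integral_def e set_lebesgue_integral_def by simp
  also have "\<dots> = sqrt (2 * pi) / a * exp (- a * c)"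
    by (simp add: real_sqrt_mult algebra_simps)
  finally show ?thesis unfolding f_def .
qed

section \<open>The Laplace transform of the finite-volume potential\<close>

lemma inverse_on_props:
  assumes "finite U" "\<And>k l. A k l = A l k" "pos_def_on U A" "\<And>k l. k \<noteq> l \<Longrightarrow> A k l \<le> 0"
  shows "is_inverse_on U A (inverse_on U A)" "\<And>k l. inverse_on U A k l = inverse_on U A l k"
    "\<And>k l. 0 \<le> inverse_on U A k l" "0 < det_on U A"
proof -
  obtain B where B: "is_inverse_on U A B" "\<forall>k l. B k l = B l k" "\<forall>k l. 0 \<le> B k l" "0 < det_on U A"
    using pos_def_inverse_exists[OF assms] by blast
  have e: "inverse_on U A = B" by (rule inverse_on_eqI[OF assms(1) B(1)])
  show "is_inverse_on U A (inverse_on U A)" "0 < det_on U A" unfolding e by (rule B)+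
  show "\<And>k l. inverse_on U A k l = inverse_on U A l k" "\<And>k l. 0 \<le> inverse_on U A k l"
    unfolding e using B by blast+
qed

locale coupling =
  fixes w :: "'v \<Rightarrow> 'v \<Rightarrow> real"
  assumes w_sym: "w k l = w l k" and w_nonneg: "0 \<le> w k l"
begin

lemma H_sym: "H_mat w \<beta> k l = H_mat w \<beta> l k"
  using w_sym[of k l] by (simp add: H_mat_def)

lemma H_off: "k \<noteq> l \<Longrightarrow> H_mat w \<beta> k l \<le> 0"
  using w_nonneg[of k l] by (simp add: H_mat_def)

lemmas H_inverse = inverse_on_props[where A="H_mat w \<beta>" for \<beta>, OF _ H_sym _ H_off]

lemma measurable_H: "k \<in> J \<Longrightarrow> (\<lambda>\<beta>. H_mat w \<beta> k l) \<in> borel_measurable (PiM J (\<lambda>_. borel))"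
  unfolding H_mat_def by measurable

lemma measurable_det_H:
  assumes "finite U" "U \<subseteq> J"
  shows "(\<lambda>\<beta>. det_on U (H_mat w \<beta>)) \<in> borel_measurable (PiM J (\<lambda>_. borel))"
  unfolding det_on_def
  by (intro borel_measurable_sum borel_measurable_times borel_measurable_prod measurable_H) (use assms in auto)

text \<open>
  Enlarging \<open>U\<close> by one vertex, all data of the matrix are expressed through its inverse on
  \<open>U\<close>.
\<close>

lemma H_insert:
  assumes U: "finite U" "i \<notin> U" and pd: "pos_def_on U (H_mat w \<beta>)"
  shows "pos_def_on (insert i U) (H_mat w \<beta>) \<longleftrightarrow> 0 < schur_complement U (H_mat w \<beta>) (inverse_on U (H_mat w \<beta>)) i"
    and "0 < schur_complement U (H_mat w \<beta>) (inverse_on U (H_mat w \<beta>)) i \<Longrightarrow>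
      inverse_on (insert i U) (H_mat w \<beta>) = bordered_inverse U (H_mat w \<beta>) (inverse_on U (H_mat w \<beta>)) i"
    and "det_on (insert i U) (H_mat w \<beta>) =
      schur_complement U (H_mat w \<beta>) (inverse_on U (H_mat w \<beta>)) i * det_on U (H_mat w \<beta>)"
proof -
  note B = H_inverse(1)[OF U(1) pd] and Bs = H_inverse(2)[OF U(1) pd]
  show "pos_def_on (insert i U) (H_mat w \<beta>) \<longleftrightarrow> 0 < schur_complement U (H_mat w \<beta>) (inverse_on U (H_mat w \<beta>)) i"
    using pos_def_on_insert[OF U H_sym Bs B] pd by blast
  show "det_on (insert i U) (H_mat w \<beta>) =
      schur_complement U (H_mat w \<beta>) (inverse_on U (H_mat w \<beta>)) i * det_on U (H_mat w \<beta>)"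
    by (rule det_on_insert[OF U H_sym Bs B])
  assume "0 < schur_complement U (H_mat w \<beta>) (inverse_on U (H_mat w \<beta>)) i"
  then show "inverse_on (insert i U) (H_mat w \<beta>) = bordered_inverse U (H_mat w \<beta>) (inverse_on U (H_mat w \<beta>)) i"
    using U(1) by (intro inverse_on_eqI is_inverse_on_insert[OF U H_sym Bs B]) auto
qed

text \<open>
  Induction through the block formulas, which are rational in the entries. The factor
  \<open>of_bool\<close> discards the potentials at which the matrix is not positive definite, where
  nothing is known about the value of \<open>inverse_on\<close>.
\<close>

lemma measurable_pos_def_inverse:
  assumes "finite U" "U \<subseteq> J"
  shows "Measurable.pred (PiM J (\<lambda>_. borel)) (\<lambda>\<beta>. pos_def_on U (H_mat w \<beta>)) \<and>
    (\<forall>k l. (\<lambda>\<beta>. of_bool (pos_def_on U (H_mat w \<beta>)) * inverse_on U (H_mat w \<beta>) k l) \<in> borel_measurable (PiM J (\<lambda>_. borel)))"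
  using assms
proof (induction U)
  case empty
  have "inverse_on {} A = (\<lambda>_ _. 0)" for A :: "'v \<Rightarrow> 'v \<Rightarrow> real"
    by (rule inverse_on_eqI) (auto simp: is_inverse_on_def)
  then show ?case by (simp add: pos_def_on_def)
next
  case (insert i U)
  let ?M = "PiM J (\<lambda>_. borel) :: ('v \<Rightarrow> real) measure"
  define P where "P \<beta> = pos_def_on U (H_mat w \<beta>)" for \<beta>
  define b where "b \<beta> k l = of_bool (P \<beta>) * inverse_on U (H_mat w \<beta>) k l" for \<beta> k l
  define s where "s \<beta> = schur_complement U (H_mat w \<beta>) (b \<beta>) i" for \<beta>
  have [measurable]: "Measurable.pred ?M P" "(\<lambda>\<beta>. b \<beta> k l) \<in> borel_measurable ?M" for k l
    using insert unfolding P_def[abs_def] b_def[abs_def] by auto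
  have Hm: "(\<lambda>\<beta>. H_mat w \<beta> k l) \<in> borel_measurable ?M" if "k \<in> insert i U" for k l
    using that insert.prems by (intro measurable_H) auto
  have vm: "(\<lambda>\<beta>. schur_vector U (H_mat w \<beta>) (b \<beta>) i k) \<in> borel_measurable ?M" for k
    unfolding schur_vector_def by (intro borel_measurable_sum borel_measurable_times Hm) auto
  have sm: "s \<in> borel_measurable ?M"
    unfolding s_def[abs_def] schur_complement_def
    by (intro borel_measurable_diff borel_measurable_sum borel_measurable_times Hm vm) auto
  note [measurable] = vm sm
  have bP: "b \<beta> = inverse_on U (H_mat w \<beta>)" if "P \<beta>" for \<beta>
    using that by (simp add: b_def fun_eq_iff)
  have pd: "pos_def_on (insert i U) (H_mat w \<beta>) \<longleftrightarrow> P \<beta> \<and> 0 < s \<beta>" for \<beta>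
  proof (cases "P \<beta>")
    case True
    then show ?thesis using H_insert(1)[OF insert(1,2), of \<beta>] unfolding s_def bP[OF True] P_def by blast
  next
    case False
    then show ?thesis using pos_def_on_remove[OF insert(1,2)] unfolding P_def by blast
  qed
  have inv: "of_bool (pos_def_on (insert i U) (H_mat w \<beta>)) * inverse_on (insert i U) (H_mat w \<beta>) k l =
      of_bool (P \<beta> \<and> 0 < s \<beta>) * bordered_inverse U (H_mat w \<beta>) (b \<beta>) i k l" for \<beta> k l
  proof (cases "P \<beta> \<and> 0 < s \<beta>")
    case True
    then show ?thesis using H_insert(2)[OF insert(1,2), of \<beta>] unfolding pd s_def using bP[of \<beta>] unfolding P_def by simp
  qed (simp add: pd)
  have "(\<lambda>\<beta>. bordered_inverse U (H_mat w \<beta>) (b \<beta>) i k l) \<in> borel_measurable ?M" for k l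
    unfolding bordered_inverse_def Let_def s_def[symmetric]
    by (cases "k = i"; cases "l = i"; cases "k \<in> U"; cases "l \<in> U"; simp)
  then show ?case unfolding inv unfolding pd by simp
qed

text \<open>
  The density of the finite-volume law up to a constant, with the vector of ones in the
  quadratic form of the operator replaced by a general vector \<open>\<theta>\<close>. Laplace transforms
  of the law are integrals of this kernel.
\<close>

definition potential_kernel :: "'v set \<Rightarrow> ('v \<Rightarrow> real) \<Rightarrow> ('v \<Rightarrow> real) \<Rightarrow> ('v \<Rightarrow> real) \<Rightarrow> real" where
  "potential_kernel U \<eta> \<theta> \<beta> = (if pos_def_on U (H_mat w \<beta>)
     then exp (- ((\<Sum>k\<in>U. \<Sum>l\<in>U. \<theta> k * H_mat w \<beta> k l * \<theta> l) +
                  (\<Sum>k\<in>U. \<Sum>l\<in>U. \<eta> k * inverse_on U (H_mat w \<beta>) k l * \<eta> l)) / 2) / sqrt (det_on U (H_mat w \<beta>))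
     else 0)"

lemma measurable_potential_kernel:
  assumes U: "finite U"
  shows "potential_kernel U \<eta> \<theta> \<in> borel_measurable (PiM U (\<lambda>_. lborel))"
proof -
  let ?M = "PiM U (\<lambda>_. borel) :: ('v \<Rightarrow> real) measure"
  note m = measurable_pos_def_inverse[OF U order_refl]
  have [measurable]: "Measurable.pred ?M (\<lambda>\<beta>. pos_def_on U (H_mat w \<beta>))"
    "(\<lambda>\<beta>. of_bool (pos_def_on U (H_mat w \<beta>)) * inverse_on U (H_mat w \<beta>) k l) \<in> borel_measurable ?M" for k l
    using m by blast+
  have [measurable]: "(\<lambda>\<beta>. det_on U (H_mat w \<beta>)) \<in> borel_measurable ?M" by (rule measurable_det_H[OF U order_refl])
  have [measurable]: "(\<lambda>\<beta>. \<Sum>k\<in>U. \<Sum>l\<in>U. \<theta> k * H_mat w \<beta> k l * \<theta> l) \<in> borel_measurable ?M"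
    by (intro borel_measurable_sum borel_measurable_times measurable_H) auto
  have eq: "potential_kernel U \<eta> \<theta> = (\<lambda>\<beta>. if pos_def_on U (H_mat w \<beta>)
     then exp (- ((\<Sum>k\<in>U. \<Sum>l\<in>U. \<theta> k * H_mat w \<beta> k l * \<theta> l) +
                  (\<Sum>k\<in>U. \<Sum>l\<in>U. \<eta> k * (of_bool (pos_def_on U (H_mat w \<beta>)) * inverse_on U (H_mat w \<beta>) k l) * \<eta> l)) / 2) / sqrt (det_on U (H_mat w \<beta>))
     else 0)"
    by (auto simp: potential_kernel_def fun_eq_iff)
  have "potential_kernel U \<eta> \<theta> \<in> borel_measurable ?M" unfolding eq by measurable
  moreover have "sets (PiM U (\<lambda>_. lborel :: real measure)) = sets ?M" by (intro sets_PiM_cong) auto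
  ultimately show ?thesis by (simp cong: measurable_cong_sets)
qed

lemma potential_kernel_nonneg: "finite U \<Longrightarrow> 0 \<le> potential_kernel U \<eta> \<theta> \<beta>"
  using H_inverse(4) by (auto simp: potential_kernel_def intro!: divide_nonneg_pos)

text \<open>
  As a function of the last coordinate \<open>y\<close>, the matrix enters only through the Schur
  complement \<open>s\<close>, which is affine in \<open>y\<close>.
\<close>

lemma potential_kernel_insert:
  fixes x \<eta> \<theta> :: "'v \<Rightarrow> real" and i :: 'v and U :: "'v set"
  defines "B \<equiv> inverse_on U (H_mat w x)"
  defines "u \<equiv> (\<lambda>k. \<Sum>l\<in>U. B k l * w l i)"
  defines "c \<equiv> \<eta> i + (\<Sum>k\<in>U. \<eta> k * u k)"
  assumes U: "finite U" "i \<notin> U" and pd: "pos_def_on U (H_mat w x)"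
  shows "potential_kernel (insert i U) \<eta> \<theta> (x(i := y)) =
    (exp (- ((\<Sum>k\<in>U. \<Sum>l\<in>U. \<theta> k * H_mat w x k l * \<theta> l) - 2 * \<theta> i * (\<Sum>k\<in>U. \<theta> k * w k i) + (\<theta> i)\<^sup>2 * (\<Sum>k\<in>U. w i k * u k)
      + (\<Sum>k\<in>U. \<Sum>l\<in>U. \<eta> k * B k l * \<eta> l)) / 2) / sqrt (det_on U (H_mat w x))) *
    (let s = - (w i i + (\<Sum>k\<in>U. w i k * u k)) + 2 * y in
       indicator {0<..} s * (exp (- ((\<theta> i)\<^sup>2 * s + c\<^sup>2 / s) / 2) / sqrt s))"
proof -
  let ?A = "H_mat w (x(i := y))"
  define s where "s = - (w i i + (\<Sum>k\<in>U. w i k * u k)) + 2 * y"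
  have AU: "?A k l = H_mat w x k l" if "k \<in> U" for k l
    using that U(2) by (auto simp: H_mat_def)
  have pdA: "pos_def_on U ?A" using pos_def_on_cong[of U ?A "H_mat w x"] AU pd by blast
  have inv: "inverse_on U ?A = B"
  proof (rule inverse_on_eqI[OF U(1)])
    show "is_inverse_on U ?A B"
      unfolding B_def using is_inverse_on_cong[of U ?A "H_mat w x"] AU H_inverse(1)[OF U(1) pd] by blast
  qed
  have det: "det_on U ?A = det_on U (H_mat w x)" by (rule det_on_cong) (rule AU)
  have Ai: "?A i k = - w i k" "?A k i = - w k i" if "k \<in> U" for k
    using that U(2) by (auto simp: H_mat_def)
  have v: "schur_vector U ?A B i k = - u k" for k
    unfolding schur_vector_def u_def using Ai(2) by (simp add: sum_negf)
  have s: "schur_complement U ?A B i = s"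
  proof -
    have "(\<Sum>k\<in>U. ?A i k * schur_vector U ?A B i k) = (\<Sum>k\<in>U. w i k * u k)"
      unfolding v using Ai(1) by (intro sum.cong refl) simp
    then show ?thesis unfolding schur_complement_def s_def by (simp add: H_mat_def)
  qed
  note ins = H_insert[OF U pdA, unfolded inv s det]
  show ?thesis
  proof (cases "0 < s")
    case False
    then have "\<not> pos_def_on (insert i U) ?A" using ins(1) by blast
    then show ?thesis using False unfolding s_def[symmetric] Let_def by (simp add: potential_kernel_def)
  next
    case True
    note B = H_inverse(1)[OF U(1) pdA, unfolded inv] and Bs = H_inverse(2)[OF U(1) pdA, unfolded inv]
    have detpos: "0 < det_on U (H_mat w x)" by (rule H_inverse(4)[OF U(1) pd])
    have q1: "(\<Sum>k\<in>insert i U. \<Sum>l\<in>insert i U. \<theta> k * ?A k l * \<theta> l) =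
        (\<Sum>k\<in>U. \<Sum>l\<in>U. \<theta> k * H_mat w x k l * \<theta> l) - 2 * \<theta> i * (\<Sum>k\<in>U. \<theta> k * w k i)
        + (\<theta> i)\<^sup>2 * (s + (\<Sum>k\<in>U. w i k * u k))"
    proof -
      have 1: "(\<Sum>k\<in>U. \<theta> k * ?A k i) = - (\<Sum>k\<in>U. \<theta> k * w k i)"
        using Ai(2) by (simp add: sum_negf)
      have 2: "?A i i = s + (\<Sum>k\<in>U. w i k * u k)" by (simp add: H_mat_def s_def)
      have 3: "(\<Sum>k\<in>U. \<Sum>l\<in>U. \<theta> k * ?A k l * \<theta> l) = (\<Sum>k\<in>U. \<Sum>l\<in>U. \<theta> k * H_mat w x k l * \<theta> l)"
        by (intro sum.cong refl) (simp add: AU)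
      show ?thesis using quadratic_form_insert[OF U H_sym Bs B, of \<theta>] unfolding 1 2 3 by (simp add: algebra_simps)
    qed
    have q2: "(\<Sum>k\<in>insert i U. \<Sum>l\<in>insert i U. \<eta> k * inverse_on (insert i U) ?A k l * \<eta> l) =
        (\<Sum>k\<in>U. \<Sum>l\<in>U. \<eta> k * B k l * \<eta> l) + c\<^sup>2 / s"
    proof -
      have "\<eta> i - (\<Sum>k\<in>U. \<eta> k * schur_vector U ?A B i k) = c" unfolding v c_def by (simp add: sum_negf)
      then show ?thesis using bordered_quadratic_form[OF U H_sym Bs B, of \<eta>] unfolding ins(2)[OF True] s by simp
    qed
    have pdi: "pos_def_on (insert i U) ?A" using ins(1) True by blast
    have "potential_kernel (insert i U) \<eta> \<theta> (x(i := y)) =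
      exp (- (((\<Sum>k\<in>U. \<Sum>l\<in>U. \<theta> k * H_mat w x k l * \<theta> l) - 2 * \<theta> i * (\<Sum>k\<in>U. \<theta> k * w k i)
        + (\<theta> i)\<^sup>2 * (s + (\<Sum>k\<in>U. w i k * u k))) + ((\<Sum>k\<in>U. \<Sum>l\<in>U. \<eta> k * B k l * \<eta> l) + c\<^sup>2 / s)) / 2) /
      sqrt (s * det_on U (H_mat w x))"
      unfolding potential_kernel_def q1 q2 ins(3) using pdi by simp
    also have "\<dots> = (exp (- ((\<Sum>k\<in>U. \<Sum>l\<in>U. \<theta> k * H_mat w x k l * \<theta> l) - 2 * \<theta> i * (\<Sum>k\<in>U. \<theta> k * w k i) + (\<theta> i)\<^sup>2 * (\<Sum>k\<in>U. w i k * u k)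
      + (\<Sum>k\<in>U. \<Sum>l\<in>U. \<eta> k * B k l * \<eta> l)) / 2) * exp (- ((\<theta> i)\<^sup>2 * s + c\<^sup>2 / s) / 2)) / (sqrt (det_on U (H_mat w x)) * sqrt s)"
      unfolding exp_add[symmetric] real_sqrt_mult by (intro arg_cong2[where f="(/)"] arg_cong[where f=exp]) (simp_all add: field_simps)
    finally show ?thesis using True unfolding s_def[symmetric] Let_def by simp
  qed
qed

lemma quadratic_form_source:
  fixes B :: "'v \<Rightarrow> 'v \<Rightarrow> real"
  assumes Bs: "\<And>k l. B k l = B l k"
  shows "(\<Sum>k\<in>U. \<Sum>l\<in>U. (\<eta> k + t * g k) * B k l * (\<eta> l + t * g l)) =
    (\<Sum>k\<in>U. \<Sum>l\<in>U. \<eta> k * B k l * \<eta> l) + 2 * t * (\<Sum>k\<in>U. \<eta> k * (\<Sum>l\<in>U. B k l * g l)) + t\<^sup>2 * (\<Sum>k\<in>U. g k * (\<Sum>l\<in>U. B k l * g l))"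
proof -
  have e: "(\<eta> k + t * g k) * B k l * (\<eta> l + t * g l) =
     \<eta> k * B k l * \<eta> l + t * (\<eta> k * (B k l * g l)) + t * (\<eta> l * (B l k * g k)) + t\<^sup>2 * (g k * (B k l * g l))" for k l
    unfolding Bs[of l k] by algebra
  have 1: "(\<Sum>k\<in>U. \<Sum>l\<in>U. t * (\<eta> k * (B k l * g l))) = t * (\<Sum>k\<in>U. \<eta> k * (\<Sum>l\<in>U. B k l * g l))"
    by (simp add: sum_distrib_left)
  have 2: "(\<Sum>k\<in>U. \<Sum>l\<in>U. t * (\<eta> l * (B l k * g k))) = t * (\<Sum>k\<in>U. \<eta> k * (\<Sum>l\<in>U. B k l * g l))"
    by (subst sum.swap) (rule 1)
  have 3: "(\<Sum>k\<in>U. \<Sum>l\<in>U. t\<^sup>2 * (g k * (B k l * g l))) = t\<^sup>2 * (\<Sum>k\<in>U. g k * (\<Sum>l\<in>U. B k l * g l))"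
    by (simp add: sum_distrib_left)
  show ?thesis unfolding e sum.distrib 1 2 3 by simp
qed

text \<open>
  Integrating out the last vertex \<open>i\<close> gives the kernel on \<open>U\<close> with the source
  \<open>\<eta> + \<theta> i * w _ i\<close>: the exponential in the inverse Gaussian integral
  supplies exactly the cross term that completes the quadratic form in the source.
\<close>

lemma potential_kernel_integral_last:
  assumes U: "finite U" "i \<notin> U" and \<theta>: "0 < \<theta> i" and \<eta>: "\<And>k. 0 \<le> \<eta> k"
  shows "(\<integral>\<^sup>+y. ennreal (potential_kernel (insert i U) \<eta> \<theta> (x(i := y))) \<partial>lborel) =
    ennreal (sqrt (pi / 2) / \<theta> i * exp (\<theta> i * (\<Sum>k\<in>U. \<theta> k * w k i) - \<theta> i * \<eta> i)) *
    ennreal (potential_kernel U (\<lambda>k. \<eta> k + \<theta> i * w k i) \<theta> x)"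
proof (cases "pos_def_on U (H_mat w x)")
  case False
  have "\<not> pos_def_on (insert i U) (H_mat w (x(i := y)))" for y
  proof
    assume "pos_def_on (insert i U) (H_mat w (x(i := y)))"
    then have "pos_def_on U (H_mat w (x(i := y)))" by (rule pos_def_on_remove[OF U])
    moreover have "H_mat w (x(i := y)) k l = H_mat w x k l" if "k \<in> U" for k l
      using that U(2) by (auto simp: H_mat_def)
    ultimately show False using False pos_def_on_cong[of U "H_mat w (x(i := y))" "H_mat w x"] by blast
  qed
  then show ?thesis using False by (simp add: potential_kernel_def)
next
  case True
  define B where "B = inverse_on U (H_mat w x)"
  define u where "u k = (\<Sum>l\<in>U. B k l * w l i)" for k
  define c where "c = \<eta> i + (\<Sum>k\<in>U. \<eta> k * u k)"
  define c0 where "c0 = w i i + (\<Sum>k\<in>U. w i k * u k)"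
  define D where "D = exp (- ((\<Sum>k\<in>U. \<Sum>l\<in>U. \<theta> k * H_mat w x k l * \<theta> l) - 2 * \<theta> i * (\<Sum>k\<in>U. \<theta> k * w k i) + (\<theta> i)\<^sup>2 * (\<Sum>k\<in>U. w i k * u k)
      + (\<Sum>k\<in>U. \<Sum>l\<in>U. \<eta> k * B k l * \<eta> l)) / 2) / sqrt (det_on U (H_mat w x))"
  define f where "f s = ennreal (indicator {0<..} s * (exp (- ((\<theta> i)\<^sup>2 * s + c\<^sup>2 / s) / 2) / sqrt s))" for s
  have det: "0 < det_on U (H_mat w x)" by (rule H_inverse(4)[OF U(1) True])
  have B: "0 \<le> B k l" "B k l = B l k" for k l using H_inverse(2,3)[OF U(1) True] by (auto simp: B_def)
  have D0: "0 \<le> D" using det by (simp add: D_def)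
  have u0: "0 \<le> u k" for k unfolding u_def by (intro sum_nonneg mult_nonneg_nonneg B w_nonneg)
  have c: "0 \<le> c" unfolding c_def by (intro add_nonneg_nonneg \<eta> sum_nonneg mult_nonneg_nonneg u0)
  have fm[measurable]: "f \<in> borel_measurable borel" unfolding f_def[abs_def] by measurable
  have If: "integral\<^sup>N lborel f = ennreal (sqrt (2 * pi) / \<theta> i * exp (- \<theta> i * c))"
    unfolding f_def by (rule inverse_gaussian_integral[OF \<theta> c])
  have pk: "potential_kernel (insert i U) \<eta> \<theta> (x(i := y)) = D * (let s = - c0 + 2 * y in
       indicator {0<..} s * (exp (- ((\<theta> i)\<^sup>2 * s + c\<^sup>2 / s) / 2) / sqrt s))" for y
    using potential_kernel_insert[OF U True] unfolding D_def c0_def c_def u_def B_def by blast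
  have "(\<integral>\<^sup>+y. ennreal (potential_kernel (insert i U) \<eta> \<theta> (x(i := y))) \<partial>lborel) = (\<integral>\<^sup>+y. ennreal D * f (- c0 + 2 * y) \<partial>lborel)"
    unfolding pk f_def Let_def ennreal_mult'[OF D0] ..
  also have "\<dots> = ennreal D * (\<integral>\<^sup>+y. f (- c0 + 2 * y) \<partial>lborel)" by (rule nn_integral_cmult) measurable
  also have "(\<integral>\<^sup>+y. f (- c0 + 2 * y) \<partial>lborel) = ennreal (sqrt (pi / 2) / \<theta> i * exp (- \<theta> i * c))"
  proof -
    let ?X = "\<integral>\<^sup>+y. f (- c0 + 2 * y) \<partial>lborel"
    have two: "ennreal 2 * ?X = integral\<^sup>N lborel f"
      using nn_integral_real_affine[OF fm, of 2 "- c0"] by simp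
    have half: "ennreal (1 / 2) * ennreal 2 = 1" using ennreal_mult'[of "1 / 2" 2] by simp
    have "?X = ennreal (1 / 2) * (ennreal 2 * ?X)" unfolding mult.assoc[symmetric] half by simp
    also have "\<dots> = ennreal (1 / 2 * (sqrt (2 * pi) / \<theta> i * exp (- \<theta> i * c)))"
      unfolding two If by (rule ennreal_mult'[symmetric]) simp
    also have "1 / 2 * (sqrt (2 * pi) / \<theta> i * exp (- \<theta> i * c)) = sqrt (pi / 2) / \<theta> i * exp (- \<theta> i * c)"
    proof -
      have "sqrt (2 * pi) = 2 * sqrt (pi / 2)"
        using real_sqrt_mult[of 4 "pi / 2"] by simp
      then show ?thesis by simp
    qed
    finally show ?thesis .
  qed
  also have "ennreal D * \<dots> = ennreal (D * (sqrt (pi / 2) / \<theta> i * exp (- \<theta> i * c)))"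
    by (rule ennreal_mult'[OF D0, symmetric])
  also have "D * (sqrt (pi / 2) / \<theta> i * exp (- \<theta> i * c)) =
      (sqrt (pi / 2) / \<theta> i * exp (\<theta> i * (\<Sum>k\<in>U. \<theta> k * w k i) - \<theta> i * \<eta> i)) *
      potential_kernel U (\<lambda>k. \<eta> k + \<theta> i * w k i) \<theta> x"
  proof -
    have q: "(\<Sum>k\<in>U. \<Sum>l\<in>U. (\<eta> k + \<theta> i * w k i) * B k l * (\<eta> l + \<theta> i * w l i)) =
       (\<Sum>k\<in>U. \<Sum>l\<in>U. \<eta> k * B k l * \<eta> l) + 2 * \<theta> i * (\<Sum>k\<in>U. \<eta> k * u k) + (\<theta> i)\<^sup>2 * (\<Sum>k\<in>U. w i k * u k)"
      using quadratic_form_source[OF B(2), where t="\<theta> i" and g="\<lambda>k. w k i"] unfolding u_def by (simp add: w_sym[of _ i])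
    have "exp (- ((\<Sum>k\<in>U. \<Sum>l\<in>U. \<theta> k * H_mat w x k l * \<theta> l) - 2 * \<theta> i * (\<Sum>k\<in>U. \<theta> k * w k i) + (\<theta> i)\<^sup>2 * (\<Sum>k\<in>U. w i k * u k)
      + (\<Sum>k\<in>U. \<Sum>l\<in>U. \<eta> k * B k l * \<eta> l)) / 2) * exp (- \<theta> i * c) =
      exp (\<theta> i * (\<Sum>k\<in>U. \<theta> k * w k i) - \<theta> i * \<eta> i) *
      exp (- ((\<Sum>k\<in>U. \<Sum>l\<in>U. \<theta> k * H_mat w x k l * \<theta> l) +
        (\<Sum>k\<in>U. \<Sum>l\<in>U. (\<eta> k + \<theta> i * w k i) * B k l * (\<eta> l + \<theta> i * w l i))) / 2)"
      unfolding q exp_add[symmetric] c_def by (intro arg_cong[where f=exp]) (simp add: field_simps)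
    then show ?thesis unfolding D_def potential_kernel_def B_def[symmetric] using True by (simp add: field_simps)
  qed
  also have "ennreal (sqrt (pi / 2) / \<theta> i * exp (\<theta> i * (\<Sum>k\<in>U. \<theta> k * w k i) - \<theta> i * \<eta> i) *
      potential_kernel U (\<lambda>k. \<eta> k + \<theta> i * w k i) \<theta> x) =
    ennreal (sqrt (pi / 2) / \<theta> i * exp (\<theta> i * (\<Sum>k\<in>U. \<theta> k * w k i) - \<theta> i * \<eta> i)) *
    ennreal (potential_kernel U (\<lambda>k. \<eta> k + \<theta> i * w k i) \<theta> x)"
    by (rule ennreal_mult') (use \<theta> in simp)
  finally show ?thesis .
qed

theorem potential_kernel_integral:
  assumes "finite U" "\<And>k. k \<in> U \<Longrightarrow> 0 < \<theta> k" "\<And>k. 0 \<le> \<eta> k"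
  shows "(\<integral>\<^sup>+\<beta>. ennreal (potential_kernel U \<eta> \<theta> \<beta>) \<partial>PiM U (\<lambda>_. lborel)) =
    ennreal ((\<Prod>k\<in>U. sqrt (pi / 2) / \<theta> k) * exp (- (\<Sum>k\<in>U. \<eta> k * \<theta> k)))"
  using assms
proof (induction U arbitrary: \<eta>)
  case empty
  interpret product_sigma_finite "\<lambda>_::'v. lborel :: real measure" by standard
  show ?case by (simp add: PiM_empty nn_integral_count_space_finite potential_kernel_def pos_def_on_def det_on_empty)
next
  case (insert i U)
  interpret product_sigma_finite "\<lambda>_::'v. lborel :: real measure" by standard
  define \<eta>' where "\<eta>' k = \<eta> k + \<theta> i * w k i" for k
  define K where "K = sqrt (pi / 2) / \<theta> i * exp (\<theta> i * (\<Sum>k\<in>U. \<theta> k * w k i) - \<theta> i * \<eta> i)"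
  have \<theta>i: "0 < \<theta> i" using insert.prems by simp
  have K0: "0 \<le> K" using \<theta>i by (simp add: K_def)
  have \<eta>': "0 \<le> \<eta>' k" for k using insert.prems(2)[of k] \<theta>i w_nonneg[of k i] by (simp add: \<eta>'_def)
  have "(\<integral>\<^sup>+\<beta>. ennreal (potential_kernel (insert i U) \<eta> \<theta> \<beta>) \<partial>PiM (insert i U) (\<lambda>_. lborel)) =
     (\<integral>\<^sup>+x. (\<integral>\<^sup>+y. ennreal (potential_kernel (insert i U) \<eta> \<theta> (x(i := y))) \<partial>lborel) \<partial>PiM U (\<lambda>_. lborel))"
    using insert(1,2) measurable_potential_kernel[of "insert i U" \<eta> \<theta>] by (intro product_nn_integral_insert) auto
  also have "\<dots> = (\<integral>\<^sup>+x. ennreal K * ennreal (potential_kernel U \<eta>' \<theta> x) \<partial>PiM U (\<lambda>_. lborel))"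
    unfolding K_def \<eta>'_def
    by (intro nn_integral_cong potential_kernel_integral_last[where \<theta>=\<theta> and \<eta>=\<eta>] insert(1,2) \<theta>i insert.prems(2))
  also have "\<dots> = ennreal K * (\<integral>\<^sup>+x. ennreal (potential_kernel U \<eta>' \<theta> x) \<partial>PiM U (\<lambda>_. lborel))"
    using measurable_potential_kernel[OF insert(1)] by (intro nn_integral_cmult) auto
  also have "(\<integral>\<^sup>+x. ennreal (potential_kernel U \<eta>' \<theta> x) \<partial>PiM U (\<lambda>_. lborel)) =
     ennreal ((\<Prod>k\<in>U. sqrt (pi / 2) / \<theta> k) * exp (- (\<Sum>k\<in>U. \<eta>' k * \<theta> k)))"
    using insert.prems by (intro insert.IH \<eta>') auto
  also have "ennreal K * \<dots> = ennreal (K * ((\<Prod>k\<in>U. sqrt (pi / 2) / \<theta> k) * exp (- (\<Sum>k\<in>U. \<eta>' k * \<theta> k))))"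
    by (rule ennreal_mult'[OF K0, symmetric])
  also have "K * ((\<Prod>k\<in>U. sqrt (pi / 2) / \<theta> k) * exp (- (\<Sum>k\<in>U. \<eta>' k * \<theta> k))) =
     (\<Prod>k\<in>insert i U. sqrt (pi / 2) / \<theta> k) * exp (- (\<Sum>k\<in>insert i U. \<eta> k * \<theta> k))"
  proof -
    have s: "(\<Sum>k\<in>U. \<eta>' k * \<theta> k) = (\<Sum>k\<in>U. \<eta> k * \<theta> k) + \<theta> i * (\<Sum>k\<in>U. \<theta> k * w k i)"
      unfolding \<eta>'_def sum_distrib_left sum.distrib[symmetric] by (intro sum.cong refl) (simp add: algebra_simps)
    have "exp (\<theta> i * (\<Sum>k\<in>U. \<theta> k * w k i) - \<theta> i * \<eta> i) * exp (- (\<Sum>k\<in>U. \<eta>' k * \<theta> k)) =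
        exp (- (\<Sum>k\<in>insert i U. \<eta> k * \<theta> k))"
      unfolding s exp_add[symmetric] using insert(1,2) by (simp add: algebra_simps)
    then show ?thesis unfolding K_def using insert(1,2) by (simp add: mult_ac)
  qed
  finally show ?case .
qed

lemma nu_fin_eq_density:
  "nu_fin U w \<eta> = density (PiM U (\<lambda>_. lborel)) (\<lambda>\<beta>. ennreal
     ((2 / pi) powr (real (card U) / 2) * exp (\<Sum>k\<in>U. \<eta> k) * potential_kernel U \<eta> (\<lambda>_. 1) \<beta>))"
  unfolding nu_fin_def
  by (intro arg_cong[where f="density _"] ext arg_cong[where f=ennreal]) (simp add: potential_kernel_def)

text \<open>
  The factor \<open>exp (- (\<Sum>k. l k * \<beta> k))\<close> changes the diagonal part of the
  quadratic form from \<open>\<theta> = 1\<close> to \<open>\<theta> = m\<close>, and the off-diagonal part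
  changes by a constant.
\<close>

theorem nu_fin_laplace:
  assumes U: "finite U" and \<eta>: "\<And>k. 0 \<le> \<eta> k" and l: "\<And>k. 0 \<le> l k"
  defines "m \<equiv> (\<lambda>k. sqrt (1 + l k))"
  shows "(\<integral>\<^sup>+\<beta>. ennreal (exp (- (\<Sum>k\<in>U. l k * \<beta> k))) \<partial>nu_fin U w \<eta>) =
    ennreal ((\<Prod>k\<in>U. 1 / m k) * exp (- (\<Sum>i\<in>U. \<Sum>j\<in>U. w i j * (m i * m j - 1)) / 2 - (\<Sum>k\<in>U. \<eta> k * (m k - 1))))"
proof -
  let ?n = "(2 / pi) powr (real (card U) / 2)"
  let ?X = "\<Sum>i\<in>U. \<Sum>j\<in>U. w i j * (m i * m j - 1)"
  let ?D = "\<lambda>\<theta> \<beta>. ?n * exp (\<Sum>k\<in>U. \<eta> k) * potential_kernel U \<eta> \<theta> \<beta>"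
  have m: "0 < m k" "(m k)\<^sup>2 = 1 + l k" for k using l[of k] by (auto simp: m_def add_pos_nonneg)
  have dens: "nu_fin U w \<eta> = density (PiM U (\<lambda>_. lborel)) (\<lambda>\<beta>. ennreal (?D (\<lambda>_. 1) \<beta>))"
    by (rule nu_fin_eq_density)
  note pm[measurable] = measurable_potential_kernel[OF U]
  have "(\<lambda>\<beta>. \<Sum>k\<in>U. l k * \<beta> k) \<in> borel_measurable (PiM U (\<lambda>_. lborel))"
    by (intro borel_measurable_sum borel_measurable_times) auto
  note [measurable] = this
  have "(\<integral>\<^sup>+\<beta>. ennreal (exp (- (\<Sum>k\<in>U. l k * \<beta> k))) \<partial>nu_fin U w \<eta>) =
     (\<integral>\<^sup>+\<beta>. ennreal (?D (\<lambda>_. 1) \<beta>) * ennreal (exp (- (\<Sum>k\<in>U. l k * \<beta> k))) \<partial>PiM U (\<lambda>_. lborel))"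
    unfolding dens by (rule nn_integral_density) measurable
  also have "\<dots> = (\<integral>\<^sup>+\<beta>. ennreal (?n * exp (\<Sum>k\<in>U. \<eta> k) * exp (- ?X / 2)) * ennreal (potential_kernel U \<eta> m \<beta>) \<partial>PiM U (\<lambda>_. lborel))"
  proof (intro nn_integral_cong)
    fix \<beta> :: "'v \<Rightarrow> real"
    have "(\<Sum>i\<in>U. \<Sum>j\<in>U. m i * H_mat w \<beta> i j * m j) = (\<Sum>i\<in>U. \<Sum>j\<in>U. 1 * H_mat w \<beta> i j * 1) + 2 * (\<Sum>k\<in>U. l k * \<beta> k) - ?X"
    proof -
      have "m i * H_mat w \<beta> i j * m j = 1 * H_mat w \<beta> i j * 1 + (if j = i then 2 * (l i * \<beta> i) else 0) - w i j * (m i * m j - 1)" for i j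
      proof (cases "j = i")
        case True
        have mm: "m i * m i = 1 + l i" using m(2)[of i] by (simp add: power2_eq_square)
        have "m i * H_mat w \<beta> i j * m j = (2 * \<beta> i - w i i) * (m i * m i)" by (simp add: H_mat_def True)
        also have "\<dots> = 1 * H_mat w \<beta> i j * 1 + (if j = i then 2 * (l i * \<beta> i) else 0) - w i j * (m i * m j - 1)"
          unfolding True mm by (simp add: H_mat_def algebra_simps)
        finally show ?thesis .
      qed (simp add: H_mat_def algebra_simps)
      then show ?thesis using U by (simp add: sum.distrib sum_subtractf sum_distrib_left sum.delta')
    qed
    then have e: "exp (- ((\<Sum>i\<in>U. \<Sum>j\<in>U. 1 * H_mat w \<beta> i j * 1) + Q) / 2) * exp (- (\<Sum>k\<in>U. l k * \<beta> k)) =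
        exp (- ?X / 2) * exp (- ((\<Sum>i\<in>U. \<Sum>j\<in>U. m i * H_mat w \<beta> i j * m j) + Q) / 2)" for Q
      unfolding exp_add[symmetric] by (intro arg_cong[where f=exp]) (simp add: field_simps)
    have "potential_kernel U \<eta> (\<lambda>_. 1) \<beta> * exp (- (\<Sum>k\<in>U. l k * \<beta> k)) = exp (- ?X / 2) * potential_kernel U \<eta> m \<beta>"
    proof (cases "pos_def_on U (H_mat w \<beta>)")
      case True
      show ?thesis unfolding potential_kernel_def if_P[OF True] times_divide_eq_left times_divide_eq_right e by (rule refl)
    qed (simp add: potential_kernel_def)
    then have "?D (\<lambda>_. 1) \<beta> * exp (- (\<Sum>k\<in>U. l k * \<beta> k)) = ?n * exp (\<Sum>k\<in>U. \<eta> k) * exp (- ?X / 2) * potential_kernel U \<eta> m \<beta>"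
      by (simp add: mult.assoc)
    then show "ennreal (?D (\<lambda>_. 1) \<beta>) * ennreal (exp (- (\<Sum>k\<in>U. l k * \<beta> k))) =
       ennreal (?n * exp (\<Sum>k\<in>U. \<eta> k) * exp (- ?X / 2)) * ennreal (potential_kernel U \<eta> m \<beta>)"
      using potential_kernel_nonneg[OF U] by (simp add: ennreal_mult[symmetric])
  qed
  also have "\<dots> = ennreal (?n * exp (\<Sum>k\<in>U. \<eta> k) * exp (- ?X / 2)) *
      ennreal ((\<Prod>k\<in>U. sqrt (pi / 2) / m k) * exp (- (\<Sum>k\<in>U. \<eta> k * m k)))"
    using potential_kernel_integral[OF U m(1) \<eta>] by (subst nn_integral_cmult) auto
  also have "\<dots> = ennreal ((?n * exp (\<Sum>k\<in>U. \<eta> k) * exp (- ?X / 2)) * ((\<Prod>k\<in>U. sqrt (pi / 2) / m k) * exp (- (\<Sum>k\<in>U. \<eta> k * m k))))"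
    by (rule ennreal_mult'[symmetric]) simp
  also have "(?n * exp (\<Sum>k\<in>U. \<eta> k) * exp (- ?X / 2)) * ((\<Prod>k\<in>U. sqrt (pi / 2) / m k) * exp (- (\<Sum>k\<in>U. \<eta> k * m k))) =
     (\<Prod>k\<in>U. 1 / m k) * exp (- ?X / 2 - (\<Sum>k\<in>U. \<eta> k * (m k - 1)))"
  proof -
    have n: "?n * (\<Prod>k\<in>U. sqrt (pi / 2) / m k) = (\<Prod>k\<in>U. 1 / m k)"
    proof -
      have "?n = sqrt (2 / pi) ^ card U"
        by (simp add: powr_half_sqrt[symmetric] powr_realpow[symmetric] powr_powr)
      then have "?n * (\<Prod>k\<in>U. sqrt (pi / 2) / m k) = (\<Prod>k\<in>U. sqrt (2 / pi) * (sqrt (pi / 2) / m k))"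
        unfolding prod.distrib prod_constant by simp
      also have "\<dots> = (\<Prod>k\<in>U. 1 / m k)"
        by (intro prod.cong refl) (simp add: real_sqrt_mult[symmetric])
      finally show ?thesis .
    qed
    have e: "exp (\<Sum>k\<in>U. \<eta> k) * exp (- ?X / 2) * exp (- (\<Sum>k\<in>U. \<eta> k * m k)) = exp (- ?X / 2 - (\<Sum>k\<in>U. \<eta> k * (m k - 1)))"
      unfolding exp_add[symmetric] by (intro arg_cong[where f=exp]) (simp add: algebra_simps sum_subtractf)
    have "(a * b * c) * (d * f) = (a * d) * (b * c * f)" for a b c d f :: real by simp
    then show ?thesis unfolding n[symmetric] e[symmetric] by blast
  qed
  finally show ?thesis .
qed

end

section \<open>Uniqueness of Laplace transforms\<close>

text \<open>
  By the Weierstrass theorem equality of the moments extends to integrals of continuous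
  functions, and these approximate the indicators of half-lines.
\<close>

lemma moments_determine_measure:
  assumes M: "finite_borel_measure M" "finite_borel_measure N"
    and supp: "AE x in M. x \<in> {0..1}" "AE x in N. x \<in> {0..1}"
    and mom: "\<And>n::nat. (LINT x|M. x ^ n) = (LINT x|N. x ^ n)"
  shows "M = N"
proof -
  interpret M: finite_borel_measure M by (rule M)
  interpret N: finite_borel_measure N by (rule M)
  have int: "integrable K f" if "finite_borel_measure K" "AE x in K. x \<in> {0..1}" "continuous_on UNIV f" 
    for K and f :: "real \<Rightarrow> real"
  proof -
    interpret K: finite_borel_measure K by (rule that)
    have "compact (f ` {0..1})" using that(3) continuous_on_subset by (intro compact_continuous_image) blast+
    then obtain b where b: "\<forall>y\<in>f ` {0..1}. norm y \<le> b" using compact_imp_bounded bounded_iff by blast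
    show ?thesis
    proof (rule K.integrable_const_bound)
      show "AE x in K. norm (f x) \<le> b" using that(2) by eventually_elim (use b in auto)
      show "f \<in> borel_measurable K"
        using borel_measurable_continuous_onI[OF that(3)] K.M_is_borel by (simp cong: measurable_cong_sets)
    qed
  qed
  have cont: "(LINT x|M. f x) = (LINT x|N. f x)" if f: "continuous_on UNIV f" for f :: "real \<Rightarrow> real"
  proof -
    define mm where "mm = measure M (space M) + measure N (space N)"
    have mm: "0 \<le> mm" by (simp add: mm_def)
    have "\<bar>(LINT x|M. f x) - (LINT x|N. f x)\<bar> \<le> e" if e: "0 < e" for e
    proof -
      define \<delta> where "\<delta> = e / (mm + 1)"
      have \<delta>: "0 < \<delta>" "\<delta> * mm \<le> e" using e mm by (auto simp: \<delta>_def field_simps)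
      obtain g where g: "real_polynomial_function g" "\<And>x. x \<in> {0..1} \<Longrightarrow> \<bar>f x - g x\<bar> < \<delta>"
        using Stone_Weierstrass_real_polynomial_function[of "{0..1}" f \<delta>] f continuous_on_subset \<delta>(1) by blast
      obtain a n where ge: "g = (\<lambda>x. \<Sum>i\<le>n. a i * x ^ i)"
        using g(1) real_polynomial_function_iff_sum by blast
      have gc: "continuous_on UNIV g" unfolding ge by (intro continuous_intros)
      have geq: "(LINT x|M. g x) = (LINT x|N. g x)"
      proof -
        have p: "integrable K (\<lambda>x. a i * x ^ i)" if "finite_borel_measure K" "AE x in K. x \<in> {0..1}" for K i
          by (rule int[OF that]) (intro continuous_intros)
        show ?thesis unfolding ge using p[OF M(1) supp(1)] p[OF M(2) supp(2)] by (simp add: mom)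
      qed
      have diff: "\<bar>(LINT x|K. f x) - (LINT x|K. g x)\<bar> \<le> \<delta> * measure K (space K)"
        if K: "finite_borel_measure K" "AE x in K. x \<in> {0..1}" for K
      proof -
        interpret K: finite_borel_measure K by (rule K)
        have "(LINT x|K. f x) - (LINT x|K. g x) = (LINT x|K. f x - g x)"
          using int[OF K f] int[OF K gc] by simp
        also have "\<bar>\<dots>\<bar> \<le> (LINT x|K. \<bar>f x - g x\<bar>)" by (rule integral_abs_bound)
        also have "\<dots> \<le> (LINT x|K. \<delta>)"
        proof (rule integral_mono_AE)
          show "integrable K (\<lambda>x. \<bar>f x - g x\<bar>)" using int[OF K f] int[OF K gc] by simp
          show "AE x in K. \<bar>f x - g x\<bar> \<le> \<delta>" using K(2)
          proof eventually_elim
            case (elim x)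
            show ?case using g(2)[OF elim] by simp
          qed
        qed simp
        finally show ?thesis by (simp add: mult.commute)
      qed
      have "\<bar>(LINT x|M. f x) - (LINT x|N. f x)\<bar> \<le> \<delta> * measure M (space M) + \<delta> * measure N (space N)"
        using diff[OF M(1) supp(1)] diff[OF M(2) supp(2)] geq by linarith
      also have "\<dots> = \<delta> * mm" by (simp add: mm_def algebra_simps)
      finally show ?thesis using \<delta>(2) by linarith
    qed
    then have "\<bar>(LINT x|M. f x) - (LINT x|N. f x)\<bar> \<le> 0" by (rule field_le_epsilon[of _ 0, simplified]) 
    then show ?thesis by simp
  qed
  have "cdf M = cdf N"
  proof
    fix a
    define f where "f m x = max 0 (min 1 (1 - real m * (x - a)))" for m :: nat and x
    have fc: "continuous_on UNIV (f m)" for m unfolding f_def by (intro continuous_intros)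
    have pt: "(\<lambda>m. f m x) \<longlonglongrightarrow> indicator {..a} x" for x
    proof (cases "x \<le> a")
      case True
      then have "real m * (x - a) \<le> 0" for m by (simp add: mult_nonneg_nonpos)
      then have "f m x = 1" for m unfolding f_def by (smt (verit))
      then show ?thesis using True by simp
    next
      case False
      then obtain m0 :: nat where m0: "1 / (x - a) < real m0" using reals_Archimedean2 by blast
      have "f m x = 0" if "m0 \<le> m" for m
      proof -
        have "1 / (x - a) < real m" using m0 that by (simp add: less_le_trans)
        then have "1 < real m * (x - a)" using False by (simp add: field_simps)
        then show ?thesis unfolding f_def by (smt (verit))
      qed
      then have "\<forall>\<^sub>F m in sequentially. f m x = indicator {..a} x"
        using False by (auto simp: eventually_sequentially)
      then show ?thesis by (rule tendsto_eventually)
    qed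
    have lim: "(\<lambda>m. LINT x|K. f m x) \<longlonglongrightarrow> cdf K a" if K: "finite_borel_measure K" for K
    proof -
      interpret K: finite_borel_measure K by (rule K)
      have "(\<lambda>m. LINT x|K. f m x) \<longlonglongrightarrow> (LINT x|K. indicator {..a} x)"
      proof (rule integral_dominated_convergence[where w="\<lambda>_. 1"])
        show "f m \<in> borel_measurable K" for m
          using borel_measurable_continuous_onI[OF fc] K.M_is_borel by (simp cong: measurable_cong_sets)
        show "(\<lambda>x. indicator {..a} x) \<in> borel_measurable K" using K.M_is_borel by simp
        show "AE x in K. norm (f m x) \<le> 1" for m by (intro AE_I2) (auto simp: f_def)
      qed (auto simp: pt)
      then show ?thesis using K.M_is_borel by (simp add: cdf_def sets_eq_imp_space_eq)
    qed
    show "cdf M a = cdf N a"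
    proof (rule LIMSEQ_unique[OF lim[OF M(1)]])
      show "(\<lambda>m. LINT x|M. f m x) \<longlonglongrightarrow> cdf N a" using lim[OF M(2)] by (simp only: cont[OF fc])
    qed
  qed
  then show ?thesis by (rule cdf_unique'[OF M])
qed

text \<open>
  The values of the Laplace transform at the natural numbers are the moments of \<open>exp (- x)\<close>,
  which lies in \<open>{0..1}\<close>.
\<close>

lemma laplace_determines_measure:
  assumes M: "finite_borel_measure M" "finite_borel_measure N"
    and supp: "AE x in M. 0 \<le> x" "AE x in N. 0 \<le> x"
    and eq: "\<And>n::nat. (\<integral>\<^sup>+x. ennreal (exp (- (real n * x))) \<partial>M) = (\<integral>\<^sup>+x. ennreal (exp (- (real n * x))) \<partial>N)"
  shows "M = N"
proof -
  define D where "D K = distr K borel (\<lambda>x::real. exp (- x))" for K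
  have m: "(\<lambda>x::real. exp (- x)) \<in> K \<rightarrow>\<^sub>M borel" if "finite_borel_measure K" for K
    using finite_borel_measure.M_is_borel[OF that] by (simp cong: measurable_cong_sets)
  have D: "finite_borel_measure (D K)" if K: "finite_borel_measure K" for K
    unfolding finite_borel_measure_def finite_borel_measure_axioms_def D_def
    using finite_measure.finite_measure_distr[OF _ m[OF K]] K by (simp add: finite_borel_measure_def)
  have s: "AE y in D K. y \<in> {0..1}" if K: "finite_borel_measure K" "AE x in K. 0 \<le> x" for K
    unfolding D_def by (subst AE_distr_iff[OF m[OF K(1)]]) (use K(2) in auto)
  have mom: "(LINT y|D K. y ^ n) = enn2real (\<integral>\<^sup>+x. ennreal (exp (- (real n * x))) \<partial>K)"
    if K: "finite_borel_measure K" for K and n :: nat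
  proof -
    have "(LINT y|D K. y ^ n) = (LINT x|K. exp (- x) ^ n)"
      unfolding D_def by (rule integral_distr[OF m[OF K]]) simp
    also have "\<dots> = (LINT x|K. exp (- (real n * x)))" by (simp add: exp_of_nat_mult[symmetric])
    also have "\<dots> = enn2real (\<integral>\<^sup>+x. ennreal (exp (- (real n * x))) \<partial>K)"
      using finite_borel_measure.M_is_borel[OF K] by (intro integral_eq_nn_integral) (auto cong: measurable_cong_sets)
    finally show ?thesis .
  qed
  have "D M = D N"
    by (rule moments_determine_measure[OF D[OF M(1)] D[OF M(2)] s[OF M(1) supp(1)] s[OF M(2) supp(2)]])
      (simp add: mom M eq)
  moreover have "distr (D K) borel (\<lambda>y. - ln y) = K" if K: "finite_borel_measure K" for K
  proof -
    have "distr (D K) borel (\<lambda>y. - ln y) = distr K borel ((\<lambda>y. - ln y) \<circ> (\<lambda>x. exp (- x)))"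
      unfolding D_def by (rule distr_distr[OF _ m[OF K]]) simp
    also have "\<dots> = distr K K (\<lambda>x. x)"
      using finite_borel_measure.M_is_borel[OF K] by (intro distr_cong) auto
    finally show ?thesis by (simp add: distr_id)
  qed
  ultimately show ?thesis using M by metis
qed

text \<open>
  One coordinate at a time, the exponential factor is replaced by the indicator of a Borel set:
  with all other factors as a weight, the image of the weighted measure under this coordinate is
  determined by its Laplace transform. After all coordinates are treated, the measures agree on
  boxes.
\<close>

lemma multivariate_laplace_determines_measure:
  fixes M N :: "('v \<Rightarrow> real) measure"
  assumes U: "finite U" and fM: "finite_measure M" "finite_measure N"
    and sM: "sets M = sets (PiM U (\<lambda>_. borel))" "sets N = sets (PiM U (\<lambda>_. borel))"
    and supp: "AE \<beta> in M. \<forall>k\<in>U. 0 \<le> \<beta> k" "AE \<beta> in N. \<forall>k\<in>U. 0 \<le> \<beta> k"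
    and eq: "\<And>l::'v \<Rightarrow> nat. (\<integral>\<^sup>+\<beta>. ennreal (exp (- (\<Sum>k\<in>U. real (l k) * \<beta> k))) \<partial>M) =
       (\<integral>\<^sup>+\<beta>. ennreal (exp (- (\<Sum>k\<in>U. real (l k) * \<beta> k))) \<partial>N)"
  shows "M = N"
proof -
  have cM: "(\<lambda>\<beta>. \<beta> k) \<in> borel_measurable K" if "sets K = sets (PiM U (\<lambda>_. borel))" "k \<in> U" for K :: "('v \<Rightarrow> real) measure" and k
    using measurable_component_singleton[OF that(2), of "\<lambda>_. borel"] that(1) by (simp cong: measurable_cong_sets)
  have mixed: "(\<integral>\<^sup>+\<beta>. (\<Prod>k\<in>S. indicator (A k) (\<beta> k)) * ennreal (exp (- (\<Sum>k\<in>U - S. real (l k) * \<beta> k))) \<partial>M) =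
      (\<integral>\<^sup>+\<beta>. (\<Prod>k\<in>S. indicator (A k) (\<beta> k)) * ennreal (exp (- (\<Sum>k\<in>U - S. real (l k) * \<beta> k))) \<partial>N)"
    if S: "S \<subseteq> U" and A: "\<And>k. A k \<in> sets borel" for S and A :: "'v \<Rightarrow> real set" and l :: "'v \<Rightarrow> nat"
  proof -
    have "finite S" using S U finite_subset by blast
    then show ?thesis using S
    proof (induction S arbitrary: l)
      case empty
      then show ?case using eq[of l] by simp
    next
      case (insert i S)
      have i: "i \<in> U" "i \<notin> S" using insert by auto
      define g where "g \<beta> = (\<Prod>k\<in>S. indicator (A k) (\<beta> k)) * ennreal (exp (- (\<Sum>k\<in>U - insert i S. real (l k) * \<beta> k)))" for \<beta>
      \<comment> \<open>The weight is at most 1 on the nonnegative orthant, so restricted to it the measure is finite.\<close>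
      define \<mu> where "\<mu> K = distr (density K (\<lambda>\<beta>. g \<beta> * indicator {\<beta>. \<forall>k\<in>U. 0 \<le> \<beta> k} \<beta>)) borel (\<lambda>\<beta>. \<beta> i)" for K
      have gm: "(\<lambda>\<beta>. g \<beta> * indicator {\<beta>. \<forall>k\<in>U. 0 \<le> \<beta> k} \<beta>) \<in> borel_measurable K" if K: "sets K = sets (PiM U (\<lambda>_. borel))" for K
      proof -
        have "g \<in> borel_measurable K" unfolding g_def[abs_def]
        proof (intro borel_measurable_times_ennreal borel_measurable_prod_ennreal)
          show "(\<lambda>\<beta>. indicator (A k) (\<beta> k) :: ennreal) \<in> borel_measurable K" if "k \<in> S" for k
          proof -
            have [measurable]: "(\<lambda>\<beta>. \<beta> k) \<in> borel_measurable K" by (rule cM[OF K]) (use that insert.prems in auto)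
            note [measurable] = A[of k]
            show ?thesis by measurable
          qed
          have "(\<lambda>\<beta>. \<Sum>k\<in>U - insert i S. real (l k) * \<beta> k) \<in> borel_measurable K"
            using cM[OF K] by (intro borel_measurable_sum borel_measurable_times) auto
          then show "(\<lambda>\<beta>. ennreal (exp (- (\<Sum>k\<in>U - insert i S. real (l k) * \<beta> k)))) \<in> borel_measurable K" by measurable
        qed
        moreover have "(\<lambda>\<beta>. indicator {\<beta>. \<forall>k\<in>U. 0 \<le> \<beta> k} \<beta> :: ennreal) \<in> borel_measurable K"
        proof -
          have "{\<beta> \<in> space K. \<forall>k\<in>U. 0 \<le> \<beta> k} \<in> sets K"
            using cM[OF K] U by (intro sets.sets_Collect_finite_All borel_measurable_le) auto
          moreover have "{\<beta>. \<forall>k\<in>U. 0 \<le> \<beta> k} \<inter> space K = {\<beta> \<in> space K. \<forall>k\<in>U. 0 \<le> \<beta> k}" by auto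
          ultimately show ?thesis by (simp add: borel_measurable_indicator_iff)
        qed
        ultimately show ?thesis by (rule borel_measurable_times_ennreal)
      qed
      have int: "(\<integral>\<^sup>+x. h x \<partial>\<mu> K) = (\<integral>\<^sup>+\<beta>. g \<beta> * h (\<beta> i) \<partial>K)"
        if K: "sets K = sets (PiM U (\<lambda>_. borel))" "AE \<beta> in K. \<forall>k\<in>U. 0 \<le> \<beta> k" and h: "h \<in> borel_measurable borel"
        for K and h :: "real \<Rightarrow> ennreal"
      proof -
        have c: "(\<lambda>\<beta>. \<beta> i) \<in> borel_measurable K" by (rule cM[OF K(1) i(1)])
        have "(\<integral>\<^sup>+x. h x \<partial>\<mu> K) = (\<integral>\<^sup>+\<beta>. h (\<beta> i) \<partial>density K (\<lambda>\<beta>. g \<beta> * indicator {\<beta>. \<forall>k\<in>U. 0 \<le> \<beta> k} \<beta>))"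
          unfolding \<mu>_def using c h by (intro nn_integral_distr) auto
        also have "\<dots> = (\<integral>\<^sup>+\<beta>. (g \<beta> * indicator {\<beta>. \<forall>k\<in>U. 0 \<le> \<beta> k} \<beta>) * h (\<beta> i) \<partial>K)"
          using gm[OF K(1)] c h by (intro nn_integral_density) auto
        also have "\<dots> = (\<integral>\<^sup>+\<beta>. g \<beta> * h (\<beta> i) \<partial>K)"
          by (rule nn_integral_cong_AE) (use K(2) in \<open>eventually_elim, simp\<close>)
        finally show ?thesis .
      qed
      have one: "finite_borel_measure (\<mu> K)" "AE x in \<mu> K. 0 \<le> x"
        if K: "sets K = sets (PiM U (\<lambda>_. borel))" "AE \<beta> in K. \<forall>k\<in>U. 0 \<le> \<beta> k" "finite_measure K" for K
      proof -
        interpret K: finite_measure K by (rule K)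
        have c: "(\<lambda>\<beta>. \<beta> i) \<in> borel_measurable K" by (rule cM[OF K(1) i(1)])
        have g1: "g \<beta> * indicator {\<beta>. \<forall>k\<in>U. 0 \<le> \<beta> k} \<beta> \<le> 1" for \<beta>
        proof (cases "\<forall>k\<in>U. 0 \<le> \<beta> k")
          case True
          have "(\<Prod>k\<in>S. indicator (A k) (\<beta> k) :: ennreal) \<le> 1"
            by (intro prod_le_1) (auto simp: indicator_def)
          moreover have "exp (- (\<Sum>k\<in>U - insert i S. real (l k) * \<beta> k)) \<le> 1"
            using True by (auto intro!: sum_nonneg)
          ultimately have "g \<beta> \<le> 1 * 1" unfolding g_def by (intro mult_mono) auto
          then show ?thesis using True by simp
        qed simp
        have "emeasure (\<mu> K) (space (\<mu> K)) = (\<integral>\<^sup>+\<beta>. g \<beta> * indicator {\<beta>. \<forall>k\<in>U. 0 \<le> \<beta> k} \<beta> \<partial>K)"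
        proof -
          have "emeasure (\<mu> K) (space (\<mu> K)) = emeasure (density K (\<lambda>\<beta>. g \<beta> * indicator {\<beta>. \<forall>k\<in>U. 0 \<le> \<beta> k} \<beta>)) (space K)"
            unfolding \<mu>_def using c by (subst emeasure_distr) auto
          also have "\<dots> = (\<integral>\<^sup>+\<beta>. g \<beta> * indicator {\<beta>. \<forall>k\<in>U. 0 \<le> \<beta> k} \<beta> \<partial>K)"
            using gm[OF K(1)] by (subst emeasure_density) (auto intro!: nn_integral_cong)
          finally show ?thesis .
        qed
        also have "\<dots> \<le> (\<integral>\<^sup>+\<beta>. 1 \<partial>K)" by (intro nn_integral_mono g1)
        also have "\<dots> < \<infinity>" by (simp add: K.emeasure_finite less_top[symmetric])
        finally have "finite_measure (\<mu> K)" by (intro finite_measureI) auto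
        then show "finite_borel_measure (\<mu> K)"
          unfolding finite_borel_measure_def finite_borel_measure_axioms_def by (simp add: \<mu>_def)
        show "AE x in \<mu> K. 0 \<le> x"
          unfolding \<mu>_def using c gm[OF K(1)] i(1)
          by (subst AE_distr_iff) (auto simp: AE_density indicator_def)
      qed
      have "\<mu> M = \<mu> N"
      proof (rule laplace_determines_measure[OF one(1)[OF sM(1) supp(1) fM(1)] one(1)[OF sM(2) supp(2) fM(2)]
            one(2)[OF sM(1) supp(1) fM(1)] one(2)[OF sM(2) supp(2) fM(2)]])
        fix n :: nat
        have e: "g \<beta> * ennreal (exp (- (real n * \<beta> i))) =
           (\<Prod>k\<in>S. indicator (A k) (\<beta> k)) * ennreal (exp (- (\<Sum>k\<in>U - S. real ((l(i := n)) k) * \<beta> k)))" for \<beta>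
        proof -
          have US: "U - S = insert i (U - insert i S)" using i by auto
          have "(\<Sum>k\<in>U - S. real ((l(i := n)) k) * \<beta> k) = real n * \<beta> i + (\<Sum>k\<in>U - insert i S. real ((l(i := n)) k) * \<beta> k)"
            by (subst US, subst sum.insert) (use U in simp_all)
          also have "(\<Sum>k\<in>U - insert i S. real ((l(i := n)) k) * \<beta> k) = (\<Sum>k\<in>U - insert i S. real (l k) * \<beta> k)"
            by (intro sum.cong) auto
          finally have sum: "(\<Sum>k\<in>U - S. real ((l(i := n)) k) * \<beta> k) = real n * \<beta> i + (\<Sum>k\<in>U - insert i S. real (l k) * \<beta> k)" .
          have "ennreal (exp (- b)) * ennreal (exp (- a)) = ennreal (exp (- (a + b)))" for a b :: real
            unfolding ennreal_mult'[OF exp_ge_zero, symmetric] exp_add[symmetric] by (simp add: add.commute)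
          then show ?thesis unfolding g_def sum mult.assoc by (rule arg_cong)
        qed
        show "(\<integral>\<^sup>+x. ennreal (exp (- (real n * x))) \<partial>\<mu> M) = (\<integral>\<^sup>+x. ennreal (exp (- (real n * x))) \<partial>\<mu> N)"
          using int[OF sM(1) supp(1), of "\<lambda>x. ennreal (exp (- (real n * x)))"]
            int[OF sM(2) supp(2), of "\<lambda>x. ennreal (exp (- (real n * x)))"] insert.IH[of "l(i := n)"] insert.prems
          unfolding e by simp
      qed
      then have "(\<integral>\<^sup>+\<beta>. g \<beta> * indicator (A i) (\<beta> i) \<partial>M) = (\<integral>\<^sup>+\<beta>. g \<beta> * indicator (A i) (\<beta> i) \<partial>N)"
        using int[OF sM(1) supp(1), of "indicator (A i)"] int[OF sM(2) supp(2), of "indicator (A i)"] A[of i] by simp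
      then show ?case unfolding g_def using insert(1,2) by (simp add: mult_ac)
    qed
  qed
  have box: "emeasure M (Pi\<^sub>E U A) = emeasure N (Pi\<^sub>E U A)" if A: "\<And>i. i \<in> U \<Longrightarrow> A i \<in> sets borel" for A
  proof -
    define A' where "A' k = (if k \<in> U then A k else {})" for k
    have A': "A' k \<in> sets borel" for k using A by (simp add: A'_def)
    have e: "emeasure K (Pi\<^sub>E U A) = (\<integral>\<^sup>+\<beta>. (\<Prod>k\<in>U. indicator (A' k) (\<beta> k)) \<partial>K)"
      if K: "sets K = sets (PiM U (\<lambda>_. borel))" for K :: "('v \<Rightarrow> real) measure"
    proof -
      have "Pi\<^sub>E U A \<in> sets K" unfolding K by (rule sets_PiM_I_finite[OF U]) (use A in auto)
      then have "emeasure K (Pi\<^sub>E U A) = (\<integral>\<^sup>+\<beta>. indicator (Pi\<^sub>E U A) \<beta> \<partial>K)" by simp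
      also have "\<dots> = (\<integral>\<^sup>+\<beta>. (\<Prod>k\<in>U. indicator (A' k) (\<beta> k)) \<partial>K)"
      proof (intro nn_integral_cong)
        fix \<beta> assume "\<beta> \<in> space K"
        then have "\<beta> \<in> extensional U" using sets_eq_imp_space_eq[OF K] by (auto simp: space_PiM PiE_def)
        then have "\<beta> \<in> Pi\<^sub>E U A \<longleftrightarrow> (\<forall>k\<in>U. \<beta> k \<in> A' k)" by (auto simp: PiE_def A'_def)
        then show "indicator (Pi\<^sub>E U A) \<beta> = (\<Prod>k\<in>U. indicator (A' k) (\<beta> k) :: ennreal)"
          using U by (auto simp: indicator_def)
      qed
      finally show ?thesis .
    qed
    show ?thesis using mixed[OF order_refl A'] unfolding e[OF sM(1)] e[OF sM(2)] by simp
  qed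
  show ?thesis
  proof (rule measure_eqI_PiM_finite[OF U sM box])
    show "range (\<lambda>_::nat. Pi\<^sub>E U (\<lambda>_. UNIV)) \<subseteq> prod_algebra U (\<lambda>_. borel :: real measure)"
      using U by (auto intro!: prod_algebraI_finite)
    show "(\<Union>i::nat. Pi\<^sub>E U (\<lambda>_. UNIV)) = space (PiM U (\<lambda>_. borel :: real measure))" by (simp add: space_PiM)
    show "emeasure M (Pi\<^sub>E U (\<lambda>_. UNIV)) \<noteq> \<infinity>" for i :: nat
      using finite_measure.emeasure_finite[OF fM(1)] by simp
  qed
qed

section \<open>Weighted graphs\<close>

locale weighted_graph =
  fixes V :: "'v set" and E :: "'v set set" and W :: "'v set \<Rightarrow> real"
  assumes simple: "simple_graph V E" and connected: "connected_on E V" and locfin: "locally_finite V E"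
    and W_pos: "e \<in> E \<Longrightarrow> 0 < W e"
begin

lemma edge_in_V: "{i, j} \<in> E \<Longrightarrow> i \<in> V \<and> j \<in> V \<and> i \<noteq> j"
  using simple unfolding simple_graph_def by (force simp: doubleton_eq_iff)

lemma nbrs_sym: "j \<in> nbrs E i \<longleftrightarrow> i \<in> nbrs E j"
  by (simp add: nbrs_def insert_commute)

lemma nbrsD: "j \<in> nbrs E i \<Longrightarrow> i \<in> V \<and> j \<in> V \<and> i \<noteq> j \<and> {i, j} \<in> E"
  using edge_in_V by (auto simp: nbrs_def)

lemma finite_nbrs: "finite (nbrs E i)"
proof (cases "i \<in> V")
  case True then show ?thesis using locfin by (simp add: locally_finite_def)
next
  case False
  then have "nbrs E i = {}" using nbrsD by blast
  then show ?thesis by simp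
qed

lemma not_self_nbr: "i \<notin> nbrs E i" using nbrsD by blast

lemma weight_sym: "weight E W i j = weight E W j i"
  by (simp add: weight_def insert_commute)

lemma weight_nonneg: "0 \<le> weight E W i j"
  using W_pos by (auto simp: weight_def less_imp_le)

lemma weight_pos: "j \<in> nbrs E i \<Longrightarrow> 0 < weight E W i j"
  using W_pos by (auto simp: weight_def nbrs_def)

lemma weight_zero: "j \<notin> nbrs E i \<Longrightarrow> weight E W i j = 0"
  by (simp add: weight_def nbrs_def)

sublocale coupling "weight E W"
  by standard (rule weight_sym, rule weight_nonneg)

lemma sum_weight_superset:
  assumes "finite S" "nbrs E i \<subseteq> S"
  shows "(\<Sum>k\<in>S. weight E W i k * f k) = (\<Sum>k\<in>nbrs E i. weight E W i k * f k)"
  using assms by (intro sum.mono_neutral_right) (auto simp: weight_zero)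

end

section \<open>The trajectory density depends on the local times only\<close>

text \<open>
  The sum runs over ordered pairs, so every edge is counted twice and the factor \<open>1 / 2\<close>
  compensates.
\<close>

definition interaction :: "('v \<Rightarrow> 'v \<Rightarrow> real) \<Rightarrow> 'v set \<Rightarrow> ('v \<Rightarrow> real) \<Rightarrow> real" where
  "interaction w S m = (\<Sum>i\<in>S. \<Sum>j\<in>S. w i j * (m i * m j - 1)) / 2"

context weighted_graph
begin

lemma interaction_update:
  assumes S: "finite S" "i \<in> S" "nbrs E i \<subseteq> S"
  shows "interaction (weight E W) S (m(i := b)) =
    interaction (weight E W) S m + (\<Sum>k\<in>nbrs E i. weight E W i k * m k) * (b - m i)"
proof -
  let ?w = "weight E W"
  have wii: "?w i i = 0" by (rule weight_zero[OF not_self_nbr])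
  have e: "?w k l * ((m(i := b)) k * (m(i := b)) l - 1) = ?w k l * (m k * m l - 1) +
      of_bool (k = i) * (?w i l * m l * (b - m i)) + of_bool (l = i) * (?w i k * m k * (b - m i))" for k l
    using wii weight_sym[of k i] by (auto simp: algebra_simps)
  have 1: "(\<Sum>k\<in>S. \<Sum>l\<in>S. of_bool (k = i) * (?w i l * m l * (b - m i))) = (\<Sum>l\<in>S. ?w i l * m l * (b - m i))"
    unfolding sum_distrib_left[symmetric] by (rule sum_of_bool_mult(2)[OF S(1,2)])
  have 2: "(\<Sum>k\<in>S. \<Sum>l\<in>S. of_bool (l = i) * (?w i k * m k * (b - m i))) = (\<Sum>l\<in>S. ?w i l * m l * (b - m i))"
    by (subst sum.swap) (rule 1)
  have 3: "(\<Sum>l\<in>S. ?w i l * m l * (b - m i)) = (\<Sum>k\<in>nbrs E i. ?w i k * m k) * (b - m i)"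
    unfolding sum_distrib_right[symmetric] sum_weight_superset[OF S(1,3)] ..
  show ?thesis unfolding interaction_def e sum.distrib 1 2 3 by simp
qed

text \<open>
  A step from \<open>i\<close> raises only \<open>m i\<close>, say to \<open>b\<close>. The exponent of its density is minus the
  resulting change of the interaction, which is affine in \<open>m i\<close>, and the factor
  \<open>m j / b\<close> transports \<open>(\<Prod>j. 1 / m j) * m (\<sigma> n)\<close> along the walk. So
  the product telescopes, and only the final local times and the last site remain.
\<close>

lemma prod_step_density:
  assumes x: "\<And>k. 0 \<le> x k" and S: "finite S"
    and walk: "\<And>k. k < n \<Longrightarrow> \<sigma> (Suc k) \<in> nbrs E (\<sigma> k)"
    and inS: "\<And>k. k \<le> n \<Longrightarrow> \<sigma> k \<in> S" "\<And>k. k < n \<Longrightarrow> nbrs E (\<sigma> k) \<subseteq> S"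
  defines "m \<equiv> (\<lambda>n j. sqrt (1 + site_time \<sigma> x n j))"
  shows "(\<Prod>k<n. step_density E W \<sigma> x k) =
    (\<Prod>k<n. weight E W (\<sigma> k) (\<sigma> (Suc k)) / 2) * (\<Prod>j\<in>S. 1 / m n j) * m n (\<sigma> n) * exp (- interaction (weight E W) S (m n))"
  using walk inS
proof (induction n)
  case 0
  have "m 0 j = 1" for j by (simp add: m_def site_time_def)
  then show ?case by (simp add: interaction_def)
next
  case (Suc n)
  let ?i = "\<sigma> n" and ?j = "\<sigma> (Suc n)" and ?w = "weight E W"
  have ij: "?i \<noteq> ?j" using Suc.prems(1)[of n] nbrsD by blast
  have iS: "?i \<in> S" "nbrs E ?i \<subseteq> S" using Suc.prems by auto
  define b where "b = sqrt (1 + site_time \<sigma> x n ?i + x n)"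
  have mpos: "0 < m n k" for k n using site_time_nonneg[of x \<sigma> n k, OF x] by (simp add: m_def add_pos_nonneg)
  have bpos: "0 < b" using site_time_nonneg[of x \<sigma> n ?i, OF x] x[of n] by (simp add: b_def add_pos_nonneg)
  have m': "m (Suc n) = (m n)(?i := b)"
    by (auto simp: m_def site_time_Suc b_def fun_eq_iff add.assoc)
  have sd: "step_density E W \<sigma> x n = ?w ?i ?j * m n ?j * (1 / (2 * b)) *
     exp (- ((\<Sum>k\<in>nbrs E ?i. ?w ?i k * m n k) * (b - m n ?i)))"
    unfolding step_density_def m_def b_def by simp
  have pr: "(\<Prod>j\<in>S. 1 / m (Suc n) j) * b = (\<Prod>j\<in>S. 1 / m n j) * m n ?i"
  proof -
    have "(\<Prod>j\<in>S. 1 / m (Suc n) j) = 1 / b * (\<Prod>j\<in>S - {?i}. 1 / m (Suc n) j)"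
      using prod.remove[OF S iS(1), of "\<lambda>j. 1 / m (Suc n) j"] by (simp add: m')
    also have "(\<Prod>j\<in>S - {?i}. 1 / m (Suc n) j) = (\<Prod>j\<in>S - {?i}. 1 / m n j)"
      by (intro prod.cong) (auto simp: m')
    finally have 1: "(\<Prod>j\<in>S. 1 / m (Suc n) j) = 1 / b * (\<Prod>j\<in>S - {?i}. 1 / m n j)" .
    have 2: "(\<Prod>j\<in>S. 1 / m n j) = 1 / m n ?i * (\<Prod>j\<in>S - {?i}. 1 / m n j)"
      by (rule prod.remove[OF S iS(1)])
    show ?thesis unfolding 1 2 using bpos mpos[of n ?i] by simp
  qed
  have en: "exp (- interaction ?w S (m (Suc n))) =
      exp (- interaction ?w S (m n)) * exp (- ((\<Sum>k\<in>nbrs E ?i. ?w ?i k * m n k) * (b - m n ?i)))"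
    unfolding m' interaction_update[OF S iS] exp_add[symmetric] by simp
  have mj: "m (Suc n) ?j = m n ?j" using ij by (simp add: m')
  have IH: "(\<Prod>k<n. step_density E W \<sigma> x k) =
    (\<Prod>k<n. ?w (\<sigma> k) (\<sigma> (Suc k)) / 2) * (\<Prod>j\<in>S. 1 / m n j) * m n ?i * exp (- interaction ?w S (m n))"
    by (rule Suc.IH) (use Suc.prems in auto)
  have "(\<Prod>k<Suc n. step_density E W \<sigma> x k) =
    (\<Prod>k<n. ?w (\<sigma> k) (\<sigma> (Suc k)) / 2) * ((\<Prod>j\<in>S. 1 / m n j) * m n ?i) * exp (- interaction ?w S (m n)) *
    (?w ?i ?j * m n ?j * (1 / (2 * b)) * exp (- ((\<Sum>k\<in>nbrs E ?i. ?w ?i k * m n k) * (b - m n ?i))))"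
    by (simp add: IH sd mult.assoc)
  also have "\<dots> = (\<Prod>k<Suc n. ?w (\<sigma> k) (\<sigma> (Suc k)) / 2) * (\<Prod>j\<in>S. 1 / m (Suc n) j) * m n ?j *
     (exp (- interaction ?w S (m n)) * exp (- ((\<Sum>k\<in>nbrs E ?i. ?w ?i k * m n k) * (b - m n ?i))))"
    unfolding pr[symmetric] using bpos by simp
  finally show ?case unfolding en mj by simp
qed

end

section \<open>Closed walks\<close>

fun walk_prod :: "('v \<Rightarrow> 'v \<Rightarrow> real) \<Rightarrow> 'v list \<Rightarrow> real" where
  "walk_prod f (a # b # xs) = f a b * walk_prod f (b # xs)"
| "walk_prod f _ = 1"

lemma walk_prod_append: "walk_prod f (xs @ a # ys) = walk_prod f (xs @ [a]) * walk_prod f (a # ys)"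
proof (induction xs)
  case (Cons b xs)
  then show ?case by (cases xs) auto
qed simp

lemma walk_prod_join:
  assumes "xs \<noteq> []" "ys \<noteq> []" "last xs = hd ys"
  shows "walk_prod f (xs @ tl ys) = walk_prod f xs * walk_prod f ys"
proof -
  have x: "xs = butlast xs @ [hd ys]" using assms by (metis append_butlast_last_id)
  have y: "ys = hd ys # tl ys" using assms by simp
  have "walk_prod f (xs @ tl ys) = walk_prod f (butlast xs @ hd ys # tl ys)"
    by (subst x) simp
  also have "\<dots> = walk_prod f (butlast xs @ [hd ys]) * walk_prod f (hd ys # tl ys)" by (rule walk_prod_append)
  finally show ?thesis using x y by metis
qed

lemma walk_prod_link:
  assumes "xs \<noteq> []" "ys \<noteq> []"
  shows "walk_prod f (xs @ ys) = walk_prod f xs * f (last xs) (hd ys) * walk_prod f ys"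
proof -
  obtain zs a where x: "xs = zs @ [a]" using assms(1) by (cases xs rule: rev_cases) auto
  obtain b ws where y: "ys = b # ws" using assms(2) by (cases ys) auto
  show ?thesis unfolding x y using walk_prod_append[of f zs a "b # ws"] by simp
qed

lemma walk_prod_nth: "walk_prod f xs = (\<Prod>k<length xs - 1. f (xs ! k) (xs ! Suc k))"
proof (induction f xs rule: walk_prod.induct)
  case (1 f a b xs)
  have "(\<Prod>k<length (a # b # xs) - 1. f ((a # b # xs) ! k) ((a # b # xs) ! Suc k)) =
    f a b * (\<Prod>k<length (b # xs) - 1. f ((b # xs) ! k) ((b # xs) ! Suc k))"
    by (simp add: prod.lessThan_Suc_shift del: prod.lessThan_Suc)
  then show ?case using 1 by simp
qed simp_all

lemma walk_prod_nonneg: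
  assumes "successively P xs" "\<And>a b. P a b \<Longrightarrow> 0 \<le> f a b"
  shows "0 \<le> walk_prod f xs"
  using assms(1) by (induction xs rule: induct_list012) (auto intro!: mult_nonneg_nonneg assms(2))

lemma successively_nth: "successively P xs \<Longrightarrow> Suc k < length xs \<Longrightarrow> P (xs ! k) (xs ! Suc k)"
  by (simp add: successively_conv_nth)

context weighted_graph
begin

abbreviation "adj a b \<equiv> b \<in> nbrs E a"

definition walk_from_to :: "'v \<Rightarrow> 'v list \<Rightarrow> 'v \<Rightarrow> bool" where
  "walk_from_to a xs b \<longleftrightarrow> xs \<noteq> [] \<and> hd xs = a \<and> last xs = b \<and> successively adj xs"

lemma walk_exists:
  assumes "a \<in> V" "b \<in> V" shows "\<exists>xs. walk_from_to a xs b"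
proof -
  have "(a, b) \<in> {(a, b). a \<in> V \<and> b \<in> V \<and> {a, b} \<in> E}\<^sup>*"
    using connected assms unfolding connected_on_def by blast
  then show ?thesis
  proof (induction rule: rtrancl_induct)
    case base
    show ?case by (rule exI[of _ "[a]"]) (simp add: walk_from_to_def)
  next
    case (step b c)
    then obtain xs where xs: "walk_from_to a xs b" by blast
    have "adj b c" using step(2) by (simp add: nbrs_def)
    then have "walk_from_to a (xs @ [c]) c" using xs by (simp add: walk_from_to_def successively_append_iff)
    then show ?case by blast
  qed
qed

lemma walk_rev: "walk_from_to a xs b \<Longrightarrow> walk_from_to b (rev xs) a"
  unfolding walk_from_to_def by (simp add: hd_rev last_rev successively_rev nbrs_sym)

lemma walk_join:
  assumes "walk_from_to a xs b" "walk_from_to b ys c"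
  shows "walk_from_to a (xs @ tl ys) c" "walk_prod f (xs @ tl ys) = walk_prod f xs * walk_prod f ys"
    "set (xs @ tl ys) = set xs \<union> set ys"
proof -
  have ne: "xs \<noteq> []" "ys \<noteq> []" "last xs = hd ys" using assms by (auto simp: walk_from_to_def)
  show "walk_prod f (xs @ tl ys) = walk_prod f xs * walk_prod f ys" by (rule walk_prod_join[OF ne])
  obtain y zs where ys: "ys = y # zs" using ne by (cases ys) auto
  have last: "last xs = y" using ne ys by simp
  show "walk_from_to a (xs @ tl ys) c"
    using assms ne unfolding walk_from_to_def ys by (cases zs) (auto simp: successively_append_iff last)
  have "y \<in> set xs" using last ne(1) last_in_set by metis
  then show "set (xs @ tl ys) = set xs \<union> set ys" by (auto simp: ys)
qed

lemma walk_link: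
  assumes "walk_from_to a xs b" "walk_from_to c ys d" "adj b c"
  shows "walk_from_to a (xs @ ys) d" "walk_prod f (xs @ ys) = walk_prod f xs * f b c * walk_prod f ys"
  using assms walk_prod_link[of xs ys f] by (auto simp: walk_from_to_def successively_append_iff)

text \<open>
  For each vertex of \<open>U\<close>, a walk to it and back is inserted.
\<close>

lemma covering_walk:
  assumes "finite U" "U \<subseteq> V" "a \<in> V"
  shows "\<exists>xs. walk_from_to a xs a \<and> U \<subseteq> set xs"
  using assms(1,2)
proof (induction U)
  case empty
  show ?case by (rule exI[of _ "[a]"]) (simp add: walk_from_to_def)
next
  case (insert i U)
  then obtain xs where xs: "walk_from_to a xs a" "U \<subseteq> set xs" by auto
  obtain ys where ys: "walk_from_to a ys i" using walk_exists[OF assms(3), of i] insert.prems by auto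
  have zs: "walk_from_to a (ys @ tl (rev ys)) a" by (rule walk_join(1)[OF ys walk_rev[OF ys]])
  have "i \<in> set ys" using ys last_in_set unfolding walk_from_to_def by blast
  then have "insert i U \<subseteq> set (xs @ tl (ys @ tl (rev ys)))"
    using xs(2) unfolding walk_join(3)[OF xs(1) zs] by auto
  then show ?case using walk_join(1)[OF xs(1) zs] by blast
qed

end

text \<open>
  All the time prescribed for a site is spent at its first visit.
\<close>

lemma site_time_prescribed:
  assumes "\<And>j. 0 \<le> (l j :: real)"
  shows "\<exists>x. (\<forall>k. 0 \<le> x k) \<and> (\<forall>j. site_time \<sigma> x n j = (if j \<in> \<sigma> ` {..<n} then l j else 0))"
proof (induction n)
  case 0
  show ?case by (rule exI[of _ "\<lambda>_. 0"]) (simp add: site_time_def)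
next
  case (Suc n)
  then obtain x where x: "\<forall>k. 0 \<le> x k" "\<forall>j. site_time \<sigma> x n j = (if j \<in> \<sigma> ` {..<n} then l j else 0)" by blast
  define x' where "x' = x(n := if \<sigma> n \<in> \<sigma> ` {..<n} then 0 else l (\<sigma> n))"
  have "site_time \<sigma> x' n j = site_time \<sigma> x n j" for j
    unfolding site_time_def x'_def by (intro sum.cong) auto
  then have "site_time \<sigma> x' (Suc n) j = (if j \<in> \<sigma> ` {..<Suc n} then l j else 0)" for j
    unfolding site_time_Suc using x(2) by (auto simp: x'_def lessThan_Suc)
  moreover have "0 \<le> x' k" for k using x(1) assms by (simp add: x'_def)
  ultimately show ?case by blast
qed

section \<open>Cycle products of the environment\<close>

locale vrjp_environment = weighted_graph V E W
  for V :: "'v set" and E :: "'v set set" and W :: "'v set \<Rightarrow> real" +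
  fixes i0 :: 'v and R :: "('v \<times> 'v \<Rightarrow> real) measure"
  assumes i0: "i0 \<in> V" and infinite_V: "infinite V" and rep: "represents_vrjp V E W i0 R"
begin

sublocale R: prob_space R using rep by (simp add: represents_vrjp_def)

lemma sets_R: "sets R = sets (rate_space E)" using rep by (simp add: represents_vrjp_def)

lemma space_R: "space R = space (rate_space E)" by (rule sets_eq_imp_space_eq[OF sets_R])

lemma rate_measurable[measurable]: "j \<in> nbrs E i \<Longrightarrow> (\<lambda>r. r (i, j)) \<in> borel_measurable R"
  using measurable_rate[OF sets_R] by (simp add: nbrs_def)

lemma rate_ge_0: "r \<in> space R \<Longrightarrow> j \<in> nbrs E i \<Longrightarrow> 0 \<le> r (i, j)"
  using rate_nonneg[of r E i j] unfolding space_R by (simp add: nbrs_def)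

definition total_rate :: "('v \<times> 'v \<Rightarrow> real) \<Rightarrow> 'v \<Rightarrow> real" where
  "total_rate r i = (\<Sum>j\<in>nbrs E i. r (i, j))"

lemma total_rate_measurable[measurable]: "(\<lambda>r. total_rate r i) \<in> borel_measurable R"
  unfolding total_rate_def by measurable

lemma total_rate_nonneg: "r \<in> space R \<Longrightarrow> 0 \<le> total_rate r i"
  unfolding total_rate_def by (intro sum_nonneg rate_ge_0)

definition rel_rate :: "('v \<times> 'v \<Rightarrow> real) \<Rightarrow> 'v \<Rightarrow> 'v \<Rightarrow> real" where
  "rel_rate r i j = 2 * r (i, j) / weight E W i j"

lemma rel_rate_measurable: "adj i j \<Longrightarrow> (\<lambda>r. rel_rate r i j) \<in> borel_measurable R"
  unfolding rel_rate_def by measurable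

lemma rel_rate_nonneg: "r \<in> space R \<Longrightarrow> adj i j \<Longrightarrow> 0 \<le> rel_rate r i j"
  unfolding rel_rate_def using rate_ge_0 weight_nonneg by simp

lemma walk_prod_measurable: "successively adj xs \<Longrightarrow> (\<lambda>r. walk_prod (rel_rate r) xs) \<in> borel_measurable R"
proof (induction xs rule: induct_list012)
  case (3 a b xs)
  then show ?case by (auto intro!: borel_measurable_times rel_rate_measurable)
qed simp_all

text \<open>
  The trajectory identity after division by the conductances, with the density in its telescoped
  form.
\<close>

lemma walk_identity:
  assumes xs: "walk_from_to i0 xs j" and x: "\<And>k. 0 \<le> x k"
  defines "n \<equiv> length xs - 1" and "\<sigma> \<equiv> (\<lambda>k. xs ! k)"
  assumes S: "finite S" "\<And>k. k \<le> n \<Longrightarrow> \<sigma> k \<in> S" "\<And>k. k < n \<Longrightarrow> nbrs E (\<sigma> k) \<subseteq> S"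
  defines "m \<equiv> (\<lambda>j. sqrt (1 + site_time \<sigma> x n j))"
  shows "(\<integral>\<^sup>+r. ennreal (walk_prod (rel_rate r) xs * exp (- (\<Sum>i\<in>S. total_rate r i * site_time \<sigma> x n i))) \<partial>R) =
     ennreal ((\<Prod>i\<in>S. 1 / m i) * m j * exp (- interaction (weight E W) S m))"
proof -
  have ne: "xs \<noteq> []" "hd xs = i0" "last xs = j" and suc: "successively adj xs" using xs by (auto simp: walk_from_to_def)
  have \<sigma>0: "\<sigma> 0 = i0" using ne by (simp add: \<sigma>_def hd_conv_nth)
  have \<sigma>n: "\<sigma> n = j" using ne by (simp add: \<sigma>_def n_def last_conv_nth)
  have step: "adj (\<sigma> k) (\<sigma> (Suc k))" if "k < n" for k
    using successively_nth[OF suc, of k] that by (simp add: \<sigma>_def n_def)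
  have p: "\<sigma> k \<noteq> \<sigma> (Suc k) \<and> \<sigma> (Suc k) \<in> V \<and> \<sigma> (Suc k) \<in> nbrs E (\<sigma> k) \<and> finite (nbrs E (\<sigma> k)) \<and> \<sigma> k \<notin> nbrs E (\<sigma> k)"
    if "k < n" for k using step[OF that] nbrsD finite_nbrs not_self_nbr by blast
  define wp where "wp = (\<Prod>k<n. weight E W (\<sigma> k) (\<sigma> (Suc k)) / 2)"
  have wp: "0 < wp" unfolding wp_def using step weight_pos by (intro prod_pos) auto
  have rep': "represents_vrjp V E W (\<sigma> 0) R" using rep \<sigma>0 by simp
  have id: "(\<integral>\<^sup>+r. ennreal (trajectory_weight E \<sigma> x n r) \<partial>R) = ennreal (\<Prod>k<n. step_density E W \<sigma> x k)"
    by (rule trajectory_identity[where \<sigma>=\<sigma>, OF rep' p weight_nonneg x])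
  have tw: "trajectory_weight E \<sigma> x n r = wp * (walk_prod (rel_rate r) xs * exp (- (\<Sum>i\<in>S. total_rate r i * site_time \<sigma> x n i)))" for r
  proof -
    have wpr: "walk_prod (rel_rate r) xs = (\<Prod>k<n. 2 * r (\<sigma> k, \<sigma> (Suc k)) / weight E W (\<sigma> k) (\<sigma> (Suc k)))"
      unfolding walk_prod_nth rel_rate_def n_def \<sigma>_def ..
    have "wp * walk_prod (rel_rate r) xs =
        (\<Prod>k<n. weight E W (\<sigma> k) (\<sigma> (Suc k)) / 2 * (2 * r (\<sigma> k, \<sigma> (Suc k)) / weight E W (\<sigma> k) (\<sigma> (Suc k))))"
      unfolding wp_def wpr prod.distrib ..
    also have "\<dots> = (\<Prod>k<n. r (\<sigma> k, \<sigma> (Suc k)))"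
    proof (rule prod.cong[OF refl])
      fix k assume "k \<in> {..<n}"
      then have "0 < weight E W (\<sigma> k) (\<sigma> (Suc k))" using weight_pos[OF step] by simp
      then show "weight E W (\<sigma> k) (\<sigma> (Suc k)) / 2 * (2 * r (\<sigma> k, \<sigma> (Suc k)) / weight E W (\<sigma> k) (\<sigma> (Suc k))) = r (\<sigma> k, \<sigma> (Suc k))"
        by simp
    qed
    finally have "wp * walk_prod (rel_rate r) xs = (\<Prod>k<n. r (\<sigma> k, \<sigma> (Suc k)))" .
    moreover have "(\<Sum>i\<in>S. total_rate r i * site_time \<sigma> x n i) = (\<Sum>k<n. (\<Sum>j\<in>nbrs E (\<sigma> k). r (\<sigma> k, j)) * x k)"
    proof -
      have "(\<Sum>i\<in>S. total_rate r i * site_time \<sigma> x n i) = (\<Sum>k<n. \<Sum>i\<in>S. total_rate r i * (if \<sigma> k = i then x k else 0))"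
        unfolding site_time_def sum_distrib_left by (rule sum.swap)
      also have "\<dots> = (\<Sum>k<n. total_rate r (\<sigma> k) * x k)"
      proof (rule sum.cong[OF refl])
        fix k assume "k \<in> {..<n}"
        then have "\<sigma> k \<in> S" using S(2) by simp
        have "(\<Sum>i\<in>S. total_rate r i * (if \<sigma> k = i then x k else 0)) = (\<Sum>i\<in>S. if \<sigma> k = i then total_rate r i * x k else 0)"
          by (intro sum.cong) auto
        then show "(\<Sum>i\<in>S. total_rate r i * (if \<sigma> k = i then x k else 0)) = total_rate r (\<sigma> k) * x k"
          using S(1) \<open>\<sigma> k \<in> S\<close> by (simp add: sum.delta')
      qed
      finally show ?thesis by (simp add: total_rate_def)
    qed
    ultimately show ?thesis unfolding trajectory_weight_def prod.distrib by (simp add: exp_sum[symmetric] sum_negf mult.assoc[symmetric])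
  qed
  have meas: "(\<lambda>r. walk_prod (rel_rate r) xs * exp (- (\<Sum>i\<in>S. total_rate r i * site_time \<sigma> x n i))) \<in> borel_measurable R"
    using walk_prod_measurable[OF suc] by measurable
  have "ennreal wp * (\<integral>\<^sup>+r. ennreal (walk_prod (rel_rate r) xs * exp (- (\<Sum>i\<in>S. total_rate r i * site_time \<sigma> x n i))) \<partial>R) =
    (\<integral>\<^sup>+r. ennreal (trajectory_weight E \<sigma> x n r) \<partial>R)"
    unfolding tw using wp meas by (subst nn_integral_cmult[symmetric]) (auto simp: ennreal_mult')
  also have "\<dots> = ennreal (wp * ((\<Prod>i\<in>S. 1 / m i) * m j * exp (- interaction (weight E W) S m)))"
    unfolding id using prod_step_density[where \<sigma>=\<sigma> and n=n, OF x S(1) step S(2,3)] unfolding m_def wp_def \<sigma>n by (simp add: mult.assoc)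
  also have "\<dots> = ennreal wp * ennreal ((\<Prod>i\<in>S. 1 / m i) * m j * exp (- interaction (weight E W) S m))"
    by (rule ennreal_mult') (use wp in simp)
  finally show ?thesis using wp by (simp add: ennreal_mult_cancel_left)
qed

text \<open>
  The case of zero holding times.
\<close>

lemma walk_expectation:
  assumes xs: "walk_from_to i0 xs j"
  shows "(\<integral>\<^sup>+r. ennreal (walk_prod (rel_rate r) xs) \<partial>R) = 1"
proof -
  define S where "S = set xs \<union> (\<Union>i\<in>set xs. nbrs E i)"
  have S: "finite S" unfolding S_def using finite_nbrs by auto
  have z: "site_time \<sigma> (\<lambda>_. 0) n i = 0" for \<sigma> n and i :: 'a by (simp add: site_time_def)
  have "(\<integral>\<^sup>+r. ennreal (walk_prod (rel_rate r) xs * exp (- (\<Sum>i\<in>S. total_rate r i * site_time (\<lambda>k. xs ! k) (\<lambda>_. 0) (length xs - 1) i))) \<partial>R) =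
     ennreal ((\<Prod>i\<in>S. 1 / sqrt (1 + site_time (\<lambda>k. xs ! k) (\<lambda>_. 0) (length xs - 1) i)) * sqrt (1 + site_time (\<lambda>k. xs ! k) (\<lambda>_. 0) (length xs - 1) j)
      * exp (- interaction (weight E W) S (\<lambda>i. sqrt (1 + site_time (\<lambda>k. xs ! k) (\<lambda>_. 0) (length xs - 1) i))))"
  proof (rule walk_identity[OF xs _ S])
    have l: "k < length xs" if "k \<le> length xs - 1" for k using that xs by (cases xs) (auto simp: walk_from_to_def)
    show "xs ! k \<in> S" if "k \<le> length xs - 1" for k using l[OF that] by (simp add: S_def)
    show "nbrs E (xs ! k) \<subseteq> S" if "k < length xs - 1" for k using that by (auto simp: S_def)
  qed simp
  then show ?thesis by (simp add: z interaction_def)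
qed

text \<open>
  The walk traversed twice is again a closed walk, so the product and its square both have
  expectation 1, and the variance vanishes.
\<close>

lemma closed_walk_AE:
  assumes xs: "walk_from_to i0 xs i0"
  shows "AE r in R. walk_prod (rel_rate r) xs = 1"
proof -
  define X where "X r = walk_prod (rel_rate r) xs" for r
  have suc: "successively adj xs" using xs by (simp add: walk_from_to_def)
  have m[measurable]: "X \<in> borel_measurable R" unfolding X_def[abs_def] by (rule walk_prod_measurable[OF suc])
  have X0: "0 \<le> X r" if "r \<in> space R" for r unfolding X_def
    using walk_prod_nonneg[OF suc] rel_rate_nonneg[OF that] by blast
  have E1: "(\<integral>\<^sup>+r. ennreal (X r) \<partial>R) = ennreal 1" unfolding X_def using walk_expectation[OF xs] by simp
  have E2: "(\<integral>\<^sup>+r. ennreal (X r * X r) \<partial>R) = ennreal 1"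
    using walk_expectation[OF walk_join(1)[OF xs xs]] unfolding walk_join(2)[OF xs xs] X_def by simp
  have "AE r in R. 0 \<le> X r" by (rule AE_I2) (rule X0)
  from iffD1[OF nn_integral_eq_integrable[OF m this zero_le_one] E1]
  have i1: "integrable R X" "(LINT r|R. X r) = 1" by auto
  have m2: "(\<lambda>r. X r * X r) \<in> borel_measurable R" by measurable
  have "AE r in R. 0 \<le> X r * X r" by (rule AE_I2) simp
  from iffD1[OF nn_integral_eq_integrable[OF m2 this zero_le_one] E2]
  have i2: "integrable R (\<lambda>r. X r * X r)" "(LINT r|R. X r * X r) = 1" by auto
  have e: "(X r - 1)\<^sup>2 = X r * X r - 2 * X r + 1" for r by (simp add: power2_eq_square algebra_simps)
  have i3: "integrable R (\<lambda>r. (X r - 1)\<^sup>2)" unfolding e using i1(1) i2(1) by simp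
  have "(LINT r|R. (X r - 1)\<^sup>2) = 0" unfolding e using i1 i2 by (simp add: R.prob_space)
  then have "AE r in R. (X r - 1)\<^sup>2 = 0"
    using integral_nonneg_eq_0_iff_AE[OF i3] by simp
  then show ?thesis by eventually_elim (simp add: X_def)
qed

definition path_to :: "'v \<Rightarrow> 'v list" where
  "path_to i = (SOME xs. walk_from_to i0 xs i)"

lemma path_to: "i \<in> V \<Longrightarrow> walk_from_to i0 (path_to i) i"
  unfolding path_to_def using someI_ex[OF walk_exists[OF i0, of i]] by blast

text \<open>
  Almost surely, the value does not depend on the chosen path, because products along closed
  walks are 1. A random multiple of it is the function \<open>green\<close>.
\<close>

definition weight_fun :: "('v \<times> 'v \<Rightarrow> real) \<Rightarrow> 'v \<Rightarrow> real" where
  "weight_fun r i = walk_prod (rel_rate r) (path_to i)"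

lemma weight_fun_measurable: "i \<in> V \<Longrightarrow> (\<lambda>r. weight_fun r i) \<in> borel_measurable R"
  unfolding weight_fun_def using path_to by (intro walk_prod_measurable) (simp add: walk_from_to_def)

text \<open>
  Three closed walks are used: to \<open>i\<close> and back, to \<open>j\<close> and back, and to \<open>i\<close>, across the
  edge to \<open>j\<close> and back. The first one also shows that the value at \<open>i\<close> is not zero.
\<close>

lemma weight_fun_AE:
  assumes j: "j \<in> nbrs E i"
  shows "AE r in R. 0 < weight_fun r i \<and> weight_fun r i * rel_rate r i j = weight_fun r j"
proof -
  have ij: "i \<in> V" "j \<in> V" using nbrsD[OF j] by auto
  note wi = path_to[OF ij(1)] and wj = path_to[OF ij(2)]
  note ri = walk_join[OF wi walk_rev[OF wi]] and rj = walk_join[OF wj walk_rev[OF wj]]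
    and l = walk_link[OF wi walk_rev[OF wj] j]
  show ?thesis
    using closed_walk_AE[OF ri(1)] closed_walk_AE[OF rj(1)] closed_walk_AE[OF l(1)] AE_space
  proof eventually_elim
    case (elim r)
    define ci where "ci = walk_prod (rel_rate r) (rev (path_to i))"
    define cj where "cj = walk_prod (rel_rate r) (rev (path_to j))"
    have 1: "weight_fun r i * ci = 1" using elim(1) unfolding ri(2) weight_fun_def ci_def .
    have 2: "weight_fun r j * cj = 1" using elim(2) unfolding rj(2) weight_fun_def cj_def .
    have 3: "weight_fun r i * rel_rate r i j * cj = 1" using elim(3) unfolding l(2) weight_fun_def cj_def .
    have "0 \<le> weight_fun r i" unfolding weight_fun_def
      using wi rel_rate_nonneg[OF elim(4)] by (intro walk_prod_nonneg[of adj]) (auto simp: walk_from_to_def)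
    moreover have "weight_fun r i \<noteq> 0" using 1 by auto
    moreover have "weight_fun r i * rel_rate r i j = weight_fun r j"
    proof -
      have "cj \<noteq> 0" using 2 by auto
      moreover have "(weight_fun r i * rel_rate r i j) * cj = weight_fun r j * cj" using 2 3 by simp
      ultimately show ?thesis by simp
    qed
    ultimately show ?case by simp
  qed
qed

text \<open>
  The walk identity for a closed walk that covers \<open>U\<close>, with holding times that add up to
  \<open>l j\<close> at each site \<open>j\<close>. The product of the ratios along the walk is 1 almost surely and
  disappears.
\<close>

lemma total_rate_laplace:
  assumes U: "finite U" "U \<subseteq> V" and l: "\<And>j. 0 \<le> l j" "\<And>j. j \<notin> U \<Longrightarrow> l j = 0"
    and S: "finite S" "U \<subseteq> S" "\<And>i. i \<in> U \<Longrightarrow> nbrs E i \<subseteq> S"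
  defines "m \<equiv> (\<lambda>j. sqrt (1 + l j))"
  shows "(\<integral>\<^sup>+r. ennreal (exp (- (\<Sum>i\<in>U. total_rate r i * l i))) \<partial>R) =
    ennreal ((\<Prod>i\<in>U. 1 / m i) * m i0 * exp (- interaction (weight E W) S m))"
proof -
  \<comment> \<open>The last site of a walk has no holding time. A second vertex makes the walk leave \<open>i0\<close>, so the start counts as a visit.\<close>
  have "infinite (V - {i0})" using infinite_V by simp
  then obtain i1 where i1: "i1 \<in> V" "i1 \<noteq> i0" by (metis Diff_iff finite.emptyI insertI1 subsetI subset_empty)
  have "finite (insert i1 U)" "insert i1 U \<subseteq> V" using U i1 by auto
  then obtain xs where xs: "walk_from_to i0 xs i0" "insert i1 U \<subseteq> set xs" using covering_walk[OF _ _ i0] by blast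
  define n where "n = length xs - 1"
  define \<sigma> where "\<sigma> k = xs ! k" for k
  have ne: "xs \<noteq> []" "hd xs = i0" "last xs = i0" using xs by (auto simp: walk_from_to_def)
  have n: "0 < n"
  proof (rule ccontr)
    assume "\<not> 0 < n"
    then have "length xs = 1" using ne(1) unfolding n_def by (cases xs) auto
    then have "xs = [i0]" using ne(2) by (cases xs) auto
    then show False using xs(2) i1 by simp
  qed
  have len: "length xs = Suc n" using ne(1) by (simp add: n_def)
  have \<sigma>0: "\<sigma> 0 = i0" using ne by (simp add: \<sigma>_def hd_conv_nth)
  have \<sigma>n: "\<sigma> n = i0" using ne by (simp add: \<sigma>_def n_def last_conv_nth)
  have vis: "j \<in> \<sigma> ` {..<n}" if "j \<in> U" for j
  proof -
    have "j \<in> set xs" using that xs(2) by auto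
    then obtain k where k: "k < Suc n" "j = \<sigma> k" unfolding in_set_conv_nth len \<sigma>_def by blast
    show ?thesis
    proof (cases "k = n")
      case True then show ?thesis using k \<sigma>n \<sigma>0 n by (auto intro!: image_eqI[of _ _ 0])
    next
      case False then show ?thesis using k by auto
    qed
  qed
  obtain x where x: "\<forall>k. 0 \<le> x k" "\<forall>j. site_time \<sigma> x n j = (if j \<in> \<sigma> ` {..<n} then l j else 0)"
    using site_time_prescribed[of l \<sigma> n] l(1) by blast
  have st: "site_time \<sigma> x n j = l j" for j using x(2) vis l(2)[of j] by (cases "j \<in> U") auto
  define T where "T = S \<union> set xs \<union> (\<Union>i\<in>set xs. nbrs E i)"
  have T: "finite T" unfolding T_def using finite_nbrs S by auto
  have "(\<integral>\<^sup>+r. ennreal (walk_prod (rel_rate r) xs * exp (- (\<Sum>i\<in>T. total_rate r i * site_time (\<lambda>k. xs ! k) x (length xs - 1) i))) \<partial>R) =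
     ennreal ((\<Prod>i\<in>T. 1 / sqrt (1 + site_time (\<lambda>k. xs ! k) x (length xs - 1) i)) * sqrt (1 + site_time (\<lambda>k. xs ! k) x (length xs - 1) i0)
      * exp (- interaction (weight E W) T (\<lambda>i. sqrt (1 + site_time (\<lambda>k. xs ! k) x (length xs - 1) i))))"
  proof (rule walk_identity[OF xs(1) _ T])
    show "0 \<le> x k" for k using x(1) by blast
    show "xs ! k \<in> T" if "k \<le> length xs - 1" for k using that len by (simp add: T_def)
    show "nbrs E (xs ! k) \<subseteq> T" if "k < length xs - 1" for k using that by (auto simp: T_def)
  qed
  then have id: "(\<integral>\<^sup>+r. ennreal (walk_prod (rel_rate r) xs * exp (- (\<Sum>i\<in>T. total_rate r i * l i))) \<partial>R) =
     ennreal ((\<Prod>i\<in>T. 1 / m i) * m i0 * exp (- interaction (weight E W) T m))"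
    unfolding m_def using st unfolding \<sigma>_def n_def by simp
  have m1: "m j = 1" if "j \<notin> U" for j using l(2)[OF that] by (simp add: m_def)
  have UT: "U \<subseteq> T" "S \<subseteq> T" using S by (auto simp: T_def)
  have s: "(\<Sum>i\<in>T. total_rate r i * l i) = (\<Sum>i\<in>U. total_rate r i * l i)" for r
    using T UT(1) l(2) by (intro sum.mono_neutral_right) auto
  have p: "(\<Prod>i\<in>T. 1 / m i) = (\<Prod>i\<in>U. 1 / m i)"
    using T UT(1) m1 by (intro prod.mono_neutral_right) auto
  have inter: "interaction (weight E W) T m = interaction (weight E W) S m"
  proof -
    have z: "weight E W i j * (m i * m j - 1) = 0" if "i \<notin> S \<or> j \<notin> S" for i j
    proof (cases "i \<in> U \<or> j \<in> U")
      case True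
      then have "j \<notin> nbrs E i" using that S(2,3) nbrs_sym by blast
      then show ?thesis by (simp add: weight_zero)
    next
      case False then show ?thesis by (simp add: m1)
    qed
    have inner: "(\<Sum>j\<in>T. weight E W i j * (m i * m j - 1)) = (\<Sum>j\<in>S. weight E W i j * (m i * m j - 1))" for i
      using T UT(2) z by (intro sum.mono_neutral_right) auto
    show ?thesis unfolding interaction_def inner
      using T UT(2) z by (intro arg_cong2[where f="(/)"] sum.mono_neutral_right refl) (auto intro!: sum.neutral)
  qed
  have "(\<integral>\<^sup>+r. ennreal (walk_prod (rel_rate r) xs * exp (- (\<Sum>i\<in>T. total_rate r i * l i))) \<partial>R) =
    (\<integral>\<^sup>+r. ennreal (exp (- (\<Sum>i\<in>U. total_rate r i * l i))) \<partial>R)"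
    by (rule nn_integral_cong_AE) (use closed_walk_AE[OF xs(1)] in \<open>eventually_elim, simp add: s\<close>)
  then show ?thesis using id unfolding p inter by simp
qed

end

section \<open>The Gamma variable\<close>

lemma sets_gamma_half[measurable_cong]: "sets gamma_half = sets borel"
  by (simp add: gamma_half_def)

text \<open>
  The case \<open>c = 0\<close> of the inverse Gaussian integral.
\<close>

lemma gamma_half_laplace:
  assumes c: "0 \<le> c"
  shows "(\<integral>\<^sup>+\<gamma>. ennreal (exp (- (c * \<gamma>))) \<partial>gamma_half) = ennreal (1 / sqrt (1 + c))"
proof -
  define a where "a = sqrt (2 * (1 + c))"
  have a: "0 < a" "a\<^sup>2 = 2 * (1 + c)" using c by (simp_all add: a_def)
  let ?f = "\<lambda>s. indicator {0<..} s * (exp (- (a\<^sup>2 * s + 0\<^sup>2 / s) / 2) / sqrt s)"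
  have "(\<integral>\<^sup>+\<gamma>. ennreal (exp (- (c * \<gamma>))) \<partial>gamma_half) =
     (\<integral>\<^sup>+\<gamma>. ennreal (indicator {0<..} \<gamma> / sqrt (pi * \<gamma>) * exp (- \<gamma>)) * ennreal (exp (- (c * \<gamma>))) \<partial>lborel)"
    unfolding gamma_half_def by (rule nn_integral_density) measurable
  also have "\<dots> = (\<integral>\<^sup>+\<gamma>. ennreal (1 / sqrt pi) * ennreal (?f \<gamma>) \<partial>lborel)"
  proof (intro nn_integral_cong)
    fix \<gamma> :: real
    have "(indicator {0<..} \<gamma> / sqrt (pi * \<gamma>) * exp (- \<gamma>)) * exp (- (c * \<gamma>)) = 1 / sqrt pi * ?f \<gamma>"
    proof (cases "0 < \<gamma>")
      case True
      have "exp (- \<gamma>) * exp (- (c * \<gamma>)) = exp (- (a\<^sup>2 * \<gamma> + 0\<^sup>2 / \<gamma>) / 2)"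
        unfolding a(2) exp_add[symmetric] by (simp add: algebra_simps)
      then show ?thesis using True by (simp add: real_sqrt_mult)
    qed simp
    then show "ennreal (indicator {0<..} \<gamma> / sqrt (pi * \<gamma>) * exp (- \<gamma>)) * ennreal (exp (- (c * \<gamma>))) =
        ennreal (1 / sqrt pi) * ennreal (?f \<gamma>)"
      by (subst ennreal_mult''[symmetric], simp, subst ennreal_mult'[symmetric]) simp_all
  qed
  also have "\<dots> = ennreal (1 / sqrt pi) * (\<integral>\<^sup>+\<gamma>. ennreal (?f \<gamma>) \<partial>lborel)"
    by (rule nn_integral_cmult) measurable
  also have "(\<integral>\<^sup>+\<gamma>. ennreal (?f \<gamma>) \<partial>lborel) = ennreal (sqrt (2 * pi) / a * exp (- a * 0))"
    by (rule inverse_gaussian_integral[OF a(1) order_refl])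
  also have "ennreal (1 / sqrt pi) * \<dots> = ennreal (1 / sqrt pi * (sqrt (2 * pi) / a * exp (- a * 0)))"
    by (rule ennreal_mult'[symmetric]) simp
  also have "1 / sqrt pi * (sqrt (2 * pi) / a * exp (- a * 0)) = 1 / sqrt (1 + c)"
  proof -
    have "a = sqrt 2 * sqrt (1 + c)" unfolding a_def by (rule real_sqrt_mult)
    moreover have "sqrt (2 * pi) = sqrt 2 * sqrt pi" by (rule real_sqrt_mult)
    ultimately show ?thesis by simp
  qed
  finally show ?thesis .
qed

lemma prob_space_gamma_half: "prob_space gamma_half"
proof
  have "emeasure gamma_half (space gamma_half) = (\<integral>\<^sup>+\<gamma>. ennreal (exp (- (0 * \<gamma>))) \<partial>gamma_half)" by simp
  also have "\<dots> = 1" by (subst gamma_half_laplace) simp_all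
  finally show "emeasure gamma_half (space gamma_half) = 1" .
qed

lemma gamma_half_pos: "AE \<gamma> in gamma_half. 0 < \<gamma>"
  unfolding gamma_half_def by (subst AE_density) (auto simp: indicator_def)

section \<open>The law of the potential on the infinite graph\<close>

lemma interaction_boundary:
  assumes S: "finite S" "U \<subseteq> S" and m: "\<And>j. j \<notin> U \<Longrightarrow> m j = 1" and sym: "\<And>i j. w i j = w j i"
  shows "interaction w S m = (\<Sum>i\<in>U. \<Sum>j\<in>U. w i j * (m i * m j - 1)) / 2 + (\<Sum>i\<in>U. (\<Sum>j\<in>S - U. w i j) * (m i - 1))"
proof -
  have U: "finite U" using S finite_subset by blast
  have split: "sum f S = sum f U + sum f (S - U)" for f :: "'a \<Rightarrow> real"
    using sum.subset_diff[OF S(2,1), of f] by (simp add: add.commute)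
  have 1: "(\<Sum>i\<in>U. \<Sum>j\<in>S - U. w i j * (m i * m j - 1)) = (\<Sum>i\<in>U. (\<Sum>j\<in>S - U. w i j) * (m i - 1))"
    unfolding sum_distrib_right by (intro sum.cong refl) (simp add: m)
  have 2: "(\<Sum>i\<in>S - U. \<Sum>j\<in>U. w i j * (m i * m j - 1)) = (\<Sum>i\<in>U. (\<Sum>j\<in>S - U. w i j) * (m i - 1))"
    unfolding sum_distrib_right by (subst sum.swap) (intro sum.cong refl, simp add: m sym)
  have 3: "(\<Sum>i\<in>S - U. \<Sum>j\<in>S - U. w i j * (m i * m j - 1)) = 0"
    by (intro sum.neutral ballI) (simp add: m)
  show ?thesis unfolding interaction_def split sum.distrib 1 2 3 by simp
qed

context weighted_graph
begin

lemma boundary_weight_eq: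
  assumes "finite S" "nbrs E i \<subseteq> S"
  shows "(\<Sum>j\<in>S - U. weight E W i j) = boundary_weight E W U i"
  unfolding boundary_weight_def 
proof (rule sum.mono_neutral_right)
  show "finite (S - U)" using assms by simp
  show "nbrs E i - U \<subseteq> S - U" using assms by blast
  show "\<forall>j\<in>S - U - (nbrs E i - U). weight E W i j = 0" using weight_zero[of _ i] by blast
qed

lemma boundary_weight_nonneg: "0 \<le> boundary_weight E W U i"
  unfolding boundary_weight_def by (intro sum_nonneg weight_nonneg)

lemma sets_nu_fin: "sets (nu_fin U (weight E W) \<eta>) = sets (PiM U (\<lambda>_. borel))"
  unfolding nu_fin_def by (simp, intro sets_PiM_cong) auto

lemma finite_measure_nu_fin:
  assumes U: "finite U" and \<eta>: "\<And>k. 0 \<le> \<eta> k" shows "finite_measure (nu_fin U (weight E W) \<eta>)"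
proof (rule finite_measureI)
  have "emeasure (nu_fin U (weight E W) \<eta>) (space (nu_fin U (weight E W) \<eta>)) =
    (\<integral>\<^sup>+\<beta>. ennreal (exp (- (\<Sum>k\<in>U. 0 * \<beta> k))) \<partial>nu_fin U (weight E W) \<eta>)" by simp
  also have "\<dots> \<noteq> \<infinity>" by (subst nu_fin_laplace[OF U \<eta>]) auto
  finally show "emeasure (nu_fin U (weight E W) \<eta>) (space (nu_fin U (weight E W) \<eta>)) \<noteq> \<infinity>" .
qed

lemma nu_fin_AE_pos_def:
  assumes U: "finite U"
  shows "AE \<beta> in nu_fin U (weight E W) \<eta>. pos_def_on U (H_mat (weight E W) \<beta>)"
  unfolding nu_fin_eq_density
proof (subst AE_density)
  note [measurable] = measurable_potential_kernel[OF U]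
  show "(\<lambda>\<beta>. ennreal ((2 / pi) powr (real (card U) / 2) * exp (\<Sum>k\<in>U. \<eta> k) * potential_kernel U \<eta> (\<lambda>_. 1) \<beta>))
      \<in> borel_measurable (PiM U (\<lambda>_. lborel))" by measurable
  have "pos_def_on U (H_mat (weight E W) \<beta>)" if "potential_kernel U \<eta> (\<lambda>_. 1) \<beta> \<noteq> 0" for \<beta>
    using that unfolding potential_kernel_def by meson
  then show "AE \<beta> in PiM U (\<lambda>_. lborel). 0 < ennreal ((2 / pi) powr (real (card U) / 2) * exp (\<Sum>k\<in>U. \<eta> k) *
      potential_kernel U \<eta> (\<lambda>_. 1) \<beta>) \<longrightarrow> pos_def_on U (H_mat (weight E W) \<beta>)"
    by (intro AE_I2 impI) force
qed

lemma pos_def_diagonal: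
  assumes U: "finite U" "k \<in> U" and pd: "pos_def_on U (H_mat (weight E W) \<beta>)"
  shows "0 \<le> \<beta> k"
proof -
  let ?f = "\<lambda>i. of_bool (i = k) :: real"
  have "\<exists>i\<in>U. ?f i \<noteq> 0" using U by (intro bexI[of _ k]) auto
  then have "0 < (\<Sum>i\<in>U. \<Sum>j\<in>U. ?f i * H_mat (weight E W) \<beta> i j * ?f j)" 
    by (rule pd[unfolded pos_def_on_def, rule_format, of ?f])
  also have "(\<Sum>i\<in>U. \<Sum>j\<in>U. ?f i * H_mat (weight E W) \<beta> i j * ?f j) = H_mat (weight E W) \<beta> k k"
  proof -
    have "(\<Sum>j\<in>U. ?f i * H_mat (weight E W) \<beta> i j * ?f j) = ?f i * H_mat (weight E W) \<beta> i k" for i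
      by (rule sum_of_bool_mult(4)[OF U])
    then show ?thesis using sum_of_bool_mult(2)[OF U] by simp
  qed
  finally show ?thesis using weight_nonneg[of k k] by (simp add: H_mat_def)
qed

end

lemma measure_eq_if_finite_marginals_eq:
  fixes M N :: "('v \<Rightarrow> real) measure"
  assumes sets: "sets M = sets (PiM V (\<lambda>_. borel))" "sets N = sets (PiM V (\<lambda>_. borel))"
    and fin: "finite_measure M"
    and marg: "\<And>U. finite U \<Longrightarrow> U \<subseteq> V \<Longrightarrow> distr M (PiM U (\<lambda>_. borel)) (\<lambda>\<beta>. restrict \<beta> U) =
      distr N (PiM U (\<lambda>_. borel)) (\<lambda>\<beta>. restrict \<beta> U)"
  shows "M = N"
proof (rule measure_eqI_PiM_infinite[OF sets _ fin])
  fix A :: "'v \<Rightarrow> real set" and J assume J: "finite J" "J \<subseteq> V" "\<And>i. i \<in> J \<Longrightarrow> A i \<in> sets borel"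
  have e: "emeasure K (prod_emb V (\<lambda>_. borel) J (Pi\<^sub>E J A)) = emeasure (distr K (PiM J (\<lambda>_. borel)) (\<lambda>\<beta>. restrict \<beta> J)) (Pi\<^sub>E J A)"
    if K: "sets K = sets (PiM V (\<lambda>_. borel))" for K :: "('v \<Rightarrow> real) measure"
  proof -
    have m: "(\<lambda>\<beta>. restrict \<beta> J) \<in> K \<rightarrow>\<^sub>M PiM J (\<lambda>_. borel)"
      using measurable_restrict_subset[OF J(2), of "\<lambda>_. borel"] K by (simp cong: measurable_cong_sets)
    have "Pi\<^sub>E J A \<in> sets (PiM J (\<lambda>_. borel))" by (rule sets_PiM_I_finite[OF J(1,3)])
    then have "emeasure (distr K (PiM J (\<lambda>_. borel)) (\<lambda>\<beta>. restrict \<beta> J)) (Pi\<^sub>E J A) =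
      emeasure K ((\<lambda>\<beta>. restrict \<beta> J) -` Pi\<^sub>E J A \<inter> space K)" by (rule emeasure_distr[OF m])
    also have "(\<lambda>\<beta>. restrict \<beta> J) -` Pi\<^sub>E J A \<inter> space K = prod_emb V (\<lambda>_. borel) J (Pi\<^sub>E J A)"
      using sets_eq_imp_space_eq[OF K] by (auto simp: prod_emb_def space_PiM)
    finally show ?thesis by (rule sym)
  qed
  show "emeasure M (prod_emb V (\<lambda>_. borel) J (Pi\<^sub>E J A)) = emeasure N (prod_emb V (\<lambda>_. borel) J (Pi\<^sub>E J A))"
    unfolding e[OF sets(1)] e[OF sets(2)] marg[OF J(1,2)] ..
qed

text \<open>
  A measure on a product of real lines is determined by its finite marginals, so the description
  that defines \<open>nu_inf\<close> determines it once a measure satisfying it is found.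
\<close>

lemma nu_inf_eqI:
  assumes N: "prob_space N" "sets N = sets (PiM V (\<lambda>_. borel))"
    and pd: "AE \<beta> in N. \<forall>U. finite U \<and> U \<subseteq> V \<longrightarrow> pos_def_on U (H_mat (weight E W) \<beta>)"
    and marg: "\<And>U. finite U \<Longrightarrow> U \<subseteq> V \<Longrightarrow> distr N (PiM U (\<lambda>_. borel)) (\<lambda>\<beta>. restrict \<beta> U) =
        nu_fin U (weight E W) (boundary_weight E W U)"
  shows "nu_inf V E W = N"
  unfolding nu_inf_def
proof (rule the_equality)
  fix M assume M: "prob_space M \<and> sets M = sets (PiM V (\<lambda>_. borel)) \<and>
     (AE \<beta> in M. \<forall>U. finite U \<and> U \<subseteq> V \<longrightarrow> pos_def_on U (H_mat (weight E W) \<beta>)) \<and>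
     (\<forall>U. finite U \<and> U \<subseteq> V \<longrightarrow> distr M (PiM U (\<lambda>_. borel)) (\<lambda>\<beta>. restrict \<beta> U) =
        nu_fin U (weight E W) (boundary_weight E W U))"
  show "M = N"
  proof (rule measure_eq_if_finite_marginals_eq)
    show "finite_measure M" using M by (blast dest: prob_space.finite_measure)
    show "distr M (PiM U (\<lambda>_. borel)) (\<lambda>\<beta>. restrict \<beta> U) = distr N (PiM U (\<lambda>_. borel)) (\<lambda>\<beta>. restrict \<beta> U)"
      if "finite U" "U \<subseteq> V" for U
      using M marg[OF that] that by metis
  qed (use M N in blast)+
qed (use N pd marg in blast)

context vrjp_environment
begin

sublocale G: prob_space gamma_half by (rule prob_space_gamma_half)

abbreviation "joint \<equiv> R \<Otimes>\<^sub>M gamma_half"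
abbreviation "pot \<equiv> env_potential V E i0"

sublocale J: pair_prob_space R gamma_half by standard

lemma pot_at: "i \<in> V \<Longrightarrow> pot \<omega> i = total_rate (fst \<omega>) i + (if i = i0 then snd \<omega> else 0)"
  by (cases \<omega>) (simp add: env_potential_def total_rate_def)

lemma pot_measurable[measurable]: "pot \<in> joint \<rightarrow>\<^sub>M PiM V (\<lambda>_. borel)"
proof -
  have "pot = (\<lambda>\<omega>. \<lambda>i\<in>V. total_rate (fst \<omega>) i + (if i = i0 then snd \<omega> else 0))"
    by (auto simp: env_potential_def total_rate_def fun_eq_iff)
  then show ?thesis by simp
qed

text \<open>
  The variable \<open>\<gamma>\<close> contributes \<open>1 / m i0\<close>, which cancels the factor \<open>m i0\<close> that
  marks the starting point. Edges that leave \<open>U\<close> end at sites with \<open>m = 1\<close> and give the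
  boundary term.
\<close>

lemma potential_laplace:
  assumes U: "finite U" "U \<subseteq> V" and l: "\<And>j. 0 \<le> l j" "\<And>j. j \<notin> U \<Longrightarrow> l j = 0"
  shows "(\<integral>\<^sup>+\<omega>. ennreal (exp (- (\<Sum>k\<in>U. l k * pot \<omega> k))) \<partial>joint) =
    (\<integral>\<^sup>+\<beta>. ennreal (exp (- (\<Sum>k\<in>U. l k * \<beta> k))) \<partial>nu_fin U (weight E W) (boundary_weight E W U))"
proof -
  define m where "m j = sqrt (1 + l j)" for j
  define S where "S = U \<union> (\<Union>i\<in>U. nbrs E i)"
  have S: "finite S" "U \<subseteq> S" "\<And>i. i \<in> U \<Longrightarrow> nbrs E i \<subseteq> S" unfolding S_def using U finite_nbrs by auto
  have m1: "m j = 1" if "j \<notin> U" for j using l(2)[OF that] by (simp add: m_def)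
  have mpos: "0 < m j" for j using l(1)[of j] by (simp add: m_def add_pos_nonneg)
  have e: "exp (- (\<Sum>k\<in>U. l k * pot (r, \<gamma>) k)) = exp (- (\<Sum>i\<in>U. total_rate r i * l i)) * exp (- (l i0 * \<gamma>))" for r \<gamma>
  proof -
    have "(\<Sum>k\<in>U. l k * pot (r, \<gamma>) k) = (\<Sum>k\<in>U. total_rate r k * l k + (if k = i0 then l k * \<gamma> else 0))"
      using U(2) by (intro sum.cong refl) (auto simp: pot_at algebra_simps)
    also have "\<dots> = (\<Sum>i\<in>U. total_rate r i * l i) + l i0 * \<gamma>"
      using U(1) l(2)[of i0] by (simp add: sum.distrib sum.delta')
    finally show ?thesis by (simp add: exp_add[symmetric])
  qed
  have meas: "(\<lambda>\<omega>. ennreal (exp (- (\<Sum>k\<in>U. l k * pot \<omega> k)))) \<in> borel_measurable joint"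
  proof -
    have "(\<lambda>\<omega>. pot \<omega> k) \<in> borel_measurable joint" if "k \<in> U" for k
      using measurable_compose[OF pot_measurable measurable_component_singleton[of k V "\<lambda>_. borel"]] that U(2) by auto
    then have "(\<lambda>\<omega>. \<Sum>k\<in>U. l k * pot \<omega> k) \<in> borel_measurable joint"
      by (intro borel_measurable_sum borel_measurable_times) auto
    then show ?thesis by measurable
  qed
  have "(\<integral>\<^sup>+\<omega>. ennreal (exp (- (\<Sum>k\<in>U. l k * pot \<omega> k))) \<partial>joint) =
    (\<integral>\<^sup>+r. (\<integral>\<^sup>+\<gamma>. ennreal (exp (- (\<Sum>k\<in>U. l k * pot (r, \<gamma>) k))) \<partial>gamma_half) \<partial>R)"
    by (rule G.nn_integral_fst[OF meas, symmetric])
  also have "\<dots> = (\<integral>\<^sup>+r. ennreal (exp (- (\<Sum>i\<in>U. total_rate r i * l i))) * ennreal (1 / m i0) \<partial>R)"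
    unfolding e m_def
  proof (rule nn_integral_cong)
    fix r
    let ?A = "exp (- (\<Sum>i\<in>U. total_rate r i * l i))"
    have [measurable]: "(\<lambda>\<gamma>. exp (- (l i0 * \<gamma>))) \<in> borel_measurable gamma_half"
      unfolding measurable_cong_sets[OF sets_gamma_half refl]
      by (intro borel_measurable_continuous_onI continuous_intros)
    have "(\<integral>\<^sup>+\<gamma>. ennreal (?A * exp (- (l i0 * \<gamma>))) \<partial>gamma_half) = (\<integral>\<^sup>+\<gamma>. ennreal ?A * ennreal (exp (- (l i0 * \<gamma>))) \<partial>gamma_half)"
      by (simp add: ennreal_mult)
    also have "\<dots> = ennreal ?A * (\<integral>\<^sup>+\<gamma>. ennreal (exp (- (l i0 * \<gamma>))) \<partial>gamma_half)"
      by (rule nn_integral_cmult) (rule measurable_compose[OF _ measurable_ennreal], fact)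
    also have "\<dots> = ennreal ?A * ennreal (1 / sqrt (1 + l i0))" unfolding gamma_half_laplace[OF l(1)] ..
    finally show "(\<integral>\<^sup>+\<gamma>. ennreal (?A * exp (- (l i0 * \<gamma>))) \<partial>gamma_half) = ennreal ?A * ennreal (1 / sqrt (1 + l i0))" .
  qed
  also have "\<dots> = (\<integral>\<^sup>+r. ennreal (exp (- (\<Sum>i\<in>U. total_rate r i * l i))) \<partial>R) * ennreal (1 / m i0)"
  proof (rule nn_integral_multc)
    have "(\<lambda>r. \<Sum>i\<in>U. total_rate r i * l i) \<in> borel_measurable R"
      by (intro borel_measurable_sum borel_measurable_times total_rate_measurable borel_measurable_const)
    then show "(\<lambda>r. ennreal (exp (- (\<Sum>i\<in>U. total_rate r i * l i)))) \<in> borel_measurable R" by measurable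
  qed
  also have "(\<integral>\<^sup>+r. ennreal (exp (- (\<Sum>i\<in>U. total_rate r i * l i))) \<partial>R) =
      ennreal ((\<Prod>i\<in>U. 1 / m i) * m i0 * exp (- interaction (weight E W) S m))"
    unfolding m_def by (rule total_rate_laplace[OF U l S])
  also have "\<dots> * ennreal (1 / m i0) = ennreal ((\<Prod>i\<in>U. 1 / m i) * m i0 * exp (- interaction (weight E W) S m) * (1 / m i0))"
    by (rule ennreal_mult''[symmetric]) (use mpos[of i0] in simp)
  also have "(\<Prod>i\<in>U. 1 / m i) * m i0 * exp (- interaction (weight E W) S m) * (1 / m i0) =
      (\<Prod>i\<in>U. 1 / m i) * exp (- (\<Sum>i\<in>U. \<Sum>j\<in>U. weight E W i j * (m i * m j - 1)) / 2 - (\<Sum>k\<in>U. boundary_weight E W U k * (m k - 1)))"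
  proof -
    have "(\<Sum>i\<in>U. (\<Sum>j\<in>S - U. weight E W i j) * (m i - 1)) = (\<Sum>k\<in>U. boundary_weight E W U k * (m k - 1))"
      by (intro sum.cong refl) (simp add: boundary_weight_eq[OF S(1,3)])
    then have "interaction (weight E W) S m = (\<Sum>i\<in>U. \<Sum>j\<in>U. weight E W i j * (m i * m j - 1)) / 2 + (\<Sum>k\<in>U. boundary_weight E W U k * (m k - 1))"
      using interaction_boundary[OF S(1,2), of m "weight E W"] m1 weight_sym by simp
    then have "- interaction (weight E W) S m = - (\<Sum>i\<in>U. \<Sum>j\<in>U. weight E W i j * (m i * m j - 1)) / 2 - (\<Sum>k\<in>U. boundary_weight E W U k * (m k - 1))"
      by simp
    then show ?thesis using mpos[of i0] by simp
  qed
  also have "ennreal \<dots> = (\<integral>\<^sup>+\<beta>. ennreal (exp (- (\<Sum>k\<in>U. l k * \<beta> k))) \<partial>nu_fin U (weight E W) (boundary_weight E W U))"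
    unfolding m_def by (rule nu_fin_laplace[OF U(1) boundary_weight_nonneg l(1), symmetric])
  finally show ?thesis .
qed

lemma AE_joint_fst: "(AE r in R. P r) \<Longrightarrow> AE \<omega> in joint. P (fst \<omega>)"
proof -
  assume "AE r in R. P r"
  then have "AE r in distr joint R fst. P r" unfolding G.distr_pair_fst .
  then show ?thesis by (rule AE_distrD[OF measurable_fst])
qed

lemma AE_joint_gamma_pos: "AE \<omega> in joint. 0 < snd \<omega>"
proof (rule AE_I)
  have "{\<gamma> \<in> space gamma_half. \<not> 0 < \<gamma>} \<in> sets gamma_half" by measurable
  moreover have "AE \<gamma> in gamma_half. \<gamma> \<notin> {\<gamma> \<in> space gamma_half. \<not> 0 < \<gamma>}"
    using gamma_half_pos by eventually_elim simp
  ultimately have "{\<gamma> \<in> space gamma_half. \<not> 0 < \<gamma>} \<in> null_sets gamma_half" by (rule iffD2[OF AE_iff_null_sets])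
  then show "emeasure joint (space R \<times> {\<gamma> \<in> space gamma_half. \<not> 0 < \<gamma>}) = 0"
    by (subst G.emeasure_pair_measure_Times) auto
  show "{\<omega> \<in> space joint. \<not> 0 < snd \<omega>} \<subseteq> space R \<times> {\<gamma> \<in> space gamma_half. \<not> 0 < \<gamma>}"
    by (auto simp: space_pair_measure)
  show "space R \<times> {\<gamma> \<in> space gamma_half. \<not> 0 < \<gamma>} \<in> sets joint" by measurable
qed

definition potential_law :: "('v \<Rightarrow> real) measure" where
  "potential_law = distr joint (PiM V (\<lambda>_. borel)) pot"

lemma potential_marginal:
  assumes U: "finite U" "U \<subseteq> V"
  shows "distr potential_law (PiM U (\<lambda>_. borel)) (\<lambda>\<beta>. restrict \<beta> U) = nu_fin U (weight E W) (boundary_weight E W U)"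
proof -
  have res: "(\<lambda>\<beta>. restrict \<beta> U) \<in> PiM V (\<lambda>_. borel :: real measure) \<rightarrow>\<^sub>M PiM U (\<lambda>_. borel)"
    by (rule measurable_restrict_subset[OF U(2)])
  have m: "(\<lambda>\<omega>. restrict (pot \<omega>) U) \<in> joint \<rightarrow>\<^sub>M PiM U (\<lambda>_. borel)"
    by (rule measurable_compose[OF pot_measurable res])
  have eq: "distr potential_law (PiM U (\<lambda>_. borel)) (\<lambda>\<beta>. restrict \<beta> U) = distr joint (PiM U (\<lambda>_. borel)) (\<lambda>\<omega>. restrict (pot \<omega>) U)"
    unfolding potential_law_def by (subst distr_distr[OF res pot_measurable]) (simp add: o_def)
  show ?thesis unfolding eq
  proof (rule multivariate_laplace_determines_measure[OF U(1)])
    show "finite_measure (distr joint (PiM U (\<lambda>_. borel)) (\<lambda>\<omega>. restrict (pot \<omega>) U))"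
      by (rule J.P.finite_measure_distr[OF m])
    show "finite_measure (nu_fin U (weight E W) (boundary_weight E W U))"
      by (rule finite_measure_nu_fin[OF U(1) boundary_weight_nonneg])
    show "sets (nu_fin U (weight E W) (boundary_weight E W U)) = sets (PiM U (\<lambda>_. borel))" by (rule sets_nu_fin)
    show "AE \<beta> in distr joint (PiM U (\<lambda>_. borel)) (\<lambda>\<omega>. restrict (pot \<omega>) U). \<forall>k\<in>U. 0 \<le> \<beta> k"
    proof (subst AE_distr_iff[OF m])
      show "{\<beta> \<in> space (PiM U (\<lambda>_. borel :: real measure)). \<forall>k\<in>U. 0 \<le> \<beta> k} \<in> sets (PiM U (\<lambda>_. borel))"
        using U(1) by measurable
      show "AE \<omega> in joint. \<forall>k\<in>U. 0 \<le> restrict (pot \<omega>) U k"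
        using AE_joint_gamma_pos AE_space
      proof eventually_elim
        case (elim \<omega>)
        then have "fst \<omega> \<in> space R" by (auto simp: space_pair_measure)
        then show ?case using U(2) elim(1) total_rate_nonneg by (auto simp: pot_at)
      qed
    qed
    show "AE \<beta> in nu_fin U (weight E W) (boundary_weight E W U). \<forall>k\<in>U. 0 \<le> \<beta> k"
      using nu_fin_AE_pos_def[OF U(1)] by eventually_elim (use pos_def_diagonal[OF U(1)] in blast)
    fix l :: "'v \<Rightarrow> nat"
    define l' where "l' k = (if k \<in> U then real (l k) else 0)" for k
    have s: "(\<Sum>k\<in>U. real (l k) * \<beta> k) = (\<Sum>k\<in>U. l' k * \<beta> k)" for \<beta>
      by (intro sum.cong) (auto simp: l'_def)
    have "(\<lambda>\<beta>. \<Sum>k\<in>U. l' k * \<beta> k) \<in> borel_measurable (PiM U (\<lambda>_. borel))"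
      by (intro borel_measurable_sum borel_measurable_times) auto
    note [measurable] = this
    have "(\<integral>\<^sup>+\<beta>. ennreal (exp (- (\<Sum>k\<in>U. l' k * \<beta> k))) \<partial>distr joint (PiM U (\<lambda>_. borel)) (\<lambda>\<omega>. restrict (pot \<omega>) U)) =
      (\<integral>\<^sup>+\<omega>. ennreal (exp (- (\<Sum>k\<in>U. l' k * restrict (pot \<omega>) U k))) \<partial>joint)"
      by (rule nn_integral_distr[OF m]) measurable
    also have "\<dots> = (\<integral>\<^sup>+\<omega>. ennreal (exp (- (\<Sum>k\<in>U. l' k * pot \<omega> k))) \<partial>joint)" by simp
    also have "\<dots> = (\<integral>\<^sup>+\<beta>. ennreal (exp (- (\<Sum>k\<in>U. l' k * \<beta> k))) \<partial>nu_fin U (weight E W) (boundary_weight E W U))"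
      by (rule potential_laplace[OF U]) (auto simp: l'_def)
    finally show "(\<integral>\<^sup>+\<beta>. ennreal (exp (- (\<Sum>k\<in>U. real (l k) * \<beta> k))) \<partial>distr joint (PiM U (\<lambda>_. borel)) (\<lambda>\<omega>. restrict (pot \<omega>) U)) =
      (\<integral>\<^sup>+\<beta>. ennreal (exp (- (\<Sum>k\<in>U. real (l k) * \<beta> k))) \<partial>nu_fin U (weight E W) (boundary_weight E W U))"
      unfolding s .
  qed simp
qed

text \<open>
  Positive definiteness on \<open>U\<close> depends on the marginal on \<open>U\<close> only, and the finite-volume
  law is concentrated on such potentials.
\<close>

lemma potential_AE_pos_def:
  assumes V: "countable V"
  shows "AE \<beta> in potential_law. \<forall>U. finite U \<and> U \<subseteq> V \<longrightarrow> pos_def_on U (H_mat (weight E W) \<beta>)"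
proof -
  have "AE \<beta> in potential_law. pos_def_on U (H_mat (weight E W) \<beta>)" if U: "finite U" "U \<subseteq> V" for U
  proof -
    have res: "(\<lambda>\<beta>. restrict \<beta> U) \<in> potential_law \<rightarrow>\<^sub>M PiM U (\<lambda>_. borel)"
      unfolding potential_law_def by (simp add: measurable_restrict_subset[OF U(2)])
    have "AE \<beta> in distr potential_law (PiM U (\<lambda>_. borel)) (\<lambda>\<beta>. restrict \<beta> U). pos_def_on U (H_mat (weight E W) \<beta>)"
      unfolding potential_marginal[OF U] by (rule nu_fin_AE_pos_def[OF U(1)])
    from AE_distrD[OF res this] show ?thesis
    proof eventually_elim
      case (elim \<beta>)
      then show ?case using pos_def_on_cong[of U "H_mat (weight E W) (restrict \<beta> U)" "H_mat (weight E W) \<beta>"]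
        by (auto simp: H_mat_def)
    qed
  qed
  then have "AE \<beta> in potential_law. \<forall>U\<in>{U. finite U \<and> U \<subseteq> V}. pos_def_on U (H_mat (weight E W) \<beta>)"
    using countable_Collect_finite_subset[OF V] by (subst AE_ball_countable) auto
  then show ?thesis by eventually_elim blast
qed

theorem potential_law_eq_nu_inf:
  assumes V: "countable V"
  shows "nu_inf V E W = potential_law"
proof (rule nu_inf_eqI[OF _ _ potential_AE_pos_def[OF V] potential_marginal])
  show "prob_space potential_law" unfolding potential_law_def by (rule J.P.prob_space_distr[OF pot_measurable])
  show "sets potential_law = sets (PiM V (\<lambda>_. borel))" by (simp add: potential_law_def)
qed

end

section \<open>Green functions\<close>

context weighted_graph
begin

lemma H_op_restricted:
  assumes U: "finite U" "i \<in> U"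
  shows "(\<Sum>j\<in>U. H_mat (weight E W) \<beta> i j * f j) = H_op E W \<beta> f i + (\<Sum>j\<in>nbrs E i - U. weight E W i j * f j)"
proof -
  have "(\<Sum>j\<in>U. H_mat (weight E W) \<beta> i j * f j) = (\<Sum>j\<in>U. of_bool (i = j) * (2 * \<beta> i * f j)) - (\<Sum>j\<in>U. weight E W i j * f j)"
    unfolding sum_subtractf[symmetric] by (intro sum.cong refl) (auto simp: H_mat_def algebra_simps)
  also have "(\<Sum>j\<in>U. of_bool (i = j) * (2 * \<beta> i * f j)) = 2 * \<beta> i * f i" by (rule sum_of_bool_mult(1)[OF U])
  also have "(\<Sum>j\<in>U. weight E W i j * f j) = (\<Sum>j\<in>U \<inter> nbrs E i. weight E W i j * f j)"
    using U(1) by (intro sum.mono_neutral_right) (auto simp: weight_zero)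
  also have "\<dots> = (\<Sum>j\<in>nbrs E i. weight E W i j * f j) - (\<Sum>j\<in>nbrs E i - U. weight E W i j * f j)"
  proof -
    have "nbrs E i - U = nbrs E i - (U \<inter> nbrs E i)" by blast
    then show ?thesis using sum_diff[OF finite_nbrs, of "U \<inter> nbrs E i" i "\<lambda>j. weight E W i j * f j"] by simp
  qed
  finally show ?thesis by (simp add: H_op_def)
qed

lemma finite_green_solves:
  assumes U: "finite U" "i \<in> U" and pd: "pos_def_on U (H_mat (weight E W) \<beta>)"
  shows "H_op E W \<beta> (inverse_on U (H_mat (weight E W) \<beta>) a) i = of_bool (i = a)"
proof -
  let ?B = "inverse_on U (H_mat (weight E W) \<beta>)"
  note B = H_inverse(1)[OF U(1) pd] and Bs = H_inverse(2)[OF U(1) pd]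
  have "H_op E W \<beta> (?B a) i = (\<Sum>j\<in>U. H_mat (weight E W) \<beta> i j * ?B a j)"
    unfolding H_op_restricted[OF U] using is_inverse_onD(4)[OF B] by simp
  also have "\<dots> = (\<Sum>j\<in>U. H_mat (weight E W) \<beta> i j * ?B j a)" by (simp add: Bs[of a])
  also have "\<dots> = of_bool (i = a)"
    using is_inverse_onD(1)[OF B U(2), of a] is_inverse_onD(4)[OF B, of a] U(2) by (cases "a \<in> U") auto
  finally show ?thesis .
qed

text \<open>
  On \<open>U\<close>, the matrix maps \<open>f\<close> to the unit mass at \<open>a\<close> plus the contribution of the
  neighbours outside \<open>U\<close>, which is nonnegative. The inverse has nonnegative entries and
  preserves this inequality.
\<close>

lemma finite_green_minimal:
  assumes U: "finite U" and pd: "pos_def_on U (H_mat (weight E W) \<beta>)"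
    and f: "\<And>j. 0 \<le> f j" "\<And>i. i \<in> U \<Longrightarrow> H_op E W \<beta> f i = of_bool (i = a)"
  shows "inverse_on U (H_mat (weight E W) \<beta>) a k \<le> f k"
proof -
  let ?H = "H_mat (weight E W) \<beta>" and ?B = "inverse_on U (H_mat (weight E W) \<beta>)"
  note B = H_inverse(1)[OF U pd] and Bs = H_inverse(2)[OF U pd] and B0 = H_inverse(3)[OF U pd]
  show ?thesis
  proof (cases "k \<in> U")
    case False
    then show ?thesis using is_inverse_onD(4)[OF B] f(1) by simp
  next
    case True
    have "?B a k = ?B k a" by (rule Bs)
    also have "\<dots> \<le> (\<Sum>i\<in>U. ?B k i * of_bool (i = a))"
      using sum_of_bool_mult(4)[OF U, of a "?B k"] is_inverse_onD(4)[OF B, of a] B0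
      by (cases "a \<in> U") (auto intro!: sum_nonneg)
    also have "\<dots> \<le> (\<Sum>i\<in>U. ?B k i * (\<Sum>j\<in>U. ?H i j * f j))"
    proof (intro sum_mono mult_left_mono B0)
      fix i assume i: "i \<in> U"
      show "of_bool (i = a) \<le> (\<Sum>j\<in>U. ?H i j * f j)"
        unfolding H_op_restricted[OF U i] f(2)[OF i] using f(1) weight_nonneg by (simp add: sum_nonneg)
    qed
    also have "\<dots> = (\<Sum>j\<in>U. (\<Sum>i\<in>U. ?B k i * ?H i j) * f j)"
      by (simp add: sum_distrib_left sum_distrib_right mult.assoc) (rule sum.swap)
    also have "\<dots> = (\<Sum>j\<in>U. of_bool (k = j) * f j)"
      using is_inverse_onD(2)[OF B True] by (intro sum.cong refl) simp
    also have "\<dots> = f k" by (rule sum_of_bool_mult(1)[OF U True])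
    finally show ?thesis .
  qed
qed

text \<open>
  The finite Green functions increase by minimality and are bounded by \<open>g\<close>, so they converge.
  Since only finitely many neighbours occur in \<open>H_op\<close>, the limit solves the same equation as
  \<open>g\<close>, and the difference is harmonic.
\<close>

lemma green_decomposition:
  assumes Vs: "exhaustion V E Vs" and a: "a \<in> V"
    and pd: "\<And>U. finite U \<Longrightarrow> U \<subseteq> V \<Longrightarrow> pos_def_on U (H_mat (weight E W) \<beta>)"
    and g: "\<And>j. 0 \<le> g j" "\<And>i. i \<in> V \<Longrightarrow> H_op E W \<beta> g i = of_bool (i = a)"
  shows "\<And>i. G_hat E W Vs \<beta> a i \<le> g i" "harmonic V E W \<beta> (\<lambda>i. g i - G_hat E W Vs \<beta> a i)"
proof -
  define B where "B n = inverse_on (Vs n) (H_mat (weight E W) \<beta>) a" for n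
  have fin: "finite (Vs n)" and sub: "Vs n \<subseteq> V" and inc: "incseq Vs" for n
    using Vs by (auto simp: exhaustion_def)
  have pdn: "pos_def_on (Vs n) (H_mat (weight E W) \<beta>)" for n by (rule pd[OF fin sub])
  have le: "B n i \<le> g i" for n i
    unfolding B_def using sub by (intro finite_green_minimal[OF fin pdn g(1)] g(2)) auto
  have mono: "B n i \<le> B (Suc n) i" for n i
    unfolding B_def
  proof (rule finite_green_minimal[OF fin pdn])
    show "0 \<le> inverse_on (Vs (Suc n)) (H_mat (weight E W) \<beta>) a j" for j by (rule H_inverse(3)[OF fin pdn])
    show "H_op E W \<beta> (inverse_on (Vs (Suc n)) (H_mat (weight E W) \<beta>) a) i = of_bool (i = a)" if "i \<in> Vs n" for i
      using incseqD[OF inc, of n "Suc n"] that by (intro finite_green_solves[OF fin _ pdn]) auto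
  qed
  have conv: "(\<lambda>n. B n i) \<longlonglongrightarrow> G_hat E W Vs \<beta> a i" for i
  proof -
    have "incseq (\<lambda>n. B n i)" by (rule incseq_SucI) (rule mono)
    then obtain L where "(\<lambda>n. B n i) \<longlonglongrightarrow> L"
      by (rule incseq_convergent[where B="g i"]) (use le in simp)
    then have "convergent (\<lambda>n. B n i)" by (rule convergentI)
    then show ?thesis unfolding G_hat_def B_def by (rule iffD1[OF convergent_LIMSEQ_iff])
  qed
  show "G_hat E W Vs \<beta> a i \<le> g i" for i
    by (rule LIMSEQ_le_const2[OF conv]) (use le in blast)
  have G: "H_op E W \<beta> (G_hat E W Vs \<beta> a) i = of_bool (i = a)" if i: "i \<in> V" for i
  proof -
    obtain n0 where n0: "i \<in> Vs n0" using Vs i by (auto simp: exhaustion_def)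
    have "(\<lambda>n. H_op E W \<beta> (B n) i) \<longlonglongrightarrow> H_op E W \<beta> (G_hat E W Vs \<beta> a) i"
      unfolding H_op_def by (intro tendsto_intros conv)
    moreover have "\<forall>\<^sub>F n in sequentially. H_op E W \<beta> (B n) i = of_bool (i = a)"
      using eventually_ge_at_top[of n0]
    proof eventually_elim
      case (elim n)
      then have "i \<in> Vs n" using incseqD[OF inc] n0 by blast
      then show ?case unfolding B_def by (rule finite_green_solves[OF fin _ pdn])
    qed
    ultimately have "(\<lambda>n. of_bool (i = a) :: real) \<longlonglongrightarrow> H_op E W \<beta> (G_hat E W Vs \<beta> a) i"
      by (rule Lim_transform_eventually)
    then show ?thesis by (simp add: LIMSEQ_const_iff)
  qed
  have "H_op E W \<beta> (\<lambda>i. g i - G_hat E W Vs \<beta> a i) i = H_op E W \<beta> g i - H_op E W \<beta> (G_hat E W Vs \<beta> a) i" for i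
    unfolding H_op_def by (simp add: right_diff_distrib sum_subtractf)
  then show "harmonic V E W \<beta> (\<lambda>i. g i - G_hat E W Vs \<beta> a i)"
    using g(2) G unfolding harmonic_def by simp
qed

end

context vrjp_environment
begin

text \<open>
  The normalization makes \<open>H_op\<close> map this function to the unit mass at \<open>i0\<close>.
\<close>

definition green :: "('v \<times> 'v \<Rightarrow> real) \<times> real \<Rightarrow> 'v \<Rightarrow> real" where
  "green \<omega> i = (if i \<in> V then weight_fun (fst \<omega>) i / (2 * snd \<omega> * weight_fun (fst \<omega>) i0) else 0)"

text \<open>
  The almost sure properties from which the representation of the rates follows
  deterministically.
\<close>

definition good :: "('v \<times> 'v \<Rightarrow> real) \<times> real \<Rightarrow> bool" where
  "good \<omega> \<longleftrightarrow> 0 < snd \<omega> \<and>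
     (\<forall>i\<in>V. \<forall>j\<in>nbrs E i. 0 < weight_fun (fst \<omega>) i \<and> weight_fun (fst \<omega>) i * rel_rate (fst \<omega>) i j = weight_fun (fst \<omega>) j) \<and>
     (\<forall>U. finite U \<and> U \<subseteq> V \<longrightarrow> pos_def_on U (H_mat (weight E W) (pot \<omega>)))"

lemma AE_good:
  assumes V: "countable V" shows "AE \<omega> in joint. good \<omega>"
proof -
  have 1: "AE r in R. \<forall>i\<in>V. \<forall>j\<in>nbrs E i. 0 < weight_fun r i \<and> weight_fun r i * rel_rate r i j = weight_fun r j"
    by (subst AE_ball_countable[OF V], rule ballI, subst AE_ball_countable[OF countable_finite[OF finite_nbrs]])
      (use weight_fun_AE in blast)
  have "AE \<beta> in distr joint (PiM V (\<lambda>_. borel)) pot. \<forall>U. finite U \<and> U \<subseteq> V \<longrightarrow> pos_def_on U (H_mat (weight E W) \<beta>)"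
    using potential_AE_pos_def[OF V] unfolding potential_law_def .
  from AE_joint_gamma_pos AE_joint_fst[OF 1] AE_distrD[OF pot_measurable this]
  show ?thesis by eventually_elim (simp add: good_def)
qed

lemma has_neighbour: "i \<in> V \<Longrightarrow> \<exists>j. j \<in> nbrs E i"
proof -
  assume i: "i \<in> V"
  have "infinite (V - {i})" using infinite_V by simp
  then obtain k where k: "k \<in> V" "k \<noteq> i" by (metis Diff_iff finite.emptyI insertI1 subsetI subset_empty)
  obtain xs where xs: "walk_from_to i xs k" using walk_exists[OF i k(1)] by blast
  obtain ys where ys: "xs = i # ys" using xs by (cases xs) (auto simp: walk_from_to_def)
  have "ys \<noteq> []"
  proof
    assume "ys = []"
    then have "last xs = i" using ys by simp
    then show False using xs k(2) by (simp add: walk_from_to_def)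
  qed
  then obtain b zs where "ys = b # zs" by (cases ys) auto
  then have "adj i b" using xs ys by (simp add: walk_from_to_def)
  then show ?thesis by blast
qed

lemma green_props:
  assumes g: "good \<omega>"
  shows "\<And>i. i \<in> V \<Longrightarrow> 0 < green \<omega> i" "\<And>i. 0 \<le> green \<omega> i"
    "\<And>i j. j \<in> nbrs E i \<Longrightarrow> fst \<omega> (i, j) = weight E W i j / 2 * (green \<omega> j / green \<omega> i)"
    "\<And>i. i \<in> V \<Longrightarrow> H_op E W (pot \<omega>) (green \<omega>) i = of_bool (i = i0)"
proof -
  have wf: "0 < weight_fun (fst \<omega>) i" if "i \<in> V" for i
    using g has_neighbour[OF that] that unfolding good_def by blast
  have \<gamma>: "0 < snd \<omega>" using g by (simp add: good_def)
  show pos: "0 < green \<omega> i" if "i \<in> V" for i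
    using wf[OF that] wf[OF i0] \<gamma> that by (simp add: green_def)
  show "0 \<le> green \<omega> i" for i using pos[of i] by (cases "i \<in> V") (auto simp: green_def)
  have step: "green \<omega> j = green \<omega> i * rel_rate (fst \<omega>) i j" if j: "j \<in> nbrs E i" for i j
  proof -
    have ij: "i \<in> V" "j \<in> V" using nbrsD[OF j] by auto
    have "weight_fun (fst \<omega>) i * rel_rate (fst \<omega>) i j = weight_fun (fst \<omega>) j" using g ij j unfolding good_def by blast
    then show ?thesis using ij by (simp add: green_def)
  qed
  show "fst \<omega> (i, j) = weight E W i j / 2 * (green \<omega> j / green \<omega> i)" if j: "j \<in> nbrs E i" for i j
    using pos[of i] nbrsD[OF j] weight_pos[OF j] unfolding step[OF j] rel_rate_def by simp
  show "H_op E W (pot \<omega>) (green \<omega>) i = of_bool (i = i0)" if i: "i \<in> V" for i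
  proof -
    have "(\<Sum>j\<in>nbrs E i. weight E W i j * green \<omega> j) = (\<Sum>j\<in>nbrs E i. 2 * green \<omega> i * fst \<omega> (i, j))"
    proof (rule sum.cong[OF refl])
      fix j assume j: "j \<in> nbrs E i"
      show "weight E W i j * green \<omega> j = 2 * green \<omega> i * fst \<omega> (i, j)"
        unfolding step[OF j] rel_rate_def using weight_pos[OF j] by simp
    qed
    also have "\<dots> = 2 * green \<omega> i * total_rate (fst \<omega>) i" by (simp add: total_rate_def sum_distrib_left)
    finally have "H_op E W (pot \<omega>) (green \<omega>) i = 2 * (if i = i0 then snd \<omega> else 0) * green \<omega> i"
      unfolding H_op_def pot_at[OF i] by (simp add: algebra_simps)
    also have "\<dots> = of_bool (i = i0)"
      using \<gamma> wf[OF i0] i0 by (auto simp: green_def)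
    finally show ?thesis .
  qed
qed

lemma green_measurable: "(\<lambda>\<omega>. green \<omega> i) \<in> borel_measurable joint"
proof (cases "i \<in> V")
  case True
  have [measurable]: "(\<lambda>r. weight_fun r i) \<in> borel_measurable R" "(\<lambda>r. weight_fun r i0) \<in> borel_measurable R"
    using weight_fun_measurable[OF True] weight_fun_measurable[OF i0] by auto
  show ?thesis unfolding green_def using True by simp
next
  case False then show ?thesis by (simp add: green_def)
qed

theorem green_representation:
  assumes Vs: "exhaustion V E Vs"
  shows "\<exists>h. (\<forall>i\<in>V. (\<lambda>\<omega>. h \<omega> i) \<in> borel_measurable joint) \<and>
     (\<forall>\<omega>\<in>space joint. (\<forall>i\<in>V. h \<omega> i \<ge> 0) \<and> harmonic V E W (pot \<omega>) (h \<omega>)) \<and>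
     (AE \<omega> in joint. let G = (\<lambda>i. G_hat E W Vs (pot \<omega>) i0 i + h \<omega> i)
        in \<forall>i\<in>V. \<forall>j\<in>nbrs E i. fst \<omega> (i, j) = weight E W i j / 2 * (G j / G i))"
proof -
  have fin: "finite (Vs n)" and sub: "Vs n \<subseteq> V" for n using Vs by (auto simp: exhaustion_def)
  have V: "countable V"
  proof -
    have e: "(\<Union>n. Vs n) = V" using Vs by (simp add: exhaustion_def)
    have "countable (\<Union>n. Vs n)" by (rule countable_UN, simp, rule countable_finite, rule fin)
    then show ?thesis unfolding e .
  qed
  obtain N where N: "{\<omega> \<in> space joint. \<not> good \<omega>} \<subseteq> N" "emeasure joint N = 0" "N \<in> sets joint"
    using AE_E[OF AE_good[OF V]] by blast
  \<comment> \<open>A version of the Green function that is measurable everywhere; it agrees with \<open>G_hat\<close> at the good points.\<close>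
  define Gh where "Gh \<omega> i = lim (\<lambda>n. of_bool (pos_def_on (Vs n) (H_mat (weight E W) (pot \<omega>))) *
      inverse_on (Vs n) (H_mat (weight E W) (pot \<omega>)) i0 i)" for \<omega> i
  have Gh_eq: "Gh \<omega> i = G_hat E W Vs (pot \<omega>) i0 i" if "good \<omega>" for \<omega> i
    using that fin sub unfolding good_def Gh_def G_hat_def by simp
  have Gh_m: "(\<lambda>\<omega>. Gh \<omega> i) \<in> borel_measurable joint" for i
    unfolding Gh_def
  proof (rule borel_measurable_lim_metric)
    fix n
    have "(\<lambda>\<beta>. of_bool (pos_def_on (Vs n) (H_mat (weight E W) \<beta>)) * inverse_on (Vs n) (H_mat (weight E W) \<beta>) i0 i)
        \<in> borel_measurable (PiM V (\<lambda>_. borel))"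
      using measurable_pos_def_inverse[OF fin sub] by blast
    from measurable_compose[OF pot_measurable this]
    show "(\<lambda>\<omega>. of_bool (pos_def_on (Vs n) (H_mat (weight E W) (pot \<omega>))) *
      inverse_on (Vs n) (H_mat (weight E W) (pot \<omega>)) i0 i) \<in> borel_measurable joint" .
  qed
  \<comment> \<open>On the exceptional null set, the zero function is nonnegative and harmonic.\<close>
  define h where "h \<omega> i = (if \<omega> \<in> N then 0 else green \<omega> i - Gh \<omega> i)" for \<omega> i
  have good: "good \<omega>" if "\<omega> \<in> space joint" "\<omega> \<notin> N" for \<omega> using that N(1) by blast
  have dec: "G_hat E W Vs (pot \<omega>) i0 i \<le> green \<omega> i" "harmonic V E W (pot \<omega>) (\<lambda>i. green \<omega> i - G_hat E W Vs (pot \<omega>) i0 i)"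
    if "good \<omega>" for \<omega> i
  proof -
    have pd: "\<And>U. finite U \<Longrightarrow> U \<subseteq> V \<Longrightarrow> pos_def_on U (H_mat (weight E W) (pot \<omega>))"
      using that unfolding good_def by blast
    note d = green_decomposition[where g="green \<omega>" and \<beta>="pot \<omega>", OF Vs i0 pd green_props(2,4)[OF that]]
    show "G_hat E W Vs (pot \<omega>) i0 i \<le> green \<omega> i" using d(1) .
    show "harmonic V E W (pot \<omega>) (\<lambda>i. green \<omega> i - G_hat E W Vs (pot \<omega>) i0 i)" using d(2) .
  qed
  show ?thesis
  proof (intro exI[of _ h] conjI ballI)
    fix i
    show "(\<lambda>\<omega>. h \<omega> i) \<in> borel_measurable joint"
      unfolding h_def using green_measurable Gh_m N(3) by measurable
  next
    fix \<omega> i assume \<omega>: "\<omega> \<in> space joint"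
    show "0 \<le> h \<omega> i"
      using dec(1)[OF good[OF \<omega>], of i] Gh_eq[OF good[OF \<omega>], of i] by (simp add: h_def)
  next
    fix \<omega> assume \<omega>: "\<omega> \<in> space joint"
    show "harmonic V E W (pot \<omega>) (h \<omega>)"
    proof (cases "\<omega> \<in> N")
      case True
      then have "h \<omega> = (\<lambda>_. 0)" by (simp add: h_def fun_eq_iff)
      then show ?thesis by (simp add: harmonic_def H_op_def)
    next
      case False
      then have "h \<omega> = (\<lambda>i. green \<omega> i - G_hat E W Vs (pot \<omega>) i0 i)"
        using Gh_eq[OF good[OF \<omega> False]] by (simp add: h_def fun_eq_iff)
      then show ?thesis using dec(2)[OF good[OF \<omega> False]] by simp
    qed
  next
    have "AE \<omega> in joint. \<omega> \<notin> N" using N(2,3) by (intro AE_not_in) auto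
    then show "AE \<omega> in joint. let G = (\<lambda>i. G_hat E W Vs (pot \<omega>) i0 i + h \<omega> i)
        in \<forall>i\<in>V. \<forall>j\<in>nbrs E i. fst \<omega> (i, j) = weight E W i j / 2 * (G j / G i)"
      using AE_space
    proof eventually_elim
      case (elim \<omega>)
      note g = good[OF elim(2,1)]
      have "G_hat E W Vs (pot \<omega>) i0 i + h \<omega> i = green \<omega> i" for i
        using elim(1) Gh_eq[OF g] by (simp add: h_def)
      then show ?case using green_props(3)[OF g] by (simp add: Let_def)
    qed
  qed
qed

end

theorem theorem2p3:
  fixes V :: "'v set" and E :: "'v set set" and W :: "'v set \<Rightarrow> real"
    and i0 :: 'v and R :: "('v \<times> 'v \<Rightarrow> real) measure" and Vs :: "nat \<Rightarrow> 'v set"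
  assumes "simple_graph V E" and "infinite V" and "connected_on E V" and "locally_finite V E"
    and "\<And>e. e \<in> E \<Longrightarrow> W e > 0"
    and "i0 \<in> V"
    and "exhaustion V E Vs"
    and "represents_vrjp V E W i0 R"
  shows "distr (R \<Otimes>\<^sub>M gamma_half) (PiM V (\<lambda>_. borel)) (env_potential V E i0) = nu_inf V E W
    \<and> (\<exists>h :: ('v \<times> 'v \<Rightarrow> real) \<times> real \<Rightarrow> 'v \<Rightarrow> real.
        (\<forall>i\<in>V. (\<lambda>\<omega>. h \<omega> i) \<in> borel_measurable (R \<Otimes>\<^sub>M gamma_half)) \<and>
        (\<forall>\<omega>\<in>space (R \<Otimes>\<^sub>M gamma_half).
           (\<forall>i\<in>V. h \<omega> i \<ge> 0) \<and> harmonic V E W (env_potential V E i0 \<omega>) (h \<omega>)) \<and>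
        (AE \<omega> in R \<Otimes>\<^sub>M gamma_half.
           let G = (\<lambda>i. G_hat E W Vs (env_potential V E i0 \<omega>) i0 i + h \<omega> i)
           in \<forall>i\<in>V. \<forall>j\<in>nbrs E i.
                fst \<omega> (i, j) = weight E W i j / 2 * (G j / G i)))"
proof -
  interpret vrjp_environment V E W i0 R
    by unfold_locales (use assms in auto)
  have "countable (\<Union>n. Vs n)"
    by (rule countable_UN, simp, rule countable_finite) (use assms(7) in \<open>simp add: exhaustion_def\<close>)
  moreover have "(\<Union>n. Vs n) = V" using assms(7) by (simp add: exhaustion_def)
  ultimately have "countable V" by (simp only:)
  then have "distr (R \<Otimes>\<^sub>M gamma_half) (PiM V (\<lambda>_. borel)) (env_potential V E i0) = nu_inf V E W"
    using potential_law_eq_nu_inf by (simp add: potential_law_def)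
  then show ?thesis using green_representation[OF assms(7)] by blast
qed

end
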